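(* Assume the Setup and the Forms definitions below, with $I$ either a bounded interval or $I=\mathbb R$. There exist $C_{10}>0$ and $\varepsilon_0>0$ such that for all $0<\varepsilon<\varepsilon_0$, $$\big\|G_\varepsilon^{-1}-\big(T_{\varepsilon,c}^{-1}\oplus 0\big)\big\|\ \le\ C_{10}\,\varepsilon^{3/2},$$ where the norm is the operator norm on $L^2(I\times S)$.
   Context: Setup. Let $I$ be either a bounded interval $[-a,b]$ with $0<a,b<\infty$, or $I=\mathbb R$. Let $r:I\to\mathbb R^3$ be a simple $C^2$ curve parametrized by arc length $s$, with curvature $k(s)$, torsion $\tau(s)$ and Frenet frame $(T,N,B)$ satisfying $T'=kN$, $N'=-kT+\tau B$, $B'=-\tau N$. Let $\alpha:I\to\mathbb R$ be $C^1$ with $\alpha(0)=0$. Put $N_\alpha=\cos\alpha\,N+\sin\alpha\,B$ and $B_\alpha=-\sin\alpha\,N+\cos\alpha\,B$. Assume $\|k\|_\infty,\|\tau\|_\infty,\|\alpha'\|_\infty<\infty$. Let $S\subset\mathbb R^2$ be open, bounded, simply connected and nonempty. Let $h:I\to(0,\infty)$ be continuous and $C^1$ on $I\setminus\{0\}$, with $\|h'/h\|_\infty<\infty$. Assume $h(s)=M-s^2+O(|s|^3)$ as $s\to0$ for some $M>0$, and that $s=0$ is the unique point of global maximum of $h$ (so $0<h\le M$). If $I=\mathbb R$, assume moreover $\limsup_{|s|\to\infty}h(s)<M$. For $0<\varepsilon<1$ let $f_\varepsilon:I\times S\to\mathbb R^3$, $f_\varepsilon(s,y_1,y_2)=r(s)+\varepsilon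 h(s)\big(y_1N_\alpha(s)+y_2B_\alpha(s)\big)$, be assumed injective. The deformed tube is $\Lambda_\varepsilon=f_\varepsilon(I\times S)$. $-\Delta_\varepsilon$ is the Dirichlet Laplacian in $L^2(\Lambda_\varepsilon)$. $\lambda_0$ is the lowest eigenvalue of the Dirichlet Laplacian on $S$, and $u_0>0$ is the corresponding eigenfunction with $\int_S u_0^2\,dy=1$. Forms. Let $z_\alpha(s)=(\cos\alpha(s),-\sin\alpha(s))$ and $\beta_\varepsilon(s,y)=1-\varepsilon h(s)k(s)\langle z_\alpha(s),y\rangle$. Let $R(y_1,y_2)=(y_2,-y_1)$. Fix a sufficiently large constant $c>0$, independent of $\varepsilon$. For $v\in H^1_0(I\times S)$ set $$\mathcal Dv=\partial_s v-v\,\tfrac{h'}{h}+(\tau+\alpha')\,\nabla_yv\cdot Ry-\tfrac{h'}{h}\,\nabla_yv\cdot y$$ and $$g_\varepsilon(v)=\int_{I\times S}\Big(|\mathcal Dv|^2+\tfrac{\beta_\varepsilon}{\varepsilon^2h^2}|\nabla_yv|^2-\tfrac{\lambda_0\beta_\varepsilon}{\varepsilon^2M^2}|v|^2+c|v|^2\Big)ds\,dy .$$ This is a form in $L^2(I\times S)$ with domain $H^1_0(I\times S)$. $G_\varepsilon$ is its associated self-adjoint operator. Up to the changes of variables, and up to an $O(\varepsilon)$ resolvent error, $G_\varepsilon$ models $-\Delta_\varepsilon+c-\lambda_0/(\varepsilon^2M^2)$. For $w\in H^1_0(I)$ let $t_\varepsilon(w)=g_\varepsilon(w\otimes u_0)$,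 where $(w\otimes u_0)(s,y)=w(s)u_0(y)$. $T_{\varepsilon,c}$ is the self-adjoint operator in $L^2(I)$ associated with $t_\varepsilon$. $\mathcal L=\{w(s)u_0(y):w\in L^2(I)\}$, and $L^2(I\times S)=\mathcal L\oplus\mathcal L^\perp$. The operator $T_{\varepsilon,c}^{-1}\oplus0$ acts on $\mathcal L$ as $w\otimes u_0\mapsto (T_{\varepsilon,c}^{-1}w)\otimes u_0$ and is $0$ on $\mathcal L^\perp$. *)

theory Defs
  imports "HOL-Analysis.Analysis" "HOL-Library.Landau_Symbols"
begin

fun Cn :: "nat \<Rightarrow> ('a::euclidean_space \<Rightarrow> real) \<Rightarrow> bool" where
  "Cn 0 \<phi> = continuous_on UNIV \<phi>"
| "Cn (Suc n) \<phi> = ((\<forall>x. \<phi> differentiable (at x)) \<and>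
      (\<forall>b\<in>Basis. Cn n (\<lambda>x. frechet_derivative \<phi> (at x) b)))"

definition tsupport :: "('a::euclidean_space \<Rightarrow> real) \<Rightarrow> 'a set" where
  "tsupport \<phi> = closure {x. \<phi> x \<noteq> 0}"

definition test_fun :: "'a::euclidean_space set \<Rightarrow> ('a \<Rightarrow> real) \<Rightarrow> bool" where
  "test_fun U \<phi> \<longleftrightarrow> (\<forall>n. Cn n \<phi>) \<and> compact (tsupport \<phi>) \<and> tsupport \<phi> \<subseteq> U"

definition cgrad :: "('a::euclidean_space \<Rightarrow> real) \<Rightarrow> 'a \<Rightarrow> 'a" where
  "cgrad \<phi> x = (\<Sum>b\<in>Basis. frechet_derivative \<phi> (at x) b *\<^sub>R b)"

definition L2 :: "'a::euclidean_space set \<Rightarrow> ('a \<Rightarrow> 'b::{real_normed_vector,second_countable_topology}) \<Rightarrow> bool" where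
  "L2 U v \<longleftrightarrow> (\<lambda>x. indicator U x *\<^sub>R v x) \<in> borel_measurable lebesgue \<and>
      integrable lebesgue (\<lambda>x. indicator U x * (norm (v x))\<^sup>2)"

definition l2inner :: "'a::euclidean_space set \<Rightarrow> ('a \<Rightarrow> real) \<Rightarrow> ('a \<Rightarrow> real) \<Rightarrow> real" where
  "l2inner U u v = (\<integral>x. indicator U x * u x * v x \<partial>lebesgue)"

definition l2norm :: "'a::euclidean_space set \<Rightarrow> ('a \<Rightarrow> real) \<Rightarrow> real" where
  "l2norm U u = sqrt (\<integral>x. indicator U x * (u x)\<^sup>2 \<partial>lebesgue)"

definition has_weak_grad :: "'a::euclidean_space set \<Rightarrow> ('a \<Rightarrow> real) \<Rightarrow> ('a \<Rightarrow> 'a) \<Rightarrow> bool" where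
  "has_weak_grad U v g \<longleftrightarrow> (\<forall>\<phi>. test_fun U \<phi> \<longrightarrow> (\<forall>b\<in>Basis.
      (\<integral>x. indicator U x * v x * frechet_derivative \<phi> (at x) b \<partial>lebesgue)
        = - (\<integral>x. indicator U x * (g x \<bullet> b) * \<phi> x \<partial>lebesgue)))"

definition H1 :: "'a::euclidean_space set \<Rightarrow> ('a \<Rightarrow> real) \<Rightarrow> bool" where
  "H1 U v \<longleftrightarrow> L2 U v \<and> (\<exists>g. L2 U g \<and> has_weak_grad U v g)"

definition wgrad :: "'a::euclidean_space set \<Rightarrow> ('a \<Rightarrow> real) \<Rightarrow> 'a \<Rightarrow> 'a" where
  "wgrad U v = (SOME g. L2 U g \<and> has_weak_grad U v g)"

definition H10 :: "'a::euclidean_space set \<Rightarrow> ('a \<Rightarrow> real) \<Rightarrow> bool" where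
  "H10 U v \<longleftrightarrow> H1 U v \<and> (\<exists>\<phi>s. (\<forall>n. test_fun U (\<phi>s n)) \<and>
      (\<lambda>n. \<integral>x. indicator U x * ((v x - \<phi>s n x)\<^sup>2 + (norm (wgrad U v x - cgrad (\<phi>s n) x))\<^sup>2) \<partial>lebesgue)
        \<longlonglongrightarrow> 0)"

definition dirichlet_eigenpair :: "(real \<times> real) set \<Rightarrow> real \<Rightarrow> (real \<times> real \<Rightarrow> real) \<Rightarrow> bool" where
  "dirichlet_eigenpair S \<mu> u \<longleftrightarrow> H10 S u \<and> l2norm S u \<noteq> 0 \<and>
     (\<forall>v. H10 S v \<longrightarrow>
        (\<integral>y. indicator S y * (wgrad S u y \<bullet> wgrad S v y) \<partial>lebesgue) = \<mu> * l2inner S u v)"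

definition Nalpha :: "(real \<Rightarrow> real^3) \<Rightarrow> (real \<Rightarrow> real^3) \<Rightarrow> (real \<Rightarrow> real) \<Rightarrow> real \<Rightarrow> real^3" where
  "Nalpha N B \<alpha> s = cos (\<alpha> s) *\<^sub>R N s + sin (\<alpha> s) *\<^sub>R B s"

definition Balpha :: "(real \<Rightarrow> real^3) \<Rightarrow> (real \<Rightarrow> real^3) \<Rightarrow> (real \<Rightarrow> real) \<Rightarrow> real \<Rightarrow> real^3" where
  "Balpha N B \<alpha> s = - sin (\<alpha> s) *\<^sub>R N s + cos (\<alpha> s) *\<^sub>R B s"

definition ftube :: "(real \<Rightarrow> real^3) \<Rightarrow> (real \<Rightarrow> real^3) \<Rightarrow> (real \<Rightarrow> real^3) \<Rightarrow> (real \<Rightarrow> real)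
    \<Rightarrow> (real \<Rightarrow> real) \<Rightarrow> real \<Rightarrow> real \<times> (real \<times> real) \<Rightarrow> real^3" where
  "ftube r N B \<alpha> h \<epsilon> p = (case p of (s, (y1, y2)) \<Rightarrow>
      r s + (\<epsilon> * h s) *\<^sub>R (y1 *\<^sub>R Nalpha N B \<alpha> s + y2 *\<^sub>R Balpha N B \<alpha> s))"

definition Rrot :: "real \<times> real \<Rightarrow> real \<times> real" where
  "Rrot y = (snd y, - fst y)"

definition zalpha :: "(real \<Rightarrow> real) \<Rightarrow> real \<Rightarrow> real \<times> real" where
  "zalpha \<alpha> s = (cos (\<alpha> s), - sin (\<alpha> s))"

definition beta_eps :: "real \<Rightarrow> (real \<Rightarrow> real) \<Rightarrow> (real \<Rightarrow> real) \<Rightarrow> (real \<Rightarrow> real) \<Rightarrow> real \<times> (real \<times> real) \<Rightarrow> real" where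
  "beta_eps \<epsilon> h k \<alpha> p = 1 - \<epsilon> * h (fst p) * k (fst p) * (zalpha \<alpha> (fst p) \<bullet> snd p)"

text \<open>The operator D applied to v on the domain U = I x S (weak derivatives).
  dh is h', ad is alpha'.\<close>
definition Dop :: "(real \<times> (real \<times> real)) set \<Rightarrow> (real \<Rightarrow> real) \<Rightarrow> (real \<Rightarrow> real) \<Rightarrow> (real \<Rightarrow> real)
    \<Rightarrow> (real \<Rightarrow> real) \<Rightarrow> (real \<times> (real \<times> real) \<Rightarrow> real) \<Rightarrow> real \<times> (real \<times> real) \<Rightarrow> real" where
  "Dop U h dh \<tau> ad v p = (let s = fst p; y = snd p; g = wgrad U v p in
      fst g - v p * (dh s / h s) + (\<tau> s + ad s) * (snd g \<bullet> Rrot y) - (dh s / h s) * (snd g \<bullet> y))"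

text \<open>Symmetric bilinear form g_eps(u,v) (polarisation of the quadratic form g_eps(v)).\<close>
definition gform :: "(real \<times> (real \<times> real)) set \<Rightarrow> (real \<Rightarrow> real) \<Rightarrow> (real \<Rightarrow> real) \<Rightarrow> (real \<Rightarrow> real)
    \<Rightarrow> (real \<Rightarrow> real) \<Rightarrow> (real \<Rightarrow> real) \<Rightarrow> (real \<Rightarrow> real) \<Rightarrow> real \<Rightarrow> real \<Rightarrow> real \<Rightarrow> real
    \<Rightarrow> (real \<times> (real \<times> real) \<Rightarrow> real) \<Rightarrow> (real \<times> (real \<times> real) \<Rightarrow> real) \<Rightarrow> real" where
  "gform U h dh k \<tau> \<alpha> ad lam0 M c \<epsilon> u v =
     (\<integral>p. indicator U p *
        (Dop U h dh \<tau> ad u p * Dop U h dh \<tau> ad v p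
         + beta_eps \<epsilon> h k \<alpha> p / (\<epsilon>\<^sup>2 * (h (fst p))\<^sup>2) * (snd (wgrad U u p) \<bullet> snd (wgrad U v p))
         - lam0 * beta_eps \<epsilon> h k \<alpha> p / (\<epsilon>\<^sup>2 * M\<^sup>2) * (u p * v p)
         + c * (u p * v p)) \<partial>lebesgue)"

definition tensor :: "(real \<Rightarrow> real) \<Rightarrow> (real \<times> real \<Rightarrow> real) \<Rightarrow> real \<times> (real \<times> real) \<Rightarrow> real" where
  "tensor w u0 p = w (fst p) * u0 (snd p)"

text \<open>Coefficient of the projection of F onto L = {w(s)u0(y)}.\<close>
definition projL :: "(real \<times> real) set \<Rightarrow> (real \<times> real \<Rightarrow> real) \<Rightarrow> (real \<times> (real \<times> real) \<Rightarrow> real) \<Rightarrow> real \<Rightarrow> real" where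
  "projL S u0 F s = (\<integral>y. indicator S y * F (s, y) * u0 y \<partial>lebesgue)"

text \<open>u = G^{-1} F, where G is the self-adjoint operator associated with the form q
  (domain H^1_0(U)): u in the form domain and q(u,v) = <F,v> for all v in the form domain.\<close>
definition form_resolvent :: "'a::euclidean_space set \<Rightarrow> (('a \<Rightarrow> real) \<Rightarrow> ('a \<Rightarrow> real) \<Rightarrow> real)
    \<Rightarrow> ('a \<Rightarrow> real) \<Rightarrow> ('a \<Rightarrow> real) \<Rightarrow> bool" where
  "form_resolvent U q F u \<longleftrightarrow> H10 U u \<and> (\<forall>v. H10 U v \<longrightarrow> q u v = l2inner U F v)"

end

theory Submission
  imports Defs "HOL-Analysis.Analysis"
begin

text \<open>
Everything is done with Borel representatives on the whole space and pairs (function, gradient) in the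
\<open>L\<^sup>2\<close>-closure \<open>W\<close> of the test functions. Slicewise, the spectral gap of the cross section together with the
harmonic-oscillator bound for the well \<open>1/h\<^sup>2 - 1/M\<^sup>2\<close> makes the form coercive: the part transversal to \<open>u0\<close> costs
\<open>\<epsilon>\<^sup>-\<^sup>2\<close>, the function itself \<open>\<epsilon>\<^sup>-\<^sup>1\<close>. For \<open>\<psi> = u - w \<otimes> u0\<close> with transversal part \<open>\<eta>\<close>, Galerkin orthogonality gives
\<open>g(\<psi>) = \<langle>F, \<eta>\<rangle> - g(w \<otimes> u0, \<eta>) = O(\<epsilon>) norm(F) sqrt(g(\<psi>))\<close>, hence \<open>norm(\<psi>) = O(\<epsilon>\<^sup>3\<^sup>/\<^sup>2) norm(F)\<close>.
\<close>

text \<open>Two obstacles shape the development. On the line \<open>h\<close> may tend to 0, so the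
  weight 1/h^2 can be unbounded; the form need not be finite on all of H^1_0, and a divergent
  Bochner integral evaluates to 0. Solutions are therefore built in the finite-energy space
  \<open>Q\<close>, regularity then gives h^(-2) times the y-gradient in L2, so that the solution
  pairs with every test element, and cutoffs in s give uniqueness among all of H^1_0. Secondly, S is
  only an open set: instead of boundary regularity of \<open>u0\<close>, the gap uses Picone's
  inequality, Poincare on small squares and convergence of finitely many averages. The deviation of
  the factor beta from 1 enters at order 1/eps. Tested on w(s)u0(y) against lam0/h^2 it cancels,
  because u0 grad u0 has mean zero; what remains on the diagonal is quadratic in eps h and is
  absorbed by c. In the mixed term it is harmless because w itself is O(eps). The exponent is 1 +
  1/2: the energy norm of the error is O(eps), and the L2 norm is smaller by the oscillator factor
  eps^(1/2).\<close>

notation scaleR (infixr "*R" 75) and inner (infixl "@." 70) and abs ("||_||") and power2 ("(_~2)" [1000] 999)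

abbreviation lims (infixr "~~>" 60) where "X ~~> L == X \<longlonglongrightarrow> L"

abbreviation (input) bm :: "('a::topological_space => 'b::topological_space) set" where "bm == borel_measurable borel"

abbreviation (input) intb :: "('a::euclidean_space => 'b::{banach, second_countable_topology}) => bool" where "intb == integrable lborel"

abbreviation (input) ael :: "('a::euclidean_space => bool) => bool" (binder "AL " 10) where
  "ael P == AE x in lborel. P x"

abbreviation (input) lint :: "('a::euclidean_space => 'b::{banach, second_countable_topology}) => 'b" (binder "LI " 10) where
  "lint f == integral\<^sup>L lborel f"

lemmas bi_add = Bochner_Integration.integrable_add
lemmas bi_bound = Bochner_Integration.integrable_bound
lemmas bi_diff = Bochner_Integration.integrable_diff
lemmas bl_add = Bochner_Integration.integral_add
lemmas bl_cong = Bochner_Integration.integral_cong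
lemmas bl_diff = Bochner_Integration.integral_diff
lemmas bl_sum = Bochner_Integration.integral_sum

section \<open>Square-integrable Borel functions on the whole space and their limits\<close>

text \<open>Measurability is Borel, with \<open>lborel\<close> in place of \<open>lebesgue\<close>:
  slices and compositions of Borel functions stay Borel, so Fubini applies without
  completions.\<close>

definition sqi :: "('a::euclidean_space => 'b::euclidean_space) => bool" where
 "sqi f \<longleftrightarrow> f \<in> bm & intb (%x. (norm (f x))~2)"

definition N2 :: "('a::euclidean_space => 'b::euclidean_space) => real" where
 "N2 f = (LI x. (norm (f x))~2)"

lemma sqi_measurable [measurable_dest]: "sqi f ==> f \<in> bm"
 by (simp add: sqi_def)

lemma sqi_integrable: "sqi f ==> intb (%x. (norm (f x))~2)"
 by (simp add: sqi_def)

lemma N2_nonneg [simp]: "0 <= N2 f"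
 by (simp add: N2_def)

lemma sqi_bound:
 assumes "f \<in> bm" "sqi g" "AL x. norm (f x) <= C * norm (g x)"
 shows "sqi f" "N2 f <= C~2 * N2 g"
proof -
 have m: "g \<in> bm" using assms by (simp add: sqi_def)
 have ae: "AL x. (norm (f x))~2 <= C~2 * (norm (g x))~2"
  using assms(3) by eventually_elim (metis norm_ge_zero power_mono power_mult_distrib)
 have ig: "intb (%x. C~2 * (norm (g x))~2)" using assms(2) by (simp add: sqi_def)
 have i: "intb (%x. (norm (f x))~2)"
  by (rule bi_bound[OF ig]) (use assms(1) ae in auto)
 show "sqi f" using i assms(1) by (simp add: sqi_def)
 have "N2 f <= (LI x. C~2 * (norm (g x))~2)" unfolding N2_def
  by (rule integral_mono_AE[OF i ig ae])
 then show "N2 f <= C~2 * N2 g" by (simp add: N2_def)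
qed

lemma sqi_AE_cong:
 assumes "f \<in> bm" "sqi g" "AL x. f x = g x"
 shows "sqi f" "N2 f = N2 g"
proof -
 show s: "sqi f" by (rule sqi_bound(1)[OF assms(1,2), of 1]) (use assms(3) in auto)
 show "N2 f = N2 g" unfolding N2_def
  by (rule integral_cong_AE) (use assms s in \<open>auto simp: sqi_def\<close>)
qed

lemma sqi_zero [simp]: "sqi (%x. 0)" by (simp add: sqi_def)

lemma N2_zero [simp]: "N2 (%x. 0) = 0" by (simp add: N2_def)

lemma norm_add_sq: "(norm (a + b :: 'b::real_normed_vector))~2 <= 2 * (norm a)~2 + 2 * (norm b)~2"
proof -
 have "(norm (a+b))~2 <= (norm a + norm b)~2" by (intro power_mono norm_triangle_ineq) auto
 also have "... <= 2 * (norm a)~2 + 2 * (norm b)~2"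
  using zero_le_power2[of "norm a - norm b"] by (simp add: power2_eq_square algebra_simps)
 finally show ?thesis .
qed

lemma sqi_add:
 assumes "sqi f" "sqi g"
 shows "sqi (%x. f x + g x)" "N2 (%x. f x + g x) <= 2 * N2 f + 2 * N2 g"
proof -
 have m[measurable]: "g \<in> bm" "f \<in> bm" using assms by (auto simp: sqi_def)
 have ig: "intb (%x. 2 * (norm (f x))~2 + 2 * (norm (g x))~2)"
  using assms by (auto simp: sqi_def)
 have i: "intb (%x. (norm (f x + g x))~2)"
  by (rule bi_bound[OF ig]) (use norm_add_sq in auto)
 show "sqi (%x. f x + g x)" using i m by (simp add: sqi_def)
 have "N2 (%x. f x + g x) <= (LI x. 2 * (norm (f x))~2 + 2 * (norm (g x))~2)" unfolding N2_def
  by (rule integral_mono[OF i ig]) (rule norm_add_sq)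
 also have "... = 2 * N2 f + 2 * N2 g" unfolding N2_def using assms by (simp add: sqi_def)
 finally show "N2 (%x. f x + g x) <= 2 * N2 f + 2 * N2 g" .
qed

lemma sqi_scale:
 assumes "sqi f" shows "sqi (%x. c *R f x)" "N2 (%x. c *R f x) = c~2 * N2 f"
 using assms by (auto simp: sqi_def N2_def power_mult_distrib)

lemma sqi_mult_const: "sqi (f::_=>real) ==> sqi (%x. c * f x)"
 using sqi_scale(1)[of f c] by simp

lemma sqi_uminus: "sqi f ==> sqi (%x. - f x)"
 by (auto simp: sqi_def)

lemma sqi_diff:
 assumes "sqi f" "sqi g"
 shows "sqi (%x. f x - g x)" "N2 (%x. f x - g x) <= 2 * N2 f + 2 * N2 g"
 using sqi_add[OF assms(1) sqi_uminus[OF assms(2)]] by (simp_all add: N2_def)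

lemma sqi_norm: "sqi f ==> sqi (%x. norm (f x))" "N2 (%x. norm (f x)) = N2 f"
 by (auto simp: sqi_def N2_def)

lemma sqi_Pair:
 assumes "sqi f" "sqi g"
 shows "sqi (%x. (f x, g x))" "N2 (%x. (f x, g x)) = N2 f + N2 g"
 using assms by (auto simp: sqi_def N2_def norm_Pair)

lemma bm_fst [measurable]:
 fixes f :: "'a => 'b::euclidean_space \<times> 'c::euclidean_space"
 shows "f \<in> borel_measurable M ==> (%x. fst (f x)) \<in> borel_measurable M"
 by (rule measurable_compose[OF _ borel_measurable_continuous_onI]) (auto intro: continuous_intros)

lemma bm_snd [measurable]:
 fixes f :: "'a => 'b::euclidean_space \<times> 'c::euclidean_space"
 shows "f \<in> borel_measurable M ==> (%x. snd (f x)) \<in> borel_measurable M"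
 by (rule measurable_compose[OF _ borel_measurable_continuous_onI]) (auto intro: continuous_intros)

lemma sqi_fst: assumes "sqi f" shows "sqi (%x. fst (f x))" "N2 (%x. fst (f x)) <= N2 f"
proof -
 have m[measurable]: "f \<in> bm" using assms by (auto simp: sqi_def)
 have a: "norm (fst (f x)) <= 1 * norm (f x)" for x by (metis mult_1 norm_fst_le prod.collapse)
 show "sqi (%x. fst (f x))" "N2 (%x. fst (f x)) <= N2 f"
  using sqi_bound[of "%x. fst (f x)" f 1] assms a by (auto simp: bm_fst)
qed

lemma sqi_snd: assumes "sqi f" shows "sqi (%x. snd (f x))" "N2 (%x. snd (f x)) <= N2 f"
proof -
 have m[measurable]: "f \<in> bm" using assms by (auto simp: sqi_def)
 have a: "norm (snd (f x)) <= 1 * norm (f x)" for x by (metis mult_1 norm_snd_le prod.collapse)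
 show "sqi (%x. snd (f x))" "N2 (%x. snd (f x)) <= N2 f"
  using sqi_bound[of "%x. snd (f x)" f 1] assms a by (auto simp: bm_snd)
qed

lemma inner_le_sq: "norm ((a::'b::real_inner) @. b) <= ((norm a)~2 + (norm b)~2)"
proof -
 have "norm (a @. b) <= norm a * norm b" using Cauchy_Schwarz_ineq2[of a b] by simp
 also have "... <= ((norm a)~2 + (norm b)~2)"
  by (metis add_increasing2 linorder_le_cases mult.commute mult_mono norm_ge_zero power2_eq_square zero_le_power2 add_increasing)
 finally show ?thesis .
qed

lemma sqi_inner:
 assumes "sqi f" "sqi g" shows "intb (%x. f x @. g x)"
proof -
 have m[measurable]: "g \<in> bm" "f \<in> bm" using assms by (auto simp: sqi_def)
 have ig: "intb (%x. (norm (f x))~2 + (norm (g x))~2)"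
  using assms by (auto simp: sqi_def)
 show ?thesis
  by (rule bi_bound[OF ig]) (use inner_le_sq in auto)
qed

lemma sqi_times: "sqi f ==> sqi g ==> intb (%x. f x * g x :: real)"
 using sqi_inner[of f g] by simp

lemma N2_inner: "N2 f = (LI x. f x @. f x)"
 by (simp add: N2_def power2_norm_eq_inner)

lemma CS_times:
 fixes f g :: "'a::euclidean_space => real"
 assumes "sqi f" "sqi g" shows "(LI x. ||f x * g x||) <= sqrt (N2 f) * sqrt (N2 g)"
proof -
 have i: "intb (%x. ||f x * g x||)" using sqi_times[OF assms] by simp
 have key: "2 * (LI x. ||f x * g x||) <= t * N2 f + N2 g / t" if "t > 0" for t
 proof -
  have "(LI x. 2 * ||f x * g x||) <= (LI x. t * (norm (f x))~2 + (norm (g x))~2 / t)"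
  proof (rule integral_mono)
   show "intb (%x. 2 * ||f x * g x||)" using i by simp
   show "intb (%x. t * (norm (f x))~2 + (norm (g x))~2 / t)" using assms by (simp add: sqi_def)
   fix x
   have "0 <= (t * ||f x|| - ||g x||)~2 / t" using that by simp
   also have "... = t * (norm (f x))~2 + (norm (g x))~2 / t - 2 * ||f x * g x||"
    using that by (simp add: power2_eq_square field_simps abs_mult)
   finally show "2 * ||f x * g x|| <= t * (norm (f x))~2 + (norm (g x))~2 / t" by simp
  qed
  also have "... = t * N2 f + N2 g / t" using assms by (simp add: sqi_def N2_def)
  finally show ?thesis by simp
 qed
 define A where "A = sqrt (N2 f)" define B where "B = sqrt (N2 g)"
 have AB: "0 <= A" "0 <= B" "N2 f = A~2" "N2 g = B~2" by (auto simp: A_def B_def)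
 have "(LI x. ||f x * g x||) <= A * B"
 proof (rule field_le_epsilon)
  fix e :: real assume e: "e > 0"
  define d where "d = e / (A + B + 1) "
  have d: "d > 0" using e AB by (simp add: d_def add_nonneg_pos)
  have *: "A + d > 0" "B + d > 0" using d AB by auto
  \<comment> \<open>Young's inequality at the optimal ratio B/A; the shift d keeps the ratio
    positive and finite when one of the norms is zero.\<close>
  have "2 * (LI x. ||f x * g x||) <= (B+d)/(A+d) * A~2 + B~2 / ((B+d)/(A+d))"
   using key[of "(B+d)/(A+d)"] * AB by simp
  also have "(B+d)/(A+d) * A~2 <= (B+d) * A"
  proof -
   have "(B+d)/(A+d) * A~2 = (B+d) * A * (A/(A+d))" by (simp add: power2_eq_square)
   also have "... <= (B+d) * A * 1" using AB * d by (intro mult_left_mono) auto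
   finally show ?thesis by simp
  qed
  also have "B~2 / ((B+d)/(A+d)) <= (A+d) * B"
  proof -
   have "B~2 / ((B+d)/(A+d)) = (A+d) * B * (B/(B+d))" by (simp add: power2_eq_square)
   also have "... <= (A+d) * B * 1" using AB * d by (intro mult_left_mono) auto
   finally show ?thesis by simp
  qed
  also have "(B+d) * A + (A+d)*B = 2 * (A*B) + d * (A+B)" by (simp add: algebra_simps)
  also have "d * (A+B) <= e"
  proof -
   have "d * (A+B) <= d * (A+B+1)" using d by simp
   also have "... = e" using AB unfolding d_def by (simp add: add_nonneg_pos less_imp_neq[symmetric])
   finally show ?thesis .
  qed
  finally show "(LI x. ||f x * g x||) <= A*B + e" using e by simp
 qed
 then show ?thesis by (simp add: A_def B_def)
qed

lemma CS_norm:
 assumes "sqi f" "sqi g" shows "intb (%x. norm (f x) * norm (g x))"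
  "(LI x. norm (f x) * norm (g x)) <= sqrt (N2 f) * sqrt (N2 g)"
 using CS_times[OF sqi_norm(1)[OF assms(1)] sqi_norm(1)[OF assms(2)]] sqi_times[OF sqi_norm(1)[OF assms(1)] sqi_norm(1)[OF assms(2)]]
 by (simp_all add: sqi_norm(2) abs_mult)

lemma CS_bound:
 assumes "sqi f" "sqi g" and m: "u \<in> bm" and b: "AL x. ||u x|| <= C * (norm (f x) * norm (g x))"
  and C: "0 <= C"
 shows "intb u" "||\<integral>x. u x \<partial>lborel|| <= C * (sqrt (N2 f) * sqrt (N2 g))"
proof -
 have i: "intb (%x. C * (norm (f x) * norm (g x)))" using CS_norm[OF assms(1,2)] by simp
 show iu: "intb u"
  by (rule bi_bound[OF i]) (use m b C in auto)
 have "||\<integral>x. u x \<partial>lborel|| <= (LI x. ||u x||)" using integral_norm_bound[of lborel u] by simp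
 also have "... <= (LI x. C * (norm (f x) * norm (g x)))"
  by (rule integral_mono_AE) (use iu i b in auto)
 also have "... <= C * (sqrt (N2 f) * sqrt (N2 g))" using CS_norm[OF assms(1,2)] C by (simp add: mult_left_mono)
 finally show "||\<integral>x. u x \<partial>lborel|| <= C * (sqrt (N2 f) * sqrt (N2 g))" .
qed

lemma CS_inner:
 assumes "sqi f" "sqi g" shows "||\<integral>x. f x @. g x \<partial>lborel|| <= sqrt (N2 f) * sqrt (N2 g)"
proof -
 have m[measurable]: "g \<in> bm" "f \<in> bm" using assms by (auto simp: sqi_def)
 show ?thesis using CS_bound(2)[of f g "%x. f x @. g x" 1] assms by (simp add: Cauchy_Schwarz_ineq2)
qed

definition l2lim :: "(nat => 'a::euclidean_space => 'b::euclidean_space) => ('a => 'b) => bool" where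
 "l2lim X f \<longleftrightarrow> sqi f & (\<forall>n. sqi (X n)) & (%n. N2 (%x. X n x - f x)) ~~> 0"

lemma l2lim_const: "sqi f ==> l2lim (%n. f) f"
 by (simp add: l2lim_def)

lemma l2lim_add:
 assumes "l2lim X f" "l2lim Y g" shows "l2lim (%n x. X n x + Y n x) (%x. f x + g x)"
proof -
 have s: "sqi f" "sqi g" "!!n. sqi (X n)" "!!n. sqi (Y n)" using assms by (auto simp: l2lim_def)
 have "(%n. 2 * N2 (%x. X n x - f x) + 2 * N2 (%x. Y n x - g x)) ~~> 2*0+2*0"
  using assms unfolding l2lim_def by (intro tendsto_intros) auto
 then have l: "(%n. 2 * N2 (%x. X n x - f x) + 2 * N2 (%x. Y n x - g x)) ~~> 0" by simp
 have "N2 (%x. X n x + Y n x - (f x + g x)) <= 2 * N2 (%x. X n x - f x) + 2 * N2 (%x. Y n x - g x)" for n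
  using sqi_add(2)[OF sqi_diff(1)[OF s(3) s(1)] sqi_diff(1)[OF s(4) s(2)], of n n] by (simp add: algebra_simps)
 then have "(%n. N2 (%x. X n x + Y n x - (f x + g x))) ~~> 0"
  by (intro tendsto_sandwich[OF _ _ tendsto_const l]) auto
 then show ?thesis using sqi_add(1) s by (auto simp: l2lim_def)
qed

text \<open>The Lipschitz bound is asked for only between \<open>X n x\<close> and
  \<open>f x\<close> and only almost everywhere, so it also covers maps that are controlled merely
  on the set where these functions live.\<close>

lemma l2lim_lip:
 fixes T :: "'a::euclidean_space => 'b::euclidean_space => 'c::euclidean_space"
 assumes l: "l2lim X f" and T: "!!n. AL x. norm (T x (X n x) - T x (f x)) <= C * norm (X n x - f x)"
  and m: "(%x. T x (f x)) \<in> bm" "!!n. (%x. T x (X n x)) \<in> bm"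
  and s: "sqi (%x. T x (f x))"
 shows "l2lim (%n x. T x (X n x)) (%x. T x (f x))"
proof -
 have d: "sqi (%x. X n x - f x)" for n using l by (auto simp: l2lim_def intro: sqi_diff(1))
 have sT: "sqi (%x. T x (X n x) - T x (f x))" "N2 (%x. T x (X n x) - T x (f x)) <= C~2 * N2 (%x. X n x - f x)" for n
  using sqi_bound[OF _ d T] m by auto
 have "sqi (%x. T x (X n x))" for n using sqi_add(1)[OF sT(1)[of n] s] by simp
 moreover have "(%n. N2 (%x. T x (X n x) - T x (f x))) ~~> 0"
 proof (rule tendsto_sandwich[OF _ _ tendsto_const])
  show "(%n. C~2 * N2 (%x. X n x - f x)) ~~> 0" using l tendsto_mult_right_zero unfolding l2lim_def by blast
 qed (use sT in auto)
 ultimately show ?thesis using s by (simp add: l2lim_def)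
qed

lemma l2lim_scale: assumes "l2lim X f" shows "l2lim (%n x. c *R X n x) (%x. c *R f x)"
proof -
 have m[measurable]: "f \<in> bm" "!!n. X n \<in> bm" using assms by (auto simp: sqi_def l2lim_def)
 have "sqi f" using assms by (auto simp: l2lim_def)
 then show ?thesis
 by (intro l2lim_lip[OF assms, where T="%x y. c *R y" and C="||c||"] sqi_scale) (auto simp flip: scaleR_diff_right)
qed

lemma l2lim_diff:
 assumes "l2lim X f" "l2lim Y g" shows "l2lim (%n x. X n x - Y n x) (%x. f x - g x)"
 using l2lim_add[OF assms(1) l2lim_scale[OF assms(2), of "-1"]] by simp

lemma l2lim_bdd_mult:
 assumes l: "l2lim X f" and [measurable]: "m \<in> bm" and b: "!!x. ||m x|| <= C"
 shows "l2lim (%n x. m x *R X n x) (%x. m x *R f x)"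
proof -
 have m[measurable]: "f \<in> bm" "!!n. X n \<in> bm" using l by (auto simp: sqi_def l2lim_def)
 have "sqi f" using l by (auto simp: l2lim_def)
 show ?thesis
 proof (rule l2lim_lip[OF l, where T="%x y. m x *R y" and C=C])
  show "sqi (%x. m x *R f x)" by (rule sqi_bound(1)[of _ f C]) (use \<open>sqi f\<close> b in \<open>auto simp: mult_right_mono\<close>)
 qed (auto simp flip: scaleR_diff_right simp: b mult_right_mono)
qed

lemma l2lim_Pair: assumes "l2lim X f" "l2lim Y g" shows "l2lim (%n x. (X n x, Y n x)) (%x. (f x, g x))"
proof -
 have s: "sqi f" "sqi g" "!!n. sqi (X n)" "!!n. sqi (Y n)" using assms by (auto simp: l2lim_def)
 have "N2 (%x. (X n x, Y n x) - (f x, g x)) = N2 (%x. X n x - f x) + N2 (%x. Y n x - g x)" for n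
  using sqi_Pair(2)[OF sqi_diff(1)[OF s(3) s(1)] sqi_diff(1)[OF s(4) s(2)], of n n] by simp
 moreover have "(%n. N2 (%x. X n x - f x) + N2 (%x. Y n x - g x)) ~~> 0+0"
  using assms unfolding l2lim_def by (intro tendsto_intros) auto
 ultimately show ?thesis using s by (auto simp: l2lim_def intro: sqi_Pair(1))
qed

lemma l2lim_fst: assumes "l2lim X f" shows "l2lim (%n x. fst (X n x)) (%x. fst (f x))"
proof (rule l2lim_lip[OF assms, where T="%x y. fst y" and C=1])
 have m[measurable]: "f \<in> bm" "!!n. X n \<in> bm" using assms by (auto simp: sqi_def l2lim_def)
 show "(%x. fst (f x)) \<in> bm" "!!n. (%x. fst (X n x)) \<in> bm" by (auto simp: bm_fst)
 show "sqi (%x. fst (f x))" using assms sqi_fst by (auto simp: l2lim_def)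
qed (auto simp flip: fst_diff simp: norm_fst_le[of "fst p" "snd p" for p, simplified])

lemma l2lim_snd: assumes "l2lim X f" shows "l2lim (%n x. snd (X n x)) (%x. snd (f x))"
proof (rule l2lim_lip[OF assms, where T="%x y. snd y" and C=1])
 have m[measurable]: "f \<in> bm" "!!n. X n \<in> bm" using assms by (auto simp: sqi_def l2lim_def)
 show "(%x. snd (f x)) \<in> bm" "!!n. (%x. snd (X n x)) \<in> bm" by (auto simp: bm_snd)
 show "sqi (%x. snd (f x))" using assms sqi_snd by (auto simp: l2lim_def)
qed (auto simp flip: snd_diff simp: norm_snd_le[of "snd p" "fst p" for p, simplified])

lemma l2lim_inner:
 assumes "l2lim X f" "l2lim Y g" shows "(%n. \<integral>x. X n x @. Y n x \<partial>lborel) ~~> (LI x. f x @. g x)"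
proof -
 have s: "sqi f" "sqi g" "!!n. sqi (X n)" "!!n. sqi (Y n)" using assms by (auto simp: l2lim_def)
 define a where "a n = sqrt (N2 (%x. X n x - f x))" for n
 define b where "b n = sqrt (N2 (%x. Y n x - g x))" for n
 have a: "a ~~> 0" and b: "b ~~> 0"
  using assms unfolding l2lim_def a_def b_def by (auto simp: tendsto_real_sqrt[where x=0, simplified])
 have eq: "(LI x. X n x @. Y n x) - (LI x. f x @. g x) =
  (LI x. (X n x - f x) @. (Y n x - g x)) + (LI x. (X n x - f x) @. g x) + (LI x. f x @. (Y n x - g x))" for n
 proof -
  have "X n x @. Y n x = (X n x - f x) @. (Y n x - g x) + (X n x - f x) @. g x + f x @. (Y n x - g x) + f x @. g x" for x
   by (simp add: algebra_simps)
  then show ?thesis by (simp add: sqi_inner sqi_diff s)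
 qed
 have bd: "norm ((LI x. X n x @. Y n x) - (LI x. f x @. g x)) <= a n * b n + a n * sqrt (N2 g) + sqrt (N2 f) * b n" for n
  unfolding eq a_def b_def real_norm_def
  using CS_inner[OF sqi_diff(1)[OF s(3,1)] sqi_diff(1)[OF s(4,2)], of n n] CS_inner[OF sqi_diff(1)[OF s(3,1)] s(2), of n] CS_inner[OF s(1) sqi_diff(1)[OF s(4,2)], of n]
  by linarith
 have "(%n. a n * b n + a n * sqrt (N2 g) + sqrt (N2 f) * b n) ~~> 0 * 0 + 0 * sqrt (N2 g) + sqrt (N2 f) * 0"
  by (intro tendsto_intros a b)
 then have "(%n. a n * b n + a n * sqrt (N2 g) + sqrt (N2 f) * b n) ~~> 0" by simp
 then have "(%n. (LI x. X n x @. Y n x) - (LI x. f x @. g x)) ~~> 0"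
  by (rule Lim_null_comparison[rotated]) (use bd in auto)
 then show ?thesis by (simp add: LIM_zero_iff)
qed

lemma l2lim_times:
 fixes f g :: "'a::euclidean_space => real"
 assumes "l2lim X f" "l2lim Y g" shows "(%n. \<integral>x. X n x * Y n x \<partial>lborel) ~~> (LI x. f x * g x)"
 using l2lim_inner[OF assms] by simp

lemma l2lim_N2: "l2lim X f ==> (%n. N2 (X n)) ~~> N2 f"
 using l2lim_inner[of X f X f] by (simp add: N2_inner)

lemma l2lim_subseq: "l2lim X f ==> strict_mono r ==> l2lim (%n. X (r n)) f"
 unfolding l2lim_def using LIMSEQ_subseq_LIMSEQ[of "%n. N2 (%x. X n x - f x)" 0 r] by (auto simp: o_def)

lemma l2lim_AE_subseq:
 assumes "l2lim X f" shows "\<exists>r. strict_mono r & (AL x. (%n. X (r n) x) ~~> f x)"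
proof -
 have s: "sqi f" "!!n. sqi (X n)" using assms by (auto simp: l2lim_def)
 have "\<exists>r::nat=>nat. strict_mono r & (AL x. (%n. (norm (X (r n) x - f x))~2) ~~> 0)"
  by (rule tendsto_L1_AE_subseq) (use assms sqi_diff(1)[OF s(2,1)] in \<open>auto simp: l2lim_def sqi_def N2_def\<close>)
 then obtain r where r: "strict_mono r" "AL x. (%n. (norm (X (r n) x - f x))~2) ~~> 0" by auto
 have "AL x. (%n. X (r n) x) ~~> f x" using r(2)
 proof eventually_elim
  case (elim x)
  have "(%n. norm (X (r n) x - f x)) ~~> 0" using tendsto_real_sqrt[OF elim] by simp
  then show ?case using LIM_zero_iff tendsto_norm_zero_iff by blast
 qed
 then show ?thesis using r by auto
qed

lemma AE_eq_0_N2: "sqi f ==> N2 f = 0 ==> AL x. f x = 0"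
 unfolding N2_def sqi_def by (subst (asm) integral_nonneg_eq_0_iff_AE) auto

lemma l2lim_unique: assumes "l2lim X f" "l2lim X g" shows "AL x. f x = g x"
proof -
 have s: "sqi f" "sqi g" using assms by (auto simp: l2lim_def)
 have "l2lim (%n x. X n x - X n x) (%x. f x - g x)" by (rule l2lim_diff[OF assms])
 then have "N2 (%x. f x - g x) = 0" using l2lim_N2[of "%n x. X n x - X n x" "%x. f x - g x"] by (simp add: LIMSEQ_const_iff)
 then show ?thesis using AE_eq_0_N2[OF sqi_diff(1)[OF s]] by auto
qed

lemma l2lim_AE_cong: assumes "l2lim X f" "AL x. f x = g x" "g \<in> bm"
 shows "l2lim X g"
proof -
 have s: "sqi f" "!!n. sqi (X n)" using assms by (auto simp: l2lim_def)
 have "AL x. g x = f x" using assms(2) by eventually_elim simp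
 then have g: "sqi g" by (rule sqi_AE_cong(1)[OF assms(3) s(1)])
 have "N2 (%x. X n x - g x) = N2 (%x. X n x - f x)" for n
  by (rule sqi_AE_cong(2)) (use s g assms(2) in \<open>auto intro: sqi_diff(1)\<close>)
 then show ?thesis using assms g by (auto simp: l2lim_def)
qed

lemma l2_dominated:
 assumes [measurable]: "f \<in> bm" "!!n. X n \<in> bm" and w: "sqi w"
  and l: "AL x. (%n. X n x) ~~> f x" and b: "!!n. AL x. norm (X n x) <= norm (w x)"
 shows "l2lim X f"
proof -
 have s: "sqi (X n)" for n using sqi_bound(1)[of "X n" w 1] b w by auto
 have "AL x. \<forall>n. norm (X n x) <= norm (w x)" using b by (simp add: AE_all_countable)
 then have bf: "AL x. norm (f x) <= norm (w x)" using l
 proof eventually_elim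
  case (elim x)
  show ?case by (rule LIMSEQ_le_const2[OF tendsto_norm[OF elim(2)]]) (use elim in auto)
 qed
 have sf: "sqi f" using sqi_bound(1)[of f w 1] bf w by auto
 have wm[measurable]: "w \<in> bm" using w by (simp add: sqi_def)
 have "(%n. \<integral>x. (norm (X n x - f x))~2 \<partial>lborel) ~~> (\<integral>x. 0 \<partial>(lborel :: 'a measure))"
 proof (rule integral_dominated_convergence[where w="%x. 4 * (norm (w x))~2"])
  show "(%x. 0::real) \<in> borel_measurable lborel" "!!n. (%x. (norm (X n x - f x))~2) \<in> borel_measurable lborel" by measurable
  show "intb (%x. 4 * (norm (w x))~2)" using w by (simp add: sqi_def)
  show "AL x. (%n. (norm (X n x - f x))~2) ~~> 0" using l
   by eventually_elim (auto intro!: tendsto_eq_intros simp: LIM_zero)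
  fix n show "AL x. norm ((norm (X n x - f x))~2) <= 4 * (norm (w x))~2" using bf b[of n]
  proof eventually_elim
   case (elim x)
   have "norm (X n x - f x) <= 2 * norm (w x)" using norm_triangle_ineq4[of "X n x" "f x"] elim by linarith
   then have "(norm (X n x - f x))~2 <= (2 * norm (w x))~2" by (intro power_mono) auto
   then show ?case by simp
  qed
 qed
 then show ?thesis using s sf by (simp add: l2lim_def N2_def)
qed

text \<open>Riesz-Fischer for functions instead of classes: a rapidly converging subsequence
  converges almost everywhere, and Fatou's lemma turns the Cauchy bound into a bound on the distance
  to that pointwise limit.\<close>

lemma l2_complete:
 assumes s: "!!n. sqi (X n)" and c: "!!e. e > 0 ==> \<exists>N. \<forall>m\<ge>N. \<forall>n\<ge>N. N2 (%x. X m x - X n x) < e"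
 shows "\<exists>f. l2lim X f"
proof -
 have m[measurable]: "X n \<in> bm" for n using s by (auto simp: sqi_def)
 have "\<exists>M. \<forall>k. (\<forall>m\<ge>M k. \<forall>n\<ge>M k. N2 (%x. X m x - X n x) < (1/4)^k)"
  by (rule choice, intro allI c) simp
 then obtain M where M: "!!k m n. m >= M k ==> n >= M k ==> N2 (%x. X m x - X n x) < (1/4)^k" by metis
 \<comment> \<open>A cumulative sum lies beyond every threshold M i with i at most k, so r k and r
   (Suc k) are both beyond M k; the summand k makes the indices tend to infinity.\<close>
 define r where "r k = (\<Sum>i\<le>k. M i) + k" for k
 have rM: "r k >= M k" for k unfolding r_def by (metis finite_atMost atMost_iff le_add1 le_trans member_le_sum order_refl zero_le)
 have rS: "r (Suc k) >= M k" for k using rM[of k] by (simp add: r_def)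
 \<comment> \<open>Weighted by 2^k, the squares of d k still have summable integrals because those
   are at most (1/4)^k. Finiteness of the weighted sum at a point then forces d k x to decay like
   2^(-k/2).\<close>
 define d where "d k x = norm (X (r (Suc k)) x - X (r k) x)" for k x
 have dm[measurable]: "d k \<in> bm" for k unfolding d_def by measurable
 have di: "(\<integral>\<^sup>+x. ennreal ((d k x)~2) \<partial>lborel) <= ennreal ((1/4)^k)" for k
 proof -
  have "intb (%x. (d k x)~2)" using sqi_diff(1)[OF s s] by (simp add: sqi_def d_def)
  then have "(\<integral>\<^sup>+x. ennreal ((d k x)~2) \<partial>lborel) = ennreal (N2 (%x. X (r (Suc k)) x - X (r k) x))"
   by (subst nn_integral_eq_integral) (auto simp: d_def N2_def)
  then show ?thesis using M[OF rS rM, of k] by (simp add: ennreal_leI less_imp_le)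
 qed
 have "(\<integral>\<^sup>+x. (\<Sum>k. ennreal (2^k * (d k x)~2)) \<partial>lborel) = (\<Sum>k. \<integral>\<^sup>+x. ennreal (2^k * (d k x)~2) \<partial>lborel)"
  by (rule nn_integral_suminf) auto
 also have "... <= (\<Sum>k. ennreal ((1/2)^k))"
 proof (rule suminf_le)
  fix k :: nat
  have "(\<integral>\<^sup>+x. ennreal (2^k * (d k x)~2) \<partial>lborel) = ennreal (2^k) * (\<integral>\<^sup>+x. ennreal ((d k x)~2) \<partial>lborel)"
   by (simp add: ennreal_mult' nn_integral_cmult)
  also have "... <= ennreal (2^k) * ennreal ((1/4)^k)" by (intro mult_left_mono di) auto
  also have "... = ennreal (2^k * (1/4)^k)" by (simp add: ennreal_mult')
  also have "(2::real)^k * (1/4)^k = (1/2)^k" by (simp flip: power_mult_distrib)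
  finally show "(\<integral>\<^sup>+x. ennreal (2^k * (d k x)~2) \<partial>lborel) <= ennreal ((1/2)^k)" .
 qed auto
 also have "... = ennreal (\<Sum>k. (1/2)^k)" by (intro suminf_ennreal2 summable_geometric) auto
 also have "... < \<infinity>" by simp
 finally have fin: "(\<integral>\<^sup>+x. (\<Sum>k. ennreal (2^k * (d k x)~2)) \<partial>lborel) ~= \<infinity>" by simp
 have "AL x. (\<Sum>k. ennreal (2^k * (d k x)~2)) ~= \<infinity>"
  by (rule nn_integral_PInf_AE) (use fin in auto)
 then have conv: "AL x. convergent (%k. X (r k) x)"
 proof eventually_elim
  case (elim x)
  have "summable (%k. 2^k * (d k x)~2)" by (rule summable_suminf_not_top) (use elim in auto)
  then have "Bseq (%k. 2^k * (d k x)~2)" by (blast intro: convergent_imp_Bseq convergentI summable_LIMSEQ_zero)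
  then obtain C where "\<forall>k. norm (2^k * (d k x)~2) <= C" by (rule BseqE)
  then have C: "2^k * (d k x)~2 <= C" for k by (simp add: abs_mult)
  have dk: "d k x <= sqrt C * (1 / sqrt 2)^k" for k
  proof -
   have "(d k x)~2 <= C * (1/2)^k" using C[of k] by (simp add: power_one_over field_simps)
   then have "sqrt ((d k x)~2) <= sqrt (C * (1/2)^k)" by (rule real_sqrt_le_mono)
   moreover have "sqrt (C * (1/2)^k) = sqrt C * (1 / sqrt 2)^k" by (simp add: real_sqrt_mult real_sqrt_power real_sqrt_divide)
   ultimately show ?thesis by (simp add: d_def)
  qed
  have "summable (%k. d k x)"
   by (rule summable_comparison_test'[OF summable_mult[OF summable_geometric[of "1/sqrt 2"], of "sqrt C"]])
    (use dk in \<open>auto simp: d_def\<close>)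
  then have "summable (%k. X (r (Suc k)) x - X (r k) x)" unfolding d_def by (rule summable_norm_cancel)
  then have "convergent (%n. \<Sum>k<n. X (r (Suc k)) x - X (r k) x)" by (simp add: summable_iff_convergent)
  then have "convergent (%n. X (r n) x - X (r 0) x)" by (simp add: sum_lessThan_telescope[of "%n. X (r n) x"])
  then have "convergent (%n. (X (r n) x - X (r 0) x) + X (r 0) x)" by (intro convergent_add convergent_const)
  then show ?case by simp
 qed
 define f where "f x = lim (%k. X (r k) x)" for x
 have fm[measurable]: "f \<in> bm" unfolding f_def by (rule borel_measurable_lim_metric) auto
 have lim: "AL x. (%k. X (r k) x) ~~> f x" using conv by eventually_elim (simp add: f_def convergent_LIMSEQ_iff)
 have rinf: "k <= r k" for k by (simp add: r_def)
 have key: "(\<integral>\<^sup>+x. ennreal ((norm (X n x - f x))~2) \<partial>lborel) <= ennreal e"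
  if e: "\<forall>m\<ge>N. \<forall>n\<ge>N. N2 (%x. X m x - X n x) < e" and n: "n >= N" for n N e
 proof -
  have "(\<integral>\<^sup>+x. ennreal ((norm (X n x - f x))~2) \<partial>lborel) = (\<integral>\<^sup>+x. liminf (%k. ennreal ((norm (X n x - X (r k) x))~2)) \<partial>lborel)"
  proof (rule nn_integral_cong_AE)
   show "AL x. ennreal ((norm (X n x - f x))~2) = liminf (%k. ennreal ((norm (X n x - X (r k) x))~2))"
    using lim
   proof eventually_elim
    case (elim x)
    have "(%k. ennreal ((norm (X n x - X (r k) x))~2)) ~~> ennreal ((norm (X n x - f x))~2)"
     by (intro tendsto_ennrealI tendsto_intros elim)
    then show ?case by (intro lim_imp_Liminf[symmetric]) simp_all
   qed
  qed
  also have "... <= liminf (%k. \<integral>\<^sup>+x. ennreal ((norm (X n x - X (r k) x))~2) \<partial>lborel)"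
   by (rule nn_integral_liminf) auto
  also have "... <= ennreal e"
  proof (rule Liminf_le)
   have "(\<integral>\<^sup>+x. ennreal ((norm (X n x - X (r k) x))~2) \<partial>lborel) <= ennreal e" if "k >= N" for k
   proof -
    have "intb (%x. (norm (X n x - X (r k) x))~2)" using sqi_diff(1)[OF s s] by (simp add: sqi_def)
    then have "(\<integral>\<^sup>+x. ennreal ((norm (X n x - X (r k) x))~2) \<partial>lborel) = ennreal (N2 (%x. X n x - X (r k) x))"
     by (subst nn_integral_eq_integral) (auto simp: N2_def)
    then show ?thesis using e n that rinf[of k] by (simp add: ennreal_leI less_imp_le)
   qed
   then show "\<forall>\<^sub>F k in sequentially. (\<integral>\<^sup>+x. ennreal ((norm (X n x - X (r k) x))~2) \<partial>lborel) <= ennreal e"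
    using eventually_sequentially by blast
  qed simp
  finally show ?thesis .
 qed
 have sd: "sqi (%x. X n x - f x) & N2 (%x. X n x - f x) <= e"
  if e: "\<forall>m\<ge>N. \<forall>n\<ge>N. N2 (%x. X m x - X n x) < e" and n: "n >= N" for n N e
 proof -
  note k = key[OF e n]
  have i: "intb (%x. (norm (X n x - f x))~2)"
   by (rule integrableI_bounded) (use k in \<open>auto simp: le_less_trans\<close>)
  have "ennreal (N2 (%x. X n x - f x)) <= ennreal e" using k unfolding N2_def by (subst (asm) nn_integral_eq_integral) (use i in auto)
  moreover have "0 <= e" using e n N2_nonneg by (metis less_eq_real_def le_less_trans)
  ultimately show ?thesis using i by (simp add: sqi_def)
 qed
 obtain N0 where N0: "\<forall>m\<ge>N0. \<forall>n\<ge>N0. N2 (%x. X m x - X n x) < 1" using c[of 1] by auto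
 have "sqi (%x. X N0 x - f x)" using sd[OF N0] by auto
 then have sf: "sqi f" using sqi_diff(1)[OF s[of N0], of "%x. X N0 x - f x"] by simp
 have "(%n. N2 (%x. X n x - f x)) ~~> 0"
 proof (rule LIMSEQ_I)
  fix e :: real assume "e > 0"
  then obtain N where "\<forall>m\<ge>N. \<forall>n\<ge>N. N2 (%x. X m x - X n x) < e/2" using c[of "e/2"] by auto
  then have "\<forall>n\<ge>N. N2 (%x. X n x - f x) <= e/2" using sd by blast
  then show "\<exists>no. \<forall>n\<ge>no. norm (N2 (%x. X n x - f x) - 0) < e" using \<open>e > 0\<close>
   by (intro exI[of _ N]) (auto intro: le_less_trans)
 qed
 then show ?thesis using sf s by (auto simp: l2lim_def)
qed

section \<open>Riesz representation for a form on a set of functions\<close>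

text \<open>Functions equal almost everywhere are not identified, so \<open>B\<close> may be only
  semidefinite and \<open>V\<close> is just a set closed under linear combinations. The representing
  element minimises J(v) = B(v,v) - 2 l(v); the parallelogram law makes a minimising sequence Cauchy
  and \<open>compl\<close> supplies its limit.\<close>

lemma riesz_representation:
 fixes V :: "('a => 'b::real_vector) set"
 assumes V0: "(%x. 0) \<in> V" and Vc: "!!f g c. f \<in> V ==> g \<in> V ==> (%x. f x + c *R g x) \<in> V"
  and sym: "!!f g. f \<in> V ==> g \<in> V ==> B f g = B g f"
  and lin: "!!f g h c. f \<in> V ==> g \<in> V ==> h \<in> V ==> B (%x. f x + c *R g x) h = B f h + c * B g h"
  and pos: "!!f. f \<in> V ==> 0 <= B f f"
  and llin: "!!f g c. f \<in> V ==> g \<in> V ==> l (%x. f x + c *R g x) = l f + c * (l g :: real)"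
  and lb: "!!f. f \<in> V ==> ||l f|| <= K * sqrt (B f f)"
  and compl: "!!X. (!!n::nat. X n \<in> V) ==> (!!e. e > 0 ==> \<exists>N. \<forall>m\<ge>N. \<forall>n\<ge>N. B (%x. X m x - X n x) (%x. X m x - X n x) < e) ==>
   \<exists>f\<in>V. (%n. B (%x. X n x - f x) (%x. X n x - f x)) ~~> 0"
 shows "\<exists>u\<in>V. \<forall>v\<in>V. B u v = l v"
proof -
 define J where "J v = B v v - 2 * l v" for v
 have add: "(%x. f x + g x) \<in> V" if "f \<in> V" "g \<in> V" for f g using Vc[OF that, of 1] by simp
 have dif: "(%x. f x - g x) \<in> V" if "f \<in> V" "g \<in> V" for f g using Vc[OF that, of "-1"] by simp
 have lin2: "B h (%x. f x + c *R g x) = B h f + c * B h g" if "f \<in> V" "g \<in> V" "h \<in> V" for f g h c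
  using lin[OF that] sym that Vc by simp
 have quad: "B (%x. f x + c *R g x) (%x. f x + c *R g x) = B f f + 2 * c * B f g + c~2 * B g g" if "f \<in> V" "g \<in> V" for f g c
  using lin[OF that Vc[OF that]] lin2[OF that] sym[OF that] that by (simp add: power2_eq_square algebra_simps)
 have Jlow: "J v >= - K~2" if "v \<in> V" for v
 proof -
  have "0 <= (sqrt (B v v) - K)~2" by simp
  also have "... = B v v - 2 * (K * sqrt (B v v)) + K~2" using pos[OF that] by (simp add: power2_diff)
  finally show ?thesis using lb[OF that] unfolding J_def by linarith
 qed
 define m where "m = Inf (J ` V)"
 have bdd: "bdd_below (J ` V)" using Jlow by (auto intro!: bdd_belowI)
 have mle: "m <= J v" if "v \<in> V" for v unfolding m_def using bdd that by (simp add: cInf_lower)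
 have "\<exists>v\<in>V. J v < m + e" if "e > 0" for e
 proof -
  have "Inf (J ` V) < m + e" using that by (simp add: m_def)
  then show ?thesis using cInf_lessD[of "J ` V"] V0 by blast
 qed
 then have "\<forall>n. \<exists>v\<in>V. J v < m + 1 / Suc n" by (metis zero_less_divide_1_iff of_nat_0_less_iff zero_less_Suc)
 then obtain X where X: "!!n. X n \<in> V" "!!n. J (X n) < m + 1 / Suc n" by metis
 \<comment> \<open>Parallelogram law at the midpoint h of X i and X j, where J is at least its
   infimum m.\<close>
 have par: "B (%x. X i x - X j x) (%x. X i x - X j x) <= 2 / Suc i + 2 / Suc j" for i j
 proof -
  let ?f = "X i" and ?g = "X j"
  define h where "h = (%x. (1/2) *R (%x. ?f x + ?g x) x)"
  have z: "(%x. 0 + (1/2) *R (?f x + ?g x)) \<in> V" by (rule Vc[OF V0 add]) (use X in auto)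
  then have hV: "h \<in> V" by (simp add: h_def)
  have zz: "B (%x. 0) w = 0" if "w \<in> V" for w using lin[OF V0 V0 that, of 1] by simp
  have lz: "l (%x. 0) = 0" using llin[OF V0 V0, of 1] by simp
  have Bh: "B h h = (1/4) * B (%x. ?f x + ?g x) (%x. ?f x + ?g x)"
   using quad[OF V0 add[of ?f ?g], of "1/2"] X zz[OF V0] zz[OF add[of ?f ?g]] by (simp add: h_def power2_eq_square)
  have lh: "l h = (1/2) * (l ?f + l ?g)" using llin[OF V0 add[of ?f ?g], of "1/2"] llin[of ?f ?g 1] X lz by (simp add: h_def)
  have q1: "B (%x. ?f x + ?g x) (%x. ?f x + ?g x) = B ?f ?f + 2 * B ?f ?g + B ?g ?g" using quad[of ?f ?g 1] X by simp
  have q2: "B (%x. ?f x - ?g x) (%x. ?f x - ?g x) = B ?f ?f - 2 * B ?f ?g + B ?g ?g" using quad[of ?f ?g "-1"] X by simp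
  have "B (%x. ?f x - ?g x) (%x. ?f x - ?g x) = 2 * J ?f + 2 * J ?g - 4 * J h"
   unfolding J_def Bh lh q1 q2 by (simp add: algebra_simps)
  also have "... <= 2 * (1 / Suc i) + 2 * (1 / Suc j)"
  proof -
   define s where "s = 1 / real (Suc i)" define t where "t = 1 / real (Suc j)"
   have "J ?f < m + s" "J ?g < m + t" using X(2)[of i] X(2)[of j] unfolding s_def t_def by auto
   then show ?thesis using mle[OF hV] unfolding s_def[symmetric] t_def[symmetric] by linarith
  qed
  finally show ?thesis by simp
 qed
 have "\<exists>f\<in>V. (%n. B (%x. X n x - f x) (%x. X n x - f x)) ~~> 0"
 proof (rule compl[OF X(1)])
  fix e :: real assume e: "e > 0"
  obtain N :: nat where N: "1 / Suc N < e / 4" using e nat_approx_posE[of "e/4"] by auto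
  show "\<exists>N. \<forall>m\<ge>N. \<forall>n\<ge>N. B (%x. X m x - X n x) (%x. X m x - X n x) < e"
  proof (intro exI[of _ N] allI impI)
   fix i j assume "i >= N" "j >= N"
   then have "1 / Suc i <= 1 / Suc N" "1 / Suc j <= 1 / Suc N" by (auto simp: frac_le)
   then show "B (%x. X i x - X j x) (%x. X i x - X j x) < e" using par[of i j] N by simp
  qed
 qed
 then obtain u where u: "u \<in> V" and lim: "(%n. B (%x. X n x - u x) (%x. X n x - u x)) ~~> 0" by auto
 \<comment> \<open>For B g g = 0 the nonnegative quadratic in c degenerates to an affine function,
   which forces B f g = 0.\<close>
 have CS: "(B f g)~2 <= B f f * B g g" if "f \<in> V" "g \<in> V" for f g
 proof -
  have q: "0 <= B f f + 2 * c * B f g + c~2 * B g g" for c using quad[OF that] pos Vc[OF that] by metis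
  show ?thesis
  proof (cases "B g g = 0")
   case True
   have "B f g = 0"
   proof (rule ccontr)
    assume n: "B f g ~= 0"
    show False using q[of "- (B f f + 1) / (2 * B f g)"] True n by (simp add: field_simps)
   qed
   then show ?thesis using True by simp
  next
   case False
   then have g: "B g g > 0" using pos that(2) by (metis less_eq_real_def)
   have "0 <= B g g * (B f f + 2 * (- B f g / B g g) * B f g + (- B f g / B g g)~2 * B g g)"
    using q[of "- B f g / B g g"] g by (intro mult_nonneg_nonneg) auto
   also have "... = B f f * B g g - (B f g)~2" using g by (simp add: field_simps power2_eq_square)
   finally show ?thesis by simp
  qed
 qed
 have Ju: "J u = m"
 proof -
  have Jd: "J (X n) = J u + 2 * B u (%x. X n x - u x) + B (%x. X n x - u x) (%x. X n x - u x) - 2 * l (%x. X n x - u x)" for n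
  proof -
   have "X n = (%x. u x + 1 *R (X n x - u x))" by auto
   then have "J (X n) = J (%x. u x + 1 *R (X n x - u x))" by simp
   also have "... = J u + 2 * B u (%x. X n x - u x) + B (%x. X n x - u x) (%x. X n x - u x) - 2 * l (%x. X n x - u x)"
    unfolding J_def using quad[OF u dif[OF X(1) u], of 1 n] llin[OF u dif[OF X(1) u], of 1 n] by simp
   finally show ?thesis .
  qed
  have sq: "(%n. sqrt (B (%x. X n x - u x) (%x. X n x - u x))) ~~> 0" using tendsto_real_sqrt[OF lim] by simp
  have t1: "(%n. B u (%x. X n x - u x)) ~~> 0"
  proof (rule Lim_null_comparison[OF _ tendsto_mult_right_zero[OF sq]])
   show "\<forall>\<^sub>F n in sequentially. norm (B u (%x. X n x - u x)) <= sqrt (B u u) * sqrt (B (%x. X n x - u x) (%x. X n x - u x))"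
    using CS[OF u dif[OF X(1) u]] real_sqrt_le_mono by (intro always_eventually) (fastforce simp: real_sqrt_mult[symmetric])
  qed
  have t2: "(%n. l (%x. X n x - u x)) ~~> 0"
   by (rule Lim_null_comparison[OF _ tendsto_mult_right_zero[OF sq, of K]]) (use lb[OF dif[OF X(1) u]] in auto)
  have "(%n. J (X n)) ~~> J u + 2 * 0 + 0 - 2 * 0" unfolding Jd by (intro tendsto_intros t1 t2 lim)
  then have a: "(%n. J (X n)) ~~> J u" by simp
  have "(%n. m + 1 / real (Suc n)) ~~> m + 0" by (intro tendsto_intros LIMSEQ_inverse_real_of_nat[unfolded inverse_eq_divide])
  then have b: "(%n. m + 1 / real (Suc n)) ~~> m" by simp
  have "J u <= m" by (rule LIMSEQ_le[OF a b]) (use X(2) in \<open>auto intro: less_imp_le\<close>)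
  then show ?thesis using mle[OF u] by simp
 qed
 have "B u v = l v" if v: "v \<in> V" for v
 proof -
  define D where "D = B u v - l v"
  have q: "0 <= 2 * c * D + c~2 * B v v" for c
   using mle[OF Vc[OF u v, of c]] Ju quad[OF u v, of c] llin[OF u v, of c] unfolding J_def D_def by (simp add: algebra_simps)
  have "D = 0"
  proof (rule ccontr)
   assume n: "D ~= 0"
   have b: "B v v >= 0" using pos v by simp
   \<comment> \<open>Up to the added 1 this is the minimiser of the quadratic in c; the 1 guards
     against B v v = 0.\<close>
   have "0 <= 2 * (- D / (B v v + 1)) * D + (- D / (B v v + 1))~2 * B v v" by (rule q)
   also have "... = (D~2 / (B v v + 1)) * (B v v / (B v v + 1) - 2)"
    by (simp only: power2_eq_square right_diff_distrib times_divide_times_eq minus_divide_left[symmetric] mult_minus_left mult_minus_right) simp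
   also have "... < 0" using b n by (intro mult_pos_neg) (auto simp: field_simps)
   finally show False by simp
  qed
  then show ?thesis by (simp add: D_def)
 qed
 then show ?thesis using u by blast
qed

section \<open>Smooth functions, bumps and test functions\<close>

lemma Cn_SucI:
 assumes "!!x. (ph has_derivative D x) (at x)" "!!b. b \<in> Basis ==> Cn n (%x. D x b)"
 shows "Cn (Suc n) ph"
proof -
 have "frechet_derivative ph (at x) = D x" for x using frechet_derivative_at[OF assms(1)] by simp
 then show ?thesis using assms by (auto simp: differentiable_def)
qed

lemma Cn_SucD:
 assumes "Cn (Suc n) ph"
 shows "(ph has_derivative frechet_derivative ph (at x)) (at x)" "b \<in> Basis ==> Cn n (%x. frechet_derivative ph (at x) b)"
 using assms by (auto simp: frechet_derivative_works)

lemma Cn_Suc_imp: "Cn (Suc n) ph ==> Cn n ph"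
proof (induction n arbitrary: ph)
 case 0
 have "continuous_on UNIV ph" by (intro continuous_at_imp_continuous_on ballI has_derivative_continuous[OF Cn_SucD(1)[OF 0]])
 then show ?case by simp
next
 case (Suc n)
 then show ?case by (intro Cn_SucI[OF Cn_SucD(1)[OF Suc.prems]] Suc.IH Cn_SucD(2)[OF Suc.prems])
qed

lemma Cn_const: "Cn n (%x. c)"
 by (induction n arbitrary: c) (auto intro!: Cn_SucI[where D="%x h. 0"] simp del: Cn.simps(2))

lemma Cn_add: "Cn n f ==> Cn n g ==> Cn n (%x. f x + g x)"
proof (induction n arbitrary: f g)
 case 0 then show ?case by (auto intro: continuous_intros)
next
 case (Suc n)
 show ?case
  by (rule Cn_SucI[where D="%x h. frechet_derivative f (at x) h + frechet_derivative g (at x) h"])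
   (auto intro!: Suc.IH has_derivative_add Cn_SucD[OF Suc.prems(1)] Cn_SucD[OF Suc.prems(2)] simp del: Cn.simps(2))
qed

lemma Cn_mult: "Cn n f ==> Cn n g ==> Cn n (%x. f x * g x)"
proof (induction n arbitrary: f g)
 case 0 then show ?case by (auto intro: continuous_intros)
next
 case (Suc n)
 show ?case
  by (rule Cn_SucI[where D="%x h. f x * frechet_derivative g (at x) h + frechet_derivative f (at x) h * g x"])
   (auto intro!: Suc.IH has_derivative_mult Cn_add Cn_Suc_imp[OF Suc.prems(1)] Cn_Suc_imp[OF Suc.prems(2)]
    Cn_SucD[OF Suc.prems(1)] Cn_SucD[OF Suc.prems(2)] simp del: Cn.simps(2))
qed

lemma Cn_sum: "(!!i. i \<in> A ==> Cn n (f i)) ==> Cn n (%x. \<Sum>i\<in>A. f i x)"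
 by (induction A rule: infinite_finite_induct) (auto intro: Cn_const Cn_add)

lemma Cn_prod: "(!!i. i \<in> A ==> Cn n (f i)) ==> Cn n (%x. \<Prod>i\<in>A. f i x)"
 by (induction A rule: infinite_finite_induct) (auto intro: Cn_const Cn_mult)

lemma frechet_basis_sum:
 assumes "(ph has_derivative D) (at x)"
 shows "D h = (\<Sum>b\<in>Basis. (h @. b) * D b)"
proof -
 have l: "linear D" using assms has_derivative_bounded_linear bounded_linear.linear by blast
 have "D h = D (\<Sum>b\<in>Basis. (h @. b) *R b)" by (simp add: euclidean_representation)
 also have "... = (\<Sum>b\<in>Basis. (h @. b) * D b)" using l by (simp add: linear_sum linear_scale)
 finally show ?thesis .
qed

lemma Cn_affine:
 fixes L :: "'a::euclidean_space => 'b::euclidean_space"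
 assumes L: "bounded_linear L"
 shows "Cn n ph ==> Cn n (%x. ph (L x + c))"
proof (induction n arbitrary: ph)
 case 0
 have "continuous_on UNIV L" using L by (simp add: linear_continuous_on)
 then show ?case using 0 by (auto intro!: continuous_on_compose2[of UNIV ph] continuous_intros)
next
 case (Suc n)
 have d: "((%x. ph (L x + c)) has_derivative (%h. frechet_derivative ph (at (L x + c)) (L h))) (at x)" for x
 proof -
  have "((%x. L x + c) has_derivative (%h. L h + 0)) (at x)"
   by (intro has_derivative_add has_derivative_const bounded_linear_imp_has_derivative L)
  then show ?thesis using has_derivative_compose[OF _ Cn_SucD(1)[OF Suc.prems]] by simp
 qed
 show ?case
 proof (rule Cn_SucI[OF d])
  fix b :: 'a assume "b \<in> Basis"
  have "(%x. frechet_derivative ph (at (L x + c)) (L b)) = (%x. \<Sum>i\<in>Basis. (L b @. i) * frechet_derivative ph (at (L x + c)) i)"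
   using frechet_basis_sum[OF Cn_SucD(1)[OF Suc.prems]] by blast
  moreover have "Cn n (%x. \<Sum>i\<in>Basis. (L b @. i) * frechet_derivative ph (at (L x + c)) i)"
   by (intro Cn_sum Cn_mult Cn_const Suc.IH Cn_SucD(2)[OF Suc.prems])
  ultimately show "Cn n (%x. frechet_derivative ph (at (L x + c)) (L b))" by simp
 qed
qed

definition sm :: "('a::euclidean_space => real) => bool" where
 "sm ph \<longleftrightarrow> (\<forall>n. Cn n ph)"

lemma sm_const: "sm (%x. c)" by (simp add: sm_def Cn_const)
lemma sm_add: "sm f ==> sm g ==> sm (%x. f x + g x)" by (simp add: sm_def Cn_add)
lemma sm_mult: "sm f ==> sm g ==> sm (%x. f x * g x)" by (simp add: sm_def Cn_mult)
lemma sm_sum: "(!!i. i \<in> A ==> sm (f i)) ==> sm (%x. \<Sum>i\<in>A. f i x)" by (simp add: sm_def Cn_sum)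
lemma sm_prod: "(!!i. i \<in> A ==> sm (f i)) ==> sm (%x. \<Prod>i\<in>A. f i x)" by (simp add: sm_def Cn_prod)
lemma sm_affine: "bounded_linear L ==> sm ph ==> sm (%x. ph (L x + c))" by (simp add: sm_def Cn_affine)
lemma sm_linear: "bounded_linear L ==> sm ph ==> sm (%x. ph (L x))" using sm_affine[of L ph 0] by simp

lemma sm_has_derivative: "sm ph ==> (ph has_derivative frechet_derivative ph (at x)) (at x)"
 unfolding sm_def using Cn_SucD(1) by blast

lemma sm_deriv: "sm ph ==> b \<in> Basis ==> sm (%x. frechet_derivative ph (at x) b)"
 unfolding sm_def using Cn_SucD(2) by blast

lemma sm_continuous: "sm ph ==> continuous_on A ph"
 unfolding sm_def by (metis Cn.simps(1) continuous_on_subset subset_UNIV)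

lemma cgrad_inner: "b \<in> Basis ==> cgrad ph x @. b = frechet_derivative ph (at x) b"
 unfolding cgrad_def by (simp add: inner_sum_left inner_Basis if_distrib cong: if_cong)

lemma sm_has_cgrad: assumes "sm ph" shows "(ph has_derivative (%h. cgrad ph x @. h)) (at x)"
proof -
 have "frechet_derivative ph (at x) h = cgrad ph x @. h" for h
  using frechet_basis_sum[OF sm_has_derivative[OF assms, of x], of h] cgrad_inner[of _ ph x]
  by (subst euclidean_inner) (simp add: mult.commute)
 then have "frechet_derivative ph (at x) = (%h. cgrad ph x @. h)" by auto
 then show ?thesis using sm_has_derivative[OF assms, of x] by simp
qed

lemma cgrad_unique: assumes "(ph has_derivative (%h. g @. h)) (at x)" shows "cgrad ph x = g"
proof (rule euclidean_eqI)
 fix b :: 'a assume "b \<in> Basis"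
 then show "cgrad ph x @. b = g @. b" using cgrad_inner frechet_derivative_at[OF assms] by metis
qed

lemma sm_cgrad_continuous: assumes "sm ph" shows "continuous_on A (cgrad ph)"
 unfolding cgrad_def by (intro continuous_intros sm_continuous sm_deriv assms)

lemma sm_cgrad_inner: assumes "sm ph" shows "sm (%x. cgrad ph x @. c)"
proof -
 have "(%x. cgrad ph x @. c) = (%x. \<Sum>b\<in>Basis. frechet_derivative ph (at x) b * (b @. c))"
  by (simp add: cgrad_def inner_sum_left)
 moreover have "sm (%x. \<Sum>b\<in>Basis. frechet_derivative ph (at x) b * (b @. c))" by (intro sm_sum sm_mult sm_const sm_deriv assms)
 ultimately show ?thesis by simp
qed

text \<open>A family whose derivatives are constant-coefficient combinations of its own members is
  smooth, by induction on the order; no formula for iterated derivatives is required.\<close>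

lemma sm_realI:
 fixes f :: "nat => real => real"
 assumes d: "!!k x. (f k has_real_derivative (\<Sum>i\<in>A k. c k i * f i x)) (at x)"
 shows "sm (f k)"
proof -
 have "Cn n (f k)" for n
 proof (induction n arbitrary: k)
  case 0
  have "continuous_on UNIV (f k)" by (intro continuous_at_imp_continuous_on ballI DERIV_isCont[OF d])
  then show ?case by simp
 next
  case (Suc n)
  show ?case
   by (rule Cn_SucI[OF d[unfolded has_field_derivative_def]]) (auto intro!: Cn_sum Cn_mult Cn_const Suc.IH)
 qed
 then show ?thesis by (simp add: sm_def)
qed

lemma sm_compose:
 fixes G :: "real => real"
 assumes G: "sm G" and p: "sm ph" shows "sm (%x. G (ph x))"
proof -
 have "sm G --> Cn n (%x. G (ph x))" for n
 proof (induction n arbitrary: G)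
  case 0
  have "continuous_on UNIV (%x. G (ph x))" if "sm G"
   by (rule continuous_on_compose2[OF sm_continuous[OF that, of UNIV] sm_continuous[OF p, of UNIV]]) simp
  then show ?case by simp
 next
  case (Suc n)
  show ?case
  proof
   assume G: "sm G"
   have d: "((%x. G (ph x)) has_derivative (%h. frechet_derivative G (at (ph x)) (frechet_derivative ph (at x) h))) (at x)" for x
    using has_derivative_compose[OF sm_has_derivative[OF p] sm_has_derivative[OF G]] by simp
   show "Cn (Suc n) (%x. G (ph x))"
   proof (rule Cn_SucI[OF d])
    fix b :: 'a assume b: "b \<in> Basis"
    have "(%x. frechet_derivative G (at (ph x)) (frechet_derivative ph (at x) b)) =
     (%x. frechet_derivative ph (at x) b * frechet_derivative G (at (ph x)) 1)"
    proof
     fix x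
     show "frechet_derivative G (at (ph x)) (frechet_derivative ph (at x) b) = frechet_derivative ph (at x) b * frechet_derivative G (at (ph x)) 1"
      using frechet_basis_sum[OF sm_has_derivative[OF G], of "ph x" "frechet_derivative ph (at x) b"] by (simp add: Basis_real_def)
    qed
    moreover have "Cn n (%x. frechet_derivative ph (at x) b * frechet_derivative G (at (ph x)) 1)" using Suc.IH sm_deriv[OF G, of 1] sm_deriv[OF p b] by (intro Cn_mult) (auto simp: sm_def)
    ultimately show "Cn n (%x. frechet_derivative G (at (ph x)) (frechet_derivative ph (at x) b))" by simp
   qed
  qed
 qed
 then show ?thesis using G by (simp add: sm_def)
qed

lemma sm_id: "sm (%x::real. x)"
proof -
 have "sm ((%k::nat. if k = 0 then (%x::real. x) else if k = 1 then (%x. 1) else (%x. 0)) 0)"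
  by (rule sm_realI[where A="%k. {Suc k}" and c="%k i. 1"]) (auto intro!: derivative_eq_intros)
 then show ?thesis by simp
qed

lemma sm_inner: "sm (%x. x @. c)"
 by (rule sm_linear[OF bounded_linear_inner_left sm_id])

definition ebump :: "real => real" where "ebump x = (if 0 < x then exp (- 1 / x) else 0)"

text \<open>The functions x^(-k) exp(-1/x), extended by 0, are closed under differentiation: f_k' =
  f_(k+2) - k f_(k+1). At the origin the right difference quotient of f_k is f_(k+1), which tends to
  0.\<close>

lemma sm_ebump: "sm ebump"
proof -
 define f where "f k x = (if 0 < x then (1/x)^k * exp (- 1 / x) else 0 :: real)" for k x
 have lim: "(f k \<longlongrightarrow> 0) (at_right 0)" for k
 proof -
  have "((%x::real. inverse x ^ k / exp (inverse x)) \<longlongrightarrow> 0) (at_right 0)"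
   by (rule filterlim_compose[OF tendsto_power_div_exp_0 filterlim_inverse_at_top_right])
  moreover have "\<forall>\<^sub>F x in at_right 0. inverse x ^ k / exp (inverse x) = f k x"
   by (rule eventually_at_right_less[THEN eventually_mono]) (auto simp: f_def field_simps exp_minus)
  ultimately show ?thesis by (rule Lim_transform_eventually)
 qed
 have d: "(f k has_real_derivative (\<Sum>i\<in>{k+1,k+2}. (if i = k+2 then 1 else - real k) * f i x)) (at x)" for k x
 proof -
  have s: "(\<Sum>i\<in>{k+1,k+2}. (if i = k+2 then 1 else - real k) * f i x) = f (k+2) x - k * f (k+1) x" by simp
  consider "x > 0" | "x < 0" | "x = 0" by linarith
  then show ?thesis
  proof cases
   case 1
   have "((%x. (1/x)^k * exp (- 1 / x)) has_real_derivative f (k+2) x - k * f (k+1) x) (at x)"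
   proof (cases k)
    case 0 then show ?thesis using 1 by (auto intro!: derivative_eq_intros simp: f_def power2_eq_square field_simps)
   next
    case (Suc m)
    have d1: "((%x. 1/x) has_real_derivative - 1 / x~2) (at x)"
     using 1 by (auto intro!: derivative_eq_intros simp: power2_eq_square)
    have d2: "((%x. exp (- 1 / x)) has_real_derivative exp (- 1/x) * (1/x~2)) (at x)"
     using 1 by (auto intro!: derivative_eq_intros simp: power2_eq_square)
    note DERIV_mult[OF DERIV_power_Suc[OF d1, of m] d2]
    then show ?thesis using 1 Suc by (simp add: f_def power2_eq_square algebra_simps)
   qed
   then show ?thesis unfolding s
    by (rule has_field_derivative_transform_within_open[of _ _ _ "{0<..}"]) (use 1 in \<open>auto simp: f_def\<close>)
  next
   case 2
   have "((%x. 0) has_real_derivative f (k+2) x - k * f (k+1) x) (at x)" using 2 by (simp add: f_def)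
   then show ?thesis unfolding s
    by (rule has_field_derivative_transform_within_open[of _ _ _ "{..<0}"]) (use 2 in \<open>auto simp: f_def\<close>)
  next
   case 3
   have "((%y. (f k y - f k 0) / (y - 0)) \<longlongrightarrow> 0) (at 0)"
   proof (rule filterlim_split_at)
    show "((%y. (f k y - f k 0) / (y - 0)) \<longlongrightarrow> 0) (at_left 0)"
     by (rule Lim_transform_eventually[OF tendsto_const])
      (auto simp: eventually_at_left_field f_def intro!: exI[of _ "-1"])
    have "\<forall>\<^sub>F y in at_right 0. f (k+1) y = (f k y - f k 0) / (y - 0)"
     by (rule eventually_at_right_less[THEN eventually_mono]) (auto simp: f_def)
    then show "((%y. (f k y - f k 0) / (y - 0)) \<longlongrightarrow> 0) (at_right 0)" by (rule Lim_transform_eventually[OF lim])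
   qed
   then show ?thesis unfolding s 3 by (simp add: has_field_derivative_iff f_def)
  qed
 qed
 have "sm (f 0)" by (rule sm_realI[OF d])
 moreover have "f 0 = ebump" by (auto simp: f_def ebump_def)
 ultimately show ?thesis by simp
qed

lemma ebump_bounds: "0 <= ebump x" "ebump x <= 1" "ebump x ~= 0 \<longleftrightarrow> 0 < x"
 by (auto simp: ebump_def)

text \<open>The products t^i (t^2 + d)^r are closed under differentiation, with two parameters
  varying at once, so the induction runs over both. For i = 0 the truncated exponent
  \<open>i-1\<close> meets the factor 0.\<close>

lemma sm_sqrt: assumes "d > 0" shows "sm (%t. sqrt (t~2 + d))"
proof -
 have pos: "t~2 + d > 0" for t :: real using assms by (simp add: add_nonneg_pos)
 have "Cn n (%t. t^i * (t~2 + d) powr r)" for n i r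
 proof (induction n arbitrary: i r)
  case 0 then show ?case using pos by (auto intro!: continuous_intros simp: less_imp_neq[OF pos, symmetric])
 next
  case (Suc n)
  have d: "((%t. t^i * (t~2 + d) powr r) has_real_derivative (real i * (t^(i-1) * (t~2 + d) powr r) + 2 * r * (t^(i+1) * (t~2+d) powr (r-1)))) (at t)" for t
   using pos[of t] by (auto intro!: derivative_eq_intros simp: powr_diff field_simps)
  show ?case
   by (rule Cn_SucI[OF d[unfolded has_field_derivative_def]]) (unfold Basis_real_def, intro Cn_add Cn_mult Cn_const Suc.IH)
 qed
 from this[of _ 0 "1/2"] have "sm (%t. t^0 * (t~2 + d) powr (1/2))" by (simp add: sm_def)
 then show ?thesis using pos by (simp add: powr_half_sqrt less_imp_le)
qed

lemma cgrad_zero: assumes "open A" "x \<in> A" "!!y. y \<in> A ==> ph y = 0" shows "cgrad ph x = 0"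
proof (rule cgrad_unique)
 have "((%x. 0) has_derivative (%h. 0 @. h)) (at x)" by simp
 then show "(ph has_derivative (%h. 0 @. h)) (at x)"
  by (rule has_derivative_transform_within_open) (use assms in auto)
qed

lemma test_funI:
 assumes "sm ph" "compact K" "K \<subseteq> U" "!!x. x \<notin> K ==> ph x = 0"
 shows "test_fun U ph"
proof -
 have "{x. ph x ~= 0} \<subseteq> K" using assms by auto
 then have s: "tsupport ph \<subseteq> K" unfolding tsupport_def using assms(2) by (simp add: closure_minimal compact_imp_closed)
 have "compact (K \<inter> tsupport ph)" using assms(2) by (intro compact_Int_closed) (auto simp: tsupport_def)
 then show ?thesis using s assms by (simp add: test_fun_def sm_def Int_absorb1)
qed

lemma test_funD:
 assumes "test_fun U ph"
 shows "sm ph" "compact (tsupport ph)" "tsupport ph \<subseteq> U" "!!x. x \<notin> tsupport ph ==> ph x = 0" "!!x. x \<notin> tsupport ph ==> cgrad ph x = 0"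
proof -
 show "sm ph" "compact (tsupport ph)" "tsupport ph \<subseteq> U" using assms by (auto simp: test_fun_def sm_def)
 have z: "ph x = 0" if "x \<notin> tsupport ph" for x
  using that closure_subset[of "{x. ph x ~= 0}"] by (auto simp: tsupport_def)
 then show "!!x. x \<notin> tsupport ph ==> ph x = 0" .
 have "open (- tsupport ph)" by (simp add: tsupport_def open_Compl)
 then show "cgrad ph x = 0" if "x \<notin> tsupport ph" for x
  using cgrad_zero[of "- tsupport ph" x ph] z that by auto
qed

lemma test_fun_add: assumes "test_fun U f" "test_fun U g" shows "test_fun U (%x. f x + g x)"
proof (rule test_funI[of _ "tsupport f \<union> tsupport g"])
 show "!!x. x \<notin> tsupport f \<union> tsupport g ==> f x + g x = 0" using test_funD(4)[OF assms(1)] test_funD(4)[OF assms(2)] by simp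
qed (use test_funD[OF assms(1)] test_funD[OF assms(2)] in \<open>auto intro: sm_add\<close>)

lemma test_fun_mult: assumes "test_fun U f" "sm g" shows "test_fun U (%x. g x * f x)"
 by (rule test_funI[of _ "tsupport f"]) (use test_funD[OF assms(1)] assms in \<open>auto intro: sm_mult\<close>)

lemma test_fun_mono: "test_fun U f ==> U \<subseteq> V ==> test_fun V f"
 by (auto simp: test_fun_def)

lemma test_fun_zero: "test_fun U (%x. 0)"
 by (rule test_funI[of _ "{}"]) (auto intro: sm_const)

lemma cgrad_add: "sm f ==> sm g ==> cgrad (%x. f x + g x) x = cgrad f x + cgrad g x"
 by (rule cgrad_unique) (auto intro!: derivative_eq_intros sm_has_cgrad simp: inner_add_left)

lemma cgrad_mult: "sm f ==> sm g ==> cgrad (%x. f x * g x) x = f x *R cgrad g x + g x *R cgrad f x"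
 by (rule cgrad_unique) (auto intro!: derivative_eq_intros sm_has_cgrad simp: inner_add_left)

lemma cgrad_const: "cgrad (%x. c) x = 0"
 by (rule cgrad_unique) simp

lemma compact_support_bounded:
 fixes f :: "'a::euclidean_space => 'b::real_normed_vector"
 assumes "continuous_on UNIV f" "compact K" "!!x. x \<notin> K ==> f x = 0"
 obtains C where "0 <= C" "!!x. norm (f x) <= C"
proof -
 have "bounded (f ` K)" using assms by (intro compact_imp_bounded compact_continuous_image) (auto intro: continuous_on_subset)
 then obtain C where "!!x. x \<in> K ==> norm (f x) <= C" unfolding bounded_iff by auto
 then have "norm (f x) <= max C 0" for x using assms(3)[of x] by (cases "x \<in> K") (auto simp: le_max_iff_disj)
 then show ?thesis using that[of "max C 0"] by auto
qed

lemma sqi_compact_support: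
 fixes f :: "'a::euclidean_space => 'b::euclidean_space"
 assumes "continuous_on UNIV f" "compact K" "!!x. x \<notin> K ==> f x = 0"
 shows "sqi f"
proof -
 obtain C where C: "0 <= C" "!!x. norm (f x) <= C" using compact_support_bounded[OF assms] by auto
 have fm: "f \<in> bm" using assms(1) by (rule borel_measurable_continuous_onI)
 have Km: "K \<in> sets borel" using assms(2) by (simp add: borel_compact)
 have "sqi (%x. indicator K x :: real)"
 proof -
  have "intb (%x. indicator K x :: real)" using assms(2) Km emeasure_compact_finite
   by (intro integrable_real_indicator) auto
  moreover have "(%x. (norm (indicator K x :: real))~2) = (%x. indicator K x)" by (auto simp: indicator_def)
  ultimately show ?thesis using Km by (simp add: sqi_def)
 qed
 then show ?thesis
  by (rule sqi_bound(1)[OF fm, of _ C]) (use C(2) assms(3) in \<open>auto simp: indicator_def\<close>)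
qed

section \<open>Integration by parts and the fundamental lemma\<close>

text \<open>Translation invariance makes the integral of every difference quotient 0, and dominated
  convergence passes to the derivative. The later integrations by parts apply this to a
  product.\<close>

lemma integral_deriv_compact_support:
 fixes f :: "'a::euclidean_space => real"
 assumes d: "!!x. (f has_derivative (%h. g x @. h)) (at x)" and cg: "continuous_on UNIV g"
  and K: "compact K" "!!x. x \<notin> K ==> f x = 0"
 shows "(LI x. g x @. b) = 0"
proof -
 have cf: "continuous_on UNIV f" by (intro continuous_at_imp_continuous_on ballI has_derivative_continuous[OF d])
 have g0: "g x = 0" if "x \<notin> K" for x
 proof -
  have "((%x. 0) has_derivative (%h. 0 @. h)) (at x)" by simp
  then have "(f has_derivative (%h. 0 @. h)) (at x)"
   by (rule has_derivative_transform_within_open[of _ _ _ _ "- K"]) (use K that compact_imp_closed in auto)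
  then show ?thesis using cgrad_unique d by metis
 qed
 obtain C where C: "0 <= C" "!!x. norm (g x) <= C" using compact_support_bounded[OF cg K(1) g0] by auto
 obtain R where "\<forall>x\<in>K. norm x <= R" using compact_imp_bounded[OF K(1)] by (auto simp: bounded_iff)
 then have R: "K \<subseteq> cball 0 R" by auto
 have fm[measurable]: "f \<in> bm" "g \<in> bm" using cf cg by (auto intro: borel_measurable_continuous_onI)
 define t where "t n = 1 / real (Suc n)" for n
 have t: "t n > 0" "t n <= 1" for n by (auto simp: t_def)
 have tl: "t ~~> 0" unfolding t_def by (rule LIMSEQ_inverse_real_of_nat[unfolded inverse_eq_divide])
 define q where "q n x = (f (t n *R b + x) - f x) / t n" for n x
 have fi: "intb f"
 proof -
  have "intb (%x. indicator K x *R f x)"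
   by (rule borel_integrable_compact[OF K(1)]) (rule continuous_on_subset[OF cf], simp)
  moreover have "(%x. indicator K x *R f x) = f"
  proof
   fix x show "indicator K x *R f x = f x" using K(2)[of x] by (cases "x \<in> K") auto
  qed
  ultimately show ?thesis by simp
 qed
 have fti: "intb (%x. f (c + x))" "(LI x. f (c + x)) = (LI x. f x)" for c
 proof -
  have "integrable (distr lborel borel ((+) c)) f" using fi lborel_distr_plus[of c] by simp
  then show "intb (%x. f (c + x))" by (subst (asm) integrable_distr_eq) auto
  show "(LI x. f (c + x)) = (LI x. f x)"
   using integral_distr[of "(+) c" lborel borel f] lborel_distr_plus[of c] by simp
 qed
 have q0: "(LI x. q n x) = 0" for n
  unfolding q_def using fti fi by simp
 have "(%n. \<integral>x. q n x \<partial>lborel) ~~> (LI x. g x @. b)"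
 \<comment> \<open>Since t n is at most 1, the quotients vanish outside the ball enlarged by norm b,
   and inside they are bounded by the Lipschitz constant of f.\<close>
 proof (rule integral_dominated_convergence[where w="%x. indicator (cball 0 (R + norm b)) x *R (C * norm b)"])
  show "intb (%x. indicator (cball 0 (R + norm b)) x *R (C * norm b))"
   by (rule borel_integrable_compact) auto
  show "AL x. (%n. q n x) ~~> g x @. b"
  proof (rule AE_I2)
   fix x
   have "((%s. f (x + s *R b)) has_derivative (%h. g x @. (h *R b))) (at 0)"
   proof (rule has_derivative_compose[where f="%s. x + s *R b" and g=f])
    show "((%s. x + s *R b) has_derivative (%h. h *R b)) (at 0)" by (auto intro!: derivative_eq_intros)
    show "(f has_derivative (@.) (g x)) (at (x + 0 *R b))" using d[of x] by simp
   qed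
   then have "((%s. f (x + s *R b)) has_real_derivative (g x @. b)) (at 0)"
    by (simp add: has_field_derivative_def mult_commute_abs)
   then have "((%h. (f (x + (0 + h) *R b) - f (x + 0 *R b)) / h) \<longlongrightarrow> g x @. b) (at 0)" by (simp add: DERIV_def)
   then have "((%h. (f (x + h *R b) - f x) / h) \<longlongrightarrow> g x @. b) (at 0)" by simp
   then have "(%n. (f (x + t n *R b) - f x) / t n) ~~> g x @. b"
    by (rule filterlim_compose[OF _ filterlim_atI[OF tl]]) (simp add: t_def)
   then show "(%n. q n x) ~~> g x @. b" by (simp add: q_def add.commute)
  qed
  fix n show "AL x. norm (q n x) <= indicator (cball 0 (R + norm b)) x *R (C * norm b)"
  proof (rule AE_I2)
   fix x
   show "norm (q n x) <= indicator (cball 0 (R + norm b)) x *R (C * norm b)"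
   proof (cases "x \<in> cball 0 (R + norm b)")
    case True
    have "norm (f (t n *R b + x) - f x) <= C * norm (t n *R b + x - x)"
    proof (rule differentiable_bound[of UNIV f "%x h. g x @. h"])
     show "onorm ((@.) (g x)) <= C" for x
     proof (rule onorm_le)
      fix y show "norm (g x @. y) <= C * norm y"
       using Cauchy_Schwarz_ineq2[of "g x" y] C(2)[of x] mult_right_mono[OF C(2)[of x] norm_ge_zero[of y]] by simp
     qed
    qed (use d in auto)
    then have "||f (t n *R b + x) - f x|| <= C * norm b * t n" using t[of n] by (simp add: mult_ac)
    then have "norm (q n x) <= C * norm b" using t[of n] by (simp add: q_def field_simps abs_mult)
    then show ?thesis using True by simp
   next
    case False
    have "norm x > R + norm b" using False by simp
    moreover have "norm x <= norm (t n *R b + x) + norm (t n *R b)" by (metis add_diff_cancel_left' norm_triangle_ineq4 add.commute)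
    moreover have "norm (t n *R b) <= norm b" using t[of n] by (simp add: mult_left_le_one_le)
    ultimately have n: "norm (t n *R b + x) > R" "norm x > R" using norm_ge_zero[of b] by linarith+
    then have "t n *R b + x \<notin> K" "x \<notin> K" using R by (auto simp: subset_iff)
    then show ?thesis using K(2) False by (simp add: q_def)
   qed
  qed
 qed (auto simp: q_def)
 then show ?thesis by (simp add: q0 LIMSEQ_const_iff)
qed

lemma sqi_indicator_compact: "compact K ==> sqi (%x. indicator K x :: real)"
proof -
 assume K: "compact K"
 have Km: "K \<in> sets borel" using K by (simp add: borel_compact)
 have "intb (%x. indicator K x :: real)" using K Km emeasure_compact_finite
  by (intro integrable_real_indicator) auto
 moreover have "(%x. (norm (indicator K x :: real))~2) = (%x. indicator K x)" by (auto simp: indicator_def)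
 ultimately show "sqi (%x. indicator K x :: real)" using Km by (simp add: sqi_def)
qed

lemma ebump_lim: "(%n. ebump (real n * t)) ~~> (if t > 0 then 1 else 0)"
proof (cases "t > 0")
 case True
 have "(%n. exp (- (inverse (real n) * (1/t)))) ~~> exp (- (0 * (1/t)))"
  by (intro tendsto_intros lim_inverse_n)
 then have "(%n. exp (- (inverse (real n) * (1/t)))) ~~> 1" by simp
 then have "(%n. ebump (real n * t)) ~~> 1"
  by (rule Lim_transform_eventually)
   (use True in \<open>auto simp: ebump_def eventually_sequentially field_simps intro!: exI[of _ 1]\<close>)
 then show ?thesis using True by simp
next
 case False
 then have "ebump (real n * t) = 0" for n by (simp add: ebump_def mult_le_0_iff not_less)
 then show ?thesis using False by simp
qed

text \<open>Smooth functions converging to the indicator of the open box and vanishing off the box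
  for every n, so that one compact box supports the whole sequence.\<close>

definition boxbump :: "'a::euclidean_space => 'a => nat => 'a => real" where
 "boxbump a d n x = (\<Prod>b\<in>Basis. ebump (real n * (x @. b - a @. b)) * ebump (real n * (d @. b - x @. b)))"

lemma sm_boxbump: "sm (boxbump a d n)"
proof -
 have "sm (%x. real n * (x @. b - a @. b))" "sm (%x. real n * (d @. b - x @. b))" for b
  using sm_add[OF sm_mult[OF sm_const[of "real n"] sm_inner[of b]] sm_const[of "- real n * (a @. b)"]]
   sm_add[OF sm_mult[OF sm_const[of "- real n"] sm_inner[of b]] sm_const[of "real n * (d @. b)"]]
  by (simp_all add: algebra_simps)
 then have "sm (%x. \<Prod>b\<in>Basis. ebump (real n * (x @. b - a @. b)) * ebump (real n * (d @. b - x @. b)))"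
  by (auto intro!: sm_prod sm_mult[OF sm_compose[OF sm_ebump] sm_compose[OF sm_ebump]])
 then show ?thesis unfolding boxbump_def .
qed

lemma boxbump_bounds: "0 <= boxbump a d n x" "boxbump a d n x <= 1"
 unfolding boxbump_def
 by (intro prod_nonneg ballI mult_nonneg_nonneg ebump_bounds) (intro prod_le_1 conjI mult_nonneg_nonneg mult_le_one ebump_bounds)

lemma boxbump_pos: "n > 0 ==> x \<in> box a d ==> 0 < boxbump a d n x"
 unfolding boxbump_def by (intro prod_pos) (auto simp: box_def ebump_def)

lemma boxbump_zero: assumes "x \<notin> box a d" shows "boxbump a d n x = 0"
proof -
 obtain b where b: "b \<in> Basis" "x @. b <= a @. b | d @. b <= x @. b" using assms by (auto simp: box_def not_less)
 then have "ebump (real n * (x @. b - a @. b)) * ebump (real n * (d @. b - x @. b)) = 0"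
  by (auto simp: ebump_def mult_le_0_iff zero_less_mult_iff)
 then show ?thesis unfolding boxbump_def using b(1) by (intro prod_zero) auto
qed

lemma test_fun_boxbump: "cbox a d \<subseteq> U ==> test_fun U (boxbump a d n)"
 using box_subset_cbox[of a d] by (intro test_funI[OF sm_boxbump compact_cbox]) (auto intro!: boxbump_zero)

lemma boxbump_lim: "(%n. boxbump a d n x) ~~> indicator (box a d) x"
proof (cases "x \<in> box a d")
 case True
 have "(%n. boxbump a d n x) ~~> (\<Prod>b\<in>(Basis::'a set). (if x @. b - a @. b > 0 then 1 else 0) * (if d @. b - x @. b > 0 then 1 else 0))"
  unfolding boxbump_def by (intro tendsto_prod tendsto_mult ebump_lim)
 also have "(\<Prod>b\<in>(Basis::'a set). (if x @. b - a @. b > 0 then 1 else 0) * (if d @. b - x @. b > 0 then 1 else 0)) = (1::real)"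
  by (intro prod.neutral) (use True in \<open>auto simp: box_def\<close>)
 finally show ?thesis using True by simp
next
 case False then show ?thesis by (simp add: boxbump_zero)
qed

text \<open>Boxes are an intersection-stable generator of the Borel sets. The total integral is a
  separate premise because the whole space is not a box, and the complement step of the induction
  needs it.\<close>

lemma integrable_AE_0_boxes:
 fixes f :: "'a::euclidean_space => real"
 assumes f: "intb f" and b0: "!!c d. (LI x. indicator (box c d) x * f x) = 0" and t: "(LI x. f x) = 0"
 shows "AL x. f x = 0"
proof -
 have si: "set_integrable lborel A f" if "A \<in> sets borel" for A
  unfolding set_integrable_def using f that by (intro integrable_mult_indicator) auto
 have A0: "set_lebesgue_integral lborel A f = 0" if "A \<in> sets borel" for A
 proof -
  have "Int_stable (range (%(a, b). box a b :: 'a set))"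
   by (auto simp: Int_stable_def box_Int_box)
  moreover have "(range (%(a, b). box a b :: 'a set)) \<subseteq> Pow UNIV" by auto
  moreover have "A \<in> sigma_sets UNIV (range (%(a, b). box a b :: 'a set))"
   using that unfolding borel_eq_box by simp
  ultimately show ?thesis
  proof (induction rule: sigma_sets_induct_disjoint)
   case (basic A) then show ?case using b0 by (auto simp: set_lebesgue_integral_def)
  next
   case empty then show ?case by (simp add: set_lebesgue_integral_def)
  next
   case (compl A)
   then have A: "A \<in> sets borel" by (simp add: borel_eq_box)
   have "f x = indicator A x * f x + indicator (UNIV - A) x * f x" for x by (auto simp: indicator_def)
   then have "(LI x. f x) = (LI x. indicator A x * f x + indicator (UNIV - A) x * f x)" by simp
   also have "... = (LI x. indicator A x * f x) + (LI x. indicator (UNIV - A) x * f x)"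
    using si[OF A] si[of "UNIV - A"] A by (intro bl_add) (auto simp: set_integrable_def)
   finally show ?case using t compl by (simp add: set_lebesgue_integral_def)
  next
   case (union F)
   have m: "F i \<in> sets borel" for i using union(2) by (auto simp: borel_eq_box)
   have "set_lebesgue_integral lborel (\<Union>i. F i) f = (\<Sum>i. set_lebesgue_integral lborel (F i) f)"
    by (rule lebesgue_integral_countable_add) (use m union(1) in \<open>auto intro: si simp: disjoint_family_on_def\<close>)
   then show ?case using union(3) by simp
  qed
 qed
 have fm[measurable]: "f \<in> bm" using f by simp
 have "AL x. indicator {x. f x > 0} x * f x = 0"
 proof (subst integral_nonneg_eq_0_iff_AE[symmetric])
  show "intb (%x. indicator {x. f x > 0} x * f x)" using si[of "{x. f x > 0}"] by (simp add: set_integrable_def)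
  show "(LI x. indicator {x. f x > 0} x * f x) = 0" using A0[of "{x. f x > 0}"] by (simp add: set_lebesgue_integral_def)
 qed (auto simp: indicator_def)
 moreover have "AL x. - (indicator {x. f x < 0} x * f x) = 0"
 proof (subst integral_nonneg_eq_0_iff_AE[symmetric])
  show "intb (%x. - (indicator {x. f x < 0} x * f x))" using si[of "{x. f x < 0}"] by (simp add: set_integrable_def)
  show "(LI x. - (indicator {x. f x < 0} x * f x)) = 0" using A0[of "{x. f x < 0}"] by (simp add: set_lebesgue_integral_def)
 qed (auto simp: indicator_def)
 ultimately show ?thesis by eventually_elim (auto simp: indicator_def split: if_splits)
qed

text \<open>On a box inside U the functions \<open>boxbump\<close> recover the integral over the
  box; restricting to compact boxes also restores integrability, which a square-integrable f may
  lack globally. By Lindelof countably many boxes cover U, so the exceptional sets add up to a null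
  set.\<close>

lemma fundamental_lemma:
 fixes f :: "'a::euclidean_space => real"
 assumes U: "open U" and f: "sqi f" and z: "!!ph. test_fun U ph ==> (LI x. f x * ph x) = 0"
 shows "AL x. x \<in> U --> f x = 0"
proof -
 have fm[measurable]: "f \<in> bm" using f by (simp add: sqi_def)
 have int: "intb (%x. indicator K x * f x)" if "compact K" for K
  using sqi_times[OF sqi_indicator_compact[OF that] f] .
 have bx: "(LI x. indicator (box a d) x * f x) = 0" if "cbox a d \<subseteq> U" for a d
 proof -
  have "(%n. \<integral>x. f x * boxbump a d n x \<partial>lborel) ~~> (LI x. f x * indicator (box a d) x)"
  proof (rule integral_dominated_convergence[where w="%x. ||indicator (cbox a d) x * f x||"])
   show "intb (%x. ||indicator (cbox a d) x * f x||)" using int[of "cbox a d"] by simp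
   show "AL x. (%n. f x * boxbump a d n x) ~~> f x * indicator (box a d) x"
    by (intro AE_I2 tendsto_intros boxbump_lim)
   fix n show "AL x. norm (f x * boxbump a d n x) <= ||indicator (cbox a d) x * f x||"
   proof (rule AE_I2)
    fix x show "norm (f x * boxbump a d n x) <= ||indicator (cbox a d) x * f x||"
     using boxbump_bounds[of a d n x] boxbump_zero[of x a d n] box_subset_cbox[of a d]
     by (cases "x \<in> box a d") (auto simp: abs_mult indicator_def intro!: mult_left_le)
   qed
   show "(%x. f x * boxbump a d n x) \<in> borel_measurable lborel"
    using borel_measurable_continuous_onI[OF sm_continuous[OF sm_boxbump]] by measurable
  qed auto
  then show ?thesis using z[OF test_fun_boxbump[OF that]] by (simp add: LIMSEQ_const_iff mult.commute)
 qed
 have loc: "AL x. x \<in> box a d --> f x = 0" if s: "cbox a d \<subseteq> U" for a d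
 proof -
  have "AL x. indicator (box a d) x * f x = 0"
  proof (rule integrable_AE_0_boxes)
   have "intb (%x. indicator (box a d) x *R (indicator (cbox a d) x * f x))"
    by (intro integrable_mult_indicator int) auto
   moreover have "(%x. indicator (box a d) x *R (indicator (cbox a d) x * f x)) = (%x. indicator (box a d) x * f x)"
   proof
    fix x show "indicator (box a d) x *R (indicator (cbox a d) x * f x) = indicator (box a d) x * f x"
     using box_subset_cbox[of a d] by (cases "x \<in> box a d") auto
   qed
   ultimately show "intb (%x. indicator (box a d) x * f x)" by simp
   show "(LI x. indicator (box a d) x * f x) = 0" by (rule bx[OF s])
   fix c e :: 'a
   let ?a = "\<Sum>i\<in>Basis. max (c @. i) (a @. i) *R i" and ?d = "\<Sum>i\<in>Basis. min (e @. i) (d @. i) *R i"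
   have "box c e \<inter> box a d = box ?a ?d" by (rule box_Int_box)
   moreover have "cbox ?a ?d \<subseteq> U" using s by (simp add: Int_interval[symmetric] le_infI2)
   ultimately have "(LI x. indicator (box c e \<inter> box a d) x * f x) = 0" using bx by simp
   then show "(LI x. indicator (box c e) x * (indicator (box a d) x * f x)) = 0"
    by (simp add: indicator_inter_arith mult.assoc)
  qed
  then show ?thesis by eventually_elim (auto simp: indicator_def)
 qed
 obtain \<D> where D: "countable \<D>" "\<D> \<subseteq> Pow U" "!!X. X \<in> \<D> ==> \<exists>a b. X = box a b & cbox a b \<subseteq> U" "\<Union>\<D> = U"
 proof -
  define \<F> where "\<F> = {box a b | a b :: 'a. cbox a b \<subseteq> U}"
  obtain \<D> where D: "\<D> \<subseteq> \<F>" "countable \<D>" "\<Union>\<D> = \<Union>\<F>"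
   by (rule Lindelof[of \<F>]) (auto simp: \<F>_def)
  have "\<Union>\<F> = U"
  proof
   show "\<Union>\<F> \<subseteq> U" using box_subset_cbox by (fastforce simp: \<F>_def)
   show "U \<subseteq> \<Union>\<F>"
   proof
    fix x assume "x \<in> U"
    then obtain a b where "cbox a b \<subseteq> U" "x \<in> box a b" using open_contains_cbox[OF U] by metis
    then show "x \<in> \<Union>\<F>" by (auto simp: \<F>_def)
   qed
  qed
  then have DU: "\<Union>\<D> = U" using D(3) by simp
  show ?thesis
  proof (rule that[of \<D>])
   show "countable \<D>" by (rule D(2))
   show "\<D> \<subseteq> Pow U" using DU by auto
   show "\<Union>\<D> = U" by (rule DU)
   show "\<exists>a b. X = box a b & cbox a b \<subseteq> U" if "X \<in> \<D>" for X
    using subsetD[OF D(1) that] by (auto simp: \<F>_def)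
  qed
 qed
 have "AL x. \<forall>X\<in>\<D>. x \<in> X --> f x = 0"
 proof (subst AE_ball_countable[OF D(1)], rule ballI)
  fix X assume "X \<in> \<D>"
  then obtain a b where "X = box a b" "cbox a b \<subseteq> U" using D(3) by metis
  then show "AL x. x \<in> X --> f x = 0" using loc by simp
 qed
 then show ?thesis by eventually_elim (use D(4) in blast)
qed

lemma sqi_inner_const: assumes "sqi f" shows "sqi (%x. f x @. b)"
proof -
 have [measurable]: "f \<in> bm" using assms by (simp add: sqi_def)
 have "AL x. norm (f x @. b) <= norm b * norm (f x)"
  using Cauchy_Schwarz_ineq2[of "f x" b for x] by (intro AE_I2) (simp add: mult.commute)
 then show ?thesis by (rule sqi_bound(1)[OF _ assms, rotated]) measurable
qed

section \<open>H^1_0 as a closure of test pairs, and its link to the given definitions\<close>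

definition tpair :: "('a::euclidean_space => real) => 'a => real \<times> 'a" where
 "tpair ph x = (ph x, cgrad ph x)"

text \<open>Carrying the gradient as a component makes linear operations and limits independent of
  the choice hidden in \<open>wgrad\<close>. Both components are extended by zero off U.\<close>

definition W :: "'a::euclidean_space set => ('a => real \<times> 'a) => bool" where
 "W U Fi \<longleftrightarrow> (\<exists>phs. (\<forall>n. test_fun U (phs n)) & l2lim (%n. tpair (phs n)) Fi)"

lemma sm_borel: "sm ph ==> ph \<in> bm"
 by (simp add: borel_measurable_continuous_onI sm_continuous)

lemma sm_cgrad_borel: "sm ph ==> cgrad ph \<in> bm"
 by (simp add: borel_measurable_continuous_onI sm_cgrad_continuous)

lemma tpair_outside: "test_fun U ph ==> x \<notin> U ==> tpair ph x = 0"
 using test_funD[of U ph] by (auto simp: tpair_def zero_prod_def)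

lemma sqi_tpair: assumes "test_fun U ph" shows "sqi (tpair ph)"
proof (rule sqi_compact_support)
 show "continuous_on UNIV (tpair ph)" unfolding tpair_def
  by (intro continuous_intros sm_continuous sm_cgrad_continuous test_funD[OF assms])
 show "compact (tsupport ph)" by (rule test_funD[OF assms])
 show "tpair ph x = 0" if "x \<notin> tsupport ph" for x using test_funD[OF assms] that by (auto simp: tpair_def zero_prod_def)
qed

lemma sqi_test: assumes "test_fun U ph" shows "sqi ph" "sqi (cgrad ph)" "sqi (%x. cgrad ph x @. b)"
proof -
 show "sqi ph" using sqi_fst(1)[OF sqi_tpair[OF assms]] by (simp add: tpair_def)
 show s: "sqi (cgrad ph)" using sqi_snd(1)[OF sqi_tpair[OF assms]] by (simp add: tpair_def)
 show "sqi (%x. cgrad ph x @. b)" by (rule sqi_inner_const[OF s])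
qed

lemma W_test: "test_fun U ph ==> W U (tpair ph)"
 unfolding W_def by (intro exI[of _ "%n. ph"]) (simp add: l2lim_const sqi_tpair)

lemma W_sqi: assumes "W U Fi" shows "sqi Fi" "sqi (%x. fst (Fi x))" "sqi (%x. snd (Fi x))"
 using assms sqi_fst(1)[of Fi] sqi_snd(1)[of Fi] by (auto simp: W_def l2lim_def)

lemma W_borel: assumes "W U Fi" shows "Fi \<in> bm"
 using W_sqi(1)[OF assms] by (simp add: sqi_def)

lemma tpair_add: "sm f ==> sm g ==> tpair (%x. f x + g x) = (%x. tpair f x + tpair g x)"
 by (auto simp: tpair_def cgrad_add)

lemma tpair_scale: "sm f ==> tpair (%x. c * f x) = (%x. c *R tpair f x)"
 by (auto simp: tpair_def cgrad_mult sm_const cgrad_const)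

lemma W_add: assumes "W U Fi" "W U Gi" shows "W U (%x. Fi x + Gi x)"
proof -
 obtain f g where f: "!!n. test_fun U (f n)" "l2lim (%n. tpair (f n)) Fi" and g: "!!n. test_fun U (g n)" "l2lim (%n. tpair (g n)) Gi"
  using assms unfolding W_def by blast
 have "tpair (%x. f n x + g n x) = (%x. tpair (f n) x + tpair (g n) x)" for n using f g test_funD(1) by (blast intro: tpair_add)
 then have "l2lim (%n. tpair (%x. f n x + g n x)) (%x. Fi x + Gi x)" using l2lim_add[OF f(2) g(2)] by simp
 then show ?thesis unfolding W_def using test_fun_add[OF f(1) g(1)] by (intro exI[of _ "%n x. f n x + g n x"]) auto
qed

lemma W_scale: assumes "W U Fi" shows "W U (%x. c *R Fi x)"
proof -
 obtain f where f: "!!n. test_fun U (f n)" "l2lim (%n. tpair (f n)) Fi"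
  using assms unfolding W_def by blast
 have "tpair (%x. c * f n x) = (%x. c *R tpair (f n) x)" for n using f test_funD(1) by (blast intro: tpair_scale)
 then have "l2lim (%n. tpair (%x. c * f n x)) (%x. c *R Fi x)" using l2lim_scale[OF f(2)] by simp
 then show ?thesis unfolding W_def using test_fun_mult[OF f(1) sm_const, of c] by (intro exI[of _ "%n x. c * f n x"]) auto
qed

lemma W_lin: "W U Fi ==> W U Gi ==> W U (%x. Fi x + c *R Gi x)"
 by (intro W_add W_scale)

lemma W_diff: "W U Fi ==> W U Gi ==> W U (%x. Fi x - Gi x)"
 using W_lin[of U Fi Gi "-1"] by simp

lemma W_zero: "W U (%x. 0)"
 using W_test[OF test_fun_zero, of U] unfolding tpair_def[abs_def] cgrad_const zero_prod_def .

lemma W_AE_cong: "W U Fi ==> AL x. Fi x = Gi x ==> Gi \<in> bm ==> W U Gi"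
 unfolding W_def using l2lim_AE_cong by blast

text \<open>Diagonal argument: each \<open>X n\<close> is replaced by a test pair at squared
  distance below 1/(n+1).\<close>

lemma W_closed: assumes X: "!!n. W U (X n)" and l: "l2lim X Fi" shows "W U Fi"
proof -
 have "\<exists>ph. test_fun U ph & N2 (%x. tpair ph x - X n x) < 1 / Suc n" for n
 proof -
  obtain f where f: "!!k. test_fun U (f k)" "l2lim (%k. tpair (f k)) (X n)" using X[of n] unfolding W_def by blast
  then have "eventually (%k. N2 (%x. tpair (f k) x - X n x) < 1 / Suc n) sequentially"
   by (intro order_tendstoD(2)[of _ 0]) (auto simp: l2lim_def)
  then show ?thesis using f(1) by (auto simp: eventually_sequentially)
 qed
 then obtain ph where p: "!!n. test_fun U (ph n)" "!!n. N2 (%x. tpair (ph n) x - X n x) < 1 / Suc n" by metis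
 have lim0: "(%n. 1 / real (Suc n)) ~~> 0" by (rule LIMSEQ_inverse_real_of_nat[unfolded inverse_eq_divide])
 have "(%n. N2 (%x. tpair (ph n) x - X n x)) ~~> 0"
  by (rule tendsto_sandwich[OF _ _ tendsto_const lim0]) (use p(2) in \<open>auto intro!: always_eventually less_imp_le\<close>)
 then have l0: "l2lim (%n x. tpair (ph n) x - X n x) (%x. 0)"
  using W_sqi[OF X] sqi_tpair[OF p(1)] by (auto simp: l2lim_def intro: sqi_diff(1))
 have "l2lim (%n x. (tpair (ph n) x - X n x) + X n x) (%x. 0 + Fi x)" by (rule l2lim_add[OF l0 l])
 then have "l2lim (%n. tpair (ph n)) Fi" by simp
 then show ?thesis unfolding W_def using p(1) by blast
qed

lemma W_outside: assumes "W U Fi" shows "AL x. x \<notin> U --> Fi x = 0"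
proof -
 obtain f where f: "!!n. test_fun U (f n)" "l2lim (%n. tpair (f n)) Fi"
  using assms unfolding W_def by blast
 obtain r where "AL x. (%n. tpair (f (r n)) x) ~~> Fi x" using l2lim_AE_subseq[OF f(2)] by auto
 then show ?thesis
 proof eventually_elim
  case (elim x)
  show ?case using elim tpair_outside[OF f(1), of x] by (auto simp: LIMSEQ_const_iff)
 qed
qed

lemma W_mult:
 assumes W: "W U Fi" and mu: "sm mu" and b: "!!x. x \<in> U ==> ||mu x|| <= C" "!!x. x \<in> U ==> norm (cgrad mu x) <= C"
 shows "W U (%x. (mu x * fst (Fi x), mu x *R snd (Fi x) + fst (Fi x) *R cgrad mu x))"
proof -
 obtain f where f: "!!n. test_fun U (f n)" "l2lim (%n. tpair (f n)) Fi"
  using W unfolding W_def by blast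
 define T where "T x p = (mu x * fst p, mu x *R snd p + fst p *R cgrad mu x)" for x and p :: "real \<times> 'a"
 have Tlin: "T x p - T x q = T x (p - q)" for x p q by (simp add: T_def algebra_simps)
 have Tb: "norm (T x p) <= 3 * C * norm p" if "x \<in> U" for x p
 proof -
  have "norm (T x p) <= norm (mu x * fst p) + norm (mu x *R snd p + fst p *R cgrad mu x)" unfolding T_def by (rule norm_Pair_le)
  also have "... <= ||mu x|| * norm (fst p) + ( ||mu x|| * norm (snd p) + norm (fst p) * norm (cgrad mu x))"
   by (intro add_mono order_trans[OF norm_triangle_ineq]) (auto simp: abs_mult)
  also have "... <= C * norm p + (C * norm p + norm p * C)"
   using b[OF that] norm_fst_le[of "fst p" "snd p"] norm_snd_le[of "snd p" "fst p"]
   by (intro add_mono mult_mono) (auto intro: order_trans[OF abs_ge_zero])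
  finally show ?thesis by simp
 qed
 note m[measurable] = sm_borel[OF mu] sm_cgrad_borel[OF mu] W_borel[OF W]
 have fm[measurable]: "tpair (f n) \<in> bm" for n using sqi_tpair[OF f(1)] by (simp add: sqi_def)
 have out: "AL x. x \<notin> U --> Fi x = 0" by (rule W_outside[OF W])
 have Tm: "(%x. T x (g x)) \<in> bm" if [measurable]: "g \<in> bm" for g
  unfolding T_def by measurable
 have l: "l2lim (%n x. T x (tpair (f n) x)) (%x. T x (Fi x))"
 proof (rule l2lim_lip[OF f(2), of _ "3 * C"])
  show "AL x. norm (T x (tpair (f n) x) - T x (Fi x)) <= 3 * C * norm (tpair (f n) x - Fi x)" for n
   using out
  proof eventually_elim
   case (elim x)
   then show ?case using Tb[of x "tpair (f n) x - Fi x"] tpair_outside[OF f(1)[of n], of x]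
    unfolding Tlin by (cases "x \<in> U") (auto simp: T_def)
  qed
  have o2: "AL x. norm (T x (Fi x)) <= 3 * C * norm (Fi x)" using out
  proof eventually_elim
   case (elim x)
   then show ?case using Tb[of x "Fi x"] by (cases "x \<in> U") (auto simp: T_def)
  qed
  show "sqi (%x. T x (Fi x))" by (rule sqi_bound(1)[OF Tm W_sqi(1)[OF W] o2]) simp
 qed (auto intro: Tm)
 have "(%x. T x (tpair (f n) x)) = tpair (%x. mu x * f n x)" for n
  by (simp add: T_def tpair_def cgrad_mult mu test_funD(1)[OF f(1)] fun_eq_iff)
 then have "l2lim (%n. tpair (%x. mu x * f n x)) (%x. T x (Fi x))" using l by simp
 then show ?thesis unfolding W_def T_def[symmetric] using test_fun_mult[OF f(1) mu] by (intro exI[of _ "%n x. mu x * f n x"]) auto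
qed

text \<open>\<open>ps\<close> need not be supported in U: the approximating test functions already
  are, so their products with \<open>ps\<close> have compact support. Hence the extension by zero is
  weakly differentiable on the whole space.\<close>

lemma W_weak:
 assumes W: "W U Fi" and p: "test_fun UNIV ps"
 shows "(LI x. fst (Fi x) * (cgrad ps x @. b)) = - (LI x. (snd (Fi x) @. b) * ps x)"
proof -
 obtain f where f: "!!n. test_fun U (f n)" "l2lim (%n. tpair (f n)) Fi"
  using W unfolding W_def by blast
 have l1: "l2lim (%n x. f n x) (%x. fst (Fi x))" using l2lim_fst[OF f(2)] by (simp add: tpair_def)
 have l2: "l2lim (%n x. cgrad (f n) x) (%x. snd (Fi x))" using l2lim_snd[OF f(2)] by (simp add: tpair_def)
 have l3: "l2lim (%n x. ps x *R b) (%x. ps x *R b)"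
 proof (rule l2lim_const)
  have m[measurable]: "ps \<in> bm" using sm_borel test_funD(1)[OF p] by blast
  show "sqi (%x. ps x *R b)" by (rule sqi_bound(1)[OF _ sqi_test(1)[OF p], of _ "norm b"]) (auto simp: mult.commute)
 qed
 have e: "(LI x. f n x * (cgrad ps x @. b)) + (LI x. cgrad (f n) x @. (ps x *R b)) = 0" for n
 proof -
  have sf: "sm (f n)" "sm ps" using f p test_funD(1) by auto
  have "(LI x. cgrad (%x. f n x * ps x) x @. b) = 0"
   by (rule integral_deriv_compact_support[OF sm_has_cgrad sm_cgrad_continuous test_funD(2)[OF f(1)[of n]]])
    (use sf test_funD(4)[OF f(1)] in \<open>auto intro: sm_mult\<close>)
  also have "(%x. cgrad (%x. f n x * ps x) x @. b) = (%x. f n x * (cgrad ps x @. b) + cgrad (f n) x @. (ps x *R b))"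
   using sf by (simp add: cgrad_mult inner_add_left fun_eq_iff)
  also have "(LI x. f n x * (cgrad ps x @. b) + cgrad (f n) x @. (ps x *R b)) =
   (LI x. f n x * (cgrad ps x @. b)) + (LI x. cgrad (f n) x @. (ps x *R b))"
   using l3 by (intro bl_add sqi_times[OF sqi_test(1)[OF f(1)] sqi_test(3)[OF p]]
     sqi_inner[OF sqi_test(2)[OF f(1)]]) (simp add: l2lim_def)
  finally show ?thesis .
 qed
 have "(%n. (LI x. f n x * (cgrad ps x @. b)) + (LI x. cgrad (f n) x @. (ps x *R b)))
  ~~> (LI x. fst (Fi x) * (cgrad ps x @. b)) + (LI x. snd (Fi x) @. (ps x *R b))"
  by (intro tendsto_add l2lim_times[OF l1 l2lim_const] l2lim_inner[OF l2 l3] sqi_test(3)[OF p])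
 then have "0 = (LI x. fst (Fi x) * (cgrad ps x @. b)) + (LI x. snd (Fi x) @. (ps x *R b))"
  unfolding e by (simp only: LIMSEQ_const_iff)
 then show ?thesis by (simp add: mult.commute[of "ps _"])
qed

lemma W_grad_unique:
 assumes U: "open U" and f: "sqi f" "sqi g"
  and e: "!!ps b. test_fun U ps ==> b \<in> Basis ==> (LI x. (f x @. b) * ps x) = (LI x. (g x @. b) * ps x)"
 shows "AL x. x \<in> U --> f x = (g x :: 'a::euclidean_space)"
proof -
 have fm[measurable]: "f \<in> bm" "g \<in> bm" using f by (auto simp: sqi_def)
 note s = sqi_inner_const[OF f(1)] sqi_inner_const[OF f(2)]
 have "AL x. x \<in> U --> f x @. b - g x @. b = 0" if "b \<in> Basis" for b
 proof (rule fundamental_lemma[OF U sqi_diff(1)[OF s]])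
  fix ph assume p: "test_fun U ph"
  show "(LI x. (f x @. b - g x @. b) * ph x) = 0"
   using e[OF p that] sqi_times[OF s(1) sqi_test(1)[OF p]] sqi_times[OF s(2) sqi_test(1)[OF p]]
   by (simp add: left_diff_distrib)
 qed
 then have "AL x. \<forall>b\<in>Basis. x \<in> U --> f x @. b - g x @. b = 0" by (subst AE_finite_all) auto
 then show ?thesis by eventually_elim (auto intro: euclidean_eqI)
qed

text \<open>Gradients of equal functions satisfy the same integration by parts against test
  functions on U, so the fundamental lemma identifies them there; off U both vanish.\<close>

lemma W_unique:
 assumes U: "open U" and W: "W U Fi" "W U Gi" and e: "AL x. x \<in> U --> fst (Fi x) = fst (Gi x)"
 shows "AL x. Fi x = Gi x"
proof -
 have ee: "AL x. fst (Fi x) = fst (Gi x)" using e W_outside[OF W(1)] W_outside[OF W(2)] by eventually_elim auto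
 note m[measurable] = W_borel[OF W(1)] W_borel[OF W(2)]
 have "AL x. x \<in> U --> snd (Fi x) = snd (Gi x)"
 proof (rule W_grad_unique[OF U W_sqi(3)[OF W(1)] W_sqi(3)[OF W(2)]])
  fix ps :: "'a => real" and b :: 'a assume p: "test_fun U ps" "b \<in> Basis"
  then have p': "test_fun UNIV ps" by (auto intro: test_fun_mono)
  note [measurable] = sm_cgrad_borel[OF test_funD(1)[OF p(1)]]
  have "(LI x. fst (Fi x) * (cgrad ps x @. b)) = (LI x. fst (Gi x) * (cgrad ps x @. b))"
   by (rule integral_cong_AE) (use ee in auto)
  then show "(LI x. (snd (Fi x) @. b) * ps x) = (LI x. (snd (Gi x) @. b) * ps x)"
   using W_weak[OF W(1) p', of b] W_weak[OF W(2) p', of b] by simp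
 qed
 then show ?thesis using ee W_outside[OF W(1)] W_outside[OF W(2)] by eventually_elim (auto intro: prod_eqI)
qed

text \<open>The given definitions integrate over \<open>lebesgue\<close>. An integrand that agrees
  almost everywhere with a Borel function can be moved to \<open>lborel\<close>.\<close>

lemma lebesgue_AE:
 fixes f g :: "'a::euclidean_space => 'b::euclidean_space"
 assumes g: "g \<in> bm" and e: "AL x. f x = g x"
 shows "f \<in> borel_measurable lebesgue" "integral\<^sup>L lebesgue f = integral\<^sup>L lborel g" "integrable lebesgue f \<longleftrightarrow> intb g"
proof -
 have gl: "g \<in> borel_measurable lebesgue" using g by (simp add: measurable_completion)
 have el: "AE x in lebesgue. f x = g x" using e by (rule AE_completion)
 show fl: "f \<in> borel_measurable lebesgue" by (rule borel_measurable_AE[OF gl]) (use el in \<open>auto elim: eventually_mono\<close>)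
 have "integral\<^sup>L lebesgue f = integral\<^sup>L lebesgue g" by (rule integral_cong_AE[OF fl gl el])
 then show "integral\<^sup>L lebesgue f = integral\<^sup>L lborel g" using g by (simp add: integral_completion)
 have "integrable lebesgue f \<longleftrightarrow> integrable lebesgue g" by (rule integrable_cong_AE[OF fl gl el])
 then show "integrable lebesgue f \<longleftrightarrow> intb g" using g by (simp add: integrable_completion)
qed

text \<open>Connects functions that matter only on U with globally defined Borel functions vanishing
  off U.\<close>

definition rep :: "'a::euclidean_space set => ('a => 'b::euclidean_space) => ('a => 'b) => bool" where
 "rep U v f \<longleftrightarrow> (AL x. indicator U x *R v x = f x)"

lemma repI:
 assumes "AL x. x \<notin> U --> f x = 0" "AL x. x \<in> U --> v x = f x"
 shows "rep U v f"
 unfolding rep_def using assms by eventually_elim (auto simp: indicator_def)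

lemma repD: assumes "rep U v f" shows "AL x. x \<notin> U --> f x = 0" "AL x. x \<in> U --> v x = f x"
 using assms unfolding rep_def by (eventually_elim, auto simp: indicator_def)+

lemma L2I: assumes s: "sqi f" and r: "rep U v f" shows "L2 U v"
proof -
 have fm[measurable]: "f \<in> bm" using s by (simp add: sqi_def)
 have "AL x. indicator U x * (norm (v x))~2 = (norm (f x))~2" using r unfolding rep_def
  by eventually_elim (auto simp: indicator_def split: if_splits)
 then have "integrable lebesgue (%x. indicator U x * (norm (v x))~2)"
  using lebesgue_AE(3)[of "%x. (norm (f x))~2"] s by (simp add: sqi_def)
 then show ?thesis unfolding L2_def using lebesgue_AE(1)[OF fm r[unfolded rep_def]] by simp
qed

lemma L2D:
 fixes v :: "'a::euclidean_space => 'b::euclidean_space"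
 assumes "L2 U v" shows "\<exists>f. sqi f & rep U v f"
proof -
 have m: "(%x. indicator U x *R v x) \<in> borel_measurable lebesgue" and i: "integrable lebesgue (%x. indicator U x * (norm (v x))~2)"
  using assms by (auto simp: L2_def)
 have "\<exists>g\<in>borel_measurable lborel. AL x. (indicator U x *R v x) @. b = (g x :: real)" for b :: 'b
  by (rule completion_ex_borel_measurable_real) (use m in \<open>rule borel_measurable_inner\<close>, simp)
 then obtain g where g: "!!b. g b \<in> borel_measurable lborel" "!!b. AL x. (indicator U x *R v x) @. b = (g b x :: real)" by metis
 define f where "f x = (\<Sum>b\<in>Basis. g b x *R b)" for x
 have fm[measurable]: "f \<in> bm" unfolding f_def using g(1) by (intro borel_measurable_sum borel_measurable_scaleR) auto
 have "AL x. \<forall>b\<in>Basis. (indicator U x *R v x) @. b = g b x" by (subst AE_finite_all) (use g(2) in auto)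
 then have ae: "rep U v f" unfolding rep_def
 proof eventually_elim
  case (elim x)
  have "f x = (\<Sum>b\<in>Basis. ((indicator U x *R v x) @. b) *R b)" unfolding f_def using elim by (intro sum.cong) auto
  then show ?case by (simp only: euclidean_representation)
 qed
 have "AL x. indicator U x * (norm (v x))~2 = (norm (f x))~2" using ae unfolding rep_def
  by eventually_elim (auto simp: indicator_def split: if_splits)
 then have "intb (%x. (norm (f x))~2)" using i lebesgue_AE(3)[of "%x. (norm (f x))~2" "%x. indicator U x * (norm (v x))~2"] by simp
 then have "sqi f" using fm by (simp add: sqi_def)
 then show ?thesis using ae by blast
qed

lemma has_weak_grad_rep:
 assumes s: "sqi f" "sqi G" and r: "rep U v f" "rep U g G"
 shows "has_weak_grad U v g \<longleftrightarrow> (\<forall>ph. test_fun U ph --> (\<forall>b\<in>Basis.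
   (LI x. f x * (cgrad ph x @. b)) = - (LI x. (G x @. b) * ph x)))"
proof -
 have "(\<integral>x. indicator U x * v x * frechet_derivative ph (at x) b \<partial>lebesgue) = (LI x. f x * (cgrad ph x @. b))"
  "(\<integral>x. indicator U x * (g x @. b) * ph x \<partial>lebesgue) = (LI x. (G x @. b) * ph x)"
  if p: "test_fun U ph" and b: "b \<in> Basis" for ph b
 proof -
  note [measurable] = sm_cgrad_borel[OF test_funD(1)[OF p]] sm_borel[OF test_funD(1)[OF p]]
  have [measurable]: "f \<in> bm" "G \<in> bm" using s by (auto simp: sqi_def)
  have "AL x. indicator U x * v x * frechet_derivative ph (at x) b = f x * (cgrad ph x @. b)"
   using r(1) unfolding rep_def by eventually_elim (simp add: cgrad_inner b)
  then show "(\<integral>x. indicator U x * v x * frechet_derivative ph (at x) b \<partial>lebesgue) = (LI x. f x * (cgrad ph x @. b))"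
   by (rule lebesgue_AE(2)[rotated]) measurable
  have "AL x. indicator U x * (g x @. b) * ph x = (G x @. b) * ph x"
   using r(2) unfolding rep_def by eventually_elim (auto simp: indicator_def split: if_splits)
  then show "(\<integral>x. indicator U x * (g x @. b) * ph x \<partial>lebesgue) = (LI x. (G x @. b) * ph x)"
   by (rule lebesgue_AE(2)[rotated]) measurable
 qed
 then show ?thesis unfolding has_weak_grad_def by simp
qed

lemma H10_integral_rep:
 assumes s: "sqi f" "sqi G" and r: "rep U v f" "rep U g G" and p: "test_fun U ph"
 shows "(\<integral>x. indicator U x * ((v x - ph x)~2 + (norm (g x - cgrad ph x))~2) \<partial>lebesgue) = N2 (%x. tpair ph x - (f x, G x))"
 unfolding N2_def
proof (rule lebesgue_AE(2))
 note [measurable] = sm_cgrad_borel[OF test_funD(1)[OF p]] sm_borel[OF test_funD(1)[OF p]]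
 have [measurable]: "f \<in> bm" "G \<in> bm" using s by (auto simp: sqi_def)
 show "(%x. (norm (tpair ph x - (f x, G x)))~2) \<in> bm" unfolding tpair_def by measurable
 show "AL x. indicator U x * ((v x - ph x)~2 + (norm (g x - cgrad ph x))~2) = (norm (tpair ph x - (f x, G x)))~2"
  using r unfolding rep_def
 proof eventually_elim
  case (elim x)
  show ?case
  proof (cases "x \<in> U")
   case True then show ?thesis using elim by (simp add: tpair_def norm_Pair norm_minus_commute power2_commute)
  next
   case False then show ?thesis using elim tpair_outside[OF p False] by (simp add: zero_prod_def)
  qed
 qed
qed

lemma H10D:
 assumes "H10 U v"
 shows "\<exists>Fi. W U Fi & rep U v (%x. fst (Fi x)) & rep U (wgrad U v) (%x. snd (Fi x))"
proof -
 have h: "L2 U v" "\<exists>g. L2 U g & has_weak_grad U v g" using assms by (auto simp: H10_def H1_def)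
 have w: "L2 U (wgrad U v)" using someI_ex[OF h(2)] by (simp add: wgrad_def)
 obtain f where f: "sqi f" "rep U v f" using L2D[OF h(1)] by auto
 obtain G where G: "sqi G" "rep U (wgrad U v) G" using L2D[OF w] by auto
 obtain phs where p: "!!n. test_fun U (phs n)"
  "(%n. \<integral>x. indicator U x * ((v x - phs n x)~2 + (norm (wgrad U v x - cgrad (phs n) x))~2) \<partial>lebesgue) ~~> 0"
  using assms unfolding H10_def by blast
 have "l2lim (%n. tpair (phs n)) (%x. (f x, G x))"
  using p(2) sqi_tpair[OF p(1)] sqi_Pair(1)[OF f(1) G(1)] unfolding H10_integral_rep[OF f(1) G(1) f(2) G(2) p(1)] l2lim_def by simp
 then have "W U (%x. (f x, G x))" unfolding W_def using p(1) by blast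
 then show ?thesis using f G by (intro exI[of _ "%x. (f x, G x)"]) auto
qed

text \<open>\<open>wgrad\<close> is an arbitrary choice among the weak gradients; their uniqueness
  identifies it almost everywhere with the second component of \<open>Fi\<close>.\<close>

lemma H10I:
 assumes U: "open U" and W: "W U Fi" and r: "rep U v (%x. fst (Fi x))"
 shows "H10 U v" "rep U (wgrad U v) (%x. snd (Fi x))"
proof -
 have r2: "rep U (%x. snd (Fi x)) (%x. snd (Fi x))"
  by (rule repI) (use W_outside[OF W] in \<open>auto elim: eventually_mono\<close>)
 have L: "L2 U v" "L2 U (%x. snd (Fi x))" using L2I[OF W_sqi(2)[OF W] r] L2I[OF W_sqi(3)[OF W] r2] by auto
 have wk: "(LI x. fst (Fi x) * (cgrad ps x @. b)) = - (LI x. (snd (Fi x) @. b) * ps x)" if "test_fun U ps" for ps b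
  using W_weak[OF W test_fun_mono[OF that]] by simp
 then have "has_weak_grad U v (%x. snd (Fi x))"
  using has_weak_grad_rep[OF W_sqi(2)[OF W] W_sqi(3)[OF W] r r2] by simp
 then have ex: "\<exists>g. L2 U g & has_weak_grad U v g" using L(2) by blast
 then have w: "L2 U (wgrad U v)" "has_weak_grad U v (wgrad U v)" using someI_ex[OF ex] by (auto simp: wgrad_def)
 obtain G where G: "sqi G" "rep U (wgrad U v) G" using L2D[OF w(1)] by auto
 have "AL x. x \<in> U --> G x = snd (Fi x)"
 proof (rule W_grad_unique[OF U G(1) W_sqi(3)[OF W]])
  fix ps :: "'a => real" and b :: 'a assume p: "test_fun U ps" "b \<in> Basis"
  show "(LI x. (G x @. b) * ps x) = (LI x. (snd (Fi x) @. b) * ps x)"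
   using wk[OF p(1), of b] w(2) p unfolding has_weak_grad_rep[OF W_sqi(2)[OF W] G(1) r G(2)] by simp
 qed
 then have "AL x. x \<in> U --> wgrad U v x = snd (Fi x)" using repD(2)[OF G(2)] by eventually_elim simp
 then show r3: "rep U (wgrad U v) (%x. snd (Fi x))"
  using repD(1)[OF r2] by (intro repI)
 obtain f where f: "!!n. test_fun U (f n)" "l2lim (%n. tpair (f n)) Fi"
  using W unfolding W_def by blast
 have "(%n. \<integral>x. indicator U x * ((v x - f n x)~2 + (norm (wgrad U v x - cgrad (f n) x))~2) \<partial>lebesgue) ~~> 0"
  unfolding H10_integral_rep[OF W_sqi(2)[OF W] W_sqi(3)[OF W] r r3 f(1)] using f(2) by (simp add: l2lim_def)
 then show "H10 U v" unfolding H10_def H1_def using L ex f(1) by blast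
qed

section \<open>Poincare on convex sets and control by finitely many averages\<close>

lemma integral_unit_square:
 fixes g :: "real => real"
 assumes g: "continuous_on {0..1} g"
 shows "(LI t. g t * indicator {0..1} t)~2 <= (LI t. (g t)~2 * indicator {0..1} t)"
  "intb (%t. (g t)~2 * indicator {0..1} t)"
proof -
 have "continuous_on {0..1} (%t. (g t)~2)" by (intro continuous_intros g)
 then have i2: "intb (%t. indicator {0..1} t *R (g t)~2)"
  by (rule borel_integrable_compact[rotated]) simp
 then show i: "intb (%t. (g t)~2 * indicator {0..1} t)" by (simp add: mult.commute)
 have "intb (%t. indicator {0..1} t *R g t)"
  by (rule borel_integrable_compact[OF _ g]) simp
 then have m: "(%t. indicator {0..1} t *R g t) \<in> bm" by simp
 have sq: "(norm (indicator {0..1} t *R g t))~2 = (g t)~2 * indicator {0..1} t" for t by (auto simp: indicator_def)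
 have s: "sqi (%t. indicator {0..1} t *R g t)" "N2 (%t. indicator {0..1} t *R g t) = (LI t. (g t)~2 * indicator {0..1} t)"
  unfolding sqi_def N2_def sq using m i by auto
 have s1: "sqi (%t. indicator {0..1::real} t :: real)" by (rule sqi_indicator_compact) simp
 have n1: "N2 (%t. indicator {0..1::real} t :: real) = 1"
 proof -
  have "N2 (%t. indicator {0..1::real} t :: real) = (LI t. indicator {0..1::real} t)" unfolding N2_def
   by (intro bl_cong) (auto simp: indicator_def)
  then show ?thesis by simp
 qed
 have "||\<integral>t. (indicator {0..1} t *R g t) @. indicator {0..1} t \<partial>lborel|| <= sqrt (LI t. (g t)~2 * indicator {0..1} t)"
  using CS_inner[OF s(1) s1] n1 s(2) by simp
 moreover have "(%t. (indicator {0..1} t *R g t) @. indicator {0..1} t) = (%t. g t * indicator {0..1} t)"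
  by (auto simp: indicator_def fun_eq_iff)
 ultimately have "||\<integral>t. g t * indicator {0..1} t \<partial>lborel|| <= sqrt (LI t. (g t)~2 * indicator {0..1} t)" by simp
 then have "( ||\<integral>t. g t * indicator {0..1} t \<partial>lborel||)~2 <= (sqrt (LI t. (g t)~2 * indicator {0..1} t))~2"
  by (intro power_mono) auto
 then show "(LI t. g t * indicator {0..1} t)~2 <= (LI t. (g t)~2 * indicator {0..1} t)"
  by (simp add: real_sqrt_pow2)
qed

lemma nn_integral_translate:
 fixes f :: "'a::euclidean_space => ennreal"
 assumes [measurable]: "f \<in> bm"
 shows "(\<integral>\<^sup>+x. f (x + c) \<partial>lborel) = (\<integral>\<^sup>+x. f x \<partial>lborel)"
proof -
 have "(\<integral>\<^sup>+x. f x \<partial>lborel) = (\<integral>\<^sup>+x. f x \<partial>(distr lborel borel ((+) c)))" by (simp add: lborel_distr_plus)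
 also have "... = (\<integral>\<^sup>+x. f (c + x) \<partial>lborel)" by (subst nn_integral_distr) auto
 finally show ?thesis by (simp add: add.commute)
qed

lemma segment_difference_bound:
 fixes F :: "'a::euclidean_space => real"
 assumes d: "!!x. (F has_derivative (%h. G x @. h)) (at x)" and cG: "continuous_on UNIV G"
 shows "ennreal ((F (x + z) - F x)~2) <= (\<integral>\<^sup>+t. ennreal ((G (x + t *R z) @. z)~2) * indicator {0..1} t \<partial>lborel)"
proof -
 have cg: "continuous_on A (%t. G (x + t *R z) @. z)" for A
  by (intro continuous_intros continuous_on_compose2[OF cG]) auto
 have der: "((%t. F (x + t *R z)) has_real_derivative (G (x + t *R z) @. z)) (at t)" for t
 proof -
  have "((%t. F (x + t *R z)) has_derivative (%h. G (x + t *R z) @. (h *R z))) (at t)"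
   by (rule has_derivative_compose[where f="%t. x + t *R z" and g=F, OF _ d]) (auto intro!: derivative_eq_intros)
  then show ?thesis by (simp add: has_field_derivative_def mult_commute_abs)
 qed
 have "(LI t. G (x + t *R z) @. z * indicator {0..1} t) = F (x + 1 *R z) - F (x + 0 *R z)"
  by (rule integral_FTC_Icc_real) (use der cg[of UNIV] in \<open>auto simp: continuous_on_eq_continuous_at\<close>)
 then have "(F (x + z) - F x)~2 <= (LI t. (G (x + t *R z) @. z)~2 * indicator {0..1} t)"
  using integral_unit_square(1)[OF cg] by simp
 then have "ennreal ((F (x + z) - F x)~2) <= ennreal (LI t. (G (x + t *R z) @. z)~2 * indicator {0..1} t)" by (rule ennreal_leI)
 also have "... = (\<integral>\<^sup>+t. ennreal ((G (x + t *R z) @. z)~2 * indicator {0..1} t) \<partial>lborel)"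
  by (rule nn_integral_eq_integral[symmetric]) (use integral_unit_square(2)[OF cg] in auto)
 also have "... = (\<integral>\<^sup>+t. ennreal ((G (x + t *R z) @. z)~2) * indicator {0..1} t \<partial>lborel)"
  by (intro nn_integral_cong) (auto simp: indicator_def)
 finally show ?thesis .
qed

text \<open>Convexity keeps the segment from x to x + z inside Q. After exchanging the integrals,
  translation invariance shows that each t contributes the same integral over Q.\<close>

lemma translate_difference_bound:
 fixes F :: "'a::euclidean_space => real"
 assumes d: "!!x. (F has_derivative (%h. G x @. h)) (at x)" and cG: "continuous_on UNIV G"
  and Q: "convex Q" and [measurable]: "Q \<in> sets borel"
 shows "(\<integral>\<^sup>+x. indicator Q x * indicator Q (x + z) * ennreal ((F (x + z) - F x)~2) \<partial>lborel)
  <= (\<integral>\<^sup>+x. indicator Q x * ennreal ((G x @. z)~2) \<partial>lborel)" (is "?L <= ?R")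
proof -
 have [measurable]: "G \<in> bm" using cG by (rule borel_measurable_continuous_onI)
 let ?K = "%x t. indicator Q (x + t *R z) * ennreal ((G (x + t *R z) @. z)~2) * indicator {0..1} t"
 have "?L <= (\<integral>\<^sup>+x. (\<integral>\<^sup>+t. ?K x t \<partial>lborel) \<partial>lborel)"
 proof (rule nn_integral_mono)
  fix x
  show "indicator Q x * indicator Q (x + z) * ennreal ((F (x + z) - F x)~2) <= (\<integral>\<^sup>+t. ?K x t \<partial>lborel)"
  proof (cases "x \<in> Q & x + z \<in> Q")
   case True
   have "x + t *R z \<in> Q" if "t \<in> {0..1}" for t
   proof -
    have "(1 - t) *R x + t *R (x + z) \<in> Q" using Q True that by (intro convexD_alt) auto
    then show ?thesis by (simp add: algebra_simps)
   qed
   then have "(\<integral>\<^sup>+t. ?K x t \<partial>lborel) = (\<integral>\<^sup>+t. ennreal ((G (x + t *R z) @. z)~2) * indicator {0..1} t \<partial>lborel)"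
    by (intro nn_integral_cong) (auto simp: indicator_def)
   then show ?thesis using segment_difference_bound[OF d cG, of x z] True by simp
  qed auto
 qed
 also have "... = (\<integral>\<^sup>+t. (\<integral>\<^sup>+x. ?K x t \<partial>lborel) \<partial>lborel)"
  by (rule lborel_pair.Fubini'[symmetric]) measurable
 also have "... = (\<integral>\<^sup>+t. ?R * indicator {0..1::real} t \<partial>lborel)"
 proof (rule nn_integral_cong)
  fix t :: real
  have "(\<integral>\<^sup>+x. ?K x t \<partial>lborel) = (\<integral>\<^sup>+x. indicator Q (x + t *R z) * ennreal ((G (x + t *R z) @. z)~2) \<partial>lborel) * indicator {0..1} t"
   by (rule nn_integral_multc) measurable
  also have "(\<integral>\<^sup>+x. indicator Q (x + t *R z) * ennreal ((G (x + t *R z) @. z)~2) \<partial>lborel) = ?R"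
   by (rule nn_integral_translate[of "%x. indicator Q x * ennreal ((G x @. z)~2)"]) measurable
  finally show "(\<integral>\<^sup>+x. ?K x t \<partial>lborel) = ?R * indicator {0..1} t" .
 qed
 also have "... = ?R" by (subst nn_integral_cmult) auto
 finally show ?thesis .
qed

lemma integrable_bounded_set:
 fixes F :: "'a::euclidean_space => real"
 assumes "continuous_on UNIV F" "bounded Q" "Q \<in> sets borel"
 shows "intb (%x. indicator Q x * F x)"
proof -
 have "intb (%x. indicator (closure Q) x *R F x)"
  by (rule borel_integrable_compact) (use assms continuous_on_subset in auto)
 then have "intb (%x. indicator Q x *R (indicator (closure Q) x *R F x))"
  by (rule integrable_mult_indicator[rotated]) (use assms in auto)
 moreover have "(%x. indicator Q x *R (indicator (closure Q) x *R F x)) = (%x. indicator Q x * F x)"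
 proof
  fix x show "indicator Q x *R (indicator (closure Q) x *R F x) = indicator Q x * F x"
   using closure_subset[of Q] by (cases "x \<in> Q") auto
 qed
 ultimately show ?thesis by simp
qed

text \<open>The left side is half the double integral of (F y - F x)^2 over Q times Q. After the
  substitution y = x + z the translate bound holds for each z, and only z of norm at most D
  contributes, which explains the volume of the ball. Multiplying through by the measure of Q avoids
  a division.\<close>

lemma poincare_convex:
 fixes F :: "'a::euclidean_space => real"
 assumes d: "!!x. (F has_derivative (%h. G x @. h)) (at x)" and cG: "continuous_on UNIV G"
  and Q: "convex Q" "bounded Q" and Qm[measurable]: "Q \<in> sets borel" and D: "!!x y. x \<in> Q ==> y \<in> Q ==> norm (x - y) <= D"
  and D0: "0 <= D"
 shows "measure lborel Q * (LI x. indicator Q x * (F x)~2) - (LI x. indicator Q x * F x)~2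
  <= D~2 * measure lborel (cball (0::'a) D) / 2 * (LI x. indicator Q x * (norm (G x))~2)"
proof -
 have cF: "continuous_on UNIV F" by (intro continuous_at_imp_continuous_on ballI has_derivative_continuous[OF d])
 have [measurable]: "G \<in> bm" "F \<in> bm" using cG cF by (auto intro: borel_measurable_continuous_onI)
 define A where "A = (LI x. indicator Q x * (F x)~2)"
 define B where "B = (LI x. indicator Q x * F x)"
 define E where "E = (LI x. indicator Q x * (norm (G x))~2)"
 define m where "m = measure lborel Q"
 have iA: "intb (%x. indicator Q x * (F x)~2)" and iB: "intb (%x. indicator Q x * F x)"
  and iE: "intb (%x. indicator Q x * (norm (G x))~2)" and i1: "intb (%x. indicator Q x * 1 :: real)"
  by (intro integrable_bounded_set continuous_intros cF cG Q Qm)+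
 have im: "(LI x. indicator Q x) = m" by (simp add: m_def)
 have inner: "(\<integral>\<^sup>+y. indicator Q y * ennreal ((F y - F x)~2) \<partial>lborel) = ennreal (A - 2 * F x * B + (F x)~2 * m)" for x
 proof -
  have e: "indicator Q y * (F y - F x)~2 = indicator Q y * (F y)~2 - 2 * F x * (indicator Q y * F y) + (F x)~2 * (indicator Q y * 1)" for y
   by (simp add: power2_diff algebra_simps)
  have "(\<integral>\<^sup>+y. indicator Q y * ennreal ((F y - F x)~2) \<partial>lborel) = (\<integral>\<^sup>+y. ennreal (indicator Q y * (F y - F x)~2) \<partial>lborel)"
   by (intro nn_integral_cong) (auto simp: indicator_def)
  also have "... = ennreal (LI y. indicator Q y * (F y - F x)~2)"
  proof (rule nn_integral_eq_integral)
   show "intb (%y. indicator Q y * (F y - F x)~2)" unfolding e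
    by (intro bi_add bi_diff integrable_mult_right iA iB i1)
  qed auto
  also have "(LI y. indicator Q y * (F y - F x)~2) = A - 2 * F x * B + (F x)~2 * m"
   unfolding e A_def B_def im[symmetric] using iA iB i1 by simp
  finally show ?thesis .
 qed
 have nn: "0 <= A - 2 * F x * B + (F x)~2 * m" for x
 proof -
  have e: "indicator Q y * (F y - F x)~2 = indicator Q y * (F y)~2 - 2 * F x * (indicator Q y * F y) + (F x)~2 * (indicator Q y * 1)" for y
   by (simp add: power2_diff algebra_simps)
  have "0 <= (LI y. indicator Q y * (F y - F x)~2)" by simp
  also have "... = A - 2 * F x * B + (F x)~2 * m" unfolding e A_def B_def im[symmetric] using iA iB i1 by simp
  finally show ?thesis .
 qed
 have "(\<integral>\<^sup>+x. \<integral>\<^sup>+y. indicator Q x * (indicator Q y * ennreal ((F y - F x)~2)) \<partial>lborel \<partial>lborel)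
  = (\<integral>\<^sup>+x. ennreal (indicator Q x * (A - 2 * F x * B + (F x)~2 * m)) \<partial>lborel)"
 proof (rule nn_integral_cong)
  fix x
  have "(\<integral>\<^sup>+y. indicator Q x * (indicator Q y * ennreal ((F y - F x)~2)) \<partial>lborel) = indicator Q x * (\<integral>\<^sup>+y. indicator Q y * ennreal ((F y - F x)~2) \<partial>lborel)"
   by (rule nn_integral_cmult) measurable
  then show "(\<integral>\<^sup>+y. indicator Q x * (indicator Q y * ennreal ((F y - F x)~2)) \<partial>lborel) = ennreal (indicator Q x * (A - 2 * F x * B + (F x)~2 * m))"
   unfolding inner by (auto simp: indicator_def)
 qed
 also have "... = ennreal (LI x. A * (indicator Q x * 1) - 2 * B * (indicator Q x * F x) + m * (indicator Q x * (F x)~2))"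
 proof -
  have e: "indicator Q x * (A - 2 * F x * B + (F x)~2 * m) = A * (indicator Q x * 1) - 2 * B * (indicator Q x * F x) + m * (indicator Q x * (F x)~2)" for x
   by (simp add: algebra_simps)
  have "(\<integral>\<^sup>+x. ennreal (indicator Q x * (A - 2 * F x * B + (F x)~2 * m)) \<partial>lborel) = ennreal (LI x. indicator Q x * (A - 2 * F x * B + (F x)~2 * m))"
  proof (rule nn_integral_eq_integral)
   show "intb (%x. indicator Q x * (A - 2 * F x * B + (F x)~2 * m))" unfolding e
    by (intro bi_add bi_diff integrable_mult_right iA iB i1)
   show "AL x. 0 <= indicator Q x * (A - 2 * F x * B + (F x)~2 * m)" using nn by (intro AE_I2 mult_nonneg_nonneg) auto
  qed
  then show ?thesis by (simp add: e)
 qed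
 also have "(LI x. A * (indicator Q x * 1) - 2 * B * (indicator Q x * F x) + m * (indicator Q x * (F x)~2)) = 2 * (m * A - B~2)"
  using iA iB i1 by (simp add: A_def[symmetric] B_def[symmetric] m_def[symmetric]) (simp add: power2_eq_square algebra_simps)
 finally have lhs: "ennreal (2 * (m * A - B~2)) = (\<integral>\<^sup>+x. \<integral>\<^sup>+y. indicator Q x * (indicator Q y * ennreal ((F y - F x)~2)) \<partial>lborel \<partial>lborel)" ..
 also have "... = (\<integral>\<^sup>+x. \<integral>\<^sup>+z. indicator Q x * (indicator Q (x + z) * ennreal ((F (x + z) - F x)~2)) \<partial>lborel \<partial>lborel)"
 proof (rule nn_integral_cong)
  fix x
  show "(\<integral>\<^sup>+y. indicator Q x * (indicator Q y * ennreal ((F y - F x)~2)) \<partial>lborel) = (\<integral>\<^sup>+z. indicator Q x * (indicator Q (x + z) * ennreal ((F (x + z) - F x)~2)) \<partial>lborel)"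
   using nn_integral_translate[of "%y. indicator Q x * (indicator Q y * ennreal ((F y - F x)~2))" x] by (simp add: add.commute)
 qed
 also have "... = (\<integral>\<^sup>+z. \<integral>\<^sup>+x. indicator Q x * (indicator Q (x + z) * ennreal ((F (x + z) - F x)~2)) \<partial>lborel \<partial>lborel)"
  by (rule lborel_pair.Fubini'[symmetric]) measurable
 also have "... <= (\<integral>\<^sup>+z. ennreal (D~2 * E) * indicator (cball (0::'a) D) z \<partial>lborel)"
 proof (rule nn_integral_mono)
  fix z :: 'a
  show "(\<integral>\<^sup>+x. indicator Q x * (indicator Q (x + z) * ennreal ((F (x + z) - F x)~2)) \<partial>lborel) <= ennreal (D~2 * E) * indicator (cball (0::'a) D) z"
  proof (cases "z \<in> cball 0 D")
   case True
   have "(\<integral>\<^sup>+x. indicator Q x * (indicator Q (x + z) * ennreal ((F (x + z) - F x)~2)) \<partial>lborel) <= (\<integral>\<^sup>+x. indicator Q x * ennreal ((G x @. z)~2) \<partial>lborel)"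
    using translate_difference_bound[OF d cG Q(1) Qm, of z] by (simp add: mult.assoc)
   also have "... <= (\<integral>\<^sup>+x. ennreal (D~2 * (indicator Q x * (norm (G x))~2)) \<partial>lborel)"
   proof (rule nn_integral_mono)
    fix x
    have "||G x @. z|| <= norm (G x) * D" using Cauchy_Schwarz_ineq2[of "G x" z] True mult_left_mono[of "norm z" D "norm (G x)"] by simp
    then have "||G x @. z||~2 <= (norm (G x) * D)~2" by (intro power_mono) auto
    then show "indicator Q x * ennreal ((G x @. z)~2) <= ennreal (D~2 * (indicator Q x * (norm (G x))~2))"
     by (cases "x \<in> Q") (auto simp: power_mult_distrib mult.commute intro!: ennreal_leI)
   qed
   also have "... = ennreal (LI x. D~2 * (indicator Q x * (norm (G x))~2))"
    by (rule nn_integral_eq_integral) (use iE in auto)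
   finally show ?thesis using True by (simp add: E_def)
  next
   case False
   have "indicator Q x * (indicator Q (x + z) * ennreal ((F (x + z) - F x)~2)) = 0" for x
    using False D[of "x + z" x] by (auto simp: indicator_def)
   then have "(\<integral>\<^sup>+x. indicator Q x * (indicator Q (x + z) * ennreal ((F (x + z) - F x)~2)) \<partial>lborel) = 0" by (simp only: nn_integral_0_iff_AE) simp
   then show ?thesis by simp
  qed
 qed
 also have "... = ennreal (D~2 * E) * emeasure lborel (cball (0::'a) D)" by (rule nn_integral_cmult_indicator) simp
 also have "... = ennreal (D~2 * E) * ennreal (measure lborel (cball (0::'a) D))"
  by (subst emeasure_eq_ennreal_measure) (use emeasure_compact_finite[of "cball (0::'a) D"] in auto)
 also have "... = ennreal (D~2 * E * measure lborel (cball (0::'a) D))" by (simp add: ennreal_mult'')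
 finally have "2 * (m * A - B~2) <= D~2 * E * measure lborel (cball (0::'a) D)"
  by (subst (asm) ennreal_le_iff) (auto simp: E_def)
 then show ?thesis unfolding A_def[symmetric] B_def[symmetric] E_def[symmetric] m_def[symmetric] by (simp add: field_simps)
qed

text \<open>Half-open squares of side \<open>de\<close>, so that they partition the plane.\<close>

definition cell :: "real => int \<times> int => (real * real) set" where
 "cell de c = {de * fst c ..< de * (fst c + 1)} \<times> {de * snd c ..< de * (snd c + 1)}"

definition cellof :: "real => real * real => int \<times> int" where
 "cellof de x = (\<lfloor>fst x / de\<rfloor>, \<lfloor>snd x / de\<rfloor>)"

lemma cell_iff: assumes "de > 0" shows "x \<in> cell de c \<longleftrightarrow> c = cellof de x"
proof -
 have "de * real_of_int i <= t & t < de * (real_of_int i + 1) \<longleftrightarrow> i = \<lfloor>t/de\<rfloor>" for i t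
  using assms by (simp add: eq_commute[of i] floor_eq_iff field_simps)
 then show ?thesis by (auto simp: cell_def cellof_def mem_Times_iff prod_eq_iff)
qed

lemma cell_facts:
 assumes "de > 0"
 shows "convex (cell de c)" "bounded (cell de c)" "cell de c \<in> sets borel" "measure lborel (cell de c) = de~2"
  "!!x y. x \<in> cell de c ==> y \<in> cell de c ==> norm (x - y) <= 2 * de"
proof -
 show "convex (cell de c)" unfolding cell_def by (intro convex_Times) auto
 show "bounded (cell de c)" unfolding cell_def by (intro bounded_Times) (auto intro: bounded_subset[OF bounded_closed_interval])
 show "cell de c \<in> sets borel" unfolding cell_def by (intro borel_Times) auto
 have "emeasure lborel (cell de c) = emeasure (lborel \<Otimes>\<^sub>M lborel) (cell de c)" by (simp add: lborel_prod)
 also have "... = emeasure lborel {de * fst c ..< de * (fst c + 1)} * emeasure lborel {de * snd c ..< de * (snd c + 1)}"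
  unfolding cell_def by (rule lborel.emeasure_pair_measure_Times) auto
 also have "... = ennreal (de~2)" using assms by (simp add: algebra_simps ennreal_mult[symmetric] power2_eq_square)
 finally show "measure lborel (cell de c) = de~2" by (simp add: measure_def)
 fix x y assume "x \<in> cell de c" "y \<in> cell de c"
 then have "||fst x - fst y|| <= de" "||snd x - snd y|| <= de" by (auto simp: cell_def mem_Times_iff algebra_simps)
 moreover have "norm (x - y) <= ||fst x - fst y|| + ||snd x - snd y||"
  using norm_Pair_le[of "fst (x - y)" "snd (x - y)"] unfolding prod.collapse by simp
 ultimately show "norm (x - y) <= 2 * de" by linarith
qed

lemma measure_cball_R2: assumes "0 <= D" shows "measure lborel (cball (0::real\<times>real) D) <= 4 * D~2"
proof -
 have "cball (0::real\<times>real) D \<subseteq> {-D..D} \<times> {-D..D}"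
 proof
  fix x :: "real * real" assume "x \<in> cball 0 D"
  then have "norm x <= D" by simp
  then have "||fst x|| <= D" "||snd x|| <= D" using norm_fst_le[of "fst x" "snd x"] norm_snd_le[of "snd x" "fst x"] by auto
  then show "x \<in> {-D..D} \<times> {-D..D}" by (auto simp: mem_Times_iff)
 qed
 moreover have "emeasure lborel ({-D..D} \<times> {-D..D}) = ennreal (4 * D~2)"
 proof -
  have "emeasure lborel ({-D..D} \<times> {-D..D}) = emeasure (lborel \<Otimes>\<^sub>M lborel) ({-D..D} \<times> {-D..D})" by (simp add: lborel_prod)
  also have "... = emeasure lborel {-D..D} * emeasure lborel {-D..D}" by (rule lborel.emeasure_pair_measure_Times) auto
  finally show ?thesis using assms by (simp add: ennreal_mult[symmetric] power2_eq_square)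
 qed
 ultimately have "emeasure lborel (cball (0::real\<times>real) D) <= ennreal (4 * D~2)"
  using emeasure_mono[of "cball (0::real\<times>real) D" "{-D..D} \<times> {-D..D}" lborel] by (auto simp: borel_Times)
 then show ?thesis by (simp add: measure_def enn2real_leI)
qed

text \<open>This replaces Rellich's theorem: up to a small multiple of the Dirichlet energy, the norm is controlled by
 finitely many cell averages.\<close>

lemma mesh_inequality:
 fixes S :: "(real * real) set"
 assumes S: "bounded S" and th: "th > 0"
 shows "\<exists>I l. finite I & (\<forall>i\<in>I. sqi (l i)) & (\<forall>Fi. W S Fi -->
  N2 (%x. fst (Fi x)) <= (\<Sum>i\<in>(I::(int\<times>int) set). (LI x. l i x * fst (Fi x))~2) + th * N2 (%x. snd (Fi x)))"
proof -
 \<comment> \<open>The Poincare constant for diameter bound 2 de is (2 de)^2 * 4 (2 de)^2 / 2 = 32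
   de^4; after division by the area de^2 it becomes 32 de^2 = th.\<close>
 define de where "de = sqrt (th / 32)"
 have d: "de > 0" "32 * de~2 = th" using th by (auto simp: de_def)
 define I where "I = cellof de ` S"
 have finI: "finite I"
 proof -
  obtain R where R: "!!x. x \<in> S ==> norm x <= R" using S by (auto simp: bounded_iff)
  have "I \<subseteq> {\<lfloor>-R/de\<rfloor>..\<lfloor>R/de\<rfloor>} \<times> {\<lfloor>-R/de\<rfloor>..\<lfloor>R/de\<rfloor>}"
  proof
   fix c assume "c \<in> I"
   then obtain x where x: "x \<in> S" "c = cellof de x" by (auto simp: I_def)
   have "||fst x|| <= R" "||snd x|| <= R" using R[OF x(1)] norm_fst_le[of "fst x" "snd x"] norm_snd_le[of "snd x" "fst x"] by auto
   then have "-R/de <= fst x/de" "fst x/de <= R/de" "-R/de <= snd x/de" "snd x/de <= R/de"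
    using d(1) by (auto intro!: divide_right_mono simp: minus_divide_left simp del: minus_divide_left[symmetric])
   then show "c \<in> {\<lfloor>-R/de\<rfloor>..\<lfloor>R/de\<rfloor>} \<times> {\<lfloor>-R/de\<rfloor>..\<lfloor>R/de\<rfloor>}" unfolding x(2) cellof_def by (auto intro: floor_mono)
  qed
  then show ?thesis by (rule finite_subset) auto
 qed
 note cf = cell_facts[OF d(1)]
 \<comment> \<open>Normalised so that the squared pairing is the squared integral over the square
   divided by its area.\<close>
 define l where "l c x = (1/de) * indicator (cell de c) x" for c and x :: "real * real"
 have sl: "sqi (l c)" for c
 proof -
  have "intb (%x. indicator (cell de c) x * 1 :: real)" by (rule integrable_bounded_set) (use cf in auto)
  then have "intb (%x. (norm (indicator (cell de c) x :: real))~2)"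
   by (rule bi_bound) (use cf(3)[of c] in \<open>auto simp: indicator_def\<close>)
  then have "sqi (%x. indicator (cell de c) x :: real)" using cf(3)[of c] by (simp add: sqi_def)
  then show ?thesis unfolding l_def by (rule sqi_mult_const)
 qed
 have test: "N2 ph <= (\<Sum>i\<in>I. (LI x. l i x * ph x)~2) + th * N2 (cgrad ph)" if p: "test_fun S ph" for ph
 proof -
  have sm: "sm ph" using test_funD(1)[OF p] .
  have cell1: "(LI x. indicator (cell de c) x * (ph x)~2) <= (LI x. l c x * ph x)~2 + th * (LI x. indicator (cell de c) x * (norm (cgrad ph x))~2)" for c
  proof -
   define A B E where "A = (LI x. indicator (cell de c) x * (ph x)~2)" and "B = (LI x. indicator (cell de c) x * ph x)"
    and "E = (LI x. indicator (cell de c) x * (norm (cgrad ph x))~2)"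
   have E0: "E >= 0" by (simp add: E_def)
   have "de~2 * A - B~2 <= (2*de)~2 * measure lborel (cball (0::real\<times>real) (2*de)) / 2 * E"
    using poincare_convex[OF sm_has_cgrad[OF sm] sm_cgrad_continuous[OF sm] cf(1,2,3) cf(5), of c] d(1)
    unfolding A_def B_def E_def cf(4) by simp
   also have "... <= (2*de)~2 * (4 * (2*de)~2) / 2 * E"
    by (intro mult_right_mono divide_right_mono mult_left_mono measure_cball_R2) (use d E0 in auto)
   also have "... = de~2 * (32 * de~2 * E)" by (simp add: power2_eq_square)
   also have "de~2 * (32 * de~2 * E) = de~2 * ((B/de)~2 + th * E) - B~2"
    using d(1) unfolding d(2)[symmetric] by (simp add: power_divide distrib_left)
   finally have "de~2 * A <= de~2 * ((B/de)~2 + th * E)" by simp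
   then have "A <= (B/de)~2 + th * E" using d by simp
   moreover have "(LI x. l c x * ph x) = B/de" unfolding l_def B_def by (simp add: mult.assoc)
   ultimately show ?thesis by (simp add: A_def E_def)
  qed
  have part: "(\<Sum>c\<in>I. \<integral>x. indicator (cell de c) x * f x \<partial>lborel) = (LI x. f x)"
   if f0: "!!x. x \<notin> S ==> f x = 0" and fi: "intb f" for f :: "real * real => real"
  proof -
   have "(\<Sum>c\<in>I. \<integral>x. indicator (cell de c) x * f x \<partial>lborel) = (LI x. (\<Sum>c\<in>I. indicator (cell de c) x * f x))"
    by (rule bl_sum[symmetric]) (use fi cf(3) integrable_mult_indicator[of _ lborel f] in auto)
   also have "(%x. \<Sum>c\<in>I. indicator (cell de c) x * f x) = f"
   proof
    fix x
    show "(\<Sum>c\<in>I. indicator (cell de c) x * f x) = f x"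
    proof (cases "x \<in> S")
     case True
     have "(\<Sum>c\<in>I. indicator (cell de c) x * f x) = (\<Sum>c\<in>I. if c = cellof de x then f x else 0)"
      by (intro sum.cong) (auto simp: indicator_def cell_iff[OF d(1)])
     also have "... = f x" using finI True by (simp add: I_def)
     finally show ?thesis .
    qed (simp add: f0)
   qed
   finally show ?thesis .
  qed
  have out: "ph x = 0" "cgrad ph x = 0" if "x \<notin> S" for x using tpair_outside[OF p that] by (auto simp: tpair_def zero_prod_def)
  have "N2 ph = (\<Sum>c\<in>I. \<integral>x. indicator (cell de c) x * (ph x)~2 \<partial>lborel)"
   using part[of "%x. (norm (ph x))~2"] out sqi_integrable[OF sqi_test(1)[OF p]] by (simp add: N2_def)
  also have "... <= (\<Sum>c\<in>I. (LI x. l c x * ph x)~2 + th * (LI x. indicator (cell de c) x * (norm (cgrad ph x))~2))"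
   by (rule sum_mono) (rule cell1)
  also have "... = (\<Sum>c\<in>I. (LI x. l c x * ph x)~2) + th * (\<Sum>c\<in>I. \<integral>x. indicator (cell de c) x * (norm (cgrad ph x))~2 \<partial>lborel)"
   by (simp add: sum.distrib sum_distrib_left)
  also have "(\<Sum>c\<in>I. \<integral>x. indicator (cell de c) x * (norm (cgrad ph x))~2 \<partial>lborel) = N2 (cgrad ph)"
   using part[of "%x. (norm (cgrad ph x))~2"] out sqi_integrable[OF sqi_test(2)[OF p]] by (simp add: N2_def)
  finally show ?thesis .
 qed
 have "N2 (%x. fst (Fi x)) <= (\<Sum>i\<in>I. (LI x. l i x * fst (Fi x))~2) + th * N2 (%x. snd (Fi x))" if W: "W S Fi" for Fi
 proof -
  obtain f where f: "!!n. test_fun S (f n)" "l2lim (%n. tpair (f n)) Fi" using W unfolding W_def by blast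
  have l1: "l2lim (%n x. f n x) (%x. fst (Fi x))" using l2lim_fst[OF f(2)] by (simp add: tpair_def)
  have l2: "l2lim (%n x. cgrad (f n) x) (%x. snd (Fi x))" using l2lim_snd[OF f(2)] by (simp add: tpair_def)
  show ?thesis
  proof (rule LIMSEQ_le)
   show "(%n. N2 (f n)) ~~> N2 (%x. fst (Fi x))" by (rule l2lim_N2[OF l1])
   show "(%n. (\<Sum>i\<in>I. (LI x. l i x * f n x)~2) + th * N2 (cgrad (f n))) ~~> (\<Sum>i\<in>I. (LI x. l i x * fst (Fi x))~2) + th * N2 (%x. snd (Fi x))"
    by (intro tendsto_intros l2lim_times[OF l2lim_const[OF sl] l1] l2lim_N2[OF l2])
  qed (use test[OF f(1)] in auto)
 qed
 then show ?thesis using finI sl by blast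
qed

section \<open>Nonlinear test functions and Picone's inequality\<close>

text \<open>The coefficients vary with n and converge only pointwise. Split c_n X_n as c_n f + c_n
  (X_n - f): dominated convergence treats the first part, boundedness of c_n the second.\<close>

lemma l2lim_coeff:
 fixes X :: "nat => 'a::euclidean_space => 'b::euclidean_space"
 assumes l: "l2lim X f" and [measurable]: "!!n. c n \<in> bm" "c0 \<in> bm"
  and b: "!!n x. ||c n x|| <= C" and ae: "AL x. (%n. c n x) ~~> c0 x"
 shows "l2lim (%n x. c n x *R X n x) (%x. c0 x *R f x)"
proof -
 have s: "sqi f" "!!n. sqi (X n)" using l by (auto simp: l2lim_def)
 have [measurable]: "f \<in> bm" "!!n. X n \<in> bm" using s by (auto simp: sqi_def)
 have C0: "0 <= C" using b[of 0 undefined] by linarith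
 have l1: "l2lim (%n x. c n x *R f x) (%x. c0 x *R f x)"
 proof (rule l2_dominated[where w="%x. C *R f x"])
  show "sqi (%x. C *R f x)" by (rule sqi_scale(1)[OF s(1)])
  show "AL x. (%n. c n x *R f x) ~~> c0 x *R f x" using ae by eventually_elim (intro tendsto_intros)
  show "AL x. norm (c n x *R f x) <= norm (C *R f x)" for n using b C0 by (intro AE_I2) (auto intro!: mult_right_mono)
 qed measurable
 have sd: "sqi (%x. c n x *R (X n x - f x))" "N2 (%x. c n x *R (X n x - f x)) <= C~2 * N2 (%x. X n x - f x)" for n
 proof -
  have "AL x. norm (c n x *R (X n x - f x)) <= C * norm (X n x - f x)" using b by (auto intro!: mult_right_mono)
  then show "sqi (%x. c n x *R (X n x - f x))" "N2 (%x. c n x *R (X n x - f x)) <= C~2 * N2 (%x. X n x - f x)"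
   using sqi_bound[of "%x. c n x *R (X n x - f x)" "%x. X n x - f x" C] sqi_diff(1)[OF s(2) s(1)] by auto
 qed
 have "(%n. N2 (%x. c n x *R (X n x - f x))) ~~> 0"
 proof (rule tendsto_sandwich[OF _ _ tendsto_const])
  show "(%n. C~2 * N2 (%x. X n x - f x)) ~~> 0" using l tendsto_mult_right_zero unfolding l2lim_def by blast
 qed (use sd in auto)
 then have l2: "l2lim (%n x. c n x *R (X n x - f x)) (%x. 0)" using sd by (simp add: l2lim_def)
 show ?thesis using l2lim_add[OF l1 l2] by (simp add: scaleR_diff_right)
qed

text \<open>Lower semicontinuity of the norm under almost everywhere convergence; this is how
  Picone's inequality survives the removal of a regularisation and the passage from test functions
  to \<open>W\<close>.\<close>

lemma l2_fatou:
 assumes s: "!!n. sqi (X n)" and ae: "AL x. (%n. X n x) ~~> f x" and [measurable]: "f \<in> bm"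
  and b: "!!n. N2 (X n) <= c n" and c: "c ~~> c0"
 shows "sqi f" "N2 f <= c0"
proof -
 have [measurable]: "X n \<in> bm" for n using s by (auto simp: sqi_def)
 have c00: "0 <= c0" by (rule LIMSEQ_le_const[OF c]) (use b N2_nonneg order_trans in blast)
 have "(\<integral>\<^sup>+x. ennreal ((norm (f x))~2) \<partial>lborel) = (\<integral>\<^sup>+x. liminf (%k. ennreal ((norm (X k x))~2)) \<partial>lborel)"
 proof (rule nn_integral_cong_AE)
  show "AL x. ennreal ((norm (f x))~2) = liminf (%k. ennreal ((norm (X k x))~2))" using ae
  proof eventually_elim
   case (elim x)
   have "(%k. ennreal ((norm (X k x))~2)) ~~> ennreal ((norm (f x))~2)" by (intro tendsto_ennrealI tendsto_intros elim)
   then show ?case by (intro lim_imp_Liminf[symmetric]) simp_all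
  qed
 qed
 also have "... <= liminf (%k. \<integral>\<^sup>+x. ennreal ((norm (X k x))~2) \<partial>lborel)" by (rule nn_integral_liminf) measurable
 also have "... <= liminf (%k. ennreal (c k))"
 proof (rule Liminf_mono, intro always_eventually allI)
  fix k
  have "(\<integral>\<^sup>+x. ennreal ((norm (X k x))~2) \<partial>lborel) = ennreal (N2 (X k))" unfolding N2_def
   by (rule nn_integral_eq_integral) (use s in \<open>auto simp: sqi_def\<close>)
  then show "(\<integral>\<^sup>+x. ennreal ((norm (X k x))~2) \<partial>lborel) <= ennreal (c k)" using b by (simp add: ennreal_leI)
 qed
 also have "... = ennreal c0" by (intro lim_imp_Liminf tendsto_ennrealI c) simp
 finally have k: "(\<integral>\<^sup>+x. ennreal ((norm (f x))~2) \<partial>lborel) <= ennreal c0" .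
 have i: "intb (%x. (norm (f x))~2)"
  by (rule integrableI_bounded) (use k in \<open>auto simp: le_less_trans\<close>)
 then show "sqi f" by (simp add: sqi_def)
 have "ennreal (N2 f) <= ennreal c0" using k unfolding N2_def by (subst (asm) nn_integral_eq_integral) (use i in auto)
 then show "N2 f <= c0" using c00 by simp
qed

text \<open>The cutoff \<open>ze\<close> gives compact support inside U although G may not vanish at
  0. The gradients converge because G' is bounded and continuous and the approximating functions
  converge almost everywhere along a subsequence.\<close>

lemma W_comp:
 fixes G G' :: "real => real"
 assumes W: "W U Fi" and G: "sm G" and dG: "!!t. (G has_real_derivative G' t) (at t)" and L: "!!t. ||G' t|| <= L" and z: "test_fun U ze"
  and cG': "continuous_on UNIV G'"
 shows "W U (%x. (ze x * G (fst (Fi x)), G (fst (Fi x)) *R cgrad ze x + (ze x * G' (fst (Fi x))) *R snd (Fi x)))"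
proof -
 obtain f0 where f0: "!!n. test_fun U (f0 n)" "l2lim (%n. tpair (f0 n)) Fi" using W unfolding W_def by blast
 obtain r where r: "strict_mono r" "AL x. (%n. tpair (f0 (r n)) x) ~~> Fi x" using l2lim_AE_subseq[OF f0(2)] by auto
 define f where "f n = f0 (r n)" for n
 have f: "!!n. test_fun U (f n)" "l2lim (%n. tpair (f n)) Fi" "AL x. (%n. f n x) ~~> fst (Fi x)"
 proof -
  show "test_fun U (f n)" for n by (simp add: f_def f0)
  show "l2lim (%n. tpair (f n)) Fi" unfolding f_def by (rule l2lim_subseq[OF f0(2) r(1)])
  show "AL x. (%n. f n x) ~~> fst (Fi x)" using r(2)
  proof eventually_elim
   case (elim x) show ?case using tendsto_fst[OF elim] by (simp add: tpair_def f_def)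
  qed
 qed
 have l1: "l2lim (%n x. f n x) (%x. fst (Fi x))" using l2lim_fst[OF f(2)] by (simp add: tpair_def)
 have l2: "l2lim (%n x. cgrad (f n) x) (%x. snd (Fi x))" using l2lim_snd[OF f(2)] by (simp add: tpair_def)
 have smz: "sm ze" "!!n. sm (f n)" using test_funD(1) z f by auto
 have [measurable]: "G \<in> bm" "G' \<in> bm" "Fi \<in> bm" "ze \<in> bm"
   "cgrad ze \<in> bm" "!!n. f n \<in> bm"
  using sm_borel[OF G] borel_measurable_continuous_onI[OF cG'] W_borel[OF W] sm_borel smz sm_cgrad_borel by auto
 have lip: "||G a - G b|| <= L * ||a - b||" for a b
  using field_differentiable_bound[of UNIV G G' L a b] dG L by simp
 obtain C1 where C1: "0 <= C1" "!!x. norm (ze x) <= C1"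
  using compact_support_bounded[OF sm_continuous[OF smz(1)] test_funD(2)[OF z] test_funD(4)[OF z]] by auto
 obtain C2 where C2: "0 <= C2" "!!x. norm (cgrad ze x) <= C2"
  using compact_support_bounded[OF sm_cgrad_continuous[OF smz(1)] test_funD(2)[OF z] test_funD(5)[OF z]] by auto
 have L0: "0 <= L" using L[of 0] by linarith
 have G0: "||G a|| <= ||G 0|| + L * ||a||" for a using lip[of a 0] by auto
 have m1: "l2lim (%n x. ze x * G (f n x)) (%x. ze x * G (fst (Fi x)))"
 proof (rule l2lim_lip[OF l1, where T="%x a. ze x * G a" and C="C1 * L"])
  show "AL x. norm (ze x * G (f n x) - ze x * G (fst (Fi x))) <= C1 * L * norm (f n x - fst (Fi x))" for n
  proof (rule AE_I2)
   fix x
   have "norm (ze x * G (f n x) - ze x * G (fst (Fi x))) = norm (ze x) * ||G (f n x) - G (fst (Fi x))||" by (simp add: abs_mult right_diff_distrib[symmetric])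
   also have "... <= C1 * (L * ||f n x - fst (Fi x)||)" by (intro mult_mono C1 lip) auto
   finally show "norm (ze x * G (f n x) - ze x * G (fst (Fi x))) <= C1 * L * norm (f n x - fst (Fi x))" by simp
  qed
  have s: "sqi (%x. ||G 0|| * ||ze x|| + C1 * L * ||fst (Fi x)||)"
   using sqi_add(1)[OF sqi_mult_const[OF sqi_norm(1)[OF sqi_test(1)[OF z]]] sqi_mult_const[OF sqi_norm(1)[OF W_sqi(2)[OF W]]], of "||G 0||" "C1 * L"] by simp
  show "sqi (%x. ze x * G (fst (Fi x)))"
  proof (rule sqi_bound(1)[OF _ s, of _ 1])
   show "AL x. norm (ze x * G (fst (Fi x))) <= 1 * norm ( ||G 0|| * ||ze x|| + C1 * L * ||fst (Fi x)||)"
   proof (rule AE_I2)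
    fix x
    have "norm (ze x * G (fst (Fi x))) <= ||ze x|| * ( ||G 0|| + L * ||fst (Fi x)||)" using mult_left_mono[OF G0[of "fst (Fi x)"] abs_ge_zero[of "ze x"]] by (simp add: abs_mult)
    also have "... <= ||G 0|| * ||ze x|| + C1 * L * ||fst (Fi x)||"
     using mult_right_mono[OF C1(2)[of x], of "L * ||fst (Fi x)||"] L0 by (simp add: algebra_simps)
    finally show "norm (ze x * G (fst (Fi x))) <= 1 * norm ( ||G 0|| * ||ze x|| + C1 * L * ||fst (Fi x)||)" by simp
   qed
  qed measurable
 qed measurable
 have m2: "l2lim (%n x. G (f n x) *R cgrad ze x) (%x. G (fst (Fi x)) *R cgrad ze x)"
 proof (rule l2lim_lip[OF l1, where T="%x a. G a *R cgrad ze x" and C="C2 * L"])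
  show "AL x. norm (G (f n x) *R cgrad ze x - G (fst (Fi x)) *R cgrad ze x) <= C2 * L * norm (f n x - fst (Fi x))" for n
  proof (rule AE_I2)
   fix x
   have "norm (G (f n x) *R cgrad ze x - G (fst (Fi x)) *R cgrad ze x) = norm (cgrad ze x) * ||G (f n x) - G (fst (Fi x))||" by (simp add: scaleR_diff_left[symmetric])
   also have "... <= C2 * (L * ||f n x - fst (Fi x)||)" by (intro mult_mono C2 lip) auto
   finally show "norm (G (f n x) *R cgrad ze x - G (fst (Fi x)) *R cgrad ze x) <= C2 * L * norm (f n x - fst (Fi x))" by simp
  qed
  have s: "sqi (%x. ||G 0|| * norm (cgrad ze x) + C2 * L * ||fst (Fi x)||)"
   using sqi_add(1)[OF sqi_mult_const[OF sqi_norm(1)[OF sqi_test(2)[OF z]]] sqi_mult_const[OF sqi_norm(1)[OF W_sqi(2)[OF W]]], of "||G 0||" "C2 * L"] by simp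
  show "sqi (%x. G (fst (Fi x)) *R cgrad ze x)"
  proof (rule sqi_bound(1)[OF _ s, of _ 1])
   show "AL x. norm (G (fst (Fi x)) *R cgrad ze x) <= 1 * norm ( ||G 0|| * norm (cgrad ze x) + C2 * L * ||fst (Fi x)||)"
   proof (rule AE_I2)
    fix x
    have "norm (G (fst (Fi x)) *R cgrad ze x) <= norm (cgrad ze x) * ( ||G 0|| + L * ||fst (Fi x)||)"
     using mult_left_mono[OF G0[of "fst (Fi x)"] norm_ge_zero[of "cgrad ze x"]] by (simp add: mult.commute)
    also have "... <= ||G 0|| * norm (cgrad ze x) + C2 * L * ||fst (Fi x)||"
     using mult_right_mono[OF C2(2)[of x], of "L * ||fst (Fi x)||"] L0 by (simp add: algebra_simps)
    finally show "norm (G (fst (Fi x)) *R cgrad ze x) <= 1 * norm ( ||G 0|| * norm (cgrad ze x) + C2 * L * ||fst (Fi x)||)" by simp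
   qed
  qed measurable
 qed measurable
 have m3: "l2lim (%n x. (ze x * G' (f n x)) *R cgrad (f n) x) (%x. (ze x * G' (fst (Fi x))) *R snd (Fi x))"
 proof (rule l2lim_coeff[OF l2, where C="C1 * L"])
  show "||ze x * G' (f n x)|| <= C1 * L" for n x using C1(2)[of x] L[of "f n x"] by (simp add: abs_mult mult_mono')
  show "AL x. (%n. ze x * G' (f n x)) ~~> ze x * G' (fst (Fi x))" using f(3)
   by eventually_elim (intro tendsto_intros isCont_tendsto_compose[of _ G'], use cG' in \<open>auto simp: continuous_on_eq_continuous_at\<close>)
 qed measurable
 have cg: "tpair (%x. ze x * G (f n x)) = (%x. (ze x * G (f n x), G (f n x) *R cgrad ze x + (ze x * G' (f n x)) *R cgrad (f n) x))" for n
 proof -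
  have "((%x. ze x * G (f n x)) has_derivative (%h. (G (f n x) *R cgrad ze x + (ze x * G' (f n x)) *R cgrad (f n) x) @. h)) (at x)" for x
  proof -
   have "((%x. G (f n x)) has_derivative (%h. G' (f n x) * (cgrad (f n) x @. h))) (at x)"
    by (rule has_derivative_compose[OF sm_has_cgrad[OF smz(2)] dG[unfolded has_field_derivative_def]])
   from has_derivative_mult[OF sm_has_cgrad[OF smz(1)] this] show ?thesis
    by (rule has_derivative_eq_rhs) (auto simp: inner_add_left algebra_simps)
  qed
  then show ?thesis by (auto simp: tpair_def cgrad_unique)
 qed
 have "l2lim (%n. tpair (%x. ze x * G (f n x))) (%x. (ze x * G (fst (Fi x)), G (fst (Fi x)) *R cgrad ze x + (ze x * G' (fst (Fi x))) *R snd (Fi x)))"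
  unfolding cg by (intro l2lim_Pair m1 l2lim_add m2 m3)
 moreover have "test_fun U (%x. ze x * G (f n x))" for n
  using test_fun_mult[OF z sm_compose[OF G smz(2)], of n] by (simp add: mult.commute)
 ultimately show ?thesis unfolding W_def by (intro exI[of _ "%n x. ze x * G (f n x)"]) auto
qed

lemma norm_diff_scaled_sq:
 fixes c p :: "'a::real_inner"
 assumes "a > 0"
 shows "(norm (a *R c - (m / a) *R p))~2 = a~2 * (norm c)~2 - 2 * m * (c @. p) + m~2 / a~2 * (p @. p)"
proof -
 have "(norm (a *R c - (m / a) *R p))~2 = a~2 * (c @. c) - 2 * (a * (m / a)) * (c @. p) + (m/a)~2 * (p @. p)"
  unfolding power2_norm_eq_inner by (simp add: inner_diff_left inner_diff_right inner_commute[of p c] power2_eq_square algebra_simps)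
 then show ?thesis using assms by (simp add: power2_norm_eq_inner power_divide)
qed

text \<open>\<open>mu0\<close> bundles the ground state with its gradient, adjusted on a null set so
  that positivity on S and vanishing off S hold at every point. Positivity makes \<open>lam0\<close>
  the bottom of the spectrum, and together with connectedness it makes \<open>lam0\<close>
  simple.\<close>

locale cross_section =
 fixes S :: "(real * real) set" and lam0 :: real and mu0 :: "real * real => real \<times> (real * real)"
 assumes S_open: "open S" and S_bounded: "bounded S" and S_connected: "connected S" and S_ne: "S ~= {}"
  and W0: "W S mu0" and weak: "!!Gi. W S Gi ==> (LI y. snd (mu0 y) @. snd (Gi y)) = lam0 * (LI y. fst (mu0 y) * fst (Gi y))"
  and pos: "!!y. y \<in> S ==> 0 < fst (mu0 y)" and out: "!!y. y \<notin> S ==> mu0 y = 0"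
  and nrm: "N2 (%y. fst (mu0 y)) = 1"
begin

definition "u0 y = fst (mu0 y)"
definition "p0 y = snd (mu0 y)"

lemma u0_sqi: "sqi u0" and p0_sqi: "sqi p0"
 using W_sqi(2,3)[OF W0] by (simp_all add: u0_def[abs_def] p0_def[abs_def])

lemma u0_borel [measurable]: "u0 \<in> bm" and p0_borel [measurable]: "p0 \<in> bm"
 using u0_sqi p0_sqi by (auto simp: sqi_def)

lemma S_borel [measurable]: "S \<in> sets borel" using S_open by simp

lemma u0_nonneg: "0 <= u0 y"
 using pos[of y] out[of y] by (cases "y \<in> S") (auto simp: u0_def)

lemma N2_p0: "N2 p0 = lam0"
 using weak[OF W0] nrm by (simp add: N2_inner p0_def u0_def[symmetric])

text \<open>Integrates the first partial derivative of y1 ph(y)^2, which has integral 0, and applies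
  Cauchy-Schwarz. It serves to show that \<open>lam0\<close> is positive.\<close>

lemma poincare_width:
 assumes W: "W S Fi" and R: "!!y. y \<in> S ==> norm y <= R"
 shows "N2 (%y. fst (Fi y)) <= 4 * R~2 * N2 (%y. snd (Fi y))"
proof -
 have R0: "0 <= R" using R S_ne norm_ge_zero order_trans by blast
 have test: "N2 ph <= 4 * R~2 * N2 (cgrad ph)" if p: "test_fun S ph" for ph
 proof -
  have sm: "sm ph" "sm (fst :: real\<times>real => real)" using test_funD(1)[OF p] sm_inner[of "(1,0) :: real\<times>real"] by (auto simp: inner_prod_def)
  have cg1: "cgrad fst y = (1,0)" for y :: "real * real"
   by (rule cgrad_unique) (auto intro!: derivative_eq_intros simp: inner_prod_def)
  have o: "ph y = 0" "cgrad ph y = 0" if "y \<notin> S" for y using tpair_outside[OF p that] by (auto simp: tpair_def zero_prod_def)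
  let ?f = "%y. fst y * (ph y * ph y)"
  have "(LI y. cgrad ?f y @. (1,0)) = 0"
   by (rule integral_deriv_compact_support[OF sm_has_cgrad sm_cgrad_continuous test_funD(2)[OF p]])
    (use sm test_funD(4)[OF p] in \<open>auto intro!: sm_mult\<close>)
  also have "(%y. cgrad ?f y @. (1,0)) = (%y. (norm (ph y))~2 + 2 * (fst y * ph y * fst (cgrad ph y)))"
   using sm by (auto simp: cgrad_mult sm_mult cg1 inner_add_left fun_eq_iff power2_eq_square inner_prod_def algebra_simps)
  finally have z: "(LI y. (norm (ph y))~2 + 2 * (fst y * ph y * fst (cgrad ph y))) = 0" .
  have eqi: "(LI y. (norm (ph y))~2 + 2 * (fst y * ph y * fst (cgrad ph y))) = N2 ph + 2 * (LI y. fst y * ph y * fst (cgrad ph y))"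
   and b: "||\<integral>y. fst y * ph y * fst (cgrad ph y) \<partial>lborel|| <= R * (sqrt (N2 ph) * sqrt (N2 (cgrad ph)))"
  proof -
   note [measurable] = sm_borel[OF sm(1)] sm_cgrad_borel[OF sm(1)]
   have ae: "AL y. ||fst y * ph y * fst (cgrad ph y)|| <= R * (norm (ph y) * norm (cgrad ph y))"
   proof (rule AE_I2)
    fix y :: "real * real"
    show "||fst y * ph y * fst (cgrad ph y)|| <= R * (norm (ph y) * norm (cgrad ph y))"
    proof (cases "y \<in> S")
     case True
     have "||fst y|| <= R" "||fst (cgrad ph y)|| <= norm (cgrad ph y)"
      using R[OF True] norm_fst_le[of "fst y" "snd y"] norm_fst_le[of "fst (cgrad ph y)" "snd (cgrad ph y)"] by auto
     then have "||fst y|| * ( ||ph y|| * ||fst (cgrad ph y)||) <= R * (norm (ph y) * norm (cgrad ph y))" using R0 by (intro mult_mono) auto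
     then show ?thesis by (simp add: abs_mult mult.assoc)
    qed (simp add: o)
   qed
   note c = CS_bound[OF sqi_test(1)[OF p] sqi_test(2)[OF p] _ ae R0]
   show "||\<integral>y. fst y * ph y * fst (cgrad ph y) \<partial>lborel|| <= R * (sqrt (N2 ph) * sqrt (N2 (cgrad ph)))" by (rule c(2)) measurable
   have "intb (%y. fst y * ph y * fst (cgrad ph y))" by (rule c(1)) measurable
   then show "(LI y. (norm (ph y))~2 + 2 * (fst y * ph y * fst (cgrad ph y))) = N2 ph + 2 * (LI y. fst y * ph y * fst (cgrad ph y))"
    using sqi_integrable[OF sqi_test(1)[OF p]] by (simp add: N2_def)
  qed
  have n: "N2 ph <= 2 * (R * (sqrt (N2 ph) * sqrt (N2 (cgrad ph))))" using b z eqi by linarith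
  define A B where "A = sqrt (N2 ph)" and "B = sqrt (N2 (cgrad ph))"
  have AB: "A >= 0" "B >= 0" "N2 ph = A~2" "N2 (cgrad ph) = B~2" by (auto simp: A_def B_def)
  have "A * A <= A * (2 * R * B)" using n AB(1) unfolding A_def[symmetric] B_def[symmetric] AB(3) by (simp add: power2_eq_square algebra_simps)
  then have "A <= 2 * R * B" using AB R0 by (cases "A = 0") auto
  then have "A~2 <= (2 * R * B)~2" using AB(1) by (rule power_mono)
  then show ?thesis using AB by (simp add: power_mult_distrib)
 qed
 obtain f where f: "!!n. test_fun S (f n)" "l2lim (%n. tpair (f n)) Fi" using W unfolding W_def by blast
 have l1: "l2lim (%n x. f n x) (%x. fst (Fi x))" using l2lim_fst[OF f(2)] by (simp add: tpair_def)
 have l2: "l2lim (%n x. cgrad (f n) x) (%x. snd (Fi x))" using l2lim_snd[OF f(2)] by (simp add: tpair_def)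
 show ?thesis
 proof (rule LIMSEQ_le[OF l2lim_N2[OF l1]])
  show "(%n. 4 * R~2 * N2 (cgrad (f n))) ~~> 4 * R~2 * N2 (%x. snd (Fi x))" by (intro tendsto_intros l2lim_N2[OF l2])
 qed (use test[OF f(1)] in auto)
qed

lemma lam0_pos: "0 < lam0"
proof -
 obtain R where R: "!!y. y \<in> S ==> norm y <= R" using S_bounded by (auto simp: bounded_iff)
 have "1 <= 4 * R~2 * lam0" using poincare_width[OF W0 R] nrm N2_p0 by (simp add: p0_def[abs_def])
 then have "0 < 4 * R~2 * lam0" by linarith
 then show ?thesis by (simp add: zero_less_mult_iff)
qed

text \<open>Formally the eigenvalue equation is tested with ph^2/u0. As u0 is only in H^1_0 and has
  no positive lower bound, 1/t is replaced by a smooth function with bounded derivative. The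
  regularised identity is exact; Fatou's lemma in the limit d -> 0 leaves an inequality.\<close>

lemma picone_test:
 assumes p: "test_fun S ph"
 shows "sqi (%y. cgrad ph y - (ph y / u0 y) *R p0 y)" "N2 (%y. cgrad ph y - (ph y / u0 y) *R p0 y) <= N2 (cgrad ph) - lam0 * N2 ph"
proof -
 have sm: "sm ph" using test_funD(1)[OF p] .
 note [measurable] = sm_borel[OF sm] sm_cgrad_borel[OF sm]
 have o: "ph y = 0" "cgrad ph y = 0" "u0 y = 0" "p0 y = 0" if "y \<notin> S" for y
  using tpair_outside[OF p that] out[OF that] by (auto simp: tpair_def zero_prod_def u0_def p0_def)
 obtain C where C: "0 <= C" "!!x. norm (ph x) <= C"
  using compact_support_bounded[OF sm_continuous[OF sm] test_funD(2)[OF p] test_funD(4)[OF p]] by auto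
 \<comment> \<open>G d t equals 2/(q + t), a regularisation of 1/t that the form 2(q - t)/d shows to
   be smooth on the whole line. It is chosen for G' = -G/q: with A = G q, hence G^2/A = G/q, the
   tested density is exactly A |grad ph|^2 minus the square of X below.\<close>
 define q where "q d t = sqrt (t~2 + d)" for d t :: real
 define G where "G d t = 2 * (q d t - t) / d" for d t :: real
 define A where "A d t = G d t * q d t" for d t :: real
 have qpos: "q d t > 0" "q d t > ||t||" "(q d t)~2 = t~2 + d" if "d > 0" for d t
 proof -
  have "t~2 + d > 0" using that by (simp add: add_nonneg_pos)
  then show "q d t > 0" "(q d t)~2 = t~2 + d" by (auto simp: q_def)
  have "sqrt (t~2) < q d t" unfolding q_def using that by (intro real_sqrt_less_mono) simp
  then show "q d t > ||t||" by simp
 qed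
 have Gpos: "G d t > 0" if "d > 0" for d t unfolding G_def using qpos(2)[OF that, of t] that by simp
 have G2: "G d t = 2 / (q d t + t)" if "d > 0" for d t
 proof -
  have nz: "q d t + t > 0" using qpos(2)[OF that, of t] by linarith
  have "(q d t - t) * (q d t + t) = d" using qpos(3)[OF that, of t] by (simp add: power2_eq_square algebra_simps)
  then have "q d t - t = d / (q d t + t)" using nz by (simp add: field_simps)
  then show ?thesis unfolding G_def using that by simp
 qed
 have Ab: "1 <= A d t" "A d t <= 2" if "d > 0" "t >= 0" for d t
  using qpos[OF that(1), of t] that(2) unfolding A_def G2[OF that(1)] by (auto simp: field_simps)
 have sG: "sm (G d)" if "d > 0" for d
 proof -
  have "sm (%t. (2/d) * (sqrt (t~2 + d) + (-1) * t))" by (intro sm_mult sm_const sm_add sm_sqrt sm_id that)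
  then show ?thesis by (simp add: G_def[abs_def] q_def)
 qed
 have dG: "(G d has_real_derivative - G d t / q d t) (at t)" if "d > 0" for d t
 proof -
  have "t~2 + d > 0" using that by (simp add: add_nonneg_pos)
  then have "((%t. 2 * (sqrt (t~2 + d) - t) / d) has_real_derivative 2 * (t / sqrt (t~2+d) - 1) / d) (at t)"
   using that by (auto intro!: derivative_eq_intros simp: field_simps)
  moreover have "2 * (t / sqrt (t~2+d) - 1) / d = - G d t / q d t"
   using qpos(1)[OF that, of t] that unfolding G_def q_def[symmetric] by (simp add: field_simps)
  ultimately show ?thesis unfolding G_def[abs_def] q_def by simp
 qed
 have dGb: "||- G d t / q d t|| <= 4 / d" if "d > 0" for d t
 proof -
  have "||- G d t / q d t|| = 2 * (q d t - t) / q d t / d" using Gpos[OF that, of t] qpos[OF that, of t] that by (simp add: G_def field_simps)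
  also have "... <= 4 / d" using qpos[OF that, of t] that by (intro divide_right_mono) (auto simp: field_simps)
  finally show ?thesis .
 qed
 have cq: "continuous_on UNIV (q d)" "continuous_on UNIV (G d)" for d unfolding q_def G_def divide_inverse by (intro continuous_intros)+
 have [measurable]: "q d \<in> bm" "G d \<in> bm" "A d \<in> bm" for d
  unfolding A_def[abs_def] by (intro borel_measurable_continuous_onI cq borel_measurable_times)+
 have Gub: "G d (u0 y) <= 2 / sqrt d" if "d > 0" for d y
 proof -
  have "sqrt d <= q d (u0 y)" unfolding q_def by (rule real_sqrt_le_mono) simp
  then have "sqrt d <= q d (u0 y) + u0 y" using u0_nonneg[of y] by linarith
  then show ?thesis unfolding G2[OF that] using that by (intro divide_left_mono) (auto intro!: mult_pos_pos add_pos_nonneg u0_nonneg qpos(1))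
 qed
 define X where "X d y = sqrt (A d (u0 y)) *R cgrad ph y - (ph y * G d (u0 y) / sqrt (A d (u0 y))) *R p0 y" for d y
 have Xm[measurable]: "X d \<in> bm" for d unfolding X_def by measurable
 have X: "sqi (X d)" "N2 (X d) = (LI y. A d (u0 y) * (norm (cgrad ph y))~2) - lam0 * (LI y. (u0 y * G d (u0 y)) * (norm (ph y))~2)" if d: "d > 0" for d
 proof -
  have aA: "1 <= A d (u0 y)" "A d (u0 y) <= 2" for y using Ab[OF d u0_nonneg] by auto
  have test2: "test_fun S (%y. ph y * ph y)" by (rule test_fun_mult[OF p sm])
  have cont: "continuous_on UNIV (%t. - G d t / q d t)" using qpos(1)[OF d] by (intro continuous_intros cq) (auto simp: less_imp_neq[symmetric])
  note Wc = W_comp[OF W0 sG[OF d] dG[OF d] dGb[OF d] test2 cont]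
  have w: "(LI y. p0 y @. (G d (u0 y) *R cgrad (%y. ph y * ph y) y + (ph y * ph y * (- G d (u0 y) / q d (u0 y))) *R p0 y))
    = lam0 * (LI y. u0 y * (ph y * ph y * G d (u0 y)))"
   using weak[OF Wc] by (simp add: p0_def u0_def)
  have e: "p0 y @. (G d (u0 y) *R cgrad (%y. ph y * ph y) y + (ph y * ph y * (- G d (u0 y) / q d (u0 y))) *R p0 y)
   = A d (u0 y) * (norm (cgrad ph y))~2 - (norm (X d y))~2" for y
  proof -
   define a where "a = sqrt (A d (u0 y))"
   have a: "a > 0" "A d (u0 y) = a~2" using aA(1)[of y] by (auto simp: a_def)
   have G: "G d (u0 y) = a~2 / q d (u0 y)"
   proof -
    have "G d (u0 y) * q d (u0 y) = a~2" using a(2) unfolding A_def .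
    then show ?thesis using qpos(1)[OF d, of "u0 y"] nonzero_eq_divide_eq[of "q d (u0 y)"] by (metis less_irrefl)
   qed
   have "(norm (X d y))~2 = a~2 * (norm (cgrad ph y))~2 - 2 * (ph y * G d (u0 y)) * (cgrad ph y @. p0 y) + (ph y)~2 * (G d (u0 y))~2 / a~2 * (p0 y @. p0 y)"
    unfolding X_def a_def[symmetric] norm_diff_scaled_sq[OF a(1)] by (simp add: power_mult_distrib)
   also have "(ph y)~2 * (G d (u0 y))~2 / a~2 = (ph y)~2 * (G d (u0 y) / q d (u0 y))"
    using a(1) qpos(1)[OF d, of "u0 y"] unfolding G by (simp add: power2_eq_square)
   finally show ?thesis unfolding a(2) using sm by (simp add: cgrad_mult inner_add_right inner_commute[of "p0 y" "cgrad ph y"] power2_eq_square algebra_simps)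
  qed
  have iA: "intb (%y. A d (u0 y) * (norm (cgrad ph y))~2)"
  proof (rule bi_bound[of _ "%y. 2 * (norm (cgrad ph y))~2"])
   show "AL y. norm (A d (u0 y) * (norm (cgrad ph y))~2) <= norm (2 * (norm (cgrad ph y))~2)"
    using aA by (intro AE_I2) (auto simp: abs_mult intro!: mult_right_mono order_trans[OF _ aA(2)] abs_of_nonneg[THEN eq_refl] order_trans[OF zero_le_one aA(1)])
  qed (use sqi_test(2)[OF p] in \<open>auto simp: sqi_def\<close>)
  show sX: "sqi (X d)"
  proof -
   have "sqi (%y. sqrt (A d (u0 y)) *R cgrad ph y)"
   proof (rule sqi_bound(1)[OF _ sqi_test(2)[OF p], of _ 2])
    have "sqrt (A d (u0 y)) <= 2" for y
    proof -
     have "sqrt (A d (u0 y)) <= sqrt 4" using aA(2)[of y] by (intro real_sqrt_le_mono) simp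
     then show ?thesis by simp
    qed
    then show "AL x. norm (sqrt (A d (u0 x)) *R cgrad ph x) <= 2 * norm (cgrad ph x)"
     using order_trans[OF zero_le_one aA(1)] by (intro AE_I2) (auto intro!: mult_right_mono)
   qed measurable
   moreover have "sqi (%y. (ph y * G d (u0 y) / sqrt (A d (u0 y))) *R p0 y)"
   proof (rule sqi_bound(1)[OF _ p0_sqi, of _ "C * (2 / sqrt d)"])
    show "AL y. norm ((ph y * G d (u0 y) / sqrt (A d (u0 y))) *R p0 y) <= C * (2 / sqrt d) * norm (p0 y)"
    proof (rule AE_I2)
     fix y
     have "||ph y * G d (u0 y) / sqrt (A d (u0 y))|| <= ||ph y|| * G d (u0 y)"
      using aA(1)[of y] Gpos[OF d, of "u0 y"] by (auto simp: abs_mult field_simps intro!: mult_left_mono mult_le_cancel_left1[THEN iffD2])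
     also have "... <= C * (2 / sqrt d)" using C Gub[OF d, of y] Gpos[OF d, of "u0 y"] by (intro mult_mono) auto
     finally show "norm ((ph y * G d (u0 y) / sqrt (A d (u0 y))) *R p0 y) <= C * (2 / sqrt d) * norm (p0 y)"
      unfolding norm_scaleR by (rule mult_right_mono) simp
    qed
   qed measurable
   ultimately show ?thesis unfolding X_def[abs_def] by (rule sqi_diff(1))
  qed
  have "(LI y. A d (u0 y) * (norm (cgrad ph y))~2 - (norm (X d y))~2) = (LI y. A d (u0 y) * (norm (cgrad ph y))~2) - N2 (X d)"
   unfolding N2_def using iA sX by (simp add: sqi_def)
  then show "N2 (X d) = (LI y. A d (u0 y) * (norm (cgrad ph y))~2) - lam0 * (LI y. (u0 y * G d (u0 y)) * (norm (ph y))~2)"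
   using w unfolding e by (simp add: power2_eq_square mult_ac)
 qed
 define d where "d n = 1 / real (Suc n)" for n
 have d: "d n > 0" for n by (simp add: d_def)
 have dl: "d ~~> 0" unfolding d_def by (rule LIMSEQ_inverse_real_of_nat[unfolded inverse_eq_divide])
 have ql: "(%n. q (d n) (u0 y)) ~~> u0 y" for y
 proof -
  have "(%n. sqrt ((u0 y)~2 + d n)) ~~> sqrt ((u0 y)~2 + 0)" by (intro tendsto_intros dl)
  then show ?thesis using u0_nonneg[of y] by (simp add: q_def)
 qed
 have Gl: "(%n. G (d n) (u0 y)) ~~> 1 / u0 y" and Al: "(%n. A (d n) (u0 y)) ~~> 1" if "y \<in> S" for y
 proof -
  have u: "u0 y > 0" using pos[OF that] by (simp add: u0_def)
  have "(%n. 2 / (q (d n) (u0 y) + u0 y)) ~~> 2 / (u0 y + u0 y)" using u by (intro tendsto_intros ql) auto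
  then show g: "(%n. G (d n) (u0 y)) ~~> 1 / u0 y" using G2[OF d] by simp
  have "(%n. G (d n) (u0 y) * q (d n) (u0 y)) ~~> 1 / u0 y * u0 y" by (intro tendsto_intros g ql)
  then show "(%n. A (d n) (u0 y)) ~~> 1" using u by (simp add: A_def)
 qed
 have aA: "1 <= A (d n) (u0 y)" "A (d n) (u0 y) <= 2" for n y using Ab[OF d u0_nonneg] by auto
 have L1: "(%n. \<integral>y. A (d n) (u0 y) * (norm (cgrad ph y))~2 \<partial>lborel) ~~> (LI y. (norm (cgrad ph y))~2)"
 proof (rule integral_dominated_convergence[where w="%y. 2 * (norm (cgrad ph y))~2"])
  show "AL y. (%n. A (d n) (u0 y) * (norm (cgrad ph y))~2) ~~> (norm (cgrad ph y))~2"
  proof (rule AE_I2)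
   fix y show "(%n. A (d n) (u0 y) * (norm (cgrad ph y))~2) ~~> (norm (cgrad ph y))~2"
    using tendsto_mult_right[OF Al, of y "(norm (cgrad ph y))~2"] o(2)[of y] by (cases "y \<in> S") auto
  qed
  show "AL y. norm (A (d n) (u0 y) * (norm (cgrad ph y))~2) <= 2 * (norm (cgrad ph y))~2" for n
   using aA(2)[of n] order_trans[OF zero_le_one aA(1)[of n]] by (intro AE_I2) (auto simp: abs_mult intro!: mult_right_mono)
 qed (use sqi_test(2)[OF p] in \<open>auto simp: sqi_def\<close>)
 have L2: "(%n. \<integral>y. (u0 y * G (d n) (u0 y)) * (norm (ph y))~2 \<partial>lborel) ~~> (LI y. (norm (ph y))~2)"
 proof (rule integral_dominated_convergence[where w="%y. (norm (ph y))~2"])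
  show "AL y. (%n. (u0 y * G (d n) (u0 y)) * (norm (ph y))~2) ~~> (norm (ph y))~2"
  proof (rule AE_I2)
   fix y show "(%n. (u0 y * G (d n) (u0 y)) * (norm (ph y))~2) ~~> (norm (ph y))~2"
   proof (cases "y \<in> S")
    case True
    then have "(%n. (u0 y * G (d n) (u0 y)) * (norm (ph y))~2) ~~> (u0 y * (1 / u0 y)) * (norm (ph y))~2" by (intro tendsto_intros Gl)
    then show ?thesis using pos[OF True] by (simp add: u0_def)
   qed (simp add: o)
  qed
  show "AL y. norm ((u0 y * G (d n) (u0 y)) * (norm (ph y))~2) <= (norm (ph y))~2" for n
  proof (rule AE_I2)
   fix y
   have "u0 y * G (d n) (u0 y) <= 1" unfolding G2[OF d] using qpos[OF d[of n], of "u0 y"] u0_nonneg[of y] by (simp add: field_simps)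
   then show "norm ((u0 y * G (d n) (u0 y)) * (norm (ph y))~2) <= (norm (ph y))~2"
    using Gpos[OF d[of n], of "u0 y"] u0_nonneg[of y] by (auto simp: abs_mult intro!: mult_left_le_one_le)
  qed
 qed (use sqi_test(1)[OF p] in \<open>auto simp: sqi_def\<close>)
 have XL: "AL y. (%n. X (d n) y) ~~> cgrad ph y - (ph y / u0 y) *R p0 y"
 proof (rule AE_I2)
  fix y show "(%n. X (d n) y) ~~> cgrad ph y - (ph y / u0 y) *R p0 y"
  proof (cases "y \<in> S")
   case True
   have "(%n. X (d n) y) ~~> sqrt 1 *R cgrad ph y - (ph y * (1 / u0 y) / sqrt 1) *R p0 y"
    unfolding X_def by (intro tendsto_intros Gl Al True) simp
   then show ?thesis by simp
  qed (simp add: X_def o)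
 qed
 have cl: "(%n. (LI y. A (d n) (u0 y) * (norm (cgrad ph y))~2) - lam0 * (LI y. (u0 y * G (d n) (u0 y)) * (norm (ph y))~2)) ~~> N2 (cgrad ph) - lam0 * N2 ph"
  unfolding N2_def by (intro tendsto_intros L1 L2)
 show "sqi (%y. cgrad ph y - (ph y / u0 y) *R p0 y)"
  by (rule l2_fatou(1)[OF X(1)[OF d] XL _ eq_refl[OF X(2)[OF d]] cl]) measurable
 show "N2 (%y. cgrad ph y - (ph y / u0 y) *R p0 y) <= N2 (cgrad ph) - lam0 * N2 ph"
  by (rule l2_fatou(2)[OF X(1)[OF d] XL _ eq_refl[OF X(2)[OF d]] cl]) measurable
qed

lemma picone:
 assumes W: "W S Fi"
 shows "sqi (%y. snd (Fi y) - (fst (Fi y) / u0 y) *R p0 y)"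
  "N2 (%y. snd (Fi y) - (fst (Fi y) / u0 y) *R p0 y) <= N2 (%y. snd (Fi y)) - lam0 * N2 (%y. fst (Fi y))"
proof -
 obtain f0 where f0: "!!n. test_fun S (f0 n)" "l2lim (%n. tpair (f0 n)) Fi" using W unfolding W_def by blast
 obtain r where r: "strict_mono r" "AL x. (%n. tpair (f0 (r n)) x) ~~> Fi x" using l2lim_AE_subseq[OF f0(2)] by auto
 define f where "f n = f0 (r n)" for n
 have f: "test_fun S (f n)" for n by (simp add: f_def f0)
 have fl: "l2lim (%n. tpair (f n)) Fi" unfolding f_def by (rule l2lim_subseq[OF f0(2) r(1)])
 have l1: "l2lim (%n x. f n x) (%x. fst (Fi x))" using l2lim_fst[OF fl] by (simp add: tpair_def)
 have l2: "l2lim (%n x. cgrad (f n) x) (%x. snd (Fi x))" using l2lim_snd[OF fl] by (simp add: tpair_def)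
 note [measurable] = W_borel[OF W]
 have XL: "AL y. (%n. cgrad (f n) y - (f n y / u0 y) *R p0 y) ~~> snd (Fi y) - (fst (Fi y) / u0 y) *R p0 y"
  using r(2) W_outside[OF W]
 proof eventually_elim
  case (elim y)
  have t: "(%n. f n y) ~~> fst (Fi y)" "(%n. cgrad (f n) y) ~~> snd (Fi y)"
   using tendsto_fst[OF elim(1)] tendsto_snd[OF elim(1)] by (simp_all add: f_def tpair_def)
  show ?case
  proof (cases "y \<in> S")
   case True
   show ?thesis using pos[OF True] by (intro tendsto_intros t) (auto simp: u0_def)
  next
   case False
   then have "u0 y = 0" using out by (simp add: u0_def)
   then show ?thesis using t by simp
  qed
 qed
 have cl: "(%n. N2 (cgrad (f n)) - lam0 * N2 (f n)) ~~> N2 (%y. snd (Fi y)) - lam0 * N2 (%y. fst (Fi y))"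
  by (intro tendsto_intros l2lim_N2 l1 l2)
 show "sqi (%y. snd (Fi y) - (fst (Fi y) / u0 y) *R p0 y)"
  by (rule l2_fatou(1)[OF picone_test(1)[OF f] XL _ picone_test(2)[OF f] cl]) measurable
 show "N2 (%y. snd (Fi y) - (fst (Fi y) / u0 y) *R p0 y) <= N2 (%y. snd (Fi y)) - lam0 * N2 (%y. fst (Fi y))"
  by (rule l2_fatou(2)[OF picone_test(1)[OF f] XL _ picone_test(2)[OF f] cl]) measurable
qed

end

section \<open>Simplicity of the lowest eigenvalue\<close>

text \<open>Overlapping neighbourhoods carry the same constant because a nonempty open set is not
  null. Connectedness makes the constant global, and a countable subcover collects the exceptional
  sets.\<close>

lemma connected_AE_const:
 fixes f :: "'a::euclidean_space => 'b"
 assumes S: "connected S" "S ~= {}"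
  and loc: "!!x. x \<in> S ==> \<exists>Q c. open Q & x \<in> Q & Q \<subseteq> S & (AL y. y \<in> Q --> f y = c)"
 shows "\<exists>c. AL y. y \<in> S --> f y = c"
proof -
 obtain Q C where Q: "!!x. x \<in> S ==> open (Q x)" "!!x. x \<in> S ==> x \<in> Q x" "!!x. x \<in> S ==> Q x \<subseteq> S"
  "!!x. x \<in> S ==> AL y. y \<in> Q x --> f y = C x" using loc by metis
 have eqC: "C x = C z" if xz: "x \<in> S" "z \<in> S" "z \<in> Q x" for x z
 proof (rule ccontr)
  assume n: "C x ~= C z"
  have "AL y. y \<in> - (Q x \<inter> Q z)" using Q(4)[OF xz(1)] Q(4)[OF xz(2)] by eventually_elim (use n in auto)
  then have "AE y in lebesgue. y \<in> - (Q x \<inter> Q z)" by (rule AE_completion)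
  then have "z \<in> - (Q x \<inter> Q z)" by (rule mem_closed_if_AE_lebesgue[rotated]) (use Q(1) xz in auto)
  then show False using xz Q(2) by auto
 qed
 have const: "C x = C z" if "x \<in> S" "z \<in> S" for x z
 proof (rule connected_local_const[OF S(1) that], rule ballI)
  fix a assume a: "a \<in> S"
  show "\<forall>\<^sub>F b in at a within S. C a = C b"
   unfolding eventually_at_topological using Q(1,2)[OF a] eqC[OF a] by auto
 qed
 obtain x0 where x0: "x0 \<in> S" using S by auto
 obtain \<D> where D: "\<D> \<subseteq> Q ` S" "countable \<D>" "\<Union>\<D> = \<Union>(Q ` S)"
  by (rule Lindelof[of "Q ` S"]) (use Q in auto)
 have "AL y. \<forall>X\<in>\<D>. y \<in> X --> f y = C x0"
 proof (subst AE_ball_countable[OF D(2)], rule ballI)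
  fix X assume "X \<in> \<D>"
  then obtain x where x: "x \<in> S" "X = Q x" using D(1) by auto
  then show "AL y. y \<in> X --> f y = C x0" using Q(4)[OF x(1)] const[OF x(1) x0] by simp
 qed
 then have "AL y. y \<in> S --> f y = C x0"
 proof eventually_elim
  case (elim y)
  show ?case using elim D(3) Q(2) by blast
 qed
 then show ?thesis by blast
qed

lemma abs_times_le: fixes a k :: real assumes "0 <= k" shows "||a|| * k <= k~2 + a~2"
proof -
 have "0 <= ( ||a|| - k)~2" by simp
 also have "... = a~2 + k~2 - 2 * ( ||a|| * k)" by (simp add: power2_diff)
 finally have "2 * ( ||a|| * k) <= a~2 + k~2" by simp
 moreover have "0 <= ||a|| * k" using assms by simp
 ultimately show ?thesis by linarith
qed

text \<open>\<open>ca\<close> and the negative of \<open>cb\<close> are the partial derivatives in a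
  and b of arctan(a / sqrt(b^2 + d)).\<close>

definition ca :: "real => real => real => real" where "ca d a b = sqrt (b~2 + d) / (b~2 + d + a~2)"
definition cb :: "real => real => real => real" where "cb d a b = a * b / (sqrt (b~2 + d) * (b~2 + d + a~2))"

lemma ca_cb_pos:
 fixes a b :: real
 assumes "d > 0" shows "sqrt (b~2 + d) > 0" "b~2 + d + a~2 > 0"
proof -
 have p: "b~2 + d > 0" using assms by (rule add_nonneg_pos[OF zero_le_power2])
 then show "sqrt (b~2 + d) > 0" by simp
 show "b~2 + d + a~2 > 0" using p zero_le_power2 by (rule add_pos_nonneg)
qed

lemma ca_cb_bound:
 assumes d: "d > 0"
 shows "||ca d a b|| <= 1 / sqrt d" "||cb d a b|| <= 1 / sqrt d"
proof -
 define k where "k = sqrt (b~2 + d)"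
 have k: "k > 0" "k~2 = b~2 + d" "||b|| <= k" "sqrt d <= k"
  using ca_cb_pos(1)[OF d] d real_sqrt_le_mono[of "b~2" "b~2 + d"] real_sqrt_le_mono[of d "b~2+d"] by (auto simp: k_def)
 have K: "k~2 + a~2 > 0" using k(1) by (simp add: add_pos_nonneg)
 have kd: "1 / k <= 1 / sqrt d" using k d by (intro divide_left_mono) auto
 have "ca d a b = k / (k~2 + a~2)" by (simp add: ca_def k_def[symmetric] k(2))
 also have "... <= 1 / k" using k(1) K by (simp add: field_simps power2_eq_square)
 finally show "||ca d a b|| <= 1 / sqrt d" using kd K k(1) k(2) by (simp add: ca_def k_def[symmetric])
 have ak: "||a|| * k <= k~2 + a~2"
  by (rule abs_times_le) (use k in simp)
 have "||cb d a b|| = ||a|| * ||b|| / (k * (k~2 + a~2))" using K k(1) by (simp add: cb_def k_def[symmetric] k(2)[symmetric] abs_mult)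
 also have "... <= ||a|| * k / (k * (k~2 + a~2))" using K k by (intro divide_right_mono mult_left_mono) auto
 also have "... = ||a|| * k / (k~2 + a~2) * (1 / k)" using k(1) by simp
 also have "... <= 1 * (1 / k)" using ak K k(1) by (intro mult_right_mono) (auto simp: field_simps)
 finally show "||cb d a b|| <= 1 / sqrt d" using kd by simp
qed

lemma arctan_quotient_derivative:
 assumes d: "d > 0" and f: "(f has_derivative (%h. f' @. h)) (at x)" and g: "(g has_derivative (%h. g' @. h)) (at x)"
 shows "((%x. arctan (f x / sqrt ((g x)~2 + d))) has_derivative (%h. (ca d (f x) (g x) *R f' - cb d (f x) (g x) *R g') @. h)) (at x)"
proof -
 define k where "k = sqrt ((g x)~2 + d)"
 have k: "k > 0" "k~2 = (g x)~2 + d" using ca_cb_pos(1)[OF d] d by (auto simp: k_def)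
 have p: "(g x)~2 + d > 0" using d by (simp add: add_nonneg_pos)
 have "((%x. (g x)~2 + d) has_derivative (%h. 2 * g x * (g' @. h))) (at x)"
  using has_derivative_add[OF has_derivative_power[OF g, of 2] has_derivative_const[of d]]
  by (rule has_derivative_eq_rhs) (auto simp: fun_eq_iff)
 from DERIV_compose_FDERIV[OF DERIV_real_sqrt[OF p] this] have dk: "((%x. sqrt ((g x)~2 + d)) has_derivative (%h. g x * (g' @. h) / k)) (at x)"
  by (rule has_derivative_eq_rhs) (auto simp: k_def fun_eq_iff field_simps)
 have dq: "((%x. f x / sqrt ((g x)~2 + d)) has_derivative (%h. (f' @. h) / k - f x * (g x * (g' @. h) / k) / (k * k))) (at x)"
  using has_derivative_divide[OF f dk] k(1) unfolding k_def[symmetric] by (auto simp: field_simps)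
 have "((%x. arctan (f x / sqrt ((g x)~2 + d))) has_derivative (%h. inverse (1 + (f x / k)~2) * ((f' @. h) / k - f x * (g x * (g' @. h) / k) / (k * k)))) (at x)"
  using has_derivative_compose[OF dq DERIV_arctan[unfolded has_field_derivative_def]] unfolding k_def[symmetric] .
 moreover have "inverse (1 + (f x / k)~2) * ((f' @. h) / k - f x * (g x * (g' @. h) / k) / (k * k)) = (ca d (f x) (g x) *R f' - cb d (f x) (g x) *R g') @. h" for h
 proof -
  have K: "k~2 + (f x)~2 > 0" using k(1) by (simp add: add_pos_nonneg)
  have i: "inverse (1 + (f x / k)~2) = k~2 / (k~2 + (f x)~2)" using k(1) K by (simp add: field_simps)
  have sk: "sqrt ((g x)~2 + d) = k" by (simp add: k_def)
  have cca: "ca d (f x) (g x) = k / (k~2 + (f x)~2)" "cb d (f x) (g x) = f x * g x / (k * (k~2 + (f x)~2))"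
   by (simp_all only: ca_def cb_def sk k(2))
  have 1: "inverse (1 + (f x / k)~2) * (1 / k) = ca d (f x) (g x)" unfolding i cca using k(1) by (simp add: power2_eq_square)
  have 2: "inverse (1 + (f x / k)~2) * (f x * g x / (k * (k * k))) = cb d (f x) (g x)" unfolding i cca using k(1) by (simp add: power2_eq_square)
  have "inverse (1 + (f x / k)~2) * ((f' @. h) / k - f x * (g x * (g' @. h) / k) / (k * k)) =
   inverse (1 + (f x / k)~2) * (1 / k) * (f' @. h) - inverse (1 + (f x / k)~2) * (f x * g x / (k * (k * k))) * (g' @. h)"
   by (simp add: right_diff_distrib mult_ac)
  then show ?thesis unfolding 1 2 by (simp add: inner_diff_left)
 qed
 ultimately show ?thesis by simp
qed

lemma indicator_bounded_int:
 fixes X :: "nat => 'a::euclidean_space => real"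
 assumes [measurable]: "!!n. X n \<in> bm" "f \<in> bm" "Q \<in> sets borel" and Q: "bounded Q"
  and b: "!!n x. ||X n x|| <= C" and l: "AL x. x \<in> Q --> (%n. X n x) ~~> f x"
 shows "(%n. \<integral>x. indicator Q x * X n x \<partial>lborel) ~~> (LI x. indicator Q x * f x)"
proof (rule integral_dominated_convergence[where w="%x. indicator Q x * C"])
 show "intb (%x. indicator Q x * C)" by (rule integrable_bounded_set) (use Q in auto)
 show "AL x. (%n. indicator Q x * X n x) ~~> indicator Q x * f x" using l
  by eventually_elim (auto simp: indicator_def)
 show "AL x. norm (indicator Q x * X n x) <= indicator Q x * C" for n using b by (intro AE_I2) (auto simp: indicator_def)
qed measurable

lemma variance_zero_AE_const:
 fixes f :: "'a::euclidean_space => real"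
 assumes [measurable]: "f \<in> bm" "Q \<in> sets borel" and Q: "bounded Q" and b: "!!x. ||f x|| <= C"
  and v: "measure lborel Q * (LI x. indicator Q x * (f x)~2) - (LI x. indicator Q x * f x)~2 <= 0"
 shows "\<exists>c. AL x. x \<in> Q --> f x = c"
proof -
 define m where "m = measure lborel Q"
 define A where "A = (LI x. indicator Q x * (f x)~2)"
 define B where "B = (LI x. indicator Q x * f x)"
 have fin: "emeasure lborel Q < \<infinity>" using Q by (rule emeasure_bounded_finite)
 have i: "intb (%x. indicator Q x * g x)" if [measurable]: "g \<in> bm" and g: "!!x. ||g x|| <= D" for g :: "'a => real" and D
 proof (rule bi_bound[where f="%x. indicator Q x * D"])
  show "intb (%x. indicator Q x * D)" by (rule integrable_bounded_set) (use Q in auto)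
  show "AL x. norm (indicator Q x * g x) <= norm (indicator Q x * D)" using g order_trans[OF g abs_ge_self] by (intro AE_I2) (auto simp: indicator_def)
 qed measurable
 have i1: "intb (%x. indicator Q x * (f x)~2)"
  by (rule i[where D="C~2"]) (auto intro: power_mono[OF b, of _ 2, simplified])
 have i2: "intb (%x. indicator Q x * f x)" by (rule i[OF _ b]) measurable
 have i3: "intb (%x. indicator Q x * 1 :: real)" by (rule i[where D=1]) auto
 show ?thesis
 proof (cases "m = 0")
  case True
  then have "emeasure lborel Q = 0" using fin by (simp add: m_def measure_eq_0_null_sets emeasure_eq_ennreal_measure)
  then have "Q \<in> null_sets lborel" by auto
  then have "AL x. x \<notin> Q" by (rule AE_not_in)
  then show ?thesis by (auto elim: eventually_mono)
 next
  case False
  then have m: "m > 0" by (simp add: m_def less_le)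
  have "(LI x. indicator Q x * (f x - B / m)~2) = A - 2 * (B/m) * B + (B/m)~2 * m"
  proof -
   have e: "indicator Q x * (f x - B / m)~2 = indicator Q x * (f x)~2 - 2 * (B/m) * (indicator Q x * f x) + (B/m)~2 * (indicator Q x * 1)" for x
    by (simp add: power2_diff algebra_simps)
   show ?thesis unfolding e using i1 i2 i3 by (simp add: A_def[symmetric] B_def[symmetric] m_def[symmetric])
  qed
  also have "... = (m * A - B~2) / m" using m by (simp add: field_simps power2_eq_square)
  also have "... <= 0" using v m unfolding A_def[symmetric] B_def[symmetric] m_def[symmetric] by (simp add: divide_nonpos_pos)
  finally have le: "(LI x. indicator Q x * (f x - B / m)~2) <= 0" .
  have "||f x - B/m|| <= C + ||B/m||" for x using b[of x] by linarith
  then have sq: "||(f x - B/m)~2|| <= (C + ||B/m||)~2" for x using power_mono[of "||f x - B/m||" _ 2] by simp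
  have "intb (%x. indicator Q x * (f x - B / m)~2)" by (rule i[OF _ sq]) measurable
  moreover have "(LI x. indicator Q x * (f x - B / m)~2) = 0" using le by (intro antisym) auto
  ultimately have "AL x. indicator Q x * (f x - B / m)~2 = 0" by (subst (asm) integral_nonneg_eq_0_iff_AE) auto
  then show ?thesis by (intro exI[of _ "B/m"]) (auto elim!: eventually_mono simp: indicator_def split: if_splits)
 qed
qed

context cross_section
begin

text \<open>Equality in Picone's inequality says that v/u0 has zero gradient, but this quotient is
  not known to lie in a Sobolev space. The bounded function arctan(v / sqrt(u0^2 + d)) replaces it:
  its gradient is at most d/(u0^2 + d) times |grad u0|/u0, so Poincare on the box gives zero
  variance as d -> 0. The boxes are nested because a bump living on the outer one must be bounded
  below on the inner one.\<close>

lemma kernel_box: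
 assumes W: "W S Fi" and g: "AL y. snd (Fi y) = (fst (Fi y) / u0 y) *R p0 y"
  and ab: "cbox a b \<subseteq> S" and ab': "cbox a' b' \<subseteq> box a b"
 shows "\<exists>c. AL y. y \<in> box a' b' --> fst (Fi y) / u0 y = c"
proof -
 define Q where "Q = box a' b'"
 have Q: "convex Q" "bounded Q" "Q \<in> sets borel" "Q \<subseteq> S" "Q \<subseteq> cbox a' b'" unfolding Q_def using box_subset_cbox[of a' b'] box_subset_cbox[of a b] ab ab' by (auto simp: convex_box)
 note [measurable] = Q(3)
 obtain D where D: "!!x. x \<in> Q ==> norm x <= D" using Q(2) by (auto simp: bounded_iff)
 have D2: "norm (x - y) <= 2 * ||D||" if "x \<in> Q" "y \<in> Q" for x y using D[OF that(1)] D[OF that(2)] norm_triangle_ineq4[of x y] by linarith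
 define Cq where "Cq = (2 * ||D||)~2 * measure lborel (cball (0::real\<times>real) (2 * ||D||)) / 2"
 define v where "v y = fst (Fi y)" for y
 have vm[measurable]: "v \<in> bm" and sv: "sqi v" using W_sqi(2)[OF W] by (auto simp: v_def[abs_def] sqi_def)
 define pu where "pu y = indicator Q y *R ((1 / u0 y) *R p0 y)" for y
 have pum[measurable]: "pu \<in> bm" unfolding pu_def by measurable
 \<comment> \<open>The logarithmic gradient of u0 is locally square integrable: Picone's inequality
   for a bump z controls (z/u0) grad u0, and z is bounded below on Q. A pointwise lower bound on u0
   is thereby avoided.\<close>
 have spu: "sqi pu"
 proof -
  define z where "z = boxbump a b 1"
  have tz: "test_fun S z" unfolding z_def by (rule test_fun_boxbump[OF ab])
  note [measurable] = sm_borel[OF test_funD(1)[OF tz]]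
  have "sqi (%y. cgrad z y - (cgrad z y - (z y / u0 y) *R p0 y))" by (intro sqi_diff(1) sqi_test(2)[OF tz] picone_test(1)[OF tz])
  then have sz: "sqi (%y. (z y / u0 y) *R p0 y)" by simp
  have "\<exists>c>0. \<forall>y\<in>cbox a' b'. c <= z y"
  proof (cases "cbox a' b' = {}")
   case False
   have "continuous_on (cbox a' b') z" using sm_continuous[OF test_funD(1)[OF tz]] .
   then obtain x where x: "x \<in> cbox a' b'" "!!y. y \<in> cbox a' b' ==> z x <= z y" using continuous_attains_inf[OF compact_cbox False] by metis
   moreover have "z x > 0" unfolding z_def by (rule boxbump_pos) (use ab' x in auto)
   ultimately show ?thesis by blast
  qed (auto intro!: exI[of _ 1])
  then obtain c where c: "c > 0" "!!y. y \<in> cbox a' b' ==> c <= z y" by auto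
  show ?thesis
  proof (rule sqi_bound(1)[OF pum sz, of "1/c"])
   show "AL y. norm (pu y) <= 1 / c * norm ((z y / u0 y) *R p0 y)"
   proof (rule AE_I2)
    fix y show "norm (pu y) <= 1 / c * norm ((z y / u0 y) *R p0 y)"
    proof (cases "y \<in> Q")
     case True
     then have "c <= z y" using c(2)[of y] Q(5) by blast
     then have "norm ((1 / u0 y) *R p0 y) * 1 <= norm ((1 / u0 y) *R p0 y) * (z y / c)" using c(1) by (intro mult_left_mono) auto
     then show ?thesis using True \<open>c <= z y\<close> c(1) by (simp add: pu_def mult_ac)
    qed (use c in \<open>simp add: pu_def\<close>)
   qed
  qed
 qed
 define fd where "fd d y = arctan (v y / sqrt ((u0 y)~2 + d))" for d y
 have fdm[measurable]: "fd d \<in> bm" for d unfolding fd_def by measurable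
 have at: "||arctan t|| <= 2" for t using arctan_bounded[of t] pi_less_4 by linarith
 define gd where "gd d y = (d / ((u0 y)~2 + d)) *R pu y" for d y
 have gdm[measurable]: "gd d \<in> bm" for d unfolding gd_def by measurable
 have gdb: "norm (gd d y) <= norm (pu y)" if "d > 0" for d y
 proof -
  have p: "(u0 y)~2 + d > 0" using that by (rule add_nonneg_pos[OF zero_le_power2])
  then have "d / ((u0 y)~2 + d) <= 1" by (simp add: divide_le_eq_1_pos)
  then show ?thesis unfolding gd_def norm_scaleR by (intro mult_left_le_one_le) (use that p in auto)
 qed
 obtain f0 where f0: "!!n. test_fun S (f0 n)" "l2lim (%n. tpair (f0 n)) Fi" using W unfolding W_def by blast
 obtain r1 where r1: "strict_mono r1" "AL x. (%n. tpair (f0 (r1 n)) x) ~~> Fi x" using l2lim_AE_subseq[OF f0(2)] by auto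
 obtain e0 where e0: "!!n. test_fun S (e0 n)" "l2lim (%n. tpair (e0 n)) mu0" using W0 unfolding W_def by blast
 obtain r2 where r2: "strict_mono r2" "AL x. (%n. tpair (e0 (r2 n)) x) ~~> mu0 x" using l2lim_AE_subseq[OF e0(2)] by auto
 define f e where "f n = f0 (r1 n)" and "e n = e0 (r2 n)" for n
 have sm: "sm (f n)" "sm (e n)" for n using test_funD(1)[OF f0(1)] test_funD(1)[OF e0(1)] by (auto simp: f_def e_def)
 have fl: "l2lim (%n. tpair (f n)) Fi" "l2lim (%n. tpair (e n)) mu0" unfolding f_def e_def by (rule l2lim_subseq[OF f0(2) r1(1)] l2lim_subseq[OF e0(2) r2(1)])+
 have l2: "l2lim (%n x. cgrad (f n) x) (%x. snd (Fi x))" "l2lim (%n x. cgrad (e n) x) p0" using l2lim_snd[OF fl(1)] l2lim_snd[OF fl(2)] by (simp_all add: tpair_def p0_def[abs_def])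
 have conv: "AL y. (%n. f n y) ~~> v y & (%n. e n y) ~~> u0 y" using r1(2) r2(2)
 proof eventually_elim
  case (elim y)
  show ?case using tendsto_fst[OF elim(1)] tendsto_fst[OF elim(2)] by (simp add: tpair_def f_def e_def v_def u0_def)
 qed
 have fem[measurable]: "f n \<in> bm" "e n \<in> bm" for n using sm sm_borel by auto
 \<comment> \<open>For fixed d, Poincare is applied to F n, built from test functions approximating
   v and u0; the coefficients \<open>ca\<close> and \<open>cb\<close> are bounded by 1/sqrt d, so
   both sides pass to the limit in n.\<close>
 have step: "measure lborel Q * (LI y. indicator Q y * (fd d y)~2) - (LI y. indicator Q y * fd d y)~2 <= Cq * N2 (gd d)" if d: "d > 0" for d
 proof -
  define F where "F n y = arctan (f n y / sqrt ((e n y)~2 + d))" for n y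
  define GF where "GF n y = ca d (f n y) (e n y) *R cgrad (f n) y - cb d (f n y) (e n y) *R cgrad (e n) y" for n y
  have Fm[measurable]: "F n \<in> bm" for n unfolding F_def by measurable
  have cont_c: "continuous_on UNIV (%y. ca d (f n y) (e n y))" "continuous_on UNIV (%y. cb d (f n y) (e n y))" for n
   unfolding ca_def cb_def using ca_cb_pos[OF d] by (auto intro!: continuous_intros sm_continuous[OF sm(1)] sm_continuous[OF sm(2)] simp: less_imp_neq[THEN not_sym])
  have der: "(F n has_derivative (%h. GF n y @. h)) (at y)" for n y
   unfolding F_def[abs_def] GF_def by (rule arctan_quotient_derivative[OF d sm_has_cgrad[OF sm(1)] sm_has_cgrad[OF sm(2)]])
  have cG: "continuous_on UNIV (GF n)" for n unfolding GF_def by (intro continuous_intros cont_c sm_cgrad_continuous sm)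
  have GFm[measurable]: "GF n \<in> bm" for n using cG by (rule borel_measurable_continuous_onI)
  have pc: "measure lborel Q * (LI y. indicator Q y * (F n y)~2) - (LI y. indicator Q y * F n y)~2 <= Cq * (LI y. indicator Q y * (norm (GF n y))~2)" for n
   unfolding Cq_def by (rule poincare_convex[OF der cG Q(1,2,3) D2]) auto
  have Fl: "AL y. y \<in> Q --> (%n. F n y) ~~> fd d y" using conv
  proof eventually_elim
   case (elim y)
   show ?case unfolding F_def fd_def using ca_cb_pos(1)[OF d, of "u0 y"] elim by (intro impI tendsto_intros) auto
  qed
  have t1: "(%n. \<integral>y. indicator Q y * F n y \<partial>lborel) ~~> (LI y. indicator Q y * fd d y)"
   by (rule indicator_bounded_int[where C=2]) (use Q Fl at in \<open>auto simp: F_def\<close>)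
  have t2: "(%n. \<integral>y. indicator Q y * (F n y)~2 \<partial>lborel) ~~> (LI y. indicator Q y * (fd d y)~2)"
  proof (rule indicator_bounded_int[where C="2~2"])
   show "||(F n y)~2|| <= 2~2" for n y using power_mono[OF at, of "f n y / sqrt ((e n y)~2 + d)" 2] by (simp add: F_def)
   show "AL y. y \<in> Q --> (%n. (F n y)~2) ~~> (fd d y)~2" using Fl by eventually_elim (auto intro: tendsto_intros)
  qed (use Q in auto)
  have lg: "l2lim (%n y. (indicator Q y * ca d (f n y) (e n y)) *R cgrad (f n) y - (indicator Q y * cb d (f n y) (e n y)) *R cgrad (e n) y)
    (%y. (indicator Q y * ca d (v y) (u0 y)) *R snd (Fi y) - (indicator Q y * cb d (v y) (u0 y)) *R p0 y)"
  proof (rule l2lim_diff; rule l2lim_coeff[where C="1 / sqrt d"])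
   show "||indicator Q y * ca d (f n y) (e n y)|| <= 1 / sqrt d" "||indicator Q y * cb d (f n y) (e n y)|| <= 1 / sqrt d" for n y
    using ca_cb_bound[OF d, of "f n y" "e n y"] d by (auto simp: indicator_def abs_mult)
   show "AL y. (%n. indicator Q y * ca d (f n y) (e n y)) ~~> indicator Q y * ca d (v y) (u0 y)" using conv
    by eventually_elim (unfold ca_def, use ca_cb_pos[OF d] in \<open>auto intro!: tendsto_intros simp: less_imp_neq[THEN not_sym]\<close>)
   show "AL y. (%n. indicator Q y * cb d (f n y) (e n y)) ~~> indicator Q y * cb d (v y) (u0 y)" using conv
    by eventually_elim (unfold cb_def, use ca_cb_pos[OF d] in \<open>auto intro!: tendsto_intros simp: less_imp_neq[THEN not_sym]\<close>)
  qed (use l2 in \<open>auto simp: ca_def cb_def\<close>)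
  let ?H = "%y. (indicator Q y * ca d (v y) (u0 y)) *R snd (Fi y) - (indicator Q y * cb d (v y) (u0 y)) *R p0 y"
  have eN: "N2 (%y. (indicator Q y * ca d (f n y) (e n y)) *R cgrad (f n) y - (indicator Q y * cb d (f n y) (e n y)) *R cgrad (e n) y) = (LI y. indicator Q y * (norm (GF n y))~2)" for n
   unfolding N2_def GF_def by (intro bl_cong) (auto simp: indicator_def)
  have t3: "(%n. \<integral>y. indicator Q y * (norm (GF n y))~2 \<partial>lborel) ~~> N2 ?H"
   using l2lim_N2[OF lg] unfolding eN .
  have "measure lborel Q * (LI y. indicator Q y * (fd d y)~2) - (LI y. indicator Q y * fd d y)~2 <= Cq * N2 ?H"
   by (rule LIMSEQ_le[OF tendsto_diff[OF tendsto_mult[OF tendsto_const t2] tendsto_power[OF t1]] tendsto_mult[OF tendsto_const t3]]) (use pc in blast)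
  also have "N2 ?H <= N2 (gd d)"
  proof -
   have sgd: "sqi (gd d)" by (rule sqi_bound(1)[OF gdm spu, of _ 1]) (use gdb[OF d] in auto)
   have ae: "AL y. norm (?H y) <= 1 * norm (gd d y)" using g
   proof eventually_elim
    case (elim y)
    show ?case
    proof (cases "y \<in> Q")
     case True
     define u where "u = u0 y" define k where "k = sqrt (u~2 + d)" define K where "K = u~2 + d + (v y)~2"
     have u: "u > 0" using pos[of y] True Q(4) by (auto simp: u_def u0_def)
     have k: "k > 0" "k~2 = u~2 + d" "K > 0" using ca_cb_pos[OF d] d by (auto simp: k_def K_def)
     \<comment> \<open>The relation g collapses the gradient of the arctangent to a multiple of p0
       y. Its numerator contains k^2 - u^2 = d, which is the source of the smallness.\<close>
     have "?H y = (ca d (v y) u * (v y / u) - cb d (v y) u) *R p0 y"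
      using True elim by (simp add: u_def v_def scaleR_diff_left)
     also have "ca d (v y) u * (v y / u) - cb d (v y) u = v y * (k~2 - u~2) / (u * k * K)"
      unfolding ca_def cb_def k_def[symmetric] K_def[symmetric] using u k(1) k(3) by (simp add: field_simps power2_eq_square)
     also have "... = (v y * k / K) * (d / (u * k~2))"
     proof -
      have kd: "k~2 - u~2 = d" using k(2) by simp
      show ?thesis unfolding kd using k(1) u k(3) by (simp add: power2_eq_square)
     qed
     finally have H: "?H y = ((v y * k / K) * (d / (u * k~2))) *R p0 y" .
     have "||v y|| * k <= K"
      unfolding K_def k(2)[symmetric] by (rule abs_times_le) (use k in simp)
     then have "||v y * k / K|| <= 1" using k by (simp add: abs_mult field_simps)
     then have "||v y * k / K|| * norm ((d / (u * k~2)) *R p0 y) <= 1 * norm ((d / (u * k~2)) *R p0 y)" by (rule mult_right_mono) simp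
     moreover have "norm (?H y) = ||v y * k / K|| * norm ((d / (u * k~2)) *R p0 y)" unfolding H norm_scaleR abs_mult by simp
     moreover have "(d / (u * k~2)) *R p0 y = gd d y" using True u k by (simp add: gd_def pu_def u_def[symmetric] k(2)[symmetric] field_simps)
     ultimately show ?thesis by simp
    qed simp
   qed
   have "sqi ?H" using lg by (simp add: l2lim_def)
   then have "?H \<in> bm" by (simp add: sqi_def)
   from sqi_bound(2)[OF this sgd ae] show ?thesis by simp
  qed
  finally show ?thesis by (simp add: Cq_def mult_left_mono)
 qed
 define d where "d n = 1 / real (Suc n)" for n
 have d: "d n > 0" for n by (simp add: d_def)
 have dl: "d ~~> 0" unfolding d_def by (rule LIMSEQ_inverse_real_of_nat[unfolded inverse_eq_divide])
 define fl where "fl y = arctan (v y / u0 y)" for y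
 have flm[measurable]: "fl \<in> bm" unfolding fl_def by measurable
 have u: "u0 y > 0" if "y \<in> Q" for y using pos[of y] that Q(4) by (auto simp: u0_def)
 have fdl: "(%n. fd (d n) y) ~~> fl y" if "y \<in> Q" for y
 proof -
  have "(%n. arctan (v y / sqrt ((u0 y)~2 + d n))) ~~> arctan (v y / sqrt ((u0 y)~2 + 0))" using u[OF that] by (intro tendsto_intros dl) auto
  then show ?thesis using u[OF that] by (simp add: fd_def fl_def)
 qed
 have t1: "(%n. \<integral>y. indicator Q y * fd (d n) y \<partial>lborel) ~~> (LI y. indicator Q y * fl y)"
  by (rule indicator_bounded_int[where C=2]) (use Q fdl at in \<open>auto simp: fd_def\<close>)
 have t2: "(%n. \<integral>y. indicator Q y * (fd (d n) y)~2 \<partial>lborel) ~~> (LI y. indicator Q y * (fl y)~2)"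
 proof (rule indicator_bounded_int[where C="2~2"])
  show "||(fd (d n) y)~2|| <= 2~2" for n y using power_mono[OF at, of _ 2] by (simp add: fd_def)
  show "AL y. y \<in> Q --> (%n. (fd (d n) y)~2) ~~> (fl y)~2" using fdl by (intro AE_I2) (auto intro: tendsto_intros)
 qed (use Q in auto)
 have t3: "(%n. N2 (gd (d n))) ~~> 0"
 proof -
  have "l2lim (%n. gd (d n)) (%y. 0)"
  proof (rule l2_dominated[OF _ gdm spu])
   show "AL y. (%n. gd (d n) y) ~~> 0"
   proof (rule AE_I2)
    fix y show "(%n. gd (d n) y) ~~> 0"
    proof (cases "y \<in> Q")
     case True
     have "(%n. gd (d n) y) ~~> (0 / ((u0 y)~2 + 0)) *R pu y" unfolding gd_def using u[OF True] by (intro tendsto_intros dl) auto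
     then show ?thesis by simp
    qed (simp add: gd_def pu_def)
   qed
  qed (use gdb[OF d] in auto)
  then show ?thesis using l2lim_N2 by fastforce
 qed
 have "measure lborel Q * (LI y. indicator Q y * (fl y)~2) - (LI y. indicator Q y * fl y)~2 <= Cq * 0"
  by (rule LIMSEQ_le[OF tendsto_diff[OF tendsto_mult[OF tendsto_const t2] tendsto_power[OF t1]] tendsto_mult[OF tendsto_const t3]]) (use step[OF d] in blast)
 then have "\<exists>c. AL y. y \<in> Q --> fl y = c"
  by (intro variance_zero_AE_const[where C=2]) (use Q at in \<open>auto simp: fl_def[abs_def]\<close>)
 then obtain c where "AL y. y \<in> Q --> fl y = c" ..
 then have "AL y. y \<in> Q --> v y / u0 y = tan c" by eventually_elim (auto simp: fl_def tan_arctan)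
 then show ?thesis by (auto simp: v_def Q_def)
qed

text \<open>An energy at most \<open>lam0\<close> forces the Picone square to vanish; then the
  quotient by u0 is locally constant, and constant because S is connected.\<close>

lemma kernel_multiple:
 assumes W: "W S Fi" and k: "N2 (%y. snd (Fi y)) <= lam0 * N2 (%y. fst (Fi y))"
 shows "\<exists>c. AL y. fst (Fi y) = c * u0 y"
proof -
 have "N2 (%y. snd (Fi y) - (fst (Fi y) / u0 y) *R p0 y) = 0" using picone(2)[OF W] k N2_nonneg by (intro antisym) (auto intro: order_trans)
 then have g: "AL y. snd (Fi y) = (fst (Fi y) / u0 y) *R p0 y" using AE_eq_0_N2[OF picone(1)[OF W]] by auto
 have "\<exists>c. AL y. y \<in> S --> fst (Fi y) / u0 y = c"
 proof (rule connected_AE_const[OF S_connected S_ne])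
  fix x assume "x \<in> S"
  then obtain a b where ab: "cbox a b \<subseteq> S" "x \<in> box a b" using open_contains_cbox[OF S_open] by metis
  obtain a' b' where ab': "cbox a' b' \<subseteq> box a b" "x \<in> box a' b'" using open_contains_cbox[OF open_box] ab(2) by metis
  obtain c where c: "AL y. y \<in> box a' b' --> fst (Fi y) / u0 y = c" using kernel_box[OF W g ab(1) ab'(1)] by auto
  have "box a' b' \<subseteq> S" using ab' ab box_subset_cbox[of a' b'] box_subset_cbox[of a b] by blast
  then show "\<exists>Q c. open Q & x \<in> Q & Q \<subseteq> S & (AL y. y \<in> Q --> fst (Fi y) / u0 y = c)"
   using c ab'(2) open_box by blast
 qed
 then obtain c where "AL y. y \<in> S --> fst (Fi y) / u0 y = c" ..
 then have "AL y. fst (Fi y) = c * u0 y" using W_outside[OF W]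
 proof eventually_elim
  case (elim y)
  show ?case using elim pos[of y] out[of y] by (cases "y \<in> S") (auto simp: u0_def)
 qed
 then show ?thesis ..
qed

end

section \<open>The spectral gap above the lowest eigenvalue\<close>

lemma finite_convergent_subseq:
 fixes X :: "'i => nat => real"
 assumes "finite I" "!!i. i \<in> I ==> bounded (range (X i))"
 shows "\<exists>r. strict_mono (r :: nat => nat) & (\<forall>i\<in>I. convergent (%n. X i (r n)))"
 using assms
proof (induction I rule: finite_induct)
 case empty then show ?case by (intro exI[of _ id]) (auto simp: strict_mono_def)
next
 case (insert i I)
 then obtain r where r: "strict_mono (r :: nat => nat)" "\<forall>i\<in>I. convergent (%n. X i (r n))" by auto
 have "bounded (range (%n. X i (r n)))" by (rule bounded_subset[OF insert.prems[of i]]) auto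
 then obtain l r2 where r2: "strict_mono (r2 :: nat => nat)" "((%n. X i (r n)) \<circ> r2) ~~> l"
  using bounded_imp_convergent_subsequence by blast
 have "convergent (%n. X j (r (r2 n)))" if "j \<in> insert i I" for j
 proof (cases "j = i")
  case True
  have "(%n. X i (r (r2 n))) ~~> l" using r2(2) by (simp add: o_def)
  then show ?thesis unfolding True by (rule convergentI)
 next
  case False
  have "convergent (%n. X j (r n))" by (rule bspec[OF r(2)]) (use that False in simp)
  then obtain L where L: "(%n. X j (r n)) ~~> L" unfolding convergent_def by (rule exE)
  have "(%n. X j (r (r2 n))) ~~> L" using LIMSEQ_subseq_LIMSEQ[OF L r2(1)] by (simp add: o_def)
  then show ?thesis by (rule convergentI)
 qed
 then show ?case using strict_mono_o[OF r(1) r2(1)] by (intro exI[of _ "r \<circ> r2"]) (auto simp: o_def)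
qed

context cross_section
begin

text \<open>The Picone square is nonnegative: a positive eigenfunction belongs to the minimum of the
  energy.\<close>

lemma energy_nonneg: "W S Fi ==> lam0 * N2 (%y. fst (Fi y)) <= N2 (%y. snd (Fi y))"
 using picone(2)[of Fi] N2_nonneg[of "%y. snd (Fi y) - (fst (Fi y) / u0 y) *R p0 y"] by linarith

lemma N2_parallelogram:
 fixes f g :: "'a::euclidean_space => 'b::euclidean_space"
 assumes "sqi f" "sqi g" shows "N2 (%x. f x - g x) + N2 (%x. f x + g x) = 2 * N2 f + 2 * N2 g"
proof -
 have "N2 (%x. f x - g x) + N2 (%x. f x + g x) = (LI x. (norm (f x - g x))~2 + (norm (f x + g x))~2)"
  unfolding N2_def using sqi_diff(1)[OF assms] sqi_add(1)[OF assms] by (simp add: sqi_def)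
 also have "... = (LI x. 2 * (norm (f x))~2 + 2 * (norm (g x))~2)"
  by (intro bl_cong) (auto simp: power2_norm_eq_inner algebra_simps)
 also have "... = 2 * N2 f + 2 * N2 g" unfolding N2_def using assms by (simp add: sqi_def)
 finally show ?thesis .
qed

text \<open>Otherwise a normalised sequence orthogonal to u0 has energy tending to
  \<open>lam0\<close>; a convergent subsequence would yield a normalised multiple of u0 that is
  orthogonal to u0. One fixed mesh is enough for compactness: by the parallelogram law the energy
  excess \<open>a\<close> of differences tends to 0, so only finitely many averages have to be made
  convergent.\<close>

lemma spectral_gap:
 "\<exists>ga>0. \<forall>Fi. W S Fi --> (LI y. u0 y * fst (Fi y)) = 0 --> (lam0 + ga) * N2 (%y. fst (Fi y)) <= N2 (%y. snd (Fi y))"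
proof (rule ccontr)
 assume neg: "\<not> ?thesis"
 have "\<exists>Fi. W S Fi & (LI y. u0 y * fst (Fi y)) = 0 & N2 (%y. fst (Fi y)) = 1 & N2 (%y. snd (Fi y)) < lam0 + 1 / Suc n" for n
 proof -
  have "\<not> (\<forall>Fi. W S Fi --> (LI y. u0 y * fst (Fi y)) = 0 --> (lam0 + 1 / Suc n) * N2 (%y. fst (Fi y)) <= N2 (%y. snd (Fi y)))"
  proof
   assume "\<forall>Fi. W S Fi --> (LI y. u0 y * fst (Fi y)) = 0 --> (lam0 + 1 / Suc n) * N2 (%y. fst (Fi y)) <= N2 (%y. snd (Fi y))"
   moreover have "1 / real (Suc n) > 0" by simp
   ultimately show False using neg by blast
  qed
  then obtain Fi where P: "W S Fi" "(LI y. u0 y * fst (Fi y)) = 0" "N2 (%y. snd (Fi y)) < (lam0 + 1 / Suc n) * N2 (%y. fst (Fi y))" by (auto simp: not_le)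
  have p: "N2 (%y. fst (Fi y)) > 0"
  proof (rule ccontr)
   assume "\<not> ?thesis"
   then have "N2 (%y. fst (Fi y)) = 0" using N2_nonneg[of "%y. fst (Fi y)"] by linarith
   then show False using P(3) N2_nonneg[of "%y. snd (Fi y)"] by simp
  qed
  define c where "c = 1 / sqrt (N2 (%y. fst (Fi y)))"
  have c: "c~2 * N2 (%y. fst (Fi y)) = 1" "c~2 > 0" using p by (auto simp: c_def power_divide)
  define Gi where "Gi = (%y. c *R Fi y)"
  have s: "sqi (%y. fst (Fi y))" "sqi (%y. snd (Fi y))" using W_sqi[OF P(1)] by auto
  have "W S Gi" unfolding Gi_def by (rule W_scale[OF P(1)])
  moreover have "(LI y. u0 y * fst (Gi y)) = 0" using P(2) by (simp add: Gi_def mult.left_commute)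
  moreover have "N2 (%y. fst (Gi y)) = 1" using sqi_scale(2)[OF s(1), of c] c by (simp add: Gi_def)
  moreover have "N2 (%y. snd (Gi y)) < lam0 + 1 / Suc n"
  proof -
   have "N2 (%y. snd (Gi y)) = c~2 * N2 (%y. snd (Fi y))" using sqi_scale(2)[OF s(2), of c] by (simp add: Gi_def)
   also have "... < c~2 * ((lam0 + 1 / Suc n) * N2 (%y. fst (Fi y)))" using P(3) c(2) by (rule mult_strict_left_mono)
   also have "... = (c~2 * N2 (%y. fst (Fi y))) * (lam0 + 1 / Suc n)" by simp
   finally show ?thesis using c(1) by simp
  qed
  ultimately show ?thesis by blast
 qed
 from choice[OF allI[OF this]] obtain X where X': "\<forall>n. W S (X n) & (LI y. u0 y * fst (X n y)) = 0 &
  N2 (%y. fst (X n y)) = 1 & N2 (%y. snd (X n y)) < lam0 + 1 / Suc n" by (rule exE)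
 have X: "W S (X n)" "(LI y. u0 y * fst (X n y)) = 0" "N2 (%y. fst (X n y)) = 1" "N2 (%y. snd (X n y)) < lam0 + 1 / Suc n" for n
  using spec[OF X', of n] by simp_all
 define a where "a Fi = N2 (%y. snd (Fi y)) - lam0 * N2 (%y. fst (Fi y))" for Fi :: "real * real => real \<times> (real * real)"
 have a0: "0 <= a Fi" if "W S Fi" for Fi using energy_nonneg[OF that] by (simp add: a_def)
 have apar: "a (%y. Fi y - Gi y) <= 2 * a Fi + 2 * a Gi" if W: "W S Fi" "W S Gi" for Fi Gi
 proof -
  have "a (%y. Fi y - Gi y) + a (%y. Fi y + Gi y) = 2 * a Fi + 2 * a Gi"
  proof -
   note A = N2_parallelogram[OF W_sqi(2)[OF W(1)] W_sqi(2)[OF W(2)]] and B = N2_parallelogram[OF W_sqi(3)[OF W(1)] W_sqi(3)[OF W(2)]]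
   have "a (%y. Fi y - Gi y) + a (%y. Fi y + Gi y) =
    (N2 (%y. snd (Fi y) - snd (Gi y)) + N2 (%y. snd (Fi y) + snd (Gi y)))
    - lam0 * (N2 (%y. fst (Fi y) - fst (Gi y)) + N2 (%y. fst (Fi y) + fst (Gi y)))"
    by (simp add: a_def distrib_left)
   also have "... = 2 * a Fi + 2 * a Gi" unfolding A B by (simp add: a_def algebra_simps)
   finally show ?thesis .
  qed
  then show ?thesis using a0[OF W_add[OF W]] by linarith
 qed
 have aX: "a (X n) < 1 / Suc n" for n using X(3,4)[of n] by (simp add: a_def)
 \<comment> \<open>With lam0 * th = 1/2 half of the gradient term can be absorbed when the energy is
   written as a Fi + lam0 * v.\<close>
 define th where "th = 1 / (2 * lam0)"
 have th: "th > 0" "lam0 * th = 1/2" using lam0_pos by (auto simp: th_def)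
 obtain I l where I: "finite I" "!!i. i \<in> I ==> sqi (l i)" and mesh: "!!Fi. W S Fi ==>
  N2 (%x. fst (Fi x)) <= (\<Sum>i\<in>(I::(int\<times>int) set). (LI x. l i x * fst (Fi x))~2) + th * N2 (%x. snd (Fi x))"
  using mesh_inequality[OF S_bounded th(1)] by blast
 define L where "L i Fi = (LI x. l i x * fst (Fi x))" for i and Fi :: "real * real => real \<times> (real * real)"
 have bd: "bounded (range (%n. L i (X n)))" if "i \<in> I" for i
 proof -
  have "norm (L i (X n)) <= sqrt (N2 (l i))" for n
   using CS_inner[OF I(2)[OF that] W_sqi(2)[OF X(1)], of n] X(3)[of n] by (simp add: L_def)
  then show ?thesis by (auto simp: bounded_iff)
 qed
 obtain r where r: "strict_mono (r :: nat => nat)" "!!i. i \<in> I ==> convergent (%n. L i (X (r n)))"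
  using finite_convergent_subseq[of I "%i n. L i (X n)", OF I(1) bd] by blast
 define Y where "Y n = X (r n)" for n
 have WY: "W S (Y n)" for n by (simp add: Y_def X)
 have aY: "(%n. a (Y n)) ~~> 0"
 proof (rule tendsto_sandwich[OF _ _ tendsto_const])
  show "(%n. 1 / real (Suc (r n))) ~~> 0"
   using LIMSEQ_subseq_LIMSEQ[OF LIMSEQ_inverse_real_of_nat[unfolded inverse_eq_divide] r(1)] by (simp add: o_def)
  show "\<forall>\<^sub>F n in sequentially. a (Y n) <= 1 / real (Suc (r n))" using aX by (auto simp: Y_def intro!: always_eventually less_imp_le)
 qed (use a0[OF WY] in auto)
 define K where "K = 2 + 2 * lam0 + 1 + 2 * th + 1"
 \<comment> \<open>The compactness statement in coercive form: excess and finitely many averages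
   control the full norm of the pair, so their convergence makes the subsequence Cauchy in
   H^1.\<close>
 have ctrl: "N2 Fi <= (2 + 2 * th) * a Fi + (2 * lam0 + 2) * (\<Sum>i\<in>I. (L i Fi)~2)" if W: "W S Fi" for Fi
 proof -
  define s where "s = (\<Sum>i\<in>I. (L i Fi)~2)"
  define v where "v = N2 (%x. fst (Fi x))"
  define g where "g = N2 (%x. snd (Fi x))"
  have m: "v <= s + th * g" using mesh[OF W] by (simp add: s_def v_def g_def L_def)
  have "g = a Fi + lam0 * v" by (simp add: a_def g_def v_def)
  also have "lam0 * v <= lam0 * (s + th * g)" using m lam0_pos by (intro mult_left_mono) auto
  also have "lam0 * (s + th * g) = lam0 * s + g / 2" using th(2) by (simp add: distrib_left mult.assoc[symmetric])
  finally have g: "g <= 2 * a Fi + 2 * lam0 * s" by simp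
  have "th * g <= th * (2 * a Fi + 2 * lam0 * s)" using g th by (intro mult_left_mono) auto
  also have "... = 2 * th * a Fi + s" using th(2)
  proof -
   have "th * (2 * lam0 * s) = 2 * (lam0 * th) * s" by (simp only: mult_ac)
   then show ?thesis using th(2) by (simp add: distrib_left)
  qed
  finally have v: "v <= 2 * s + 2 * th * a Fi" using m by linarith
  have "N2 Fi = v + g" using sqi_Pair(2)[OF W_sqi(2)[OF W] W_sqi(3)[OF W]] by (simp add: v_def g_def)
  then show ?thesis using v g unfolding s_def[symmetric] by (simp add: algebra_simps)
 qed
 have "\<exists>Fi. l2lim Y Fi"
 proof (rule l2_complete[OF W_sqi(1)[OF WY]])
  fix e :: real assume e: "e > 0"
  define A B where "A = 2 + 2 * th" and "B = (2 * lam0 + 2) * (card I + 1)"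
  have AB: "A > 0" "B > 0" using th lam0_pos by (auto simp: A_def B_def intro!: mult_pos_pos add_pos_pos)
  have "\<forall>\<^sub>F n in sequentially. a (Y n) < e / (8 * A)" using order_tendstoD(2)[OF aY, of "e / (8 * A)"] e AB by simp
  then obtain N1 where N1: "!!n. n >= N1 ==> a (Y n) < e / (8 * A)" by (auto simp: eventually_sequentially)
  have "\<forall>i\<in>I. \<exists>N. \<forall>m\<ge>N. \<forall>n\<ge>N. ||L i (Y m) - L i (Y n)|| < sqrt (e / (2 * B))"
  proof
   fix i assume "i \<in> I"
   then have "Cauchy (%n. L i (Y n))" using r(2) by (simp add: Y_def convergent_Cauchy)
   moreover have "sqrt (e / (2 * B)) > 0" using e AB by simp
   ultimately show "\<exists>N. \<forall>m\<ge>N. \<forall>n\<ge>N. ||L i (Y m) - L i (Y n)|| < sqrt (e / (2 * B))" by (auto simp: Cauchy_def dist_real_def)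
  qed
  from bchoice[OF this] obtain N2' where N2': "\<forall>i\<in>I. \<forall>m\<ge>N2' i. \<forall>n\<ge>N2' i. ||L i (Y m) - L i (Y n)|| < sqrt (e / (2 * B))" by (rule exE)
  define N where "N = N1 + (\<Sum>i\<in>I. N2' i)"
  have NI: "N2' i <= N" if "i \<in> I" for i using member_le_sum[OF that, of N2'] I(1) unfolding N_def by (simp add: trans_le_add2)
  show "\<exists>N. \<forall>m\<ge>N. \<forall>n\<ge>N. N2 (%x. Y m x - Y n x) < e"
  proof (intro exI[of _ N] allI impI)
   fix m n assume mn: "N <= m" "N <= n"
   have La: "L i (%x. Y m x - Y n x) = L i (Y m) - L i (Y n)" if "i \<in> I" for i
    unfolding L_def using sqi_times[OF I(2)[OF that] W_sqi(2)[OF WY]] by (simp add: right_diff_distrib)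
   have "(L i (%x. Y m x - Y n x))~2 <= e / (2 * B)" if i: "i \<in> I" for i
   proof -
    have "||L i (Y m) - L i (Y n)|| < sqrt (e / (2 * B))" using bspec[OF N2' i] order_trans[OF NI[OF i] mn(1)] order_trans[OF NI[OF i] mn(2)] by simp
    then have "||L i (Y m) - L i (Y n)||~2 <= (sqrt (e / (2 * B)))~2" by (intro power_mono) auto
    then show ?thesis using La[OF i] e AB by simp
   qed
   then have "(\<Sum>i\<in>I. (L i (%x. Y m x - Y n x))~2) <= (\<Sum>i\<in>I. e / (2 * B))" by (rule sum_mono)
   also have "... = card I * (e / (2 * B))" by simp
   finally have s: "(2 * lam0 + 2) * (\<Sum>i\<in>I. (L i (%x. Y m x - Y n x))~2) <= (2 * lam0 + 2) * (card I * (e / (2 * B)))" using lam0_pos by (intro mult_left_mono) auto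
   have "(2 * lam0 + 2) * (card I * (e / (2 * B))) <= (2 * lam0 + 2) * ((card I + 1) * (e / (2 * B)))"
    using lam0_pos e AB by (intro mult_left_mono mult_right_mono) auto
   also have "... = B * (e / (2 * B))"
   proof -
    have "(2 * lam0 + 2) * ((card I + 1) * q) = B * q" for q :: real by (simp add: B_def mult.assoc)
    then show ?thesis .
   qed
   also have "... = e / 2" using AB by simp
   finally have s2: "(2 * lam0 + 2) * (\<Sum>i\<in>I. (L i (%x. Y m x - Y n x))~2) <= e / 2" using s by linarith
   have "a (%x. Y m x - Y n x) <= 2 * a (Y m) + 2 * a (Y n)" by (rule apar[OF WY WY])
   also have "... < 4 * (e / (8 * A))" using N1[of m] N1[of n] mn by (simp add: N_def)
   finally have "A * a (%x. Y m x - Y n x) < A * (4 * (e / (8 * A)))" using AB by (intro mult_strict_left_mono) auto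
   also have "... = e / 2" using AB by simp
   finally have "A * a (%x. Y m x - Y n x) < e / 2" .
   then show "N2 (%x. Y m x - Y n x) < e" using ctrl[OF W_diff[OF WY WY], of m n] s2 unfolding A_def by linarith
  qed
 qed
 then obtain Fi where l: "l2lim Y Fi" ..
 have W: "W S Fi" by (rule W_closed[OF WY l])
 have "(%n. N2 (%y. fst (Y n y))) ~~> N2 (%y. fst (Fi y))" by (rule l2lim_N2[OF l2lim_fst[OF l]])
 then have n1: "N2 (%y. fst (Fi y)) = 1" using X(3) by (simp add: Y_def LIMSEQ_const_iff)
 have "(%n. \<integral>y. u0 y * fst (Y n y) \<partial>lborel) ~~> (LI y. u0 y * fst (Fi y))" by (rule l2lim_times[OF l2lim_const[OF u0_sqi] l2lim_fst[OF l]])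
 then have o: "(LI y. u0 y * fst (Fi y)) = 0" using X(2) by (simp add: Y_def LIMSEQ_const_iff)
 have "(%n. a (Y n)) ~~> a Fi" unfolding a_def by (intro tendsto_intros l2lim_N2 l2lim_fst l2lim_snd l)
 then have "a Fi = 0" using aY LIMSEQ_unique by blast
 then obtain c where c: "AL y. fst (Fi y) = c * u0 y" using kernel_multiple[OF W] by (auto simp: a_def)
 note [measurable] = W_borel[OF W]
 have "(LI y. u0 y * fst (Fi y)) = (LI y. c * (norm (u0 y))~2)"
  by (rule integral_cong_AE) (use c in \<open>auto simp: power2_eq_square\<close>)
 also have "... = c" using nrm by (simp add: N2_def u0_def)
 finally have "c = 0" using o by simp
 then have "AL y. fst (Fi y) = 0" using c by simp
 then have "N2 (%y. fst (Fi y)) = N2 (%y::real\<times>real. 0::real)" unfolding N2_def by (intro integral_cong_AE) auto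
 then show False using n1 by simp
qed

section \<open>The weighted energy on one cross section\<close>

text \<open>Half the integral of a derivative of u0^2. It removes the first-order effect of the
  weight beta on the ground state.\<close>

lemma u0_p0_orth: "(LI y. u0 y * (p0 y @. b)) = 0"
proof -
 obtain f where f: "!!n. test_fun S (f n)" "l2lim (%n. tpair (f n)) mu0" using W0 unfolding W_def by blast
 have l1: "l2lim (%n x. f n x) u0" using l2lim_fst[OF f(2)] by (simp add: tpair_def u0_def[abs_def])
 have l2: "l2lim (%n x. cgrad (f n) x) p0" using l2lim_snd[OF f(2)] by (simp add: tpair_def p0_def[abs_def])
 have l3: "l2lim (%n x. cgrad (f n) x @. b) (%x. p0 x @. b)"
 proof (rule l2lim_lip[OF l2, where T="%x y. y @. b" and C="norm b"])
  have [measurable]: "cgrad (f n) \<in> bm" for n by (rule sm_cgrad_borel[OF test_funD(1)[OF f(1)]])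
  show "AL x. norm (cgrad (f n) x @. b - p0 x @. b) <= norm b * norm (cgrad (f n) x - p0 x)" for n
   using Cauchy_Schwarz_ineq2[of "cgrad (f n) x - p0 x" b for x] by (intro AE_I2) (simp add: inner_diff_left[symmetric] mult.commute)
  show "(%x. p0 x @. b) \<in> bm" "!!n. (%x. cgrad (f n) x @. b) \<in> bm" by measurable
 qed (rule sqi_inner_const[OF p0_sqi])
 have "(LI y. f n y * (cgrad (f n) y @. b)) = 0" for n
 proof -
  have sm: "sm (f n)" using test_funD(1)[OF f(1)] .
  have "(LI y. cgrad (%y. f n y * f n y) y @. b) = 0"
   by (rule integral_deriv_compact_support[OF sm_has_cgrad sm_cgrad_continuous test_funD(2)[OF f(1)[of n]]])
    (use sm test_funD(4)[OF f(1)] in \<open>auto intro!: sm_mult\<close>)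
  then show ?thesis using sm by (simp add: cgrad_mult inner_add_left)
 qed
 then show ?thesis using l2lim_times[OF l1 l3] by (simp add: LIMSEQ_const_iff)
qed

definition "SR = (SOME R. 0 < R & (\<forall>y\<in>S. norm y <= R))"

lemma SR: "0 < SR" "y \<in> S ==> norm y <= SR"
proof -
 obtain R where "\<forall>y\<in>S. norm y <= R" using S_bounded by (auto simp: bounded_iff)
 then have "0 < max R 1 & (\<forall>y\<in>S. norm y <= max R 1)" by (auto simp: le_max_iff_disj)
 then have "0 < SR & (\<forall>y\<in>S. norm y <= SR)" unfolding SR_def by (rule someI)
 then show "0 < SR" "y \<in> S ==> norm y <= SR" by auto
qed

text \<open>The eigenvalue equation tested with (1 - e.y) times the given element, where 1 - e.y
  plays the role of beta on a slice. Differentiating the weight leaves a single term linear in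
  e.\<close>

lemma eigenfunction_weighted:
 assumes W: "W S Gi"
 shows "(LI y. (1 - e @. y) * (p0 y @. snd (Gi y) - lam0 * (u0 y * fst (Gi y)))) = (LI y. fst (Gi y) * (e @. p0 y))"
  "intb (%y. (1 - e @. y) * (p0 y @. snd (Gi y) - lam0 * (u0 y * fst (Gi y))))"
proof -
 define mu where "mu = (%y. 1 - e @. y)"
 have smm: "sm mu"
 proof -
  have "sm (%y. 1 + (-1) * (y @. e))" by (intro sm_add sm_mult sm_const sm_inner)
  then show ?thesis by (simp add: mu_def inner_commute)
 qed
 have cg: "cgrad mu y = - e" for y unfolding mu_def by (rule cgrad_unique) (auto intro!: derivative_eq_intros)
 define C where "C = 1 + norm e * SR + norm e"
 have ey: "||e @. y|| <= norm e * SR" if "y \<in> S" for y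
  using order_trans[OF Cauchy_Schwarz_ineq2 mult_left_mono[OF SR(2)[OF that] norm_ge_zero[of e]]] .
 have b1: "||mu y|| <= C" if "y \<in> S" for y unfolding C_def mu_def using ey[OF that] by (smt (verit) norm_ge_zero)
 have b2: "norm (cgrad mu y) <= C" for y unfolding cg C_def using SR(1) by (simp add: add_nonneg_nonneg)
 have Wm: "W S (%y. (mu y * fst (Gi y), mu y *R snd (Gi y) + fst (Gi y) *R cgrad mu y))"
  by (rule W_mult[OF W smm b1 b2])
 note s = W_sqi[OF Wm] and sP = W_sqi[OF W]
 have e1: "intb (%y. p0 y @. (mu y *R snd (Gi y) + fst (Gi y) *R cgrad mu y))" using sqi_inner[OF p0_sqi s(3)] by simp
 have e2: "intb (%y. fst (Gi y) * (e @. p0 y))" using sqi_times[OF sP(2) sqi_inner_const[OF p0_sqi, of e]] by (simp add: inner_commute)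
 have e3: "intb (%y. u0 y * (mu y * fst (Gi y)))" using sqi_times[OF u0_sqi s(2)] by simp
 have eq: "mu y * (p0 y @. snd (Gi y) - lam0 * (u0 y * fst (Gi y))) =
  p0 y @. (mu y *R snd (Gi y) + fst (Gi y) *R cgrad mu y) + fst (Gi y) * (e @. p0 y) - lam0 * (u0 y * (mu y * fst (Gi y)))" for y
  by (simp add: cg inner_add_right inner_commute algebra_simps)
 have "(LI y. mu y * (p0 y @. snd (Gi y) - lam0 * (u0 y * fst (Gi y)))) = (LI y. p0 y @. (mu y *R snd (Gi y) + fst (Gi y) *R cgrad mu y)) + (LI y. fst (Gi y) * (e @. p0 y)) - lam0 * (LI y. u0 y * (mu y * fst (Gi y)))"
  unfolding eq using e1 e2 e3 by simp
 also have "(LI y. p0 y @. (mu y *R snd (Gi y) + fst (Gi y) *R cgrad mu y)) = lam0 * (LI y. u0 y * (mu y * fst (Gi y)))"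
  using weak[OF Wm] by (simp add: p0_def u0_def)
 finally show "(LI y. (1 - e @. y) * (p0 y @. snd (Gi y) - lam0 * (u0 y * fst (Gi y)))) = (LI y. fst (Gi y) * (e @. p0 y))"
  by (simp add: mu_def)
 have "intb (%y. mu y * (p0 y @. snd (Gi y) - lam0 * (u0 y * fst (Gi y))))" unfolding eq using e1 e2 e3 by simp
 then show "intb (%y. (1 - e @. y) * (p0 y @. snd (Gi y) - lam0 * (u0 y * fst (Gi y))))" by (simp add: mu_def)
qed

end

context cross_section
begin

text \<open>The loss is quadratic in e: the linear term on the ground-state component vanishes by
  \<open>u0_p0_orth\<close>, and the mixed term is absorbed into the gap by Young's inequality. This
  matters because e = eps h k z is later divided by (eps h)^2: a quadratic loss stays bounded, a
  linear one would be of order 1/eps.\<close>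

lemma slice_lower:
 "\<exists>de>0. \<forall>e Fi. norm e * SR <= de --> W S Fi -->
  de * N2 (%y. snd (Fi y) - (LI y. u0 y * fst (Fi y)) *R p0 y) - (norm e)~2 / de * (LI y. u0 y * fst (Fi y))~2
   <= (LI y. (1 - e @. y) * ((norm (snd (Fi y)))~2 - lam0 * (fst (Fi y))~2))"
proof -
 obtain ga where ga: "ga > 0" and gap: "!!Fi. W S Fi ==> (LI y. u0 y * fst (Fi y)) = 0 ==> (lam0 + ga) * N2 (%y. fst (Fi y)) <= N2 (%y. snd (Fi y))"
  using spectral_gap by blast
 \<comment> \<open>On the complement of u0 the gap reads lam0 N2 v <= q N2 g. With 1 - q = 4 de and
   |e.y| at most de the weighted form keeps 2 de N2 g; one half is the stated gain, the other pays
   for the mixed term.\<close>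
 define q where "q = lam0 / (lam0 + ga)"
 define de where "de = (1 - q) / 4"
 have q: "0 < q" "q < 1" using lam0_pos ga by (auto simp: q_def field_simps)
 have d: "de > 0" "de <= 1" using q by (auto simp: de_def)
 have main: "de * N2 (%y. snd (Fi y) - w *R p0 y) - (norm e)~2 / de * w~2
   <= (LI y. (1 - e @. y) * ((norm (snd (Fi y)))~2 - lam0 * (fst (Fi y))~2))"
  if e: "norm e * SR <= de" and W: "W S Fi" and w: "w = (LI y. u0 y * fst (Fi y))" for e Fi w
 proof -
  define Gi where "Gi y = Fi y - w *R mu0 y" for y
  have WP: "W S Gi" unfolding Gi_def using W_lin[OF W W0, of "- w"] by simp
  define v g where "v y = fst (Gi y)" and "g y = snd (Gi y)" for y
  have Pv: "fst (Fi y) = w * u0 y + v y" "snd (Fi y) = w *R p0 y + g y" for y by (auto simp: v_def g_def Gi_def u0_def p0_def)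
  have sv: "sqi v" and sg: "sqi g" using W_sqi[OF WP] by (auto simp: v_def[abs_def] g_def[abs_def])
  note [measurable] = sqi_measurable[OF sv] sqi_measurable[OF sg]
  have o: "(LI y. u0 y * v y) = 0"
  proof -
   have "(LI y. u0 y * v y) = (LI y. u0 y * fst (Fi y) - w * (norm (u0 y))~2)"
    by (intro bl_cong) (auto simp: v_def Gi_def u0_def power2_eq_square algebra_simps)
   also have "... = w - w * N2 u0" using sqi_times[OF u0_sqi W_sqi(2)[OF W]] u0_sqi by (simp add: w N2_def sqi_def)
   finally show ?thesis using nrm by (simp add: u0_def[abs_def])
  qed
  have gp: "(lam0 + ga) * N2 v <= N2 g" using gap[OF WP] o by (simp add: v_def[abs_def] g_def[abs_def])
  have Nv: "lam0 * N2 v <= q * N2 g"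
  proof -
   have "lam0 * N2 v = q * ((lam0 + ga) * N2 v)" using lam0_pos ga by (simp add: q_def)
   also have "... <= q * N2 g" using gp q by (intro mult_left_mono) auto
   finally show ?thesis .
  qed
  define rh where "rh = norm e * SR"
  have rho: "0 <= rh" "rh <= de" using e SR(1) by (auto simp: rh_def)
  have ey: "||e @. y|| <= rh" if "y \<in> S" for y
   using order_trans[OF Cauchy_Schwarz_ineq2 mult_left_mono[OF SR(2)[OF that] norm_ge_zero[of e]]] by (simp add: rh_def)
  note I1 = eigenfunction_weighted[OF W0, of e] and I2 = eigenfunction_weighted[OF WP, of e]
  have out: "AL y. y \<notin> S --> v y = 0 & g y = 0" using W_outside[OF WP] by eventually_elim (auto simp: v_def g_def)
  have lowpt: "AL y. (1 - rh) * (norm (g y))~2 - (1 + rh) * (lam0 * (norm (v y))~2) <= (1 - e @. y) * ((norm (g y))~2 - lam0 * (v y)~2)"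
   using out
  proof eventually_elim
   case (elim y)
   show ?case
   proof (cases "y \<in> S")
    case True
    have "(1 - rh) * (norm (g y))~2 <= (1 - e @. y) * (norm (g y))~2" using ey[OF True] by (intro mult_right_mono) auto
    moreover have "(1 - e @. y) * (lam0 * (v y)~2) <= (1 + rh) * (lam0 * (v y)~2)" using ey[OF True] lam0_pos by (intro mult_right_mono) auto
    ultimately show ?thesis by (simp add: right_diff_distrib)
   next
    case False then show ?thesis using elim by simp
   qed
  qed
  have bdpt: "AL y. norm ((1 - e @. y) * ((norm (g y))~2 - lam0 * (v y)~2)) <= norm ((1 + rh) * ((norm (g y))~2 + lam0 * (norm (v y))~2))"
   using out
  proof eventually_elim
   case (elim y)
   show ?case
   proof (cases "y \<in> S")
    case True
    have L0: "0 <= lam0 * (v y)~2" using lam0_pos by simp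
    have a1: "||1 - e @. y|| <= 1 + rh" using ey[OF True] by linarith
    have a2: "||(norm (g y))~2 - lam0 * (v y)~2|| <= (norm (g y))~2 + lam0 * (norm (v y))~2"
     using L0 zero_le_power2[of "norm (g y)"] unfolding real_norm_def power2_abs abs_le_iff by linarith
    have "norm ((1 - e @. y) * ((norm (g y))~2 - lam0 * (v y)~2)) <= (1 + rh) * ((norm (g y))~2 + lam0 * (norm (v y))~2)"
     using mult_mono[OF a1 a2] rho(1) unfolding real_norm_def abs_mult by simp
    then show ?thesis by (rule order_trans) (simp only: real_norm_def abs_ge_self)
   next
    case False then show ?thesis using elim by simp
   qed
  qed
  have i3: "intb (%y. (1 - e @. y) * ((norm (g y))~2 - lam0 * (v y)~2))"
   by (rule bi_bound[OF _ _ bdpt]) (use sqi_integrable[OF sv] sqi_integrable[OF sg] in auto)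
  define T where "T = (LI y. (1 - e @. y) * ((norm (g y))~2 - lam0 * (v y)~2))"
  have T: "2 * de * N2 g <= T"
  proof -
   have "(1 - rh) * N2 g - (1 + rh) * (lam0 * N2 v) = (LI y. (1 - rh) * (norm (g y))~2 - (1 + rh) * (lam0 * (norm (v y))~2))"
    unfolding N2_def using sqi_integrable[OF sv] sqi_integrable[OF sg] by simp
   also have "... <= T" unfolding T_def by (rule integral_mono_AE[OF _ i3 lowpt]) (use sqi_integrable[OF sv] sqi_integrable[OF sg] in simp)
   finally have 1: "(1 - rh) * N2 g - (1 + rh) * (lam0 * N2 v) <= T" .
   have "(1 + rh) * (lam0 * N2 v) <= (1 + rh) * (q * N2 g)" using Nv rho by (intro mult_left_mono) auto
   then have "((1 - rh) - (1 + rh) * q) * N2 g <= T" using 1 by (simp add: left_diff_distrib mult.assoc)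
   moreover have "2 * de <= (1 - rh) - (1 + rh) * q"
   proof -
    have "rh * q <= rh * 1" using rho q by (intro mult_left_mono) auto
    moreover have "(1 - rh) - (1 + rh) * q = 1 - rh - q - rh * q" by (simp add: algebra_simps)
    moreover have "1 - q = 4 * de" by (simp add: de_def)
    ultimately show ?thesis using rho by linarith
   qed
   ultimately show ?thesis using mult_right_mono[of "2 * de" "(1 - rh) - (1 + rh) * q" "N2 g"] by simp
  qed
  have X: "||\<integral>y. v y * (e @. p0 y) \<partial>lborel|| <= norm e * sqrt (N2 g)"
  proof -
   have "||\<integral>y. v y * (e @. p0 y) \<partial>lborel|| <= norm e * (sqrt (N2 v) * sqrt (N2 p0))"
   proof (rule CS_bound(2)[OF sv p0_sqi])
    show "AL y. ||v y * (e @. p0 y)|| <= norm e * (norm (v y) * norm (p0 y))"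
    proof (rule AE_I2)
     fix y show "||v y * (e @. p0 y)|| <= norm e * (norm (v y) * norm (p0 y))"
      using mult_left_mono[OF Cauchy_Schwarz_ineq2[of e "p0 y"] abs_ge_zero[of "v y"]] by (simp add: abs_mult mult_ac)
    qed
   qed auto
   also have "sqrt (N2 v) * sqrt (N2 p0) = sqrt (lam0 * N2 v)" by (simp add: N2_p0 real_sqrt_mult)
   also have "... <= sqrt (N2 g)" using Nv q mult_right_mono[of q 1 "N2 g"] by (intro real_sqrt_le_mono) auto
   finally show ?thesis by (simp add: mult_left_mono)
  qed
  have "(LI y. (1 - e @. y) * ((norm (snd (Fi y)))~2 - lam0 * (fst (Fi y))~2)) =
   w~2 * (LI y. (1 - e @. y) * (p0 y @. snd (mu0 y) - lam0 * (u0 y * fst (mu0 y))))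
   + 2 * w * (LI y. (1 - e @. y) * (p0 y @. snd (Gi y) - lam0 * (u0 y * fst (Gi y)))) + T"
  proof -
   have eq: "(1 - e @. y) * ((norm (snd (Fi y)))~2 - lam0 * (fst (Fi y))~2) =
    w~2 * ((1 - e @. y) * (p0 y @. snd (mu0 y) - lam0 * (u0 y * fst (mu0 y))))
    + 2 * w * ((1 - e @. y) * (p0 y @. snd (Gi y) - lam0 * (u0 y * fst (Gi y)))) + (1 - e @. y) * ((norm (g y))~2 - lam0 * (v y)~2)" for y
   proof -
    have "(norm (snd (Fi y)))~2 - lam0 * (fst (Fi y))~2 = w~2 * (p0 y @. snd (mu0 y) - lam0 * (u0 y * fst (mu0 y)))
     + 2 * w * (p0 y @. snd (Gi y) - lam0 * (u0 y * fst (Gi y))) + ((norm (g y))~2 - lam0 * (v y)~2)"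
     unfolding Pv v_def[symmetric] g_def[symmetric] p0_def[symmetric] u0_def[symmetric] power2_norm_eq_inner
     by (simp add: inner_add_left inner_add_right inner_commute[of "g y" "p0 y"] power2_eq_square algebra_simps)
    then show ?thesis by (simp only: distrib_left mult.left_commute[of "1 - e @. y"])
   qed
   show ?thesis unfolding eq T_def using I1(2) I2(2) i3 by simp
  qed
  also have "... = w~2 * 0 + 2 * w * (LI y. v y * (e @. p0 y)) + T"
  proof -
   have "(LI y. fst (mu0 y) * (e @. p0 y)) = 0" using u0_p0_orth[of e] by (simp add: u0_def inner_commute)
   then show ?thesis unfolding I1(1) I2(1) by (simp add: v_def)
  qed
  finally have fin: "(LI y. (1 - e @. y) * ((norm (snd (Fi y)))~2 - lam0 * (fst (Fi y))~2)) = 2 * w * (LI y. v y * (e @. p0 y)) + T" by simp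
  define Y where "Y = (LI y. v y * (e @. p0 y))"
  have y2: "- (2 * w * Y) <= de * N2 g + (norm e)~2 / de * w~2"
  proof -
   define n where "n = sqrt (N2 g)"
   have n: "n >= 0" "N2 g = n~2" by (auto simp: n_def)
   have "- (2 * w * Y) <= 2 * ||w|| * ||Y||" by (metis abs_ge_minus_self abs_mult abs_numeral)
   also have "... <= 2 * ||w|| * (norm e * n)" using X by (intro mult_left_mono) (auto simp: Y_def n_def)
   also have "... <= de * n~2 + (norm e)~2 / de * w~2"
   proof -
    have "0 <= (de * n - norm e * ||w||)~2 / de" using d by simp
    also have "... = de * n~2 + (norm e)~2 / de * w~2 - 2 * ||w|| * (norm e * n)"
     using d by (simp add: power2_diff power_mult_distrib field_simps power2_eq_square)
    finally show ?thesis by simp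
   qed
   finally show ?thesis by (simp add: n(2))
  qed
  have "N2 (%y. snd (Fi y) - w *R p0 y) = N2 g" by (simp add: Pv)
  then show ?thesis using fin T y2 unfolding Y_def[symmetric] by simp
 qed
 show ?thesis by (intro exI[of _ de] conjI d allI impI main refl)
qed

end

section \<open>Slices, tensor products and the projection onto the ground state\<close>

lemma slice_borel [measurable (raw)]:
 fixes f :: "'a::euclidean_space \<times> 'b::euclidean_space => 'c::topological_space"
 assumes "f \<in> bm" shows "(%y. f (s, y)) \<in> bm"
 by (rule measurable_compose[OF _ assms]) (intro borel_measurable_continuous_onI continuous_intros)

lemma pair_borel:
 fixes f :: "'a::euclidean_space \<times> 'b::euclidean_space => 'c::topological_space"
 shows "f \<in> bm \<longleftrightarrow> f \<in> borel_measurable (lborel \<Otimes>\<^sub>M lborel)"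
 by (simp add: lborel_prod)

lemma fubini:
 fixes f :: "'a::euclidean_space \<times> 'b::euclidean_space => real"
 assumes "intb f"
 shows "AL s. intb (%y. f (s, y))" "intb (%s. \<integral>y. f (s, y) \<partial>lborel)"
  "(LI s. (LI y. f (s, y))) = (LI p. f p)"
proof -
 have i: "integrable (lborel \<Otimes>\<^sub>M lborel) f" using assms by (simp add: lborel_prod)
 show "AL s. intb (%y. f (s, y))" by (rule lborel_pair.AE_integrable_fst'[OF i])
 show "intb (%s. \<integral>y. f (s, y) \<partial>lborel)" by (rule lborel_pair.integrable_fst'[OF i])
 show "(LI s. (LI y. f (s, y))) = (LI p. f p)" using lborel_pair.integral_fst'[OF i] by (simp add: lborel_prod)
qed

lemma AE_slices:
 fixes Q :: "'a::euclidean_space \<times> 'b::euclidean_space => bool"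
 assumes "AL p. Q p" shows "AL s. AL y. Q (s, y)"
proof -
 have "AE p in lborel \<Otimes>\<^sub>M lborel. Q p" unfolding lborel_prod by (rule assms)
 then show ?thesis by (rule lborel_pair.AE_pair)
qed

lemma sqi_slice:
 fixes f :: "'a::euclidean_space \<times> 'b::euclidean_space => 'c::euclidean_space"
 assumes "sqi f"
 shows "AL s. sqi (%y. f (s, y))" "intb (%s. N2 (%y. f (s, y)))" "(LI s. N2 (%y. f (s, y))) = N2 f"
proof -
 have [measurable]: "f \<in> bm" using assms by (simp add: sqi_def)
 note F = fubini[OF sqi_integrable[OF assms]]
 show "AL s. sqi (%y. f (s, y))" using F(1) by eventually_elim (simp add: sqi_def)
 show "intb (%s. N2 (%y. f (s, y)))" using F(2) by (simp add: N2_def)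
 show "(LI s. N2 (%y. f (s, y))) = N2 f" using F(3) by (simp add: N2_def)
qed

lemma sqi_from_slices:
 fixes f :: "'a::euclidean_space \<times> 'b::euclidean_space => 'c::euclidean_space"
 assumes fm[measurable]: "f \<in> bm" and b: "AL s. sqi (%y. f (s, y)) & N2 (%y. f (s, y)) <= b s"
  and ib: "intb b"
 shows "sqi f" "N2 f <= (LI s. b s)"
proof -
 have b0: "AL s. 0 <= b s" using b by eventually_elim (meson N2_nonneg order_trans)
 have "(\<integral>\<^sup>+p. ennreal ((norm (f p))~2) \<partial>lborel) = (\<integral>\<^sup>+p. ennreal ((norm (f p))~2) \<partial>(lborel \<Otimes>\<^sub>M lborel))" by (simp add: lborel_prod)
 also have "... = (\<integral>\<^sup>+s. \<integral>\<^sup>+y. ennreal ((norm (f (s, y)))~2) \<partial>lborel \<partial>lborel)"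
  by (rule lborel.nn_integral_fst[symmetric]) (simp add: lborel_prod)
 also have "... <= (\<integral>\<^sup>+s. ennreal (b s) \<partial>lborel)"
 proof (rule nn_integral_mono_AE, use b in eventually_elim)
  case (elim s)
  have "(\<integral>\<^sup>+y. ennreal ((norm (f (s, y)))~2) \<partial>lborel) = ennreal (N2 (%y. f (s, y)))"
   unfolding N2_def by (rule nn_integral_eq_integral) (use elim in \<open>auto simp: sqi_def\<close>)
  then show ?case using elim by (simp add: ennreal_leI)
 qed
 also have "... = ennreal (LI s. b s)" by (rule nn_integral_eq_integral[OF ib b0])
 finally have k: "(\<integral>\<^sup>+p. ennreal ((norm (f p))~2) \<partial>lborel) <= ennreal (LI s. b s)" .
 have i: "intb (%x. (norm (f x))~2)"
  by (rule integrableI_bounded) (use k in \<open>auto simp: le_less_trans\<close>)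
 then show "sqi f" by (simp add: sqi_def)
 have nb: "0 <= (LI s. b s)" by (rule integral_nonneg_AE[OF b0])
 have "ennreal (N2 f) <= ennreal (LI s. b s)" using k unfolding N2_def by (subst (asm) nn_integral_eq_integral) (use i in auto)
 then show "N2 f <= (LI s. b s)" using nb by simp
qed

lemma slice_compare:
 fixes f :: "'a::euclidean_space \<times> 'b::euclidean_space => 'c::euclidean_space" and g :: "'a \<times> 'b => 'd::euclidean_space"
 assumes "f \<in> bm" "sqi g"
  and b: "AL s. sqi (%y. g (s, y)) --> sqi (%y. f (s, y)) & N2 (%y. f (s, y)) <= C * N2 (%y. g (s, y))"
 shows "sqi f" "N2 f <= C * N2 g"
proof -
 have b': "AL s. sqi (%y. f (s, y)) & N2 (%y. f (s, y)) <= C * N2 (%y. g (s, y))"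
  using b sqi_slice(1)[OF assms(2)] by eventually_elim simp
 have i: "intb (%s. C * N2 (%y. g (s, y)))" using sqi_slice(2)[OF assms(2)] by simp
 show "sqi f" "N2 f <= C * N2 g" using sqi_from_slices[OF assms(1) b' i] sqi_slice(3)[OF assms(2)] by auto
qed

lemma slice_mono:
 fixes f g :: "'a::euclidean_space \<times> 'b::euclidean_space => real"
 assumes i: "intb f" "intb g" and b: "AL s. (LI y. f (s, y)) <= (LI y. g (s, y))"
 shows "(LI p. f p) <= (LI p. g p)"
 unfolding fubini(3)[OF i(1), symmetric] fubini(3)[OF i(2), symmetric]
 by (rule integral_mono_AE[OF fubini(2)[OF i(1)] fubini(2)[OF i(2)] b])

lemma slice_eq_0:
 fixes f :: "'a::euclidean_space \<times> 'b::euclidean_space => real"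
 assumes i: "intb f" and b: "AL s. (LI y. f (s, y)) = 0"
 shows "(LI p. f p) = 0"
 unfolding fubini(3)[OF i, symmetric] using integral_cong_AE[of "%s. \<integral>y. f (s, y) \<partial>lborel" lborel "%s. 0"] fubini(2)[OF i] b by auto

definition tens :: "('a::euclidean_space => real) => ('b::euclidean_space => 'c::euclidean_space) => 'a \<times> 'b => 'c" where
 "tens w f p = w (fst p) *R f (snd p)"

lemma tens_borel [measurable (raw)]:
 fixes w :: "'a::euclidean_space => real" and f :: "'b::euclidean_space => 'c::euclidean_space"
 assumes [measurable]: "w \<in> bm" "f \<in> bm" shows "tens w f \<in> bm"
 unfolding tens_def[abs_def] by measurable

lemma sqi_tens:
 fixes w :: "'a::euclidean_space => real" and f :: "'b::euclidean_space => 'c::euclidean_space"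
 assumes "sqi w" "sqi f" shows "sqi (tens w f)" "N2 (tens w f) = N2 w * N2 f"
proof -
 have [measurable]: "w \<in> bm" "f \<in> bm" using assms by (auto simp: sqi_def)
 have sl: "sqi (%y. tens w f (s, y))" "N2 (%y. tens w f (s, y)) = (norm (w s))~2 * N2 f" for s
  using sqi_scale[OF assms(2), of "w s"] by (simp_all add: tens_def)
 have i: "intb (%s. (norm (w s))~2 * N2 f)" using assms by (simp add: sqi_def)
 show s: "sqi (tens w f)" by (rule sqi_from_slices(1)[OF _ _ i]) (use sl in auto)
 show "N2 (tens w f) = N2 w * N2 f" using sqi_slice(3)[OF s] unfolding sl by (simp add: N2_def)
qed

lemma l2lim_tens:
 fixes w :: "'a::euclidean_space => real" and f :: "'b::euclidean_space => 'c::euclidean_space"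
 assumes "l2lim X w" "l2lim Y f" shows "l2lim (%n. tens (X n) (Y n)) (tens w f)"
proof -
 have s: "sqi w" "sqi f" "!!n. sqi (X n)" "!!n. sqi (Y n)" using assms by (auto simp: l2lim_def)
 have bd: "N2 (%p. tens (X n) (Y n) p - tens w f p) <= 2 * (N2 (%s. X n s - w s) * N2 (Y n)) + 2 * (N2 w * N2 (%y. Y n y - f y))" for n
 proof -
  have "tens (X n) (Y n) p - tens w f p = tens (%s. X n s - w s) (Y n) p + tens w (%y. Y n y - f y) p" for p
   by (simp add: tens_def algebra_simps)
  then have "N2 (%p. tens (X n) (Y n) p - tens w f p) <= 2 * N2 (tens (%s. X n s - w s) (Y n)) + 2 * N2 (tens w (%y. Y n y - f y))"
   using sqi_add(2)[OF sqi_tens(1)[OF sqi_diff(1)[OF s(3) s(1)] s(4)] sqi_tens(1)[OF s(1) sqi_diff(1)[OF s(4) s(2)]], of n n n] by simp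
  then show ?thesis by (simp add: sqi_tens(2) sqi_diff(1) s)
 qed
 have "(%n. 2 * (N2 (%s. X n s - w s) * N2 (Y n)) + 2 * (N2 w * N2 (%y. Y n y - f y))) ~~> 2 * (0 * N2 f) + 2 * (N2 w * 0)"
  using assms by (intro tendsto_intros l2lim_N2) (auto simp: l2lim_def)
 then have l: "(%n. 2 * (N2 (%s. X n s - w s) * N2 (Y n)) + 2 * (N2 w * N2 (%y. Y n y - f y))) ~~> 0" by simp
 have "(%n. N2 (%p. tens (X n) (Y n) p - tens w f p)) ~~> 0"
  by (rule tendsto_sandwich[OF _ _ tendsto_const l]) (use bd in auto)
 then show ?thesis using s sqi_tens(1) by (auto simp: l2lim_def)
qed

lemma test_fun_slice:
 fixes ph :: "real * 'b::euclidean_space => real"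
 assumes p: "test_fun (J \<times> S) ph"
 shows "test_fun S (%y. ph (s, y))" "cgrad (%y. ph (s, y)) y = snd (cgrad ph (s, y))"
proof -
 have L: "bounded_linear (%y::'b. (0::real, y))" by (rule bounded_linear_Pair[OF bounded_linear_zero bounded_linear_ident])
 have sm: "sm ph" using test_funD(1)[OF p] .
 have "sm (%y. ph ((0, y) + (s, 0)))" by (rule sm_affine[OF L sm])
 then have sms: "sm (%y. ph (s, y))" by simp
 show "test_fun S (%y. ph (s, y))"
 proof (rule test_funI[OF sms])
  show "compact (snd ` tsupport ph)" by (intro compact_continuous_image test_funD(2)[OF p] continuous_intros)
  show "snd ` tsupport ph \<subseteq> S" using test_funD(3)[OF p] by auto
  show "ph (s, y) = 0" if "y \<notin> snd ` tsupport ph" for y using test_funD(4)[OF p, of "(s, y)"] that by force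
 qed
 have "((%y. ph (s, y)) has_derivative (%h. cgrad ph (s, y) @. (0, h))) (at y)"
  by (rule has_derivative_compose[OF _ sm_has_cgrad[OF sm]]) (auto intro!: derivative_eq_intros)
 then show "cgrad (%y. ph (s, y)) y = snd (cgrad ph (s, y))" by (intro cgrad_unique) (simp add: inner_prod_def)
qed

text \<open>Squared distances between slices of \<open>Fi\<close> and of approximating test
  functions tend to 0 in L1(ds), hence for almost every s along a subsequence; and slices of test
  functions are test functions on S.\<close>

lemma W_slice:
 fixes Fi :: "real * 'b::euclidean_space => real \<times> (real * 'b)"
 assumes W: "W (J \<times> S) Fi"
 shows "AL s. W S (%y. (fst (Fi (s, y)), snd (snd (Fi (s, y)))))"
proof -
 obtain f where f: "!!n. test_fun (J \<times> S) (f n)" "l2lim (%n. tpair (f n)) Fi" using W unfolding W_def by blast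
 define T where "T Gi = (%p. (fst (Gi p), snd (snd (Gi p))))" for Gi :: "real * 'b => real \<times> (real * 'b)"
 have l: "l2lim (%n. T (tpair (f n))) (T Fi)" unfolding T_def by (intro l2lim_Pair l2lim_fst l2lim_snd f(2))
 have s: "sqi (T Fi)" "!!n. sqi (T (tpair (f n)))" using l by (auto simp: l2lim_def)
 define d where "d n s = N2 (%y. T (tpair (f n)) (s, y) - T Fi (s, y))" for n s
 have sd: "sqi (%p. T (tpair (f n)) p - T Fi p)" for n by (rule sqi_diff(1)[OF s(2,1)])
 have di: "intb (d n)" "(LI s. d n s) = N2 (%p. T (tpair (f n)) p - T Fi p)" for n
  unfolding d_def using sqi_slice(2,3)[OF sd[of n]] by auto
 have "(%n. \<integral>s. norm (d n s) \<partial>lborel) ~~> 0" using l di(2) by (simp add: d_def l2lim_def)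
 then obtain r where r: "strict_mono r" "AL s. (%n. d (r n) s) ~~> 0" using tendsto_L1_AE_subseq[of lborel d, OF di(1)] by auto
 show ?thesis using r(2) sqi_slice(1)[OF s(1)]
 proof eventually_elim
  case (elim s0)
  have e: "(%y. T (tpair (f n)) (s0, y)) = tpair (%y. f n (s0, y))" for n
   using test_fun_slice(2)[OF f(1)] by (auto simp: T_def tpair_def)
  have "l2lim (%n. tpair (%y. f (r n) (s0, y))) (%y. T Fi (s0, y))"
   using elim sqi_tpair[OF test_fun_slice(1)[OF f(1)]] unfolding l2lim_def d_def e[symmetric] by (simp add: e)
  then have "W S (%y. T Fi (s0, y))" unfolding W_def using test_fun_slice(1)[OF f(1)] by (intro exI[of _ "%n y. f (r n) (s0, y)"]) auto
  then show ?case by (simp add: T_def)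
 qed
qed

lemma test_fun_tens:
 fixes w :: "real => real" and f :: "'b::euclidean_space => real"
 assumes w: "test_fun J w" and f: "test_fun S f"
 shows "test_fun (J \<times> S) (tens w f)" "cgrad (tens w f) = (%p. (tens (cgrad w) f p, tens w (cgrad f) p))"
proof -
 have sm: "sm w" "sm f" using test_funD(1) w f by auto
 have e: "tens w f = (%p. w (fst p) * f (snd p))" by (auto simp: tens_def)
 have smt: "sm (tens w f)" unfolding e by (intro sm_mult sm_linear[OF bounded_linear_fst] sm_linear[OF bounded_linear_snd] sm)
 show "test_fun (J \<times> S) (tens w f)"
  by (rule test_funI[OF smt compact_Times[OF test_funD(2)[OF w] test_funD(2)[OF f]]])
   (use test_funD(3)[OF w] test_funD(3)[OF f] test_funD(4)[OF w] test_funD(4)[OF f] in \<open>auto simp: tens_def mem_Times_iff\<close>)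
 show "cgrad (tens w f) = (%p. (tens (cgrad w) f p, tens w (cgrad f) p))"
 proof
  fix p :: "real * 'b"
  have d1: "((%p. w (fst p)) has_derivative (%h. cgrad w (fst p) @. fst h)) (at p)"
   by (rule has_derivative_compose[OF has_derivative_fst[OF has_derivative_ident] sm_has_cgrad[OF sm(1)]])
  have d2: "((%p. f (snd p)) has_derivative (%h. cgrad f (snd p) @. snd h)) (at p)"
   by (rule has_derivative_compose[OF has_derivative_snd[OF has_derivative_ident] sm_has_cgrad[OF sm(2)]])
  have "(tens w f has_derivative (%h. (tens (cgrad w) f p, tens w (cgrad f) p) @. h)) (at p)"
   unfolding e by (rule has_derivative_eq_rhs[OF has_derivative_mult[OF d1 d2]]) (auto simp: tens_def inner_prod_def algebra_simps)
  then show "cgrad (tens w f) p = (tens (cgrad w) f p, tens w (cgrad f) p)" by (rule cgrad_unique)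
 qed
qed

text \<open>The product rule at the level of pairs: a tensor product together with its s-derivative
  and y-gradient.\<close>

definition ptens :: "(real => real * real) => ('b::euclidean_space => real * 'b) => real * 'b => real \<times> (real * 'b)" where
 "ptens om mu p = (tens (%s. fst (om s)) (%y. fst (mu y)) p, (tens (%s. snd (om s)) (%y. fst (mu y)) p, tens (%s. fst (om s)) (%y. snd (mu y)) p))"

lemma W_ptens:
 assumes w: "W J om" and m: "W S mu" shows "W (J \<times> S) (ptens om mu)"
proof -
 obtain f where f: "!!n. test_fun J (f n)" "l2lim (%n. tpair (f n)) om" using w unfolding W_def by blast
 obtain g where g: "!!n. test_fun S (g n)" "l2lim (%n. tpair (g n)) mu" using m unfolding W_def by blast
 have "l2lim (%n. ptens (tpair (f n)) (tpair (g n))) (ptens om mu)"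
  unfolding ptens_def[abs_def] by (intro l2lim_Pair l2lim_tens l2lim_fst l2lim_snd f g)
 moreover have "ptens (tpair (f n)) (tpair (g n)) = tpair (tens (f n) (g n))" for n
  by (auto simp: ptens_def tpair_def test_fun_tens(2)[OF f(1) g(1)])
 ultimately show ?thesis unfolding W_def using test_fun_tens(1)[OF f(1) g(1)] by (intro exI[of _ "%n. tens (f n) (g n)"]) auto
qed

definition Pr :: "('b::euclidean_space => real) => ('a::euclidean_space \<times> 'b => real) => 'a => real" where
 "Pr u f s = (LI y. u y * f (s, y))"

lemma Pr_borel [measurable (raw)]:
 assumes [measurable]: "u \<in> bm" "f \<in> bm" shows "Pr u f \<in> bm"
proof -
 have "(%p. u (snd p) * f p) \<in> bm" by measurable
 then have "(%p. u (snd p) * f p) \<in> borel_measurable (lborel \<Otimes>\<^sub>M lborel)" by (simp only: pair_borel)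
 then have "(%s. \<integral>y. u (snd (s, y)) * f (s, y) \<partial>lborel) \<in> borel_measurable lborel"
  by (intro lborel.borel_measurable_lebesgue_integral) (simp add: case_prod_unfold)
 then show ?thesis by (simp add: Pr_def[abs_def])
qed

lemma Pr_slice_bound: "sqi u ==> sqi (%y. f (s, y)) ==> (Pr u f s)~2 <= N2 u * N2 (%y. f (s, y))"
proof -
 assume s: "sqi u" "sqi (%y. f (s, y))"
 have "||Pr u f s|| <= sqrt (N2 u) * sqrt (N2 (%y. f (s, y)))" using CS_inner[OF s] by (simp add: Pr_def)
 then have "||Pr u f s||~2 <= (sqrt (N2 u) * sqrt (N2 (%y. f (s, y))))~2" by (rule power_mono) simp
 then show ?thesis by (simp add: power_mult_distrib)
qed

lemma sqi_Pr:
 fixes f :: "'a::euclidean_space \<times> 'b::euclidean_space => real"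
 assumes u: "sqi u" and f: "sqi f" shows "sqi (Pr u f)" "N2 (Pr u f) <= N2 u * N2 f"
proof -
 have [measurable]: "u \<in> bm" "f \<in> bm" using u f by (auto simp: sqi_def)
 have i: "intb (%s. N2 u * N2 (%y. f (s, y)))" using sqi_slice(2)[OF f] by simp
 have ae: "AL s. (norm (Pr u f s))~2 <= N2 u * N2 (%y. f (s, y))"
  using sqi_slice(1)[OF f] by eventually_elim (use Pr_slice_bound[OF u] in simp)
 have i2: "intb (%s. (norm (Pr u f s))~2)"
  by (rule bi_bound[OF i]) (use ae in \<open>auto elim: eventually_mono\<close>)
 then show "sqi (Pr u f)" by (simp add: sqi_def)
 have "N2 (Pr u f) <= (LI s. N2 u * N2 (%y. f (s, y)))" unfolding N2_def by (rule integral_mono_AE[OF i2 _ ae[unfolded N2_def]]) (use i in \<open>simp add: N2_def\<close>)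
 then show "N2 (Pr u f) <= N2 u * N2 f" using sqi_slice(3)[OF f] by simp
qed

lemma Pr_diff:
 assumes u: "sqi u" and f: "sqi f" "sqi g" shows "AL s. Pr u (%p. f p - g p) s = Pr u f s - Pr u g s"
 using sqi_slice(1)[OF f(1)] sqi_slice(1)[OF f(2)]
proof eventually_elim
 case (elim s)
 then show ?case using sqi_times[OF u elim(1)] sqi_times[OF u elim(2)] by (simp add: Pr_def right_diff_distrib)
qed

lemma l2lim_Pr:
 fixes f :: "'a::euclidean_space \<times> 'b::euclidean_space => real"
 assumes u: "sqi u" and l: "l2lim X f" shows "l2lim (%n. Pr u (X n)) (Pr u f)"
proof -
 have s: "sqi f" "!!n. sqi (X n)" using l by (auto simp: l2lim_def)
 have bd: "N2 (%s. Pr u (X n) s - Pr u f s) <= N2 u * N2 (%p. X n p - f p)" for n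
 proof -
  have "AL x. Pr u (X n) x - Pr u f x = Pr u (%p. X n p - f p) x" using Pr_diff[OF u s(2) s(1), of n] by eventually_elim simp
  moreover have "(%s. Pr u (X n) s - Pr u f s) \<in> bm"
   using sqi_Pr(1)[OF u s(1)] sqi_Pr(1)[OF u s(2)] by (intro borel_measurable_diff) (auto simp: sqi_def)
  ultimately have "N2 (%s. Pr u (X n) s - Pr u f s) = N2 (Pr u (%p. X n p - f p))"
   using sqi_AE_cong(2)[OF _ sqi_Pr(1)[OF u sqi_diff(1)[OF s(2) s(1)]]] by blast
  then show ?thesis using sqi_Pr(2)[OF u sqi_diff(1)[OF s(2) s(1)], of n] by simp
 qed
 have "(%n. N2 (%p. X n p - f p)) ~~> 0" using l by (simp add: l2lim_def)
 then have z: "(%n. N2 u * N2 (%p. X n p - f p)) ~~> 0" by (rule tendsto_mult_right_zero)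
 have "(%n. N2 (%s. Pr u (X n) s - Pr u f s)) ~~> 0"
  by (rule tendsto_sandwich[OF _ _ tendsto_const z]) (use bd in auto)
 then show ?thesis using sqi_Pr(1)[OF u s(1)] sqi_Pr(1)[OF u s(2)] by (simp add: l2lim_def)
qed

text \<open>Differentiation under the integral sign. The s-derivatives of ph are again smooth and
  vanish off the support of ph, so \<open>sm_realI\<close> applies to the projections of the
  iterated derivatives \<open>it k\<close>.\<close>

lemma Pr_test:
 fixes ph :: "real * 'b::euclidean_space => real"
 assumes ui: "intb u" and p: "test_fun (J \<times> S) ph"
 shows "test_fun J (Pr u ph)" "cgrad (Pr u ph) = Pr u (%p. fst (cgrad ph p))"
proof -
 have [measurable]: "u \<in> bm" using ui by simp
 define K where "K = tsupport ph"
 have K: "compact K" using test_funD(2)[OF p] by (simp add: K_def)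
 define good where "good ps \<longleftrightarrow> sm ps & (\<forall>p. p \<notin> K --> ps p = 0)" for ps :: "real * 'b => real"
 define ds where "ds ps p = cgrad ps p @. (1, 0)" for ps :: "real * 'b => real" and p
 have gds: "good (ds ps)" if g: "good ps" for ps
 proof -
  have "cgrad ps p = 0" if "p \<notin> K" for p
   by (rule cgrad_zero[of "- K"]) (use that g K in \<open>auto simp: good_def compact_imp_closed open_Compl\<close>)
  moreover have "sm (ds ps)" unfolding ds_def[abs_def] using g by (intro sm_cgrad_inner) (simp add: good_def)
  ultimately show ?thesis by (simp add: good_def ds_def)
 qed
 have der: "(Pr u ps has_real_derivative Pr u (ds ps) s) (at s)" if g: "good ps" for ps s
 proof -
  have smp: "sm ps" using g by (simp add: good_def)
  note [measurable] = sm_borel[OF smp]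
  have smd: "sm (ds ps)" using gds[OF g] by (simp add: good_def)
  note [measurable] = sm_borel[OF smd]
  obtain C where C: "0 <= C" "!!p. norm (ds ps p) <= C"
   using compact_support_bounded[OF sm_continuous[OF smd] K] gds[OF g] by (auto simp: good_def)
  obtain C' where C': "0 <= C'" "!!p. norm (ps p) <= C'"
   using compact_support_bounded[OF sm_continuous[OF smp] K] g by (auto simp: good_def)
  have d1: "((%t. ps (t, y)) has_real_derivative ds ps (t, y)) (at t)" for t y
  proof -
   have "((%t. ps (t, y)) has_derivative (%h. cgrad ps (t, y) @. (h, 0))) (at t)"
    by (rule has_derivative_compose[OF _ sm_has_cgrad[OF smp]]) (auto intro!: derivative_eq_intros)
   moreover have "cgrad ps (t, y) @. (h, 0) = ds ps (t, y) * h" for h by (simp add: ds_def inner_prod_def)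
   ultimately show ?thesis by (simp add: has_field_derivative_def)
  qed
  have lip: "||ps (a, y) - ps (b, y)|| <= C * ||a - b||" for a b y
   using field_differentiable_bound[of UNIV "%t. ps (t, y)" "%t. ds ps (t, y)" C a b] d1 C(2) by simp
  have iu: "intb (%y. u y * ps (t, y))" for t
  proof (rule bi_bound[of _ "%y. C' * u y"])
   show "AL y. norm (u y * ps (t, y)) <= norm (C' * u y)"
   proof (rule AE_I2)
    fix y
    have "||u y|| * ||ps (t, y)|| <= ||u y|| * C'" using C'(2)[of "(t, y)"] by (intro mult_left_mono) auto
    then show "norm (u y * ps (t, y)) <= norm (C' * u y)" using C'(1) by (simp add: abs_mult mult.commute)
   qed
  qed (use ui in auto)
  have "((%t. (Pr u ps t - Pr u ps s) / (t - s)) \<longlongrightarrow> Pr u (ds ps) s) (at s)"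
   unfolding tendsto_at_iff_sequentially
  proof (intro allI impI)
   fix X :: "nat => real" assume X: "\<forall>i. X i \<in> UNIV - {s}" "X ~~> s"
   have A: "(%n. \<integral>y. u y * ((ps (X n, y) - ps (s, y)) / (X n - s)) \<partial>lborel) ~~> (LI y. u y * ds ps (s, y))"
   proof (rule integral_dominated_convergence[where w="%y. C * ||u y||"])
    show "AL y. (%n. u y * ((ps (X n, y) - ps (s, y)) / (X n - s))) ~~> u y * ds ps (s, y)"
    proof (rule AE_I2)
     fix y
     have "((%t. (ps (t, y) - ps (s, y)) / (t - s)) \<longlongrightarrow> ds ps (s, y)) (at s)" using d1[of y s] by (simp add: has_field_derivative_iff)
     then have "(%n. (ps (X n, y) - ps (s, y)) / (X n - s)) ~~> ds ps (s, y)"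
      using X unfolding tendsto_at_iff_sequentially by (auto simp: o_def)
     then show "(%n. u y * ((ps (X n, y) - ps (s, y)) / (X n - s))) ~~> u y * ds ps (s, y)" by (intro tendsto_intros)
    qed
    show "AL y. norm (u y * ((ps (X n, y) - ps (s, y)) / (X n - s))) <= C * ||u y||" for n
    proof (rule AE_I2)
     fix y
     have "X n ~= s" using X(1) by auto
     then have "||(ps (X n, y) - ps (s, y)) / (X n - s)|| <= C" using lip[of "X n" y s] by (simp add: abs_divide field_simps)
     then have "||u y|| * ||(ps (X n, y) - ps (s, y)) / (X n - s)|| <= ||u y|| * C" by (rule mult_left_mono) simp
     then show "norm (u y * ((ps (X n, y) - ps (s, y)) / (X n - s))) <= C * ||u y||" by (simp only: real_norm_def abs_mult mult.commute)
    qed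
   qed (use ui in auto)
   have B: "(LI y. u y * ((ps (X n, y) - ps (s, y)) / (X n - s))) = (Pr u ps (X n) - Pr u ps s) / (X n - s)" for n
   proof -
    have e: "u y * ((ps (X n, y) - ps (s, y)) / (X n - s)) = (u y * ps (X n, y) - u y * ps (s, y)) / (X n - s)" for y by (simp add: right_diff_distrib)
    show ?thesis unfolding Pr_def e using iu[of "X n"] iu[of s] by simp
   qed
   show "((%t. (Pr u ps t - Pr u ps s) / (t - s)) \<circ> X) ~~> Pr u (ds ps) s"
    using A unfolding B o_def Pr_def[of u "ds ps"] .
  qed
  then show ?thesis by (simp add: has_field_derivative_iff)
 qed
 have gp: "good ph" using test_funD(1)[OF p] test_funD(4)[OF p] by (auto simp: good_def K_def)
 define it where "it k = (ds ^^ k) ph" for k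
 have git: "good (it k)" for k by (induction k) (auto simp: it_def gp gds)
 have "sm ((%k. Pr u (it k)) 0)"
  by (rule sm_realI[where A="%k. {Suc k}" and c="%k i. 1"]) (use der[OF git] in \<open>simp add: it_def\<close>)
 then have smP: "sm (Pr u ph)" by (simp add: it_def)
 show "test_fun J (Pr u ph)"
 proof (rule test_funI[OF smP])
  show "compact (fst ` K)" by (intro compact_continuous_image K continuous_intros)
  show "fst ` K \<subseteq> J" using test_funD(3)[OF p] by (auto simp: K_def)
  show "Pr u ph s = 0" if "s \<notin> fst ` K" for s
  proof -
   have "ph (s, y) = 0" for y using gp that by (force simp: good_def)
   then show ?thesis by (simp add: Pr_def)
  qed
 qed
 show "cgrad (Pr u ph) = Pr u (%p. fst (cgrad ph p))"
 proof
  fix s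
  have "cgrad (Pr u ph) s = Pr u (ds ph) s"
   by (rule cgrad_unique) (use der[OF gp, of s] in \<open>simp add: has_field_derivative_def\<close>)
  then show "cgrad (Pr u ph) s = Pr u (%p. fst (cgrad ph p)) s" by (simp add: ds_def[abs_def] inner_prod_def)
 qed
qed

lemma W_Pr:
 fixes Fi :: "real * 'b::euclidean_space => real \<times> (real * 'b)"
 assumes u: "sqi u" "intb u" and W: "W (J \<times> S) Fi"
 shows "W J (%s. (Pr u (%p. fst (Fi p)) s, Pr u (%p. fst (snd (Fi p))) s))"
proof -
 obtain f where f: "!!n. test_fun (J \<times> S) (f n)" "l2lim (%n. tpair (f n)) Fi" using W unfolding W_def by blast
 have "l2lim (%n s. (Pr u (%p. fst (tpair (f n) p)) s, Pr u (%p. fst (snd (tpair (f n) p))) s)) (%s. (Pr u (%p. fst (Fi p)) s, Pr u (%p. fst (snd (Fi p))) s))"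
  by (intro l2lim_Pair l2lim_Pr u l2lim_fst l2lim_snd f(2))
 moreover have "(%s. (Pr u (%p. fst (tpair (f n) p)) s, Pr u (%p. fst (snd (tpair (f n) p))) s)) = tpair (Pr u (f n))" for n
  using Pr_test(2)[OF u(2) f(1)] by (simp add: tpair_def[abs_def])
 ultimately show ?thesis unfolding W_def using Pr_test(1)[OF u(2) f(1)] by (intro exI[of _ "%n. Pr u (f n)"]) auto
qed

abbreviation vv :: "(real * real \<times> real => real * real \<times> real * real) => real * real \<times> real => real" where
 "vv Fi p \<equiv> fst (Fi p)"
abbreviation gs :: "(real * real \<times> real => real * real \<times> real * real) => real * real \<times> real => real" where
 "gs Fi p \<equiv> fst (snd (Fi p))"
abbreviation gy :: "(real * real \<times> real => real * real \<times> real * real) => real * real \<times> real => real * real" where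
 "gy Fi p \<equiv> snd (snd (Fi p))"

lemma sqi_real_sq: "sqi (f :: _ => real) ==> intb (%x. (f x)~2)"
 by (simp add: sqi_def)

lemma N2_real: "N2 (f :: _ => real) = (LI x. (f x)~2)"
 by (simp add: N2_def)

lemma sqi_bdd_scale:
 fixes f :: "'a::euclidean_space => 'b::euclidean_space"
 assumes f: "sqi f" and m[measurable]: "m \<in> bm" and b: "AL x. f x = 0 | ||m x|| <= C"
 shows "sqi (%x. m x *R f x)" "N2 (%x. m x *R f x) <= C~2 * N2 f"
proof -
 have [measurable]: "f \<in> bm" using f by (simp add: sqi_def)
 have "AL x. norm (m x *R f x) <= C * norm (f x)" using b by eventually_elim (auto intro: mult_right_mono)
 from sqi_bound[OF _ f this] show "sqi (%x. m x *R f x)" "N2 (%x. m x *R f x) <= C~2 * N2 f" by auto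
qed

section \<open>The harmonic-oscillator bound\<close>

text \<open>Bounded substitutes for the multiplier s of the virial identity and for the well s^2, so
  that all integrals are finite without weights. What makes the pair work is th1^2 <= th2 and th1'
  >= 1 - 3 th2.\<close>

definition th1 :: "real => real" where "th1 s = s / (1 + s~2)"
definition th2 :: "real => real" where "th2 s = s~2 / (1 + s~2)"
definition th1' :: "real => real" where "th1' s = (1 - s~2) / (1 + s~2)~2"

lemma th_facts:
 shows "0 <= th2 s" "th2 s <= 1" "(th1 s)~2 <= th2 s" "1 - 3 * th2 s <= th1' s" "||th1 s|| <= 1" "||th1' s|| <= 1"
  "(th1 has_real_derivative th1' s) (at s)"
proof -
 define x where "x = s~2"
 have x: "x >= 0" by (simp add: x_def)
 show t0: "0 <= th2 s" by (simp add: th2_def)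
 show t1: "th2 s <= 1" unfolding th2_def x_def[symmetric] using x by simp
 have "(th1 s)~2 = x / (1 + x)~2" by (simp add: th1_def x_def power_divide)
 also have "... <= x / (1 + x)" using x by (intro divide_left_mono) (auto simp: power2_eq_square intro!: mult_pos_pos add_pos_nonneg)
 finally show t2: "(th1 s)~2 <= th2 s" by (simp add: th2_def x_def)
 have "1 - 3 * (x / (1 + x)) = (1 - 2 * x) / (1 + x)" using x by (simp add: field_simps)
 also have "... = (1 - 2 * x) * (1 + x) / (1 + x)~2" using x by (simp add: power2_eq_square)
 also have "... <= (1 - x) / (1 + x)~2" using x by (intro divide_right_mono) (auto simp: algebra_simps)
 finally show "1 - 3 * th2 s <= th1' s" by (simp add: th2_def th1'_def x_def)
 have "(th1 s)~2 <= 1~2" using t1 t2 by simp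
 then show "||th1 s|| <= 1" using abs_le_square_iff[of "th1 s" 1] by simp
 have "||1 - x|| <= (1 + x)~2" using x by (auto simp: abs_le_iff power2_eq_square algebra_simps)
 then show "||th1' s|| <= 1" unfolding th1'_def x_def[symmetric] using x by (simp add: abs_divide)
 have "1 + s~2 ~= 0" using x by (simp add: x_def add_nonneg_eq_0_iff)
 then show "(th1 has_real_derivative th1' s) (at s)" unfolding th1_def[abs_def] th1'_def
  by (auto intro!: derivative_eq_intros simp: power2_eq_square algebra_simps)
qed

lemma th_continuous: "continuous_on A th1" "continuous_on A th2" "continuous_on A th1'"
proof -
 have "1 + s~2 ~= 0" for s :: real by (simp add: add_nonneg_eq_0_iff)
 then show "continuous_on A th1" "continuous_on A th2" "continuous_on A th1'"
  unfolding th1_def[abs_def] th2_def[abs_def] th1'_def[abs_def] by (auto intro!: continuous_intros)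
qed

lemma th_borel [measurable]: "th1 \<in> bm" "th2 \<in> bm" "th1' \<in> bm"
 by (intro borel_measurable_continuous_onI th_continuous)+

lemma virial_identity:
 assumes W: "W U Fi"
 shows "(LI p. th1' (fst p) * (vv Fi p)~2) = - 2 * (LI p. th1 (fst p) * (vv Fi p * gs Fi p))"
proof -
 obtain f where f: "!!n. test_fun U (f n)" "l2lim (%n. tpair (f n)) Fi" using W unfolding W_def by blast
 have l1: "l2lim (%n x. f n x) (%x. fst (Fi x))" using l2lim_fst[OF f(2)] by (simp add: tpair_def)
 have l2: "l2lim (%n x. fst (cgrad (f n) x)) (%x. gs Fi x)" using l2lim_fst[OF l2lim_snd[OF f(2)]] by (simp add: tpair_def)
 have m1: "l2lim (%n p. th1' (fst p) *R f n p) (%p. th1' (fst p) *R vv Fi p)"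
  by (rule l2lim_bdd_mult[OF l1, where C=1]) (use th_facts in auto)
 have m2: "l2lim (%n p. th1 (fst p) *R f n p) (%p. th1 (fst p) *R vv Fi p)"
  by (rule l2lim_bdd_mult[OF l1, where C=1]) (use th_facts in auto)
 have e: "(LI p. (th1' (fst p) *R f n p) * f n p) + 2 * (LI p. (th1 (fst p) *R f n p) * fst (cgrad (f n) p)) = 0" for n
 proof -
  have sm: "sm (f n)" using test_funD(1)[OF f(1)] .
  let ?g = "%p. (th1' (fst p) * (f n p * f n p)) *R (1, 0) + (2 * th1 (fst p) * f n p) *R cgrad (f n) p"
  have d1: "((%p. th1 (fst p)) has_derivative (%h. th1' (fst p) * fst h)) (at p)" for p :: "real * real \<times> real"
   by (rule has_derivative_compose[OF has_derivative_fst[OF has_derivative_ident] th_facts(7)[unfolded has_field_derivative_def]])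
  have d: "((%p. th1 (fst p) * (f n p * f n p)) has_derivative (%h. ?g p @. h)) (at p)" for p
   by (rule has_derivative_eq_rhs[OF has_derivative_mult[OF d1 has_derivative_mult[OF sm_has_cgrad[OF sm] sm_has_cgrad[OF sm]]]])
    (auto simp: fun_eq_iff inner_add_left inner_prod_def algebra_simps)
  have c: "continuous_on UNIV ?g"
   by (intro continuous_intros sm_continuous[OF sm] sm_cgrad_continuous[OF sm] continuous_on_compose2[OF th_continuous(1)] continuous_on_compose2[OF th_continuous(3)]) auto
  have "(LI p. ?g p @. (1, 0)) = 0"
   by (rule integral_deriv_compact_support[OF d c test_funD(2)[OF f(1)[of n]]]) (use test_funD(4)[OF f(1)] in auto)
  also have "(%p. ?g p @. (1, 0)) = (%p. (th1' (fst p) *R f n p) * f n p + 2 * ((th1 (fst p) *R f n p) * fst (cgrad (f n) p)))"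
   by (auto simp: fun_eq_iff inner_add_left inner_prod_def)
  also have "(LI p. (th1' (fst p) *R f n p) * f n p + 2 * ((th1 (fst p) *R f n p) * fst (cgrad (f n) p))) =
   (LI p. (th1' (fst p) *R f n p) * f n p) + (LI p. 2 * ((th1 (fst p) *R f n p) * fst (cgrad (f n) p)))"
   using m1 m2 l1 l2 by (intro bl_add integrable_mult_right sqi_times) (auto simp: l2lim_def)
  finally show ?thesis by simp
 qed
 have "(%n. (LI p. (th1' (fst p) *R f n p) * f n p) + 2 * (LI p. (th1 (fst p) *R f n p) * fst (cgrad (f n) p)))
  ~~> (LI p. (th1' (fst p) *R vv Fi p) * vv Fi p) + 2 * (LI p. (th1 (fst p) *R vv Fi p) * gs Fi p)"
  by (intro tendsto_intros l2lim_times m1 m2 l1 l2)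
 then have "0 = (LI p. (th1' (fst p) *R vv Fi p) * vv Fi p) + 2 * (LI p. (th1 (fst p) *R vv Fi p) * gs Fi p)"
  unfolding e by (simp only: LIMSEQ_const_iff)
 then show ?thesis by (simp add: power2_eq_square mult.assoc)
qed

text \<open>Virial argument: 1 is at most th1' + 3 th2, the part with th1' is integrated by parts,
  and Young's inequality with parameter eps balances kinetic against potential energy. Dividing by
  eps shows the ground-state energy 1/eps of an oscillator with potential eps^(-2) th2.\<close>

lemma oscillator_bound:
 assumes W: "W U Fi" and e: "0 < eps" "eps <= 1"
 shows "N2 (vv Fi) <= eps * N2 (gs Fi) + 4 / eps * (LI p. th2 (fst p) * (vv Fi p)~2)"
proof -
 have s: "sqi (vv Fi)" "sqi (gs Fi)" using W_sqi(2)[OF W] sqi_fst(1)[OF W_sqi(3)[OF W]] by auto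
 have s1: "sqi (%p. th1 (fst p) *R vv Fi p)" "sqi (%p. th1' (fst p) *R vv Fi p)" "sqi (%p. th2 (fst p) *R vv Fi p)"
  by (rule sqi_bdd_scale(1)[OF s(1), where C=1]; use th_facts in auto)+
 have i1: "intb (%p. th1 (fst p) * (vv Fi p * gs Fi p))" using sqi_times[OF s1(1) s(2)] by (simp add: mult.assoc)
 have i2: "intb (%p. th1' (fst p) * (vv Fi p)~2)" using sqi_times[OF s1(2) s(1)] by (simp add: mult.assoc power2_eq_square)
 have i3: "intb (%p. th2 (fst p) * (vv Fi p)~2)" using sqi_times[OF s1(3) s(1)] by (simp add: mult.assoc power2_eq_square)
 define I where "I = (LI p. th2 (fst p) * (vv Fi p)~2)"
 have I0: "I >= 0" unfolding I_def using th_facts by (intro integral_nonneg_AE) auto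
 have "N2 (vv Fi) <= (LI p. th1' (fst p) * (vv Fi p)~2 + 3 * (th2 (fst p) * (vv Fi p)~2))" unfolding N2_real
 proof (rule integral_mono)
  fix p :: "real * real \<times> real"
  have "1 * (vv Fi p)~2 <= (th1' (fst p) + 3 * th2 (fst p)) * (vv Fi p)~2" using th_facts(4)[of "fst p"] by (intro mult_right_mono) auto
  then show "(vv Fi p)~2 <= th1' (fst p) * (vv Fi p)~2 + 3 * (th2 (fst p) * (vv Fi p)~2)" by (simp add: algebra_simps)
 qed (use sqi_real_sq[OF s(1)] i2 i3 in auto)
 also have "... = (LI p. - 2 * (th1 (fst p) * (vv Fi p * gs Fi p))) + 3 * I" unfolding I_def using i2 i3 virial_identity[OF W] by simp
 also have "(LI p. - 2 * (th1 (fst p) * (vv Fi p * gs Fi p))) <= (LI p. eps * (gs Fi p)~2 + (1/eps) * (th2 (fst p) * (vv Fi p)~2))"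
 proof (rule integral_mono)
  show "intb (%p. - 2 * (th1 (fst p) * (vv Fi p * gs Fi p)))" using i1 by (intro integrable_mult_right)
  show "intb (%p. eps * (gs Fi p)~2 + (1/eps) * (th2 (fst p) * (vv Fi p)~2))" using i3 sqi_real_sq[OF s(2)] by simp
  fix p :: "real * real \<times> real"
  have "0 <= (eps * gs Fi p + th1 (fst p) * vv Fi p)~2 / eps" using e by simp
  also have "... = eps * (gs Fi p)~2 + (1/eps) * ((th1 (fst p))~2 * (vv Fi p)~2) + 2 * (th1 (fst p) * (vv Fi p * gs Fi p))"
   using e by (simp add: power2_sum power_mult_distrib field_simps power2_eq_square)
  also have "(1/eps) * ((th1 (fst p))~2 * (vv Fi p)~2) <= (1/eps) * (th2 (fst p) * (vv Fi p)~2)"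
   using e th_facts(3)[of "fst p"] by (intro mult_left_mono mult_right_mono) auto
  finally show "- 2 * (th1 (fst p) * (vv Fi p * gs Fi p)) <= eps * (gs Fi p)~2 + (1/eps) * (th2 (fst p) * (vv Fi p)~2)" by simp
 qed
 also have "... = eps * N2 (gs Fi) + (1/eps) * I" unfolding N2_real I_def using i3 sqi_real_sq[OF s(2)] by simp
 also have "eps * N2 (gs Fi) + (1/eps) * I + 3 * I <= eps * N2 (gs Fi) + (4/eps) * I"
 proof -
  have "3 * I <= (3 / eps) * I" using e I0 by (intro mult_right_mono) (auto simp: field_simps)
  moreover have "(4/eps) * I = (1/eps) * I + (3/eps) * I" by (simp add: add_divide_distrib[symmetric] distrib_right[symmetric])
  ultimately show ?thesis by linarith
 qed
 finally show ?thesis by (simp add: I_def)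
qed

section \<open>The form on the tube and its coercivity\<close>

text \<open>The geometry reduced to coefficients on the whole line. In the application H is 1/h^2,
  rho is h'/h, sig is \<tau> + \<alpha>' and ev is h k z_alpha. H has a positive lower bound but no
  upper bound; \<open>H_comp\<close> limits its variation over unit distances, and the bound on H
  |ev|^2 expresses that k^2 is bounded.\<close>

locale tube = cross_section S lam0 mu0 for S lam0 mu0 +
 fixes J :: "real set" and H rho sig :: "real => real" and ev :: "real => real * real" and M K ka L :: real
 assumes J_open: "open J"
  and coeff_borel [measurable]: "H \<in> bm" "rho \<in> bm" "sig \<in> bm" "ev \<in> bm"
  and M_pos: "0 < M" and H_low: "!!s. 1 / M~2 <= H s" and K_nonneg: "0 <= K"
  and coeff_bound: "!!s. ||rho s|| <= K" "!!s. ||sig s|| <= K" "!!s. norm (ev s) <= K" "!!s. H s * (norm (ev s))~2 <= K"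
  and ka_pos: "0 < ka" and well: "!!s. s \<in> J ==> ka * th2 s <= lam0 * (H s - 1 / M~2)"
  and H_comp: "!!s t. ||s - t|| <= 1 ==> H s <= L * H t"
begin

definition "sH p = sqrt (H (fst p))" for p :: "real * real \<times> real"
definition "Xp Fi p = - vv Fi p * rho (fst p) + sig (fst p) * (gy Fi p @. Rrot (snd p)) - rho (fst p) * (gy Fi p @. snd p)"
definition "Dp Fi p = gs Fi p + Xp Fi p"
definition "bt eps p = 1 - eps * (ev (fst p) @. snd p)" for p :: "real * real \<times> real"
definition "gden eps c Fi Gi p = Dp Fi p * Dp Gi p + bt eps p * H (fst p) / eps~2 * (gy Fi p @. gy Gi p)
 - lam0 * bt eps p / (eps~2 * M~2) * (vv Fi p * vv Gi p) + c * (vv Fi p * vv Gi p)"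
definition "gq eps c Fi Gi = (LI p. gden eps c Fi Gi p)"
definition "V s = lam0 * (H s - 1 / M~2)"
text \<open>The finite-energy elements: for unbounded H, membership in \<open>W\<close> does not
  make the integral in \<open>gq\<close> converge.\<close>

definition "Q Fi \<longleftrightarrow> W (J \<times> S) Fi & sqi (%p. sH p *R gy Fi p)"

lemma H_pos: "0 < H s" using H_low[of s] M_pos by (metis less_le_trans zero_less_divide_1_iff zero_less_power)

lemma sH_sq: "(sH p)~2 = H (fst p)" using H_pos[of "fst p"] by (simp add: sH_def)

lemma sH_pos: "0 < sH p" using H_pos[of "fst p"] by (simp add: sH_def)

lemma Rrot_borel [measurable]: "Rrot \<in> bm"
 unfolding Rrot_def[abs_def] by (intro borel_measurable_continuous_onI continuous_intros)

lemma norm_Rrot: "norm (Rrot y) = norm y"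
 by (cases y) (simp add: Rrot_def norm_Pair add.commute)

lemma sH_borel [measurable]: "sH \<in> bm" unfolding sH_def[abs_def] by measurable

lemma bt_borel [measurable]: "bt eps \<in> bm" unfolding bt_def[abs_def] by measurable

lemma V_borel [measurable]: "V \<in> bm" unfolding V_def[abs_def] by measurable

lemma V_nonneg: "0 <= V s" using H_low[of s] lam0_pos by (simp add: V_def)

lemma W_out: "W (J \<times> S) Fi ==> AL p. fst p \<notin> J | snd p \<notin> S --> Fi p = 0"
 using W_outside[of "J \<times> S" Fi] by (auto elim!: eventually_mono simp: mem_Times_iff)

lemma W_parts:
 assumes "W (J \<times> S) Fi"
 shows "sqi (vv Fi)" "sqi (gs Fi)" "sqi (gy Fi)" "Fi \<in> bm"
 using W_sqi(2)[OF assms] sqi_fst(1)[OF W_sqi(3)[OF assms]] sqi_snd(1)[OF W_sqi(3)[OF assms]] W_borel[OF assms] by auto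

lemma Q_W: "Q Fi ==> W (J \<times> S) Fi" and Q_gy: "Q Fi ==> sqi (%p. sH p *R gy Fi p)"
 by (auto simp: Q_def)

lemma bt_bound: assumes "snd p \<in> S" "0 <= eps" shows "||bt eps p - 1|| <= eps * (K * SR)"
proof -
 have "||ev (fst p) @. snd p|| <= K * SR"
  using order_trans[OF Cauchy_Schwarz_ineq2 mult_mono[OF coeff_bound(3) SR(2)[OF assms(1)] K_nonneg norm_ge_zero]] .
 then have "eps * ||ev (fst p) @. snd p|| <= eps * (K * SR)" using assms(2) by (rule mult_left_mono)
 then show ?thesis using assms(2) by (simp add: bt_def abs_mult)
qed

definition "CX = 4 * (K * (1 + 2 * SR))~2"

lemma Xp_bound:
 assumes "snd p \<in> S" shows "||Xp Fi p|| <= K * (1 + 2 * SR) * ( ||vv Fi p|| + norm (gy Fi p))"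
proof -
 have R: "||gy Fi p @. snd p|| <= norm (gy Fi p) * SR" "||gy Fi p @. Rrot (snd p)|| <= norm (gy Fi p) * SR"
  using order_trans[OF Cauchy_Schwarz_ineq2 mult_left_mono[OF SR(2)[OF assms] norm_ge_zero]]
   order_trans[OF Cauchy_Schwarz_ineq2, of _ "Rrot (snd p)"] mult_left_mono[OF SR(2)[OF assms] norm_ge_zero[of "gy Fi p"]] by (auto simp: norm_Rrot)
 have "||Xp Fi p|| <= ||vv Fi p|| * ||rho (fst p)|| + ||sig (fst p)|| * ||gy Fi p @. Rrot (snd p)|| + ||rho (fst p)|| * ||gy Fi p @. snd p||"
  unfolding Xp_def abs_mult[symmetric] by linarith
 also have "... <= ||vv Fi p|| * K + K * (norm (gy Fi p) * SR) + K * (norm (gy Fi p) * SR)"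
  by (intro add_mono mult_mono coeff_bound R K_nonneg) auto
 also have "... <= K * (1 + 2 * SR) * ( ||vv Fi p|| + norm (gy Fi p))"
 proof -
  have "0 <= K * (2 * SR) * ||vv Fi p|| + K * norm (gy Fi p)" using K_nonneg SR(1) by (intro add_nonneg_nonneg mult_nonneg_nonneg) auto
  then show ?thesis by (simp add: algebra_simps)
 qed
 finally show ?thesis .
qed

lemma Xp_sqi:
 assumes W: "W (J \<times> S) Fi" shows "sqi (Xp Fi)" "N2 (Xp Fi) <= CX * (N2 (vv Fi) + N2 (gy Fi))"
proof -
 note s = W_parts[OF W] note [measurable] = s(4)
 have Xm: "Xp Fi \<in> bm" unfolding Xp_def[abs_def] by measurable
 have C0: "0 <= K * (1 + 2 * SR)" using K_nonneg SR(1) by simp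
 have ae: "AL p. norm (Xp Fi p) <= 2 * (K * (1 + 2 * SR)) * norm (vv Fi p, gy Fi p)" using W_out[OF W]
 proof eventually_elim
  case (elim p)
  show ?case
  proof (cases "snd p \<in> S")
   case True
   have "||vv Fi p|| + norm (gy Fi p) <= 2 * norm (vv Fi p, gy Fi p)"
    using norm_fst_le[of "vv Fi p" "gy Fi p"] norm_snd_le[of "gy Fi p" "vv Fi p"] by simp
   then have "K * (1 + 2 * SR) * ( ||vv Fi p|| + norm (gy Fi p)) <= K * (1 + 2 * SR) * (2 * norm (vv Fi p, gy Fi p))" using C0 by (rule mult_left_mono)
   then show ?thesis using Xp_bound[OF True, of Fi] by simp
  next
   case False then show ?thesis using elim C0 by (simp add: Xp_def)
  qed
 qed
 have sp: "sqi (%p. (vv Fi p, gy Fi p))" "N2 (%p. (vv Fi p, gy Fi p)) = N2 (vv Fi) + N2 (gy Fi)" using sqi_Pair[OF s(1) s(3)] by auto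
 show "sqi (Xp Fi)" by (rule sqi_bound(1)[OF Xm sp(1) ae])
 show "N2 (Xp Fi) <= CX * (N2 (vv Fi) + N2 (gy Fi))" using sqi_bound(2)[OF Xm sp(1) ae] by (simp add: sp(2) CX_def power_mult_distrib)
qed

lemma Dp_sqi: assumes W: "W (J \<times> S) Fi" shows "sqi (Dp Fi)"
 using sqi_add(1)[OF W_parts(2)[OF W] Xp_sqi(1)[OF W]] by (simp add: Dp_def[abs_def])

definition "Pw Fi = Pr u0 (vv Fi)"

lemma N2_u0: "N2 u0 = 1" using nrm by (simp add: u0_def[abs_def])

lemma slice_facts:
 assumes W: "W (J \<times> S) Fi"
 shows "AL s. W S (%y. (vv Fi (s, y), gy Fi (s, y))) & sqi (%y. vv Fi (s, y)) & sqi (%y. gy Fi (s, y)) &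
  (Pw Fi s)~2 <= N2 (%y. vv Fi (s, y)) & lam0 * N2 (%y. vv Fi (s, y)) <= N2 (%y. gy Fi (s, y))"
 using W_slice[OF W]
proof eventually_elim
 case (elim s)
 have sv: "sqi (%y. vv Fi (s, y))" "sqi (%y. gy Fi (s, y))" using W_sqi(2,3)[OF elim] by auto
 then show ?case using elim energy_nonneg[OF elim] Pr_slice_bound[OF u0_sqi, where f="vv Fi" and s=s] by (simp add: N2_u0 Pw_def)
qed

lemma Pw_sqi: assumes W: "W (J \<times> S) Fi" shows "sqi (Pw Fi)" "N2 (Pw Fi) <= N2 (vv Fi)"
 using sqi_Pr[OF u0_sqi W_parts(1)[OF W]] by (auto simp: Pw_def N2_u0)

text \<open>The weight depends on s only, so a slicewise inequality survives multiplication by H and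
  integration.\<close>

lemma weighted_slices:
 fixes f :: "real * real \<times> real => 'b::euclidean_space" and g :: "real * real \<times> real => 'c::euclidean_space"
 assumes f[measurable]: "f \<in> bm" and g: "sqi (%p. sH p *R g p)"
  and b: "AL s. sqi (%y. f (s, y)) & N2 (%y. f (s, y)) <= C * N2 (%y. g (s, y)) & sqi (%y. g (s, y))"
 shows "sqi (%p. sH p *R f p)" "N2 (%p. sH p *R f p) <= C * N2 (%p. sH p *R g p)"
proof -
 have sHs: "sH (s, y) = sqrt (H s)" for s y by (simp add: sH_def)
 have "AL s. sqi (%y. sH (s, y) *R g (s, y)) --> sqi (%y. sH (s, y) *R f (s, y)) &
  N2 (%y. sH (s, y) *R f (s, y)) <= C * N2 (%y. sH (s, y) *R g (s, y))" using b
 proof eventually_elim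
  case (elim s)
  have "H s * N2 (%y. f (s, y)) <= H s * (C * N2 (%y. g (s, y)))" using elim H_pos[of s] by (intro mult_left_mono) auto
  then show ?case using sqi_scale[of "%y. f (s, y)" "sqrt (H s)"] sqi_scale[of "%y. g (s, y)" "sqrt (H s)"] elim H_pos[of s]
   by (simp add: sHs mult.left_commute)
 qed
 from slice_compare[OF _ g this] show "sqi (%p. sH p *R f p)" "N2 (%p. sH p *R f p) <= C * N2 (%p. sH p *R g p)" by auto
qed

text \<open>On almost every slice lam0 N2 v is at most N2 of the y-gradient, hence the weighted
  gradient also controls the weighted function.\<close>

lemma Q_v: assumes Q: "Q Fi" shows "sqi (%p. sH p *R vv Fi p)" "N2 (%p. sH p *R vv Fi p) <= 1 / lam0 * N2 (%p. sH p *R gy Fi p)"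
proof -
 note [measurable] = W_parts(4)[OF Q_W[OF Q]]
 have "AL s. sqi (%y. vv Fi (s, y)) & N2 (%y. vv Fi (s, y)) <= 1 / lam0 * N2 (%y. gy Fi (s, y)) & sqi (%y. gy Fi (s, y))"
  using slice_facts[OF Q_W[OF Q]] by eventually_elim (use lam0_pos in \<open>auto simp: field_simps\<close>)
 from weighted_slices[OF _ Q_gy[OF Q] this] show "sqi (%p. sH p *R vv Fi p)" "N2 (%p. sH p *R vv Fi p) <= 1 / lam0 * N2 (%p. sH p *R gy Fi p)" by auto
qed

lemma tens_Pw_weighted:
 fixes q :: "real * real => 'b::euclidean_space"
 assumes Q: "Q Fi" and q: "sqi q"
 shows "sqi (%p. sH p *R tens (Pw Fi) q p)" "N2 (%p. sH p *R tens (Pw Fi) q p) <= N2 q * N2 (%p. sH p *R vv Fi p)"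
proof -
 have [measurable]: "q \<in> bm" "Pw Fi \<in> bm" using q Pw_sqi(1)[OF Q_W[OF Q]] by (auto simp: sqi_def)
 have "AL s. sqi (%y. tens (Pw Fi) q (s, y)) & N2 (%y. tens (Pw Fi) q (s, y)) <= N2 q * N2 (%y. vv Fi (s, y)) & sqi (%y. vv Fi (s, y))"
  using slice_facts[OF Q_W[OF Q]]
 proof eventually_elim
  case (elim s)
  have "(Pw Fi s)~2 * N2 q <= N2 (%y. vv Fi (s, y)) * N2 q" using elim by (intro mult_right_mono) auto
  then show ?case using sqi_scale[OF q, of "Pw Fi s"] elim by (simp add: tens_def mult.commute)
 qed
 from weighted_slices[OF _ Q_v(1)[OF Q] this] show "sqi (%p. sH p *R tens (Pw Fi) q p)" "N2 (%p. sH p *R tens (Pw Fi) q p) <= N2 q * N2 (%p. sH p *R vv Fi p)" by auto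
qed

text \<open>The y-gradient of the component orthogonal to u0 on each slice.\<close>

definition "gyp Fi p = gy Fi p - tens (Pw Fi) p0 p"
definition "En Fi = N2 (%p. sH p *R gyp Fi p)"

lemma gyp_sqi: assumes Q: "Q Fi" shows "sqi (%p. sH p *R gyp Fi p)"
 using sqi_diff(1)[OF Q_gy[OF Q] tens_Pw_weighted(1)[OF Q p0_sqi]] by (simp add: gyp_def[abs_def] scaleR_diff_right)

lemma unweight:
 fixes f :: "real * real \<times> real => 'b::euclidean_space"
 assumes f[measurable]: "f \<in> bm" and s: "sqi (%p. sH p *R f p)" shows "sqi f" "N2 f <= M~2 * N2 (%p. sH p *R f p)"
proof -
 have "1 / M <= sH p" for p
 proof -
  have "sqrt (1 / M~2) <= sH p" unfolding sH_def by (rule real_sqrt_le_mono[OF H_low])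
  then show ?thesis using M_pos by (simp add: real_sqrt_divide)
 qed
 then have "norm (f p) <= M * norm (sH p *R f p)" for p
  using mult_right_mono[of "1 / M" "sH p" "norm (f p)"] M_pos sH_pos[of p] by (simp add: field_simps)
 then show "sqi f" "N2 f <= M~2 * N2 (%p. sH p *R f p)" using sqi_bound[OF f s, of M] by auto
qed

lemma gy_split: assumes Q: "Q Fi" shows "N2 (gy Fi) <= 2 * M~2 * En Fi + 2 * lam0 * N2 (vv Fi)"
proof -
 note W = Q_W[OF Q] note [measurable] = W_parts(4)[OF W]
 have [measurable]: "Pw Fi \<in> bm" using Pw_sqi(1)[OF W] by (auto simp: sqi_def)
 have gm: "gyp Fi \<in> bm" unfolding gyp_def[abs_def] by measurable
 note u = unweight[OF gm gyp_sqi[OF Q]]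
 have "N2 (%p. gyp Fi p + tens (Pw Fi) p0 p) <= 2 * N2 (gyp Fi) + 2 * N2 (tens (Pw Fi) p0)"
  by (rule sqi_add(2)[OF u(1) sqi_tens(1)[OF Pw_sqi(1)[OF W] p0_sqi]])
 moreover have "N2 (tens (Pw Fi) p0) <= lam0 * N2 (vv Fi)"
  unfolding sqi_tens(2)[OF Pw_sqi(1)[OF W] p0_sqi] N2_p0 using mult_right_mono[OF Pw_sqi(2)[OF W], of lam0] lam0_pos by (simp add: mult.commute)
 moreover have "N2 (%p. gyp Fi p + tens (Pw Fi) p0 p) = N2 (gy Fi)" by (simp add: gyp_def)
 moreover have "N2 (gyp Fi) <= M~2 * En Fi" using u(2) by (simp only: En_def)
 ultimately show ?thesis by linarith
qed

definition "BV Fi = (LI p. V (fst p) * (vv Fi p)~2)"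

lemma BV_int: assumes Q: "Q Fi" shows "intb (%p. V (fst p) * (vv Fi p)~2)"
  "lam0 * N2 (%p. sH p *R vv Fi p) = BV Fi + lam0 / M~2 * N2 (vv Fi)" "0 <= BV Fi"
proof -
 have i1: "intb (%p. H (fst p) * (vv Fi p)~2)" using sqi_real_sq[OF Q_v(1)[OF Q, unfolded real_scaleR_def]] by (simp add: power_mult_distrib sH_sq)
 have i2: "intb (%p. (vv Fi p)~2)" by (rule sqi_real_sq[OF W_parts(1)[OF Q_W[OF Q]]])
 have e: "V (fst p) * (vv Fi p)~2 = lam0 * (H (fst p) * (vv Fi p)~2) - lam0 / M~2 * (vv Fi p)~2" for p by (simp add: V_def algebra_simps)
 show "intb (%p. V (fst p) * (vv Fi p)~2)" unfolding e using i1 i2 by simp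
 have "BV Fi = lam0 * (LI p. H (fst p) * (vv Fi p)~2) - lam0 / M~2 * N2 (vv Fi)"
  unfolding BV_def e N2_real using i1 i2 by simp
 moreover have "N2 (%p. sH p *R vv Fi p) = (LI p. H (fst p) * (vv Fi p)~2)" by (simp add: N2_real power_mult_distrib sH_sq)
 ultimately show "lam0 * N2 (%p. sH p *R vv Fi p) = BV Fi + lam0 / M~2 * N2 (vv Fi)" by simp
 show "0 <= BV Fi" unfolding BV_def using V_nonneg by (intro integral_nonneg_AE) auto
qed

lemma sHgy_split: assumes Q: "Q Fi" shows "N2 (%p. sH p *R gy Fi p) <= 2 * En Fi + 2 * BV Fi + 2 * lam0 / M~2 * N2 (vv Fi)"
proof -
 have "N2 (%p. sH p *R gyp Fi p + sH p *R tens (Pw Fi) p0 p) <= 2 * En Fi + 2 * N2 (%p. sH p *R tens (Pw Fi) p0 p)"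
  unfolding En_def by (rule sqi_add(2)[OF gyp_sqi[OF Q] tens_Pw_weighted(1)[OF Q p0_sqi]])
 moreover have "N2 (%p. sH p *R tens (Pw Fi) p0 p) <= BV Fi + lam0 / M~2 * N2 (vv Fi)"
  using tens_Pw_weighted(2)[OF Q p0_sqi] BV_int(2)[OF Q] by (simp add: N2_p0)
 ultimately show ?thesis by (simp add: gyp_def scaleR_diff_right[symmetric] scaleR_add_right[symmetric])
qed

end

context tube
begin

text \<open>Weaker than finite energy of both: one factor may have infinite energy if the other
  compensates, as elements with compact support in s do.\<close>

definition "pairI Fi Gi \<longleftrightarrow> W (J \<times> S) Fi & W (J \<times> S) Gi & intb (%p. H (fst p) * (norm (gy Fi p) * norm (gy Gi p)))"

lemma pairI_sym: "pairI Fi Gi ==> pairI Gi Fi"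
 by (simp add: pairI_def mult.commute)

lemma pairI_Q: assumes "Q Fi" "Q Gi" shows "pairI Fi Gi"
proof -
 have "intb (%p. norm (sH p *R gy Fi p) * norm (sH p *R gy Gi p))" by (rule CS_norm(1)[OF Q_gy[OF assms(1)] Q_gy[OF assms(2)]])
 moreover have "(%p. norm (sH p *R gy Fi p) * norm (sH p *R gy Gi p)) = (%p. H (fst p) * (norm (gy Fi p) * norm (gy Gi p)))"
 proof
  fix p
  have "norm (sH p *R gy Fi p) * norm (sH p *R gy Gi p) = (sH p)~2 * (norm (gy Fi p) * norm (gy Gi p))"
   using sH_pos[of p] by (simp add: power2_eq_square)
  then show "norm (sH p *R gy Fi p) * norm (sH p *R gy Gi p) = H (fst p) * (norm (gy Fi p) * norm (gy Gi p))" by (simp only: sH_sq)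
 qed
 ultimately show ?thesis using assms by (simp add: pairI_def Q_W)
qed

lemma gden_terms:
 assumes p: "pairI Fi Gi" and e: "0 < eps"
 shows "intb (%p. Dp Fi p * Dp Gi p)"
  "intb (%p. bt eps p * H (fst p) / eps~2 * (gy Fi p @. gy Gi p))"
  "intb (%p. lam0 * bt eps p / (eps~2 * M~2) * (vv Fi p * vv Gi p))"
  "intb (%p. c * (vv Fi p * vv Gi p))"
  "intb (gden eps c Fi Gi)"
proof -
 have W: "W (J \<times> S) Fi" "W (J \<times> S) Gi" and iH: "intb (%p. H (fst p) * (norm (gy Fi p) * norm (gy Gi p)))" using p by (auto simp: pairI_def)
 note [measurable] = W_parts(4)[OF W(1)] W_parts(4)[OF W(2)]
 define B where "B = 1 + eps * (K * SR)"
 have B0: "0 <= B" using e K_nonneg SR(1) by (simp add: B_def)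
 have bt: "||bt eps p|| <= B" if "snd p \<in> S" for p using bt_bound[OF that, of eps] e by (simp add: B_def)
 show i1: "intb (%p. Dp Fi p * Dp Gi p)" by (rule sqi_times[OF Dp_sqi[OF W(1)] Dp_sqi[OF W(2)]])
 show i2: "intb (%p. bt eps p * H (fst p) / eps~2 * (gy Fi p @. gy Gi p))"
 proof (rule bi_bound[of _ "%p. B / eps~2 * (H (fst p) * (norm (gy Fi p) * norm (gy Gi p)))"])
  show "intb (%p. B / eps~2 * (H (fst p) * (norm (gy Fi p) * norm (gy Gi p))))" using iH by (rule integrable_mult_right)
  show "AL p. norm (bt eps p * H (fst p) / eps~2 * (gy Fi p @. gy Gi p)) <= norm (B / eps~2 * (H (fst p) * (norm (gy Fi p) * norm (gy Gi p))))"
   using W_out[OF W(1)]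
  proof eventually_elim
   case (elim p)
   show ?case
   proof (cases "snd p \<in> S")
    case True
    have "norm (bt eps p * H (fst p) / eps~2 * (gy Fi p @. gy Gi p)) = ||bt eps p|| * (H (fst p) / eps~2 * ||gy Fi p @. gy Gi p||)"
     using H_pos[of "fst p"] by (simp add: abs_mult)
    also have "... <= B * (H (fst p) / eps~2 * (norm (gy Fi p) * norm (gy Gi p)))"
     using H_pos[of "fst p"] B0 by (intro mult_mono bt True mult_left_mono Cauchy_Schwarz_ineq2) auto
    also have "... = B / eps~2 * (H (fst p) * (norm (gy Fi p) * norm (gy Gi p)))" by simp
    finally show ?thesis by (rule order_trans) (simp only: real_norm_def abs_ge_self)
   next
    case False then show ?thesis using elim by simp
   qed
  qed
 qed measurable
 have iv: "intb (%p. vv Fi p * vv Gi p)" by (rule sqi_times[OF W_parts(1)[OF W(1)] W_parts(1)[OF W(2)]])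
 show i3: "intb (%p. lam0 * bt eps p / (eps~2 * M~2) * (vv Fi p * vv Gi p))"
 proof (rule bi_bound[of _ "%p. lam0 * B / (eps~2 * M~2) * (vv Fi p * vv Gi p)"])
  show "AL p. norm (lam0 * bt eps p / (eps~2 * M~2) * (vv Fi p * vv Gi p)) <= norm (lam0 * B / (eps~2 * M~2) * (vv Fi p * vv Gi p))"
   using W_out[OF W(1)]
  proof eventually_elim
   case (elim p)
   show ?case
   proof (cases "snd p \<in> S")
    case True
    show ?thesis unfolding norm_mult by (intro mult_right_mono) (use bt[OF True] B0 lam0_pos in \<open>auto simp: abs_mult intro!: divide_right_mono mult_left_mono\<close>)
   next
    case False then show ?thesis using elim by simp
   qed
  qed
 qed (use iv in auto)
 show i4: "intb (%p. c * (vv Fi p * vv Gi p))" using iv by simp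
 show "intb (gden eps c Fi Gi)" unfolding gden_def[abs_def]
  by (intro bi_add bi_diff i1 i2 i3 i4)
qed

lemma gden_sym: "gden eps c Fi Gi p = gden eps c Gi Fi p"
 by (simp add: gden_def inner_commute mult.commute[of "vv Fi p"] mult.commute[of "Dp Fi p"])

lemma gq_sym: "gq eps c Fi Gi = gq eps c Gi Fi"
 unfolding gq_def by (intro bl_cong refl gden_sym)

lemma gden_lin: "gden eps c (%p. Fi p + a *R Gi p) X p = gden eps c Fi X p + a * gden eps c Gi X p"
proof -
 have D: "Dp (%p. Fi p + a *R Gi p) p = Dp Fi p + a * Dp Gi p" by (simp add: Dp_def Xp_def inner_add_left algebra_simps)
 show ?thesis unfolding gden_def D by (simp add: inner_add_left distrib_left distrib_right right_diff_distrib mult.assoc mult.left_commute[of a])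
qed

lemma gq_lin:
 assumes "pairI Fi X" "pairI Gi X" "0 < eps"
 shows "gq eps c (%p. Fi p + a *R Gi p) X = gq eps c Fi X + a * gq eps c Gi X"
 unfolding gq_def gden_lin using gden_terms(5)[OF assms(1,3), of c] gden_terms(5)[OF assms(2,3), of c] by simp

lemma Q_lin: assumes "Q Fi" "Q Gi" shows "Q (%p. Fi p + a *R Gi p)"
proof -
 have "sqi (%p. sH p *R gy Fi p + a *R (sH p *R gy Gi p))" by (intro sqi_add(1) sqi_scale(1) Q_gy assms)
 then show ?thesis using W_lin[OF Q_W[OF assms(1)] Q_W[OF assms(2)], of a] by (simp add: Q_def algebra_simps)
qed

text \<open>\<open>slice_lower\<close> with e = eps ev(s), multiplied by H/eps^2 and integrated over
  s. The quadratic loss becomes H |ev|^2 / de, at most K/de uniformly in eps.\<close>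

lemma transversal_lower:
 assumes d: "0 < de" and low: "\<forall>e Fi. norm e * SR <= de --> W S Fi -->
  de * N2 (%y. snd (Fi y) - (LI y. u0 y * fst (Fi y)) *R p0 y) - (norm e)~2 / de * (LI y. u0 y * fst (Fi y))~2
   <= (LI y. (1 - e @. y) * ((norm (snd (Fi y)))~2 - lam0 * (fst (Fi y))~2))"
  and e: "0 < eps" "eps * (K * SR) <= de" and Q: "Q Fi"
 shows "de / eps~2 * En Fi - K / de * N2 (vv Fi) <= (LI p. bt eps p * H (fst p) / eps~2 * ((norm (gy Fi p))~2 - lam0 * (vv Fi p)~2))"
  "intb (%p. bt eps p * H (fst p) / eps~2 * ((norm (gy Fi p))~2 - lam0 * (vv Fi p)~2))"
  "intb (%p. bt eps p * H (fst p) / eps~2 * (vv Fi p)~2)"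
proof -
 note W = Q_W[OF Q] note [measurable] = W_parts(4)[OF W]
 define B where "B = 1 + eps * (K * SR)"
 have bt: "||bt eps p|| <= B" if "snd p \<in> S" for p using bt_bound[OF that, of eps] e by (simp add: B_def)
 have B0: "0 <= B" using e K_nonneg SR(1) by (simp add: B_def)
 have iHv: "intb (%p. H (fst p) * (vv Fi p)~2)" using sqi_real_sq[OF Q_v(1)[OF Q, unfolded real_scaleR_def]] by (simp add: power_mult_distrib sH_sq)
 show i2: "intb (%p. bt eps p * H (fst p) / eps~2 * (vv Fi p)~2)"
 proof (rule bi_bound[of _ "%p. B / eps~2 * (H (fst p) * (vv Fi p)~2)"])
  show "intb (%p. B / eps~2 * (H (fst p) * (vv Fi p)~2))" using iHv by (rule integrable_mult_right)
  show "AL p. norm (bt eps p * H (fst p) / eps~2 * (vv Fi p)~2) <= norm (B / eps~2 * (H (fst p) * (vv Fi p)~2))" using W_out[OF W]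
  proof eventually_elim
   case (elim p)
   show ?case
   proof (cases "snd p \<in> S")
    case True
    have "||bt eps p|| * (H (fst p) / eps~2 * (vv Fi p)~2) <= B * (H (fst p) / eps~2 * (vv Fi p)~2)" using bt[OF True] H_pos[of "fst p"] by (intro mult_right_mono) auto
    then show ?thesis using B0 H_pos[of "fst p"] by (simp add: abs_mult)
   next
    case False then show ?thesis using elim by simp
   qed
  qed
 qed measurable
 have i1: "intb (%p. bt eps p * H (fst p) / eps~2 * (norm (gy Fi p))~2)"
  using gden_terms(2)[OF pairI_Q[OF Q Q] e(1)] by (simp add: power2_norm_eq_inner)
 have eqf: "bt eps p * H (fst p) / eps~2 * ((norm (gy Fi p))~2 - lam0 * (vv Fi p)~2) = bt eps p * H (fst p) / eps~2 * (norm (gy Fi p))~2 - lam0 * (bt eps p * H (fst p) / eps~2 * (vv Fi p)~2)" for p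
  by (simp add: right_diff_distrib)
 show i3: "intb (%p. bt eps p * H (fst p) / eps~2 * ((norm (gy Fi p))~2 - lam0 * (vv Fi p)~2))" unfolding eqf
  by (intro bi_diff integrable_mult_right i1 i2)
 note sg = gyp_sqi[OF Q] and sv = W_parts(1)[OF W]
 let ?f1 = "%p. de / eps~2 * (norm (sH p *R gyp Fi p))~2 - K / de * (norm (vv Fi p))~2"
 have if1: "intb ?f1" using sqi_integrable[OF sg] sqi_integrable[OF sv] by (intro bi_diff integrable_mult_right)
 have "(LI p. ?f1 p) <= (LI p. bt eps p * H (fst p) / eps~2 * ((norm (gy Fi p))~2 - lam0 * (vv Fi p)~2))"
 proof (rule slice_mono[OF if1 i3])
  show "AL s. (LI y. ?f1 (s, y)) <= (LI y. bt eps (s, y) * H (fst (s, y)) / eps~2 * ((norm (gy Fi (s, y)))~2 - lam0 * (vv Fi (s, y))~2))"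
   using slice_facts[OF W] sqi_slice(1)[OF sg]
  proof eventually_elim
   case (elim s)
   define w where "w = Pw Fi s"
   define A where "A = N2 (%y. gyp Fi (s, y))"
   have we: "w = (LI y. u0 y * vv Fi (s, y))" by (simp add: w_def Pw_def Pr_def)
   have ne: "norm (eps *R ev s) * SR <= de"
   proof -
    have "norm (ev s) * SR <= K * SR" using coeff_bound(3) SR(1) by (intro mult_right_mono) auto
    then have "eps * (norm (ev s) * SR) <= eps * (K * SR)" using e by (intro mult_left_mono) auto
    then show ?thesis using order_trans[OF _ e(2)] e(1) by simp
   qed
   have gyp: "gyp Fi (s, y) = gy Fi (s, y) - w *R p0 y" for y by (simp add: gyp_def tens_def w_def)
   have sl: "de * A - (norm (eps *R ev s))~2 / de * w~2 <= (LI y. (1 - (eps *R ev s) @. y) * ((norm (gy Fi (s, y)))~2 - lam0 * (vv Fi (s, y))~2))"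
    using low[rule_format, OF ne, of "%y. (vv Fi (s, y), gy Fi (s, y))"] elim unfolding A_def gyp we by simp
   have E1: "(LI y. bt eps (s, y) * H (fst (s, y)) / eps~2 * ((norm (gy Fi (s, y)))~2 - lam0 * (vv Fi (s, y))~2)) =
    H s / eps~2 * (LI y. (1 - (eps *R ev s) @. y) * ((norm (gy Fi (s, y)))~2 - lam0 * (vv Fi (s, y))~2))"
    unfolding integral_mult_right_zero[symmetric] by (intro bl_cong) (auto simp: bt_def)
   have E2: "H s / eps~2 * (de * A - (norm (eps *R ev s))~2 / de * w~2) <= H s / eps~2 * (LI y. (1 - (eps *R ev s) @. y) * ((norm (gy Fi (s, y)))~2 - lam0 * (vv Fi (s, y))~2))"
    using sl H_pos[of s] by (intro mult_left_mono) auto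
   have E3: "H s / eps~2 * (de * A - (norm (eps *R ev s))~2 / de * w~2) = de / eps~2 * (H s * A) - H s * (norm (ev s))~2 / de * w~2"
    using e d by (simp add: power_mult_distrib right_diff_distrib mult.assoc mult.left_commute)
   have E4: "de / eps~2 * (H s * A) - K / de * N2 (%y. vv Fi (s, y)) <= de / eps~2 * (H s * A) - H s * (norm (ev s))~2 / de * w~2"
   proof -
    have "H s * (norm (ev s))~2 / de * w~2 <= K / de * N2 (%y. vv Fi (s, y))"
     using coeff_bound(4)[of s] d elim K_nonneg H_pos[of s] by (intro mult_mono divide_right_mono) (auto simp: w_def)
    then show ?thesis by simp
   qed
   have E5: "de / eps~2 * (H s * A) - K / de * N2 (%y. vv Fi (s, y)) = (LI y. ?f1 (s, y))"
   proof -
    have "(LI y. ?f1 (s, y)) = (LI y. de / eps~2 * (norm (sH (s, y) *R gyp Fi (s, y)))~2) - (LI y. K / de * (norm (vv Fi (s, y)))~2)"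
     using elim by (intro bl_diff integrable_mult_right sqi_integrable) auto
    also have "(LI y. de / eps~2 * (norm (sH (s, y) *R gyp Fi (s, y)))~2) = de / eps~2 * (H s * A)"
     using H_pos[of s] by (simp add: A_def N2_def sH_def power_mult_distrib)
    finally show ?thesis by (simp add: N2_def)
   qed
   show ?case unfolding E1 E5[symmetric] by (rule order_trans[OF E4[folded E3] E2])
  qed
 qed
 moreover have "(LI p. ?f1 p) = de / eps~2 * En Fi - K / de * N2 (vv Fi)"
 proof -
  have "(LI p. ?f1 p) = (LI p. de / eps~2 * (norm (sH p *R gyp Fi p))~2) - (LI p. K / de * (norm (vv Fi p))~2)"
   by (intro bl_diff integrable_mult_right sqi_integrable sg sv)
  then show ?thesis by (simp add: En_def N2_def)
 qed
 ultimately show "de / eps~2 * En Fi - K / de * N2 (vv Fi) <= (LI p. bt eps p * H (fst p) / eps~2 * ((norm (gy Fi p))~2 - lam0 * (vv Fi p)~2))" by simp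
qed

text \<open>Adding and subtracting lam0 beta H v^2 / eps^2 splits the form into |Dv|^2, the
  transversal energy and the nonnegative well beta V v^2 / eps^2. Well and s-derivative together
  feed the oscillator bound, which is the origin of the factor eps in the estimate of N2 (vv
  Fi).\<close>

theorem coercivity:
 "\<exists>c0 c1 e1. 0 < c1 & 0 < e1 & e1 <= 1 & (\<forall>eps c Fi. 0 < eps --> eps < e1 --> c0 <= c --> Q Fi -->
  c1 * N2 (gs Fi) <= gq eps c Fi Fi & c1 * En Fi <= eps~2 * gq eps c Fi Fi & c1 * N2 (vv Fi) <= eps * gq eps c Fi Fi \<and>
  c1 * N2 (%p. sH p *R gy Fi p) <= gq eps c Fi Fi)"
proof -
 obtain de where d: "0 < de" and low: "\<forall>e Fi. norm e * SR <= de --> W S Fi -->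
  de * N2 (%y. snd (Fi y) - (LI y. u0 y * fst (Fi y)) *R p0 y) - (norm e)~2 / de * (LI y. u0 y * fst (Fi y))~2
   <= (LI y. (1 - e @. y) * ((norm (snd (Fi y)))~2 - lam0 * (fst (Fi y))~2))"
  using slice_lower by blast
 \<comment> \<open>c pays for the multiples of N2 v lost in \<open>transversal_lower\<close> and in
   |Dv|^2 >= |gs|^2/2 - |Xp|^2. The bound m on eps gives eps K SR <= de for
   \<open>slice_lower\<close> and beta >= 1/2; the square root in e1 lets half of the transversal
   energy absorb 2 CX M^2 En. The summands 1 only exclude division by zero.\<close>
 define c0 where "c0 = CX * (1 + 2 * lam0) + K / de"
 define m where "m = min de (1/2) / (K * SR + 1)"
 define e1 where "e1 = min (min 1 m) (sqrt (de / (4 * (CX * M~2 + 1))))"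
 define a where "a = 2 + 8 / ka"
 define b where "b = 4 / de + 4 + 2 * lam0 / M~2 * a"
 define c1 where "c1 = 1 / (2 + 2 / de + a + b)"
 have KS: "0 <= K * SR" using K_nonneg SR(1) by simp
 have CX0: "0 <= CX" by (simp add: CX_def)
 have CM: "0 < CX * M~2 + 1" using CX0 by (simp add: add_nonneg_pos)
 have ab: "a > 0" "b > 0" using ka_pos d lam0_pos M_pos by (auto simp: a_def b_def intro!: add_pos_pos add_pos_nonneg)
 have c1: "0 < c1" using ab d by (simp add: c1_def add_pos_pos)
 have m0: "0 < m" using d KS by (simp add: m_def)
 have e1: "0 < e1" "e1 <= 1" using m0 d CM by (auto simp: e1_def)
 have main: "c1 * N2 (gs Fi) <= gq eps c Fi Fi & c1 * En Fi <= eps~2 * gq eps c Fi Fi & c1 * N2 (vv Fi) <= eps * gq eps c Fi Fi \<and>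
  c1 * N2 (%p. sH p *R gy Fi p) <= gq eps c Fi Fi" if e: "0 < eps" "eps < e1" and c: "c0 <= c" and Q: "Q Fi" for eps c Fi
 proof -
  note W = Q_W[OF Q] note [measurable] = W_parts(4)[OF W]
  have em: "eps <= 1" "eps <= m" using e by (auto simp: e1_def)
  have eK: "eps * (K * SR) <= de" "eps * (K * SR) <= 1/2"
  proof -
   have "eps * (K * SR) <= m * (K * SR + 1)" using em e KS by (intro mult_mono) auto
   also have "... = min de (1/2)" using KS by (simp add: m_def)
   finally show "eps * (K * SR) <= de" "eps * (K * SR) <= 1/2" by auto
  qed
  have e2: "eps~2 * (4 * (CX * M~2 + 1)) <= de"
  proof -
   have "eps <= sqrt (de / (4 * (CX * M~2 + 1)))" using e by (auto simp: e1_def)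
   then have "eps~2 <= (sqrt (de / (4 * (CX * M~2 + 1))))~2" using e by (intro power_mono) auto
   also have "... = de / (4 * (CX * M~2 + 1))" using d CM by simp
   finally show ?thesis using CM by (simp add: field_simps)
  qed
  define G D A nv B where "G = N2 (gs Fi)" and "D = N2 (Dp Fi)" and "A = En Fi" and "nv = N2 (vv Fi)" and "B = BV Fi"
  have nn: "0 <= G" "0 <= D" "0 <= A" "0 <= nv" "0 <= B" using BV_int(3)[OF Q] by (auto simp: G_def D_def A_def nv_def B_def En_def)
  note T = transversal_lower[OF d low e(1) eK(1) Q]
  have s1: "G <= 2 * D + 2 * CX * (nv + (2 * M~2 * A + 2 * lam0 * nv))"
  proof -
   have "N2 (%p. Dp Fi p - Xp Fi p) <= 2 * D + 2 * N2 (Xp Fi)" unfolding D_def by (rule sqi_diff(2)[OF Dp_sqi[OF W] Xp_sqi(1)[OF W]])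
   moreover have "(%p. Dp Fi p - Xp Fi p) = gs Fi" by (auto simp: Dp_def)
   moreover have "N2 (Xp Fi) <= CX * (nv + (2 * M~2 * A + 2 * lam0 * nv))"
    using order_trans[OF Xp_sqi(2)[OF W] mult_left_mono[OF add_left_mono[OF gy_split[OF Q]] CX0]] by (simp add: nv_def A_def)
   ultimately show ?thesis by (simp add: G_def)
  qed
  have BVl: "1 / (2 * eps~2) * B <= (LI p. bt eps p * V (fst p) / eps~2 * (vv Fi p)~2)" and
   iBV: "intb (%p. bt eps p * V (fst p) / eps~2 * (vv Fi p)~2)"
  proof -
   have e: "bt eps p * V (fst p) / eps~2 * (vv Fi p)~2 = lam0 * (bt eps p * H (fst p) / eps~2 * (vv Fi p)~2) - lam0 * bt eps p / (eps~2 * M~2) * (vv Fi p * vv Fi p)" for p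
    by (simp add: V_def power2_eq_square field_simps diff_divide_distrib)
   show i: "intb (%p. bt eps p * V (fst p) / eps~2 * (vv Fi p)~2)" unfolding e
    by (intro bi_diff integrable_mult_right T(3) gden_terms(3)[OF pairI_Q[OF Q Q] \<open>0 < eps\<close>])
   have "1 / (2 * eps~2) * B = (LI p. 1 / (2 * eps~2) * (V (fst p) * (vv Fi p)~2))" by (simp add: B_def BV_def)
   also have "... <= (LI p. bt eps p * V (fst p) / eps~2 * (vv Fi p)~2)"
   proof (rule integral_mono_AE[OF _ i])
    show "intb (%p. 1 / (2 * eps~2) * (V (fst p) * (vv Fi p)~2))" using BV_int(1)[OF Q] by (rule integrable_mult_right)
    show "AL p. 1 / (2 * eps~2) * (V (fst p) * (vv Fi p)~2) <= bt eps p * V (fst p) / eps~2 * (vv Fi p)~2" using W_out[OF W]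
    proof eventually_elim
     case (elim p)
     show ?case
     proof (cases "snd p \<in> S")
      case True
      have "1/2 <= bt eps p" using bt_bound[OF True, of eps] eK(2) \<open>0 < eps\<close> by linarith
      then have "1/2 * (V (fst p) / eps~2 * (vv Fi p)~2) <= bt eps p * (V (fst p) / eps~2 * (vv Fi p)~2)" using V_nonneg by (intro mult_right_mono) auto
      then show ?thesis by simp
     next
      case False then show ?thesis using elim by simp
     qed
    qed
   qed
   finally show "1 / (2 * eps~2) * B <= (LI p. bt eps p * V (fst p) / eps~2 * (vv Fi p)~2)" .
  qed
  have gqe: "gq eps c Fi Fi = D + (LI p. bt eps p * H (fst p) / eps~2 * ((norm (gy Fi p))~2 - lam0 * (vv Fi p)~2))
   + (LI p. bt eps p * V (fst p) / eps~2 * (vv Fi p)~2) + c * nv"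
  proof -
   have iA: "intb (%p. (Dp Fi p)~2)" by (rule sqi_real_sq[OF Dp_sqi[OF W]])
   have ic: "intb (%p. c * (vv Fi p)~2)" using sqi_real_sq[OF W_parts(1)[OF W]] by simp
   have "gden eps c Fi Fi p = (Dp Fi p)~2 + bt eps p * H (fst p) / eps~2 * ((norm (gy Fi p))~2 - lam0 * (vv Fi p)~2) + bt eps p * V (fst p) / eps~2 * (vv Fi p)~2 + c * (vv Fi p)~2" for p
    unfolding gden_def V_def power2_norm_eq_inner by (simp add: power2_eq_square field_simps diff_divide_distrib add_divide_distrib)
   then have "gq eps c Fi Fi = (LI p. (Dp Fi p)~2 + bt eps p * H (fst p) / eps~2 * ((norm (gy Fi p))~2 - lam0 * (vv Fi p)~2) + bt eps p * V (fst p) / eps~2 * (vv Fi p)~2 + c * (vv Fi p)~2)"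
    by (simp add: gq_def)
   also have "... = (LI p. (Dp Fi p)~2) + (LI p. bt eps p * H (fst p) / eps~2 * ((norm (gy Fi p))~2 - lam0 * (vv Fi p)~2)) + (LI p. bt eps p * V (fst p) / eps~2 * (vv Fi p)~2) + (LI p. c * (vv Fi p)~2)"
    using iA T(2) iBV ic by (simp only: bl_add bi_add)
   finally show ?thesis by (simp add: D_def nv_def N2_real)
  qed
  define g where "g = gq eps c Fi Fi"
  have low1: "G / 2 + de / (2 * eps~2) * A + 1 / (2 * eps~2) * B <= g"
  proof -
   have ep: "eps~2 > 0" using e by simp
   have "2 * CX * M~2 <= de / (2 * eps~2)"
   proof -
    have "eps~2 * (4 * (CX * M~2)) <= eps~2 * (4 * (CX * M~2 + 1))" using ep by (intro mult_left_mono) auto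
    then have "eps~2 * (4 * (CX * M~2)) <= de" using e2 by linarith
    then show ?thesis using ep by (simp add: field_simps)
   qed
   then have x1: "2 * CX * M~2 * A <= de / (2 * eps~2) * A" using nn by (intro mult_right_mono) auto
   have x2: "(CX * (1 + 2 * lam0) + K / de) * nv <= c * nv" using c nn unfolding c0_def by (intro mult_right_mono) auto
   have x3: "de / eps~2 * A = de / (2 * eps~2) * A + de / (2 * eps~2) * A" by (simp add: field_simps)
   have x4: "D >= G / 2 - (CX * (1 + 2 * lam0)) * nv - 2 * CX * M~2 * A" using s1 by (simp add: algebra_simps)
   have x5: "(CX * (1 + 2 * lam0) + K / de) * nv = (CX * (1 + 2 * lam0)) * nv + K / de * nv" by (simp add: algebra_simps)
   have lin: "a1 - k <= I1 ==> b <= I2 ==> x <= y ==> kk <= cc ==> a1 = y + y ==> r - q - x <= t ==> kk = q + k ==> r + y + b <= t + I1 + I2 + cc"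
    for a1 k I1 b I2 x y kk cc r q t :: real by linarith
   show ?thesis unfolding g_def gqe by (rule lin[OF T(1)[folded A_def nv_def] BVl x1 x2 x3 x4 x5])
  qed
  have ep: "eps~2 > 0" using e by simp
  have pp: "0 <= de / (2 * eps~2) * A" "0 <= 1 / (2 * eps~2) * B" using nn d by auto
  have g0: "0 <= g" using low1 nn pp by linarith
  have r1: "G <= 2 * g" using low1 pp by linarith
  have r2: "A <= 2 / de * (eps~2 * g)"
  proof -
   have "de / (2 * eps~2) * A <= g" using low1 nn pp by linarith
   then show ?thesis using d ep by (simp add: field_simps)
  qed
  have r3: "B <= 2 * eps~2 * g"
  proof -
   have "1 / (2 * eps~2) * B <= g" using low1 nn pp by linarith
   then show ?thesis using ep by (simp add: field_simps)
  qed
  \<comment> \<open>The well energy is at most 2 eps^2 g and dominates ka th2 v^2, so the potential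
    term of the oscillator bound is at most (8/ka) eps g; the kinetic term adds 2 eps g. This is the
    constant a.\<close>
  have r4: "nv <= a * (eps * g)"
  proof -
   have wb: "ka * (LI p. th2 (fst p) * (vv Fi p)~2) <= B"
   proof -
    have i3: "intb (%p. th2 (fst p) * (vv Fi p)~2)"
    proof (rule bi_bound[OF sqi_real_sq[OF W_parts(1)[OF W]]])
     show "AL p. norm (th2 (fst p) * (vv Fi p)~2) <= norm ((vv Fi p)~2)" using th_facts(1,2) by (intro AE_I2) (auto simp: abs_mult intro!: mult_left_le_one_le)
    qed measurable
    have "ka * (LI p. th2 (fst p) * (vv Fi p)~2) = (LI p. ka * (th2 (fst p) * (vv Fi p)~2))" by simp
    also have "... <= B" unfolding B_def BV_def
    proof (rule integral_mono_AE[OF _ BV_int(1)[OF Q]])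
     show "intb (%p. ka * (th2 (fst p) * (vv Fi p)~2))" using i3 by simp
     show "AL p. ka * (th2 (fst p) * (vv Fi p)~2) <= V (fst p) * (vv Fi p)~2" using W_out[OF W]
     proof eventually_elim
      case (elim p)
      show ?case
      proof (cases "fst p \<in> J")
       case True
       have "(ka * th2 (fst p)) * (vv Fi p)~2 <= V (fst p) * (vv Fi p)~2" using well[OF True] by (intro mult_right_mono) (auto simp: V_def)
       then show ?thesis by (simp add: mult.assoc)
      next
       case False then show ?thesis using elim by simp
      qed
     qed
    qed
    finally show ?thesis .
   qed
   have "(LI p. th2 (fst p) * (vv Fi p)~2) <= 2 * eps~2 * g / ka" using wb r3 ka_pos by (simp add: field_simps)
   then have "4 / eps * (LI p. th2 (fst p) * (vv Fi p)~2) <= 4 / eps * (2 * eps~2 * g / ka)" using e by (intro mult_left_mono) auto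
   also have "... = 8 / ka * (eps * g)" using e by (simp add: power2_eq_square)
   finally have "nv <= eps * G + 8 / ka * (eps * g)" using oscillator_bound[OF W e(1) em(1)] by (simp add: nv_def G_def)
   also have "eps * G <= eps * (2 * g)" using r1 e by (intro mult_left_mono) auto
   finally show ?thesis by (simp add: a_def algebra_simps)
  qed
  have r5: "N2 (%p. sH p *R gy Fi p) <= b * g"
  proof -
   have e21: "eps~2 <= 1" using em e by (simp add: power_le_one)
   have eg: "eps~2 * g <= 1 * g" "eps * g <= 1 * g" using e21 em g0 by (intro mult_right_mono; simp)+
   have q1: "A <= 2 / de * g" using r2 mult_left_mono[OF eg(1), of "2 / de"] d by simp
   have q2: "B <= 2 * g" using r3 eg by simp
   have q3: "nv <= a * g" using order_trans[OF r4 mult_left_mono[OF eg(2)[unfolded mult_1]]] ab by simp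
   have "2 * lam0 / M~2 * nv <= 2 * lam0 / M~2 * (a * g)" using q3 lam0_pos by (intro mult_left_mono) auto
   then have "N2 (%p. sH p *R gy Fi p) <= 2 * (2 / de * g) + 2 * (2 * g) + 2 * lam0 / M~2 * (a * g)"
    using sHgy_split[OF Q] q1 q2 by (simp add: A_def B_def nv_def)
   also have "... = b * g" by (simp add: b_def algebra_simps)
   finally show ?thesis .
  qed
  have cc: "c1 * x <= y" if "x <= t * y" "0 <= y" "t <= 2 + 2 / de + a + b" for x y t
  proof -
   have s0: "0 < 2 + 2 / de + a + b" using ab d by (simp add: add_pos_pos)
   have "x <= (2 + 2 / de + a + b) * y" using order_trans[OF that(1) mult_right_mono[OF that(3,2)]] .
   then show ?thesis using s0 by (simp add: c1_def field_simps)
  qed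
  have d2: "2 / de > 0" using d by simp
  show ?thesis unfolding g_def[symmetric]
   using cc[of G 2 g] cc[of A "2 / de" "eps~2 * g"] cc[of nv a "eps * g"] cc[of "N2 (%p. sH p *R gy Fi p)" b g] r1 r2 r4 r5 g0 ab d2 e
   by (simp add: G_def A_def nv_def)
 qed
 then show ?thesis using c1 e1 by blast
qed

end

section \<open>Localisation in s and solvability under an unbounded weight\<close>

lemma fst_cgrad:
 assumes m: "sm (m :: real => real)"
 shows "sm (%p :: real * 'b::euclidean_space. m (fst p))" "cgrad (%p :: real * 'b. m (fst p)) p = (cgrad m (fst p), 0)"
proof -
 show "sm (%p :: real * 'b. m (fst p))" by (rule sm_linear[OF bounded_linear_fst m])
 have "((%p :: real * 'b. m (fst p)) has_derivative (%h. cgrad m (fst p) @. fst h)) (at p)"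
  by (rule has_derivative_compose[OF has_derivative_fst[OF has_derivative_ident] sm_has_cgrad[OF m]])
 then show "cgrad (%p :: real * 'b. m (fst p)) p = (cgrad m (fst p), 0)" by (intro cgrad_unique) (simp add: inner_prod_def)
qed

lemma test_fun_bounds:
 assumes "test_fun U (m :: real => real)"
 obtains C R where "0 <= C" "!!s. ||m s|| <= C" "!!s. ||cgrad m s|| <= C" "!!s. ||s|| > R ==> m s = 0" "!!s. ||s|| > R ==> cgrad m s = 0"
proof -
 note t = test_funD[OF assms]
 obtain C1 where C1: "0 <= C1" "!!x. norm (m x) <= C1" using compact_support_bounded[OF sm_continuous[OF t(1)] t(2) t(4)] by blast
 obtain C2 where C2: "0 <= C2" "!!x. norm (cgrad m x) <= C2" using compact_support_bounded[OF sm_cgrad_continuous[OF t(1)] t(2) t(5)] by blast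
 obtain R where R: "!!x. x \<in> tsupport m ==> norm x <= R" using compact_imp_bounded[OF t(2)] by (auto simp: bounded_iff)
 have z: "s \<notin> tsupport m" if "||s|| > R" for s using R[of s] that by auto
 show ?thesis by (rule that[of "C1 + C2" R]) (use C1 C2 t z in \<open>auto intro: add_increasing add_increasing2\<close>)
qed

lemma unit_cutoff: "\<exists>et c. test_fun UNIV et & et (0::real) = 1 & (\<forall>s. 0 <= et s) & (\<forall>s. ||s|| > 1 --> et s = 0 & cgrad et s = (0::real)) & 0 < c & (\<forall>s. ||s|| <= 1/2 --> c <= et s)"
proof -
 define b where "b = boxbump (-1::real) 1 1"
 define et where "et s = (1 / b 0) * b s" for s
 have b0: "b s > 0" if "||s|| < 1" for s unfolding b_def by (rule boxbump_pos) (use that in auto)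
 have z: "et s = 0" if "s \<in> - {-1..1}" for s using boxbump_zero[of s "-1" 1 1] that by (auto simp: et_def b_def)
 have tb: "test_fun UNIV b" unfolding b_def by (rule test_fun_boxbump) simp
 have t: "test_fun UNIV et" unfolding et_def by (rule test_fun_mult[OF tb sm_const])
 have nn: "0 <= et s" for s unfolding et_def b_def by (intro mult_nonneg_nonneg boxbump_bounds(1)) (simp only: zero_le_divide_1_iff boxbump_bounds(1))
 have zd: "cgrad et s = 0" if "s \<in> - {-1..1}" for s using z by (intro cgrad_zero[of "- {-1..1}"]) (use that in auto)
 obtain x where x: "x \<in> {-1/2..1/2}" "\<forall>y\<in>{-1/2..1/2}. et x <= et y"
  using continuous_attains_inf[of "{-1/2..1/2::real}" et] sm_continuous[OF test_funD(1)[OF t]] by auto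
 have "0 < b x" by (rule b0) (use x in auto)
 then have "0 < et x" using b0[of 0] by (simp add: et_def)
 moreover have "et 0 = 1" using b0[of 0] by (simp add: et_def)
 moreover have "et s = 0" "cgrad et s = 0" if "||s|| > 1" for s by (rule z zd, use that in auto)+
 moreover have "et x <= et s" if "||s|| <= 1/2" for s by (rule bspec[OF x(2)], unfold atLeastAtMost_iff) (use that in linarith)
 ultimately show ?thesis using t nn by (intro exI[of _ et] exI[of _ "et x"]) auto
qed

context tube
begin

text \<open>An L2 realisation of the Hilbert norm of the finite-energy space, so that its
  completeness reduces to \<open>l2_complete\<close>.\<close>

definition "Z Fi p = (Fi p, sH p *R gy Fi p)"
definition Mm :: "(real => real) => (real * real \<times> real => real * real \<times> real * real) => real * real \<times> real => real * real \<times> real * real" where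
 "Mm m Fi p = (m (fst p) * vv Fi p, (m (fst p) * gs Fi p + cgrad m (fst p) * vv Fi p, m (fst p) *R gy Fi p))"

text \<open>What the domain of the full form and the subspace of tensor products share: linear,
  closed, stable under cutoffs in s. Existence, regularity and uniqueness are proved once for both
  operators.\<close>

definition "fsp \<V> \<longleftrightarrow> (\<forall>Fi\<in>\<V>. W (J \<times> S) Fi) & (%p. 0) \<in> \<V> & (\<forall>Fi\<in>\<V>. \<forall>Gi\<in>\<V>. \<forall>a. (%p. Fi p + a *R Gi p) \<in> \<V>) \<and>
 (\<forall>X Fi. (\<forall>n::nat. X n \<in> \<V>) --> l2lim X Fi --> Fi \<in> \<V>) & (\<forall>Fi\<in>\<V>. \<forall>m. test_fun UNIV m --> Mm m Fi \<in> \<V>)"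

lemma fspD:
 assumes "fsp \<V>"
 shows "!!Fi. Fi \<in> \<V> ==> W (J \<times> S) Fi" "(%p. 0) \<in> \<V>" "!!Fi Gi a. Fi \<in> \<V> ==> Gi \<in> \<V> ==> (%p. Fi p + a *R Gi p) \<in> \<V>"
  "!!X Fi. (!!n::nat. X n \<in> \<V>) ==> l2lim X Fi ==> Fi \<in> \<V>" "!!Fi m. Fi \<in> \<V> ==> test_fun UNIV m ==> Mm m Fi \<in> \<V>"
 using assms unfolding fsp_def by blast+

lemma W_Mm:
 assumes "W (J \<times> S) Fi" "test_fun UNIV m" shows "W (J \<times> S) (Mm m Fi)"
proof -
 obtain C R where C: "!!s. ||m s|| <= C" "!!s. ||cgrad m s|| <= C" using test_fun_bounds[OF assms(2)] by metis
 note s = test_funD(1)[OF assms(2)]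
 have "W (J \<times> S) (%p. (m (fst p) * fst (Fi p), m (fst p) *R snd (Fi p) + fst (Fi p) *R cgrad (%p. m (fst p)) p))"
  by (rule W_mult[OF assms(1) fst_cgrad(1)[OF s], of C]) (use C in \<open>auto simp: fst_cgrad(2)[OF s]\<close>)
 then show ?thesis by (simp add: fst_cgrad(2)[OF s] Mm_def[abs_def] scaleR_prod_def prod_eq_iff plus_prod_def mult.commute)
qed

lemma fsp_W: "fsp {Fi. W (J \<times> S) Fi}"
 unfolding fsp_def using W_zero W_lin W_closed W_Mm by blast

lemma Dp_Mm: "Dp (Mm m Fi) p = m (fst p) * Dp Fi p + cgrad m (fst p) * vv Fi p"
 by (simp add: Dp_def Xp_def Mm_def algebra_simps)

text \<open>The IMS localisation formula, valid pointwise because the cutoff depends on s only and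
  its derivative enters through \<open>Dp\<close> alone.\<close>

lemma gden_Mm: "gden eps c Fi (Mm m (Mm m Fi)) p = gden eps c (Mm m Fi) (Mm m Fi) p - (cgrad m (fst p) * vv Fi p)~2"
proof -
 have D: "Dp (Mm m (Mm m Fi)) p = (m (fst p))~2 * Dp Fi p + 2 * (m (fst p) * (cgrad m (fst p) * vv Fi p))"
  unfolding Dp_Mm by (simp add: Mm_def algebra_simps power2_eq_square)
 show ?thesis unfolding gden_def D unfolding Dp_Mm by (simp add: Mm_def power2_eq_square algebra_simps)
qed

lemma L_ge: "1 <= L" using H_comp[of 0 0] H_pos[of 0] by simp

text \<open>By \<open>H_comp\<close> the weight grows at most by the factor L per unit step away
  from 0.\<close>

lemma H_loc: "\<exists>C. \<forall>s. ||s|| <= R --> H s <= C"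
proof -
 have "\<exists>C. \<forall>s. ||s|| <= real n --> H s <= C" for n
 proof (induction n)
  case 0 then show ?case by (intro exI[of _ "H 0"]) auto
 next
  case (Suc n)
  then obtain C where C: "!!s. ||s|| <= real n ==> H s <= C" by blast
  have L0: "0 <= L" using L_ge by simp
  have "H s <= L * C" if "||s|| <= real (Suc n)" for s
  proof -
   define t where "t = (if s > 0 then max (s - 1) 0 else min (s + 1) 0)"
   have "||s - t|| <= 1" "||t|| <= real n" using that by (auto simp: t_def)
   then show ?thesis using order_trans[OF H_comp mult_left_mono[OF C L0]] by blast
  qed
  then show ?case by blast
 qed
 from this[of "nat \<lceil>R\<rceil>"] obtain C where "\<forall>s. ||s|| <= real (nat \<lceil>R\<rceil>) --> H s <= C" by blast
 then show ?thesis by (intro exI[of _ C]) (metis order_trans real_nat_ceiling_ge)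
qed

lemma Hm_bound:
 assumes m: "test_fun UNIV m" shows "\<exists>C. \<forall>s. ||H s * m s|| <= C"
proof -
 obtain C R where C: "0 <= C" "!!s. ||m s|| <= C" "!!s. ||s|| > R ==> m s = 0" using test_fun_bounds[OF m] by metis
 obtain D where D: "!!s. ||s|| <= R ==> H s <= D" using H_loc[of R] by blast
 have "||H s * m s|| <= max D 0 * C" for s
 proof (cases "||s|| <= R")
  case True then show ?thesis using H_pos[of s] D[OF True] C by (auto simp: abs_mult le_max_iff_disj intro!: mult_mono)
 next
  case False then show ?thesis using C by simp
 qed
 then show ?thesis by blast
qed

lemma sqi_H_Mm:
 assumes W: "W (J \<times> S) Fi" and m: "test_fun UNIV m" shows "sqi (%p. H (fst p) *R gy (Mm m Fi) p)"
proof -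
 obtain C where C: "!!s. ||H s * m s|| <= C" using Hm_bound[OF m] by blast
 have [measurable]: "m \<in> bm" by (rule sm_borel[OF test_funD(1)[OF m]])
 show ?thesis using sqi_bdd_scale(1)[OF W_parts(3)[OF W], of "%p. H (fst p) * m (fst p)" C] C by (simp add: Mm_def)
qed

lemma M_sH: "1 <= M * sH p"
proof -
 have "sqrt (1 / M~2) <= sH p" unfolding sH_def by (rule real_sqrt_le_mono[OF H_low])
 then show ?thesis using M_pos by (simp add: real_sqrt_divide field_simps)
qed

lemma sH_H: "sH p <= M * H (fst p)"
 using mult_right_mono[OF M_sH[of p], of "sH p"] sH_pos[of p] by (simp add: sH_sq[symmetric] power2_eq_square)

lemma Q_of_H: assumes W: "W (J \<times> S) Fi" and s: "sqi (%p. H (fst p) *R gy Fi p)" shows "Q Fi"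
proof -
 note [measurable] = W_parts(4)[OF W]
 have b: "norm (sH p *R gy Fi p) <= M * norm (H (fst p) *R gy Fi p)" for p
  using mult_right_mono[OF sH_H[of p] norm_ge_zero[of "gy Fi p"]] H_pos[of "fst p"] sH_pos[of p] by simp
 have "sqi (%p. sH p *R gy Fi p)" by (rule sqi_bound(1)[OF _ s AE_I2[OF b]]) measurable
 then show ?thesis using W by (simp add: Q_def)
qed

lemma Mm_Q: "W (J \<times> S) Fi ==> test_fun UNIV m ==> Q (Mm m Fi)"
 by (rule Q_of_H[OF W_Mm sqi_H_Mm])

lemma pairI_H:
 assumes W: "W (J \<times> S) Fi" "W (J \<times> S) Gi" and s: "sqi (%p. H (fst p) *R gy Gi p)" shows "pairI Fi Gi" "pairI Gi Fi"
proof -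
 have "intb (%p. norm (gy Fi p) * norm (H (fst p) *R gy Gi p))" by (rule CS_norm(1)[OF W_parts(3)[OF W(1)] s])
 also have "(%p. norm (gy Fi p) * norm (H (fst p) *R gy Gi p)) = (%p. H (fst p) * (norm (gy Fi p) * norm (gy Gi p)))"
  using H_pos by (auto simp: fun_eq_iff less_imp_le)
 finally show p: "pairI Fi Gi" using W by (simp add: pairI_def)
 show "pairI Gi Fi" by (rule pairI_sym[OF p])
qed

lemma gq_Mm:
 assumes W: "W (J \<times> S) Fi" and m: "test_fun UNIV m" and e: "0 < eps"
 shows "gq eps c Fi (Mm m (Mm m Fi)) = gq eps c (Mm m Fi) (Mm m Fi) - N2 (%p. cgrad m (fst p) * vv Fi p)"
  "sqi (%p. cgrad m (fst p) * vv Fi p)"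
proof -
 obtain C R where C: "!!s. ||cgrad m s|| <= C" using test_fun_bounds[OF m] by metis
 have [measurable]: "cgrad m \<in> bm" by (rule sm_cgrad_borel[OF test_funD(1)[OF m]])
 show s: "sqi (%p. cgrad m (fst p) * vv Fi p)" using sqi_bdd_scale(1)[OF W_parts(1)[OF W], of "%p. cgrad m (fst p)" C] C by simp
 note QM = Mm_Q[OF W m]
 show "gq eps c Fi (Mm m (Mm m Fi)) = gq eps c (Mm m Fi) (Mm m Fi) - N2 (%p. cgrad m (fst p) * vv Fi p)"
  unfolding gq_def gden_Mm N2_real using gden_terms(5)[OF pairI_Q[OF QM QM] e] sqi_real_sq[OF s] by (rule bl_diff)
qed

definition "coer eps c C \<longleftrightarrow> 0 < eps & 0 < C & (\<forall>Fi. Q Fi --> C * N2 (Z Fi) <= gq eps c Fi Fi)"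

lemma Z_sqi: assumes "Q Fi"
 shows "sqi (Z Fi)" "N2 (Z Fi) = N2 Fi + N2 (%p. sH p *R gy Fi p)" "N2 Fi = N2 (vv Fi) + N2 (gs Fi) + N2 (gy Fi)"
proof -
 note w = W_parts[OF Q_W[OF assms]]
 show "sqi (Z Fi)" "N2 (Z Fi) = N2 Fi + N2 (%p. sH p *R gy Fi p)"
  using sqi_Pair[OF W_sqi(1)[OF Q_W[OF assms]] Q_gy[OF assms]] by (auto simp: Z_def[abs_def])
 show "N2 Fi = N2 (vv Fi) + N2 (gs Fi) + N2 (gy Fi)"
  using sqi_Pair(2)[OF w(1) sqi_Pair(1)[OF w(2,3)]] sqi_Pair(2)[OF w(2,3)] by simp
qed

lemma gq_upper:
 assumes Q: "Q Fi" and e: "0 < eps"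
 shows "||gq eps c Fi Fi|| <= ((1 + 2 * K * (1 + 2 * SR))~2 + (1 + eps * (K * SR)) / eps~2 + lam0 * (1 + eps * (K * SR)) / (eps~2 * M~2) + ||c||) * N2 (Z Fi)" (is "_ <= ?C * _")
proof -
 note W = Q_W[OF Q] note [measurable] = W_parts(4)[OF W]
 define B where "B = 1 + eps * (K * SR)"
 have B0: "0 <= B" using e K_nonneg SR(1) by (simp add: B_def)
 have C0: "0 <= ?C" using B0 lam0_pos by (simp add: B_def)
 have ae: "AL p. ||gden eps c Fi Fi p|| <= ?C * (norm (Z Fi p) * norm (Z Fi p))" using W_out[OF W]
 proof eventually_elim
  case (elim p)
  show ?case
  proof (cases "snd p \<in> S")
   case True
   define z where "z = norm (Z Fi p)"
   have z: "norm (Fi p) <= z" "sH p * norm (gy Fi p) <= z"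
    using norm_fst_le[of "Fi p" "sH p *R gy Fi p"] norm_snd_le[of "sH p *R gy Fi p" "Fi p"] sH_pos[of p] by (auto simp: z_def Z_def)
   have v: "||vv Fi p|| <= z" "norm (snd (Fi p)) <= z" using z(1) norm_fst_le[of "vv Fi p" "snd (Fi p)"] norm_snd_le[of "snd (Fi p)" "vv Fi p"] by auto
   have g: "||gs Fi p|| <= z" "norm (gy Fi p) <= z" using v(2) norm_fst_le[of "gs Fi p" "gy Fi p"] norm_snd_le[of "gy Fi p" "gs Fi p"] by auto
   have z0: "0 <= z" by (simp add: z_def)
   have b: "||bt eps p|| <= B" using bt_bound[OF True, of eps] e by (simp add: B_def)
   have KS: "0 <= K * (1 + 2 * SR)" using K_nonneg SR(1) by simp
   have "||Xp Fi p|| <= K * (1 + 2 * SR) * (z + z)" by (rule order_trans[OF Xp_bound[OF True, of Fi] mult_left_mono[OF add_mono[OF v(1) g(2)] KS]])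
   then have D: "||Dp Fi p|| <= (1 + 2 * K * (1 + 2 * SR)) * z" unfolding Dp_def using g(1) by (simp add: algebra_simps)
   have t1: "||Dp Fi p * Dp Fi p|| <= (1 + 2 * K * (1 + 2 * SR))~2 * (z * z)"
    using mult_mono[OF D D order_trans[OF abs_ge_zero D] abs_ge_zero] by (simp only: abs_mult power2_eq_square mult_ac)
   have "H (fst p) * (norm (gy Fi p))~2 = (sH p * norm (gy Fi p))~2" by (simp add: power_mult_distrib sH_sq)
   also have "... <= z~2" using z(2) sH_pos[of p] by (intro power_mono) auto
   finally have "||bt eps p|| * (H (fst p) * (norm (gy Fi p))~2) <= B * z~2" using b B0 H_pos[of "fst p"] by (intro mult_mono) auto
   then have t2: "||bt eps p * H (fst p) / eps~2 * (gy Fi p @. gy Fi p)|| <= B / eps~2 * (z * z)"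
    using H_pos[of "fst p"] e by (simp add: abs_mult power2_norm_eq_inner[symmetric] divide_right_mono power2_eq_square[of z, symmetric] mult.assoc)
   have vz: "||vv Fi p * vv Fi p|| <= z * z" unfolding abs_mult using v(1) z0 by (intro mult_mono) auto
   have "||lam0 * bt eps p / (eps~2 * M~2)|| <= lam0 * B / (eps~2 * M~2)" using b lam0_pos by (auto simp: abs_mult intro!: divide_right_mono mult_left_mono)
   then have t3: "||lam0 * bt eps p / (eps~2 * M~2) * (vv Fi p * vv Fi p)|| <= lam0 * B / (eps~2 * M~2) * (z * z)"
    unfolding abs_mult[of "lam0 * bt eps p / (eps~2 * M~2)"] using vz B0 lam0_pos by (intro mult_mono) auto
   have t4: "||c * (vv Fi p * vv Fi p)|| <= ||c|| * (z * z)" unfolding abs_mult[of c] using vz by (intro mult_left_mono) auto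
   show ?thesis unfolding gden_def z_def[symmetric] B_def[symmetric] distrib_right using t1 t2 t3 t4 by linarith
  next
   case False then show ?thesis using elim C0 by (simp add: gden_def Dp_def Xp_def)
  qed
 qed
 have m: "gden eps c Fi Fi \<in> bm" using borel_measurable_integrable[OF gden_terms(5)[OF pairI_Q[OF Q Q] e]] by simp
 show ?thesis using CS_bound(2)[OF Z_sqi(1)[OF Q] Z_sqi(1)[OF Q] m ae C0] by (simp add: gq_def)
qed

text \<open>The weighted gradients converge to some limit; dividing by \<open>sH\<close>, which is
  bounded below, and using uniqueness of L2 limits identifies it with the weighted gradient of
  \<open>Fi\<close>.\<close>

lemma Q_closed:
 assumes X: "!!n. Q (X n)" and c: "!!e. e > 0 ==> \<exists>N. \<forall>m\<ge>N. \<forall>n\<ge>N. N2 (%p. Z (X m) p - Z (X n) p) < e"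
 shows "\<exists>Fi. l2lim X Fi & Q Fi & l2lim (%n. Z (X n)) (Z Fi)"
proof -
 obtain f where f: "l2lim (%n. Z (X n)) f" using l2_complete[of "%n. Z (X n)"] Z_sqi(1)[OF X] c by blast
 define Fi where "Fi p = fst (f p)" for p
 have l1: "l2lim X Fi" using l2lim_fst[OF f] by (simp add: Z_def Fi_def[abs_def])
 have W: "W (J \<times> S) Fi" by (rule W_closed[OF Q_W[OF X] l1])
 note [measurable] = W_parts(4)[OF W]
 have l2: "l2lim (%n p. sH p *R gy (X n) p) (%p. snd (f p))" using l2lim_snd[OF f] by (simp add: Z_def)
 have sb: "||1 / sH p|| <= M" for p using M_sH[of p] sH_pos[of p] by (simp add: field_simps)
 have "l2lim (%n p. (1 / sH p) *R (sH p *R gy (X n) p)) (%p. (1 / sH p) *R snd (f p))"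
  by (rule l2lim_bdd_mult[OF l2 _ sb]) measurable
 moreover have "(1 / sH p) *R (sH p *R gy (X n) p) = gy (X n) p" for n p using sH_pos[of p] by simp
 ultimately have l3: "l2lim (%n p. gy (X n) p) (%p. (1 / sH p) *R snd (f p))" by simp
 have ae: "AL p. f p = Z Fi p" using l2lim_unique[OF l3 l2lim_snd[OF l2lim_snd[OF l1]]]
 proof eventually_elim
  case (elim p)
  then have "sH p *R ((1 / sH p) *R snd (f p)) = sH p *R gy Fi p" by simp
  then show ?case using sH_pos[of p] by (simp add: Z_def Fi_def prod_eq_iff)
 qed
 have Zm: "Z Fi \<in> bm" unfolding Z_def[abs_def] by measurable
 have lZ: "l2lim (%n. Z (X n)) (Z Fi)" by (rule l2lim_AE_cong[OF f ae Zm])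
 then have "sqi (Z Fi)" by (simp add: l2lim_def)
 then have "sqi (%p. sH p *R gy Fi p)" using sqi_snd(1)[of "Z Fi"] by (simp add: Z_def)
 then show ?thesis using l1 W lZ by (intro exI[of _ Fi]) (simp add: Q_def)
qed

lemma Z_lin: "Z (%p. Fi p + a *R Gi p) p = Z Fi p + a *R Z Gi p" by (simp add: Z_def algebra_simps)

lemma Z_diff: "Z (%p. Fi p - Gi p) = (%p. Z Fi p - Z Gi p)" using Z_lin[of Fi "-1" Gi] by auto

lemma vv_le_Z: assumes "Q Fi" shows "N2 (vv Fi) <= N2 (Z Fi)"
 using Z_sqi(2,3)[OF assms] N2_nonneg[of "gs Fi"] N2_nonneg[of "gy Fi"] N2_nonneg[of "%p. sH p *R gy Fi p"] by linarith

text \<open>Riesz representation on the finite-energy elements of the subspace. The equation is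
  obtained only against test elements of finite energy; extending it is the task of the regularity
  lemma.\<close>

lemma form_solution:
 assumes V: "fsp \<V>" and co: "coer eps c C" and F: "sqi F"
 shows "\<exists>u\<in>\<V>. Q u & (\<forall>v\<in>\<V>. Q v --> gq eps c u v = (LI p. F p * vv v p))"
proof -
 define A where "A = {Fi \<in> \<V>. Q Fi}"
 have e: "0 < eps" and C: "0 < C" and cb: "!!Fi. Q Fi ==> C * N2 (Z Fi) <= gq eps c Fi Fi" using co by (auto simp: coer_def)
 have Q: "Fi \<in> A ==> Q Fi" and AV: "Fi \<in> A ==> Fi \<in> \<V>" for Fi by (auto simp: A_def)
 have iF: "intb (%p. F p * vv Fi p)" if "Q Fi" for Fi by (rule sqi_times[OF F W_parts(1)[OF Q_W[OF that]]])
 have "\<exists>u\<in>A. \<forall>v\<in>A. gq eps c u v = (LI p. F p * vv v p)"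
 proof (rule riesz_representation[where K = "sqrt (N2 F) * sqrt (1 / C)"])
  show "(%x. 0) \<in> A" using fspD(2)[OF V] W_zero by (simp add: A_def Q_def)
  show lin: "(%x. f x + a *R g x) \<in> A" if "f \<in> A" "g \<in> A" for f g a using that fspD(3)[OF V] Q_lin by (simp add: A_def)
  show "gq eps c f g = gq eps c g f" for f g by (rule gq_sym)
  show "gq eps c (%x. f x + a *R g x) h = gq eps c f h + a * gq eps c g h" if "f \<in> A" "g \<in> A" "h \<in> A" for f g h a
   by (rule gq_lin[OF pairI_Q pairI_Q e]) (use that Q in auto)
  show "0 <= gq eps c f f" if "f \<in> A" for f by (rule order_trans[OF _ cb[OF Q[OF that]]]) (use C in simp)
  show "(LI p. F p * vv (%x. f x + a *R g x) p) = (LI p. F p * vv f p) + a * (LI p. F p * vv g p)" if "f \<in> A" "g \<in> A" for f g a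
  proof -
   have "(LI p. F p * vv f p + a * (F p * vv g p)) = (LI p. F p * vv f p) + (LI p. a * (F p * vv g p))"
    by (intro bl_add integrable_mult_right iF Q that)
   then show ?thesis by (simp add: algebra_simps)
  qed
  show "||\<integral>p. F p * vv f p \<partial>lborel|| <= sqrt (N2 F) * sqrt (1 / C) * sqrt (gq eps c f f)" if "f \<in> A" for f
  proof -
   have "N2 (vv f) <= 1 / C * gq eps c f f" using order_trans[OF mult_left_mono[OF vv_le_Z[OF Q[OF that]], of C] cb[OF Q[OF that]]] C by (simp add: field_simps)
   then have "sqrt (N2 (vv f)) <= sqrt (1 / C) * sqrt (gq eps c f f)" unfolding real_sqrt_mult[symmetric] by (rule real_sqrt_le_mono)
   then have "sqrt (N2 F) * sqrt (N2 (vv f)) <= sqrt (N2 F) * (sqrt (1 / C) * sqrt (gq eps c f f))" by (rule mult_left_mono) simp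
   then show ?thesis using order_trans[OF CS_inner[OF F W_parts(1)[OF Q_W[OF Q[OF that]]], unfolded inner_real_def]] by (simp add: mult.assoc)
  qed
  fix X :: "nat => _" assume X: "!!n. X n \<in> A" and ch: "!!e. e > 0 ==> \<exists>N. \<forall>m\<ge>N. \<forall>n\<ge>N. gq eps c (%x. X m x - X n x) (%x. X m x - X n x) < e"
  have QX: "Q (X n)" for n by (rule Q[OF X])
  have Qd: "Q (%x. Fi x - Gi x)" if "Q Fi" "Q Gi" for Fi Gi using Q_lin[OF that, of "-1"] by simp
  have "\<exists>N. \<forall>m\<ge>N. \<forall>n\<ge>N. N2 (%p. Z (X m) p - Z (X n) p) < r" if r: "r > 0" for r
  proof -
   obtain N where N: "!!m n. m >= N ==> n >= N ==> gq eps c (%x. X m x - X n x) (%x. X m x - X n x) < C * r" using ch[OF mult_pos_pos[OF C r]] by blast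
   have "N2 (%p. Z (X m) p - Z (X n) p) < r" if "m >= N" "n >= N" for m n
   proof -
    have "C * N2 (%p. Z (X m) p - Z (X n) p) < C * r" using le_less_trans[OF cb[OF Qd[OF QX[of m] QX[of n]]] N[OF that]] by (simp add: Z_diff)
    then show ?thesis using C by simp
   qed
   then show ?thesis by blast
  qed
  then obtain Fi where P: "l2lim X Fi" "Q Fi" "l2lim (%n. Z (X n)) (Z Fi)" using Q_closed[of X, OF QX] by blast
  define U where "U = ((1 + 2 * K * (1 + 2 * SR))~2 + (1 + eps * (K * SR)) / eps~2 + lam0 * (1 + eps * (K * SR)) / (eps~2 * M~2) + ||c||)"
  have ub: "gq eps c (%x. X n x - Fi x) (%x. X n x - Fi x) <= U * N2 (%p. Z (X n) p - Z Fi p)" for n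
   using gq_upper[OF Qd[OF QX[of n] P(2)] e, of c] unfolding U_def[symmetric] Z_diff by linarith
  have lb: "0 <= gq eps c (%x. X n x - Fi x) (%x. X n x - Fi x)" for n by (rule order_trans[OF _ cb[OF Qd[OF QX P(2)]]]) (use C in simp)
  have "(%n. U * N2 (%p. Z (X n) p - Z Fi p)) ~~> U * 0" using P(3) unfolding l2lim_def by (intro tendsto_intros) auto
  then have l: "(%n. U * N2 (%p. Z (X n) p - Z Fi p)) ~~> 0" by simp
  have "(%n. gq eps c (%x. X n x - Fi x) (%x. X n x - Fi x)) ~~> 0"
   by (rule tendsto_sandwich[OF _ _ tendsto_const l]) (use lb ub in auto)
  moreover have "Fi \<in> A" using fspD(4)[OF V _ P(1)] P(2) AV[OF X] by (simp add: A_def)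
  ultimately show "\<exists>f\<in>A. (%n. gq eps c (%x. X n x - f x) (%x. X n x - f x)) ~~> 0" by blast
 qed
 then show ?thesis by (auto simp: A_def)
qed

end

lemma test_fun_real:
 fixes et :: "real => real"
 assumes t: "test_fun UNIV et" and z: "!!s. ||s|| > 1 ==> et s = 0" and r: "0 < r"
 shows "test_fun UNIV (%s. et (r * s + a))" "cgrad (%s. et (r * s + a)) s = r * cgrad et (r * s + a)"
proof -
 have sm: "sm et" by (rule test_funD(1)[OF t])
 show "test_fun UNIV (%s. et (r * s + a))"
 proof (rule test_funI[of _ "{(-1 - a) / r..(1 - a) / r}"])
  show "sm (%s. et (r * s + a))" by (rule sm_affine[OF bounded_linear_mult_right sm])
  show "et (r * s + a) = 0" if "s \<notin> {(-1 - a) / r..(1 - a) / r}" for s using that r by (intro z) (auto simp: field_simps)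
 qed auto
 have "((%s. et (r * s + a)) has_derivative (%h. cgrad et (r * s + a) @. (r * h))) (at s)"
  by (rule has_derivative_compose[OF _ sm_has_cgrad[OF sm]]) (auto intro!: derivative_eq_intros)
 then show "cgrad (%s. et (r * s + a)) s = r * cgrad et (r * s + a)" by (intro cgrad_unique) (simp add: mult_ac)
qed

lemma cutoff_sequence:
 obtains m :: "nat => real => real" and C where "!!n. test_fun UNIV (m n)" "!!n s. ||m n s|| <= C" "!!n s. ||cgrad (m n) s|| <= C"
  "!!s. (%n. m n s) ~~> 1" "!!s. (%n. cgrad (m n) s) ~~> 0"
proof -
 obtain et where e: "test_fun UNIV et" "et (0::real) = 1" "!!s. ||s|| > 1 ==> et s = 0" using unit_cutoff by blast
 obtain C R where C: "0 <= C" "!!s. ||et s|| <= C" "!!s. ||cgrad et s|| <= C" using test_fun_bounds[OF e(1)] by metis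
 define r where "r n = 1 / real (Suc n)" for n
 have r: "0 < r n" "r n <= 1" for n by (auto simp: r_def)
 have rl: "r ~~> 0" unfolding r_def by (rule lim_1_over_n[THEN LIMSEQ_Suc])
 have rs: "(%n. r n * s) ~~> 0 * s" for s by (intro tendsto_intros rl)
 note t = test_fun_real[OF e(1) e(3) r(1), where a = 0, unfolded add_0_right]
 have i: "isCont f 0 ==> (%n. f (r n * s)) ~~> f 0" for f :: "real => real" and s
  using rs[of s] by (intro isCont_tendsto_compose[of 0 f]) simp_all
 have c: "isCont et 0" "isCont (cgrad et) 0"
  using sm_continuous[OF test_funD(1)[OF e(1)], of UNIV] sm_cgrad_continuous[OF test_funD(1)[OF e(1)], of UNIV] by (auto simp: continuous_on_eq_continuous_at)
 have d: "(%n. r n * cgrad et (r n * s)) ~~> 0 * cgrad et 0" for s by (intro tendsto_mult rl i[OF c(2)])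
 have b: "||r n * cgrad et (r n * s)|| <= C" for n s
  using mult_mono[OF r(2)[of n] C(3)[of "r n * s"]] r(1)[of n] by (simp add: abs_mult)
 show ?thesis
  by (rule that[of "%n s. et (r n * s)" C]) (use t C b i[OF c(1)] e(2) d in simp_all)
qed

context tube
begin

text \<open>A smooth stand-in for sqrt H on |s| <= N: integer translates of one bump with weights
  sqrt (H n). At most three translates meet at a point and \<open>H_comp\<close> compares the
  neighbouring weights, so value and derivative are bounded by sqrt H with constants independent of
  N.\<close>

lemma weight_cutoff:
 "\<exists>C c. 0 <= C & 0 < c & (\<forall>N::nat. \<exists>m. test_fun UNIV m & (\<forall>s. ||m s|| <= C * sqrt (H s)) & (\<forall>s. ||cgrad m s|| <= C * sqrt (H s)) \<and>
  (\<forall>s. ||s|| <= real N --> c * sqrt (H s) <= m s))"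
proof -
 obtain et c where e: "test_fun UNIV et" "!!s. 0 <= et s" "!!s. ||s|| > 1 ==> et s = 0" "!!s. ||s|| > 1 ==> cgrad et s = (0::real)" "0 < c" "!!s. ||s|| <= 1/2 ==> c <= et s"
  using unit_cutoff by blast
 obtain D R where D: "0 <= D" "!!s. ||et s|| <= D" "!!s. ||cgrad et s|| <= D" using test_fun_bounds[OF e(1)] by metis
 define C where "C = 3 * (sqrt L * D)"
 have t: "test_fun UNIV (%s. et (s + a))" "cgrad (%s. et (s + a)) s = cgrad et (s + a)" for a s
  using test_fun_real[OF e(1) e(3), where r=1 and a=a] by simp_all
 have bd: "||\<Sum>n\<in>A. sqrt (H (of_int n)) * g (s + - of_int n)|| <= C * sqrt (H s)"
  if A: "finite A" and g: "!!t. ||g t|| <= D" "!!t. ||t|| > 1 ==> g t = 0" for A :: "int set" and g s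
 proof -
  define B where "B = {\<lfloor>s\<rfloor> - 1..\<lfloor>s\<rfloor> + 1}"
  have o: "||s + - of_int n|| > 1" if "n \<notin> B" for n :: int using that by (simp add: B_def) linarith
  have "(\<Sum>n\<in>A. sqrt (H (of_int n)) * g (s + - of_int n)) = (\<Sum>n\<in>A \<inter> B. sqrt (H (of_int n)) * g (s + - of_int n))"
   using A g(2)[OF o] by (intro sum.mono_neutral_right) auto
  also have "||...|| <= (\<Sum>n\<in>A \<inter> B. ||sqrt (H (of_int n)) * g (s + - of_int n)||)" by (rule sum_abs)
  also have "... <= of_nat (card (A \<inter> B)) * (sqrt L * sqrt (H s) * D)"
  proof (rule sum_bounded_above)
   fix n assume "n \<in> A \<inter> B"
   have sL: "0 <= sqrt L * sqrt (H s) * D" using D(1) L_ge H_pos[of s] by simp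
   show "||sqrt (H (of_int n)) * g (s + - of_int n)|| <= sqrt L * sqrt (H s) * D"
   proof (cases "||s + - of_int n|| <= 1")
    case True
    then have "||of_int n - s|| <= 1" by linarith
    then have "sqrt (H (of_int n)) <= sqrt (L * H s)" by (intro real_sqrt_le_mono H_comp)
    then show ?thesis unfolding abs_mult using g(1) H_pos[of "of_int n"] H_pos[of s] L_ge by (intro mult_mono) (auto simp: real_sqrt_mult)
   next
    case False then show ?thesis using g(2)[of "s + - of_int n"] sL by simp
   qed
  qed
  also have "... <= 3 * (sqrt L * sqrt (H s) * D)"
  proof (rule mult_right_mono)
   have "card (A \<inter> B) <= card B" by (rule card_mono) (auto simp: B_def)
   then show "real (card (A \<inter> B)) <= 3" by (simp add: B_def)
  qed (use D L_ge H_pos[of s] in simp)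
  finally show ?thesis by (simp add: C_def mult_ac)
 qed
 have "\<exists>m. test_fun UNIV m & (\<forall>s. ||m s|| <= C * sqrt (H s)) & (\<forall>s. ||cgrad m s|| <= C * sqrt (H s)) & (\<forall>s. ||s|| <= real N --> c / sqrt L * sqrt (H s) <= m s)" for N :: nat
 proof -
  define A where "A = {- int N - 1..int N + 1}"
  have A: "finite A" by (simp add: A_def)
  define m where "m s = (\<Sum>n\<in>A. sqrt (H (of_int n)) * et (s + - of_int n))" for s
  have tt: "test_fun UNIV (%s. \<Sum>n\<in>F. sqrt (H (of_int n)) * et (s + - of_int n))" if "finite F" for F :: "int set"
   using that
  proof (induction F)
   case empty then show ?case by (simp add: test_fun_zero)
  next
   case (insert n F)
   then show ?case using test_fun_add[OF test_fun_mult[OF t(1)[of "- of_int n"] sm_const[of "sqrt (H (of_int n))"]]] by simp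
  qed
  have tm: "test_fun UNIV m" unfolding m_def by (rule tt[OF A])
  have cm: "cgrad m s = (\<Sum>n\<in>A. sqrt (H (of_int n)) * cgrad et (s + - of_int n))" for s
  proof (rule cgrad_unique)
   have "((%s. sqrt (H (of_int n)) * et (s + - of_int n)) has_derivative (%h. sqrt (H (of_int n)) * (cgrad et (s + - of_int n) @. h))) (at s)" for n
    using has_derivative_mult_right[OF sm_has_cgrad[OF test_funD(1)[OF t(1)[of "- of_int n"]], of s], of "sqrt (H (of_int n))"] unfolding t(2) .
   then have "(m has_derivative (%h. \<Sum>n\<in>A. sqrt (H (of_int n)) * (cgrad et (s + - of_int n) @. h))) (at s)"
    unfolding m_def[abs_def] by (rule has_derivative_sum)
   then show "(m has_derivative (%h. (\<Sum>n\<in>A. sqrt (H (of_int n)) * cgrad et (s + - of_int n)) @. h)) (at s)"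
    by (simp add: sum_distrib_right mult.assoc)
  qed
  have low: "c / sqrt L * sqrt (H s) <= m s" if s: "||s|| <= real N" for s
  proof -
   define n where "n = round s"
   have n: "||s + - of_int n|| <= 1/2" using of_int_round_abs_le[of s] by (simp add: n_def abs_minus_commute)
   have "real_of_int (- int N - 1) <= real_of_int n" "real_of_int n <= real_of_int (int N + 1)" using n s by (simp, linarith)+
   then have nA: "n \<in> A" unfolding of_int_le_iff by (simp add: A_def)
   have "sqrt (H s) <= sqrt (L * H (of_int n))" by (intro real_sqrt_le_mono H_comp) (use n in linarith)
   then have "c * sqrt (H s) <= c * (sqrt L * sqrt (H (of_int n)))" using e(5) by (intro mult_left_mono) (auto simp: real_sqrt_mult)
   then have "c / sqrt L * sqrt (H s) <= sqrt (H (of_int n)) * c" using L_ge by (simp add: field_simps)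
   also have "... <= sqrt (H (of_int n)) * et (s + - of_int n)" using e(6)[OF n] H_pos[of "of_int n"] by (intro mult_left_mono) auto
   also have "... <= m s" unfolding m_def by (rule member_le_sum[OF nA _ A]) (use e(2) H_pos in \<open>auto intro!: mult_nonneg_nonneg simp: less_imp_le\<close>)
   finally show ?thesis .
  qed
  show ?thesis by (intro exI[of _ m] conjI tm allI impI low) (auto simp only: m_def cm intro!: bd A D e(3,4))
 qed
 moreover have "0 <= C" "0 < c / sqrt L" using D L_ge e(5) by (auto simp: C_def)
 ultimately show ?thesis by blast
qed

text \<open>Testing with \<open>m~2 u\<close> for cutoffs \<open>m\<close> comparable to the square root of \<open>H\<close> trades one power of the
 unbounded weight for the right hand side, so a finite-energy solution pairs with every element of the form domain.\<close>
lemma solution_regularity: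
 assumes V: "fsp \<V>" and co: "coer eps c C" and F: "sqi F" and u: "u \<in> \<V>" "Q u"
  and sol: "!!v. v \<in> \<V> ==> Q v ==> gq eps c u v = (LI p. F p * vv v p)"
 shows "sqi (%p. H (fst p) *R gy u p)"
proof -
 have e: "0 < eps" and C: "0 < C" and cb: "!!Fi. Q Fi ==> C * N2 (Z Fi) <= gq eps c Fi Fi" using co by (auto simp: coer_def)
 note W = Q_W[OF u(2)] note [measurable] = W_parts(4)[OF W]
 have [measurable]: "F \<in> bm" using F by (simp add: sqi_def)
 obtain D d where D: "0 <= D" and d: "0 < d" and ex: "!!N::nat. \<exists>m. test_fun UNIV m & (\<forall>s. ||m s|| <= D * sqrt (H s)) & (\<forall>s. ||cgrad m s|| <= D * sqrt (H s)) \<and>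
  (\<forall>s. ||s|| <= real N --> d * sqrt (H s) <= m s)" using weight_cutoff by blast
 define a where "a = D * (sqrt (N2 F) * sqrt (1 / (lam0 * C)))"
 define b where "b = D~2 * N2 (%p. sH p *R vv u p)"
 define X where "X N p = (if ||fst p|| <= real N then H (fst p) *R gy u p else 0)" for N :: nat and p
 have main: "sqi (X N)" "N2 (X N) <= (1 / d)~2 * ((a~2 + 2 * b) / C)" for N
 proof -
  obtain m where m: "test_fun UNIV m" "!!s. ||m s|| <= D * sqrt (H s)" "!!s. ||cgrad m s|| <= D * sqrt (H s)" "!!s. ||s|| <= real N ==> d * sqrt (H s) <= m s"
   using ex[of N] by blast
  have [measurable]: "m \<in> bm" "cgrad m \<in> bm" using test_funD(1)[OF m(1)] by (auto intro: sm_borel sm_cgrad_borel)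
  define x where "x = gq eps c (Mm m u) (Mm m u)"
  have Q1: "Q (Mm m u)" by (rule Mm_Q[OF W m(1)])
  have Zx: "N2 (Z (Mm m u)) <= x / C" using cb[OF Q1] C by (simp add: x_def field_simps)
  have x0: "0 <= x" using order_trans[OF N2_nonneg Zx] C by (simp add: zero_le_divide_iff)
  have V1: "Mm m (Mm m u) \<in> \<V>" by (intro fspD(5)[OF V] u m)
  have "x - N2 (%p. cgrad m (fst p) * vv u p) = (LI p. F p * vv (Mm m (Mm m u)) p)"
   using gq_Mm(1)[OF W m(1) e, of c] sol[OF V1 Mm_Q[OF Q_W[OF Q1] m(1)]] by (simp add: x_def)
  moreover have "N2 (%p. cgrad m (fst p) * vv u p) <= b" unfolding b_def
  proof (rule sqi_bound(2)[OF _ Q_v(1)[OF u(2)]])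
   show "AL p. norm (cgrad m (fst p) * vv u p) <= D * norm (sH p *R vv u p)"
    using mult_right_mono[OF m(3) abs_ge_zero] H_pos by (intro AE_I2) (auto simp: abs_mult sH_def less_imp_le mult.assoc)
  qed measurable
  moreover have "||\<integral>p. F p * vv (Mm m (Mm m u)) p \<partial>lborel|| <= a * sqrt x"
  proof -
   note s = Q_v[OF Q1]
   have "||\<integral>p. F p * vv (Mm m (Mm m u)) p \<partial>lborel|| <= D * (sqrt (N2 F) * sqrt (N2 (%p. sH p *R vv (Mm m u) p)))"
   proof (rule CS_bound(2)[OF F s(1) _ _ D])
    show "AL p. ||F p * vv (Mm m (Mm m u)) p|| <= D * (norm (F p) * norm (sH p *R vv (Mm m u) p))"
    proof (rule AE_I2)
     fix p
     have "||m (fst p)|| * ( ||F p|| * ||vv (Mm m u) p||) <= (D * sqrt (H (fst p))) * ( ||F p|| * ||vv (Mm m u) p||)" by (rule mult_right_mono[OF m(2)]) simp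
     then show "||F p * vv (Mm m (Mm m u)) p|| <= D * (norm (F p) * norm (sH p *R vv (Mm m u) p))"
      using H_pos[of "fst p"] by (simp add: Mm_def[of m "Mm m u"] abs_mult sH_def mult_ac)
    qed
   qed (unfold Mm_def, measurable)
   also have "N2 (%p. sH p *R vv (Mm m u) p) <= 1 / (lam0 * C) * x"
   proof -
    have "N2 (%p. sH p *R gy (Mm m u) p) <= x / C" using Z_sqi(2)[OF Q1] N2_nonneg[of "Mm m u"] Zx by linarith
    then have "1 / lam0 * N2 (%p. sH p *R gy (Mm m u) p) <= 1 / lam0 * (x / C)" using lam0_pos by (intro mult_left_mono) auto
    then show ?thesis using s(2) by (simp add: field_simps)
   qed
   finally show ?thesis using D by (simp add: a_def real_sqrt_mult real_sqrt_divide mult_left_mono mult.assoc)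
  qed
  \<comment> \<open>This bounds x, and with it the truncated field \<open>X N\<close>, independently
    of N; Fatou's lemma then removes the truncation.\<close>
  ultimately have "x <= a * sqrt x + b" by linarith
  moreover have "2 * (a * sqrt x) <= a~2 + x" using sum_squares_ge_zero[of "a - sqrt x" 0] x0 by (simp add: power2_eq_square algebra_simps)
  ultimately have "x <= a~2 + 2 * b" by linarith
  then have "x / C <= (a~2 + 2 * b) / C" using C by (simp add: divide_right_mono)
  then have Nb: "N2 (%p. sH p *R gy (Mm m u) p) <= (a~2 + 2 * b) / C" using Z_sqi(2)[OF Q1] N2_nonneg[of "Mm m u"] Zx by linarith
  have ae: "AL p. norm (X N p) <= 1 / d * norm (sH p *R gy (Mm m u) p)"
  proof (rule AE_I2)
   fix p
   show "norm (X N p) <= 1 / d * norm (sH p *R gy (Mm m u) p)"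
   proof (cases "||fst p|| <= real N")
    case True
    have "d * sH p <= m (fst p)" using m(4)[OF True] by (simp add: sH_def)
    then have i: "(d * sH p) * (sH p * norm (gy u p)) <= m (fst p) * (sH p * norm (gy u p))" using sH_pos[of p] by (intro mult_right_mono) auto
    have j: "(d * sH p) * (sH p * norm (gy u p)) = d * (H (fst p) * norm (gy u p))" using sH_sq[of p] by (simp add: power2_eq_square mult.assoc[symmetric])
    have "0 <= m (fst p)" using m(4)[OF True] d H_pos[of "fst p"] by (meson less_imp_le mult_nonneg_nonneg order_trans real_sqrt_ge_zero)
    then show ?thesis using i[unfolded j] d H_pos[of "fst p"] sH_pos[of p] True by (simp add: X_def Mm_def pos_le_divide_eq mult_ac)
   next
    case False then show ?thesis using d by (simp add: X_def)
   qed
  qed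
  have Xm: "X N \<in> bm" unfolding X_def[abs_def] by measurable
  show "sqi (X N)" by (rule sqi_bound(1)[OF Xm Q_gy[OF Q1] ae])
  show "N2 (X N) <= (1 / d)~2 * ((a~2 + 2 * b) / C)"
   by (rule order_trans[OF sqi_bound(2)[OF Xm Q_gy[OF Q1] ae] mult_left_mono[OF Nb]]) simp
 qed
 show ?thesis
 proof (rule l2_fatou(1)[OF main(1) _ _ main(2) tendsto_const])
  show "AL p. (%N. X N p) ~~> H (fst p) *R gy u p"
  proof (rule AE_I2)
   fix p :: "real * real \<times> real"
   obtain k :: nat where k: "||fst p|| <= real k" using real_arch_simple by blast
   have "eventually (%N. X N p = H (fst p) *R gy u p) sequentially"
    using eventually_ge_at_top[of k] by eventually_elim (use k in \<open>auto simp: X_def\<close>)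
   then show "(%N. X N p) ~~> H (fst p) *R gy u p" by (rule tendsto_eventually)
  qed
 qed measurable
qed

text \<open>The form with first argument u, written as a pointwise pairing with the second argument
  and its gradient. Once H times the y-gradient of u is in L2 this field is too, so the form becomes
  continuous in its second argument.\<close>

definition "Gd eps c u p = ((c - lam0 * bt eps p / (eps~2 * M~2)) * vv u p - rho (fst p) * Dp u p,
 (Dp u p, (sig (fst p) * Dp u p) *R Rrot (snd p) - (rho (fst p) * Dp u p) *R snd p + (bt eps p / eps~2) *R (H (fst p) *R gy u p)))"

lemma gden_Gd: "gden eps c u v p = Gd eps c u p @. v p"
proof -
 have i: "x @. y = fst x * fst y + (fst (snd x) * fst (snd y) + snd (snd x) @. snd (snd y))" for x y :: "real * real \<times> real * real"
  by (simp add: inner_prod_def)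
 show ?thesis unfolding i gden_def Gd_def Dp_def[of v] Xp_def[of v]
  by (simp add: inner_add_left inner_diff_left inner_commute[of "Rrot _"] inner_commute[of "snd p"] inner_commute[of "gy u p"] algebra_simps diff_divide_distrib)
qed

lemma Gd_sqi:
 assumes W: "W (J \<times> S) u" and s: "sqi (%p. H (fst p) *R gy u p)" and e: "0 < eps"
 shows "sqi (Gd eps c u)"
proof -
 define B where "B = 1 + eps * (K * SR)"
 have out: "AL p. snd p \<notin> S --> Fi p = 0" if "!!p. u p = 0 ==> Fi p = 0" for Fi :: "real * real \<times> real => 'b::zero"
  using W_out[OF W] by eventually_elim (use that in auto)
 have bt: "||bt eps p|| <= B" if "snd p \<in> S" for p using bt_bound[OF that, of eps] e by (simp add: B_def)
 note D = Dp_sqi[OF W] note [measurable] = W_parts(4)[OF W] sqi_measurable[OF D]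
 have D0: "AL p. snd p \<notin> S --> Dp u p = 0" by (rule out) (simp add: Dp_def Xp_def)
 have ov: "AL p. snd p \<notin> S --> vv u p = 0" and og: "AL p. snd p \<notin> S --> gy u p = 0" by (rule out; simp)+
 have 1: "sqi (%p. (c - lam0 * bt eps p / (eps~2 * M~2)) *R vv u p)"
 proof (rule sqi_bdd_scale(1)[OF W_parts(1)[OF W], where C = "||c|| + lam0 * B / (eps~2 * M~2)"])
  show "AL p. vv u p = 0 | ||c - lam0 * bt eps p / (eps~2 * M~2)|| <= ||c|| + lam0 * B / (eps~2 * M~2)"
   using ov
  proof eventually_elim
   case (elim p)
   have "||lam0 * bt eps p / (eps~2 * M~2)|| <= lam0 * B / (eps~2 * M~2)" if "snd p \<in> S"
    using bt[OF that] lam0_pos by (auto simp: abs_mult intro!: divide_right_mono mult_left_mono)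
   then show ?case using elim by (metis (no_types) abs_triangle_ineq4 add_left_mono order_trans)
  qed
 qed measurable
 have 2: "sqi (%p. rho (fst p) *R Dp u p)" by (rule sqi_bdd_scale(1)[OF D, where C=K]) (use coeff_bound in auto)
 have 3: "sqi (%p. (sig (fst p) * Dp u p) *R Rrot (snd p))" "sqi (%p. (rho (fst p) * Dp u p) *R snd p)"
 proof -
  have b: "||k * x|| * norm y <= K * SR * ||x||" if "||k|| <= K" "norm y <= SR" for k x :: real and y :: "real * real"
   using mult_right_mono[OF mult_mono[OF that K_nonneg norm_ge_zero], of "||x||"] by (simp add: abs_mult mult_ac)
  have "AL p. norm ((sig (fst p) * Dp u p) *R Rrot (snd p)) <= K * SR * norm (Dp u p) & norm ((rho (fst p) * Dp u p) *R snd p) <= K * SR * norm (Dp u p)"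
   using D0
  proof eventually_elim
   case (elim p)
   then show ?case using b[OF coeff_bound(2) SR(2), of "snd p" "fst p" "Dp u p"] b[OF coeff_bound(1) SR(2), of "snd p" "fst p" "Dp u p"] by (cases "snd p \<in> S") (auto simp: norm_Rrot)
  qed
  then have "AL p. norm ((sig (fst p) * Dp u p) *R Rrot (snd p)) <= K * SR * norm (Dp u p)" "AL p. norm ((rho (fst p) * Dp u p) *R snd p) <= K * SR * norm (Dp u p)"
   by (auto elim: eventually_mono)
  then show "sqi (%p. (sig (fst p) * Dp u p) *R Rrot (snd p))" "sqi (%p. (rho (fst p) * Dp u p) *R snd p)"
   by (auto intro!: sqi_bound(1)[OF _ D])
 qed
 have 4: "sqi (%p. (bt eps p / eps~2) *R (H (fst p) *R gy u p))"
 proof (rule sqi_bdd_scale(1)[OF s, where C = "B / eps~2"])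
  show "AL p. H (fst p) *R gy u p = 0 | ||bt eps p / eps~2|| <= B / eps~2"
   using og by eventually_elim (use bt e in \<open>auto simp: divide_right_mono\<close>)
 qed measurable
 show ?thesis unfolding Gd_def[abs_def]
  using sqi_Pair(1)[OF sqi_diff(1)[OF 1 2] sqi_Pair(1)[OF D sqi_add(1)[OF sqi_diff(1)[OF 3] 4]]] by simp
qed

lemma l2lim_Mm:
 assumes W: "W (J \<times> S) v" and m: "!!n. test_fun UNIV (m n)" "!!n s. ||m n s|| <= C" "!!n s. ||cgrad (m n) s|| <= C"
  "!!s. (%n. m n s) ~~> 1" "!!s. (%n. cgrad (m n) s) ~~> 0"
 shows "l2lim (%n. Mm (m n) v) v" "l2lim (%n p. cgrad (m n) (fst p) *R vv v p) (%p. 0)"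
proof -
 have [measurable]: "m n \<in> bm" "cgrad (m n) \<in> bm" for n using test_funD(1)[OF m(1)] by (auto intro: sm_borel sm_cgrad_borel)
 have d: "l2lim (%n p. cgrad (m n) (fst p) *R f p) (%p. 0 *R f p)" if "sqi f" for f :: "real * real \<times> real => 'c::euclidean_space"
  by (rule l2lim_coeff[OF l2lim_const[OF that], where C=C]) (use m in auto)
 show "l2lim (%n p. cgrad (m n) (fst p) *R vv v p) (%p. 0)" using d[OF W_parts(1)[OF W]] by simp
 have "l2lim (%n p. m n (fst p) *R v p) (%p. 1 *R v p)"
  by (rule l2lim_coeff[OF l2lim_const[OF W_sqi(1)[OF W]], where C=C]) (use m in auto)
 moreover have "sqi (%p. (0::real, (vv v p, 0 :: real * real)))" by (intro sqi_Pair(1) W_parts(1)[OF W] sqi_zero)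
 ultimately have "l2lim (%n p. m n (fst p) *R v p + cgrad (m n) (fst p) *R (0::real, (vv v p, 0 :: real * real))) (%p. 1 *R v p + 0 *R (0::real, (vv v p, 0 :: real * real)))"
  by (rule l2lim_add[OF _ d])
 moreover have "m n (fst p) *R v p + cgrad (m n) (fst p) *R (0::real, (vv v p, 0 :: real * real)) = Mm (m n) v p" for n p
  by (simp add: Mm_def prod_eq_iff)
 ultimately show "l2lim (%n. Mm (m n) v) v" by (simp add: zero_prod_def[symmetric])
qed

text \<open>Cutoffs of an arbitrary v have finite energy and converge to v together with their
  gradients; by regularity of u the left side of the equation follows them to the limit.\<close>

theorem solution_exists:
 assumes V: "fsp \<V>" and co: "coer eps c C" and F: "sqi F"
 shows "\<exists>u\<in>\<V>. Q u & sqi (%p. H (fst p) *R gy u p) & (\<forall>v\<in>\<V>. gq eps c u v = (LI p. F p * vv v p))"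
proof -
 have e: "0 < eps" using co by (simp add: coer_def)
 obtain u where u: "u \<in> \<V>" "Q u" and sol: "!!v. v \<in> \<V> ==> Q v ==> gq eps c u v = (LI p. F p * vv v p)" using form_solution[OF assms] by blast
 have s: "sqi (%p. H (fst p) *R gy u p)" by (rule solution_regularity[OF V co F u sol])
 obtain m :: "nat => real => real" and D where m: "!!n. test_fun UNIV (m n)" "!!n s. ||m n s|| <= D" "!!n s. ||cgrad (m n) s|| <= D"
  "!!s. (%n. m n s) ~~> 1" "!!s. (%n. cgrad (m n) s) ~~> 0" using cutoff_sequence by blast
 have "gq eps c u v = (LI p. F p * vv v p)" if v: "v \<in> \<V>" for v
 proof -
  note l = l2lim_Mm(1)[OF fspD(1)[OF V v] m]
  have g: "gq eps c u Fi = (LI p. Gd eps c u p @. Fi p)" for Fi by (simp add: gq_def gden_Gd)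
  have l1: "(%n. gq eps c u (Mm (m n) v)) ~~> gq eps c u v" unfolding g by (rule l2lim_inner[OF l2lim_const[OF Gd_sqi[OF Q_W[OF u(2)] s e]] l])
  have eq: "gq eps c u (Mm (m n) v) = (LI p. F p * vv (Mm (m n) v) p)" for n
   by (rule sol[OF fspD(5)[OF V v m(1)] Mm_Q[OF fspD(1)[OF V v] m(1)]])
  have l2: "(%n. \<integral>p. F p * vv (Mm (m n) v) p \<partial>lborel) ~~> (LI p. F p * vv v p)" by (rule l2lim_times[OF l2lim_const[OF F] l2lim_fst[OF l]])
  show ?thesis by (rule LIMSEQ_unique[OF l1[unfolded eq] l2])
 qed
 then show ?thesis using u s by blast
qed

text \<open>\<open>u'\<close> may have infinite energy. The difference is tested with m^2 times
  itself, where all pairings converge; by \<open>gden_Mm\<close> the form of m times the difference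
  equals the squared norm of m' times it, which tends to 0, so coercivity finishes.\<close>

theorem solution_unique:
 assumes V: "fsp \<V>" and co: "coer eps c C" and u: "u \<in> \<V>" "sqi (%p. H (fst p) *R gy u p)" "!!v. v \<in> \<V> ==> gq eps c u v = l v"
  and u': "u' \<in> \<V>" "!!v. v \<in> \<V> ==> gq eps c u' v = l v"
 shows "AL p. u' p = u p"
proof -
 have e: "0 < eps" and C: "0 < C" and cb: "!!Fi. Q Fi ==> C * N2 (Z Fi) <= gq eps c Fi Fi" using co by (auto simp: coer_def)
 obtain m :: "nat => real => real" and D where m: "!!n. test_fun UNIV (m n)" "!!n s. ||m n s|| <= D" "!!n s. ||cgrad (m n) s|| <= D"
  "!!s. (%n. m n s) ~~> 1" "!!s. (%n. cgrad (m n) s) ~~> 0" using cutoff_sequence by blast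
 define ps where "ps p = u' p + (-1) *R u p" for p
 have pV: "ps \<in> \<V>" unfolding ps_def by (rule fspD(3)[OF V u'(1) u(1)])
 note W = fspD(1)[OF V pV]
 have b: "C * N2 (%p. vv (Mm (m n) ps) p) <= N2 (%p. cgrad (m n) (fst p) *R vv ps p)" for n
 proof -
  have V2: "Mm (m n) (Mm (m n) ps) \<in> \<V>" by (intro fspD(5)[OF V] pV m(1))
  note sH = sqi_H_Mm[OF W_Mm[OF W m(1)[of n]] m(1)[of n]]
  have pI: "pairI x (Mm (m n) (Mm (m n) ps))" if "x \<in> \<V>" for x by (rule pairI_H(1)[OF fspD(1)[OF V that] fspD(1)[OF V V2] sH])
  have "gq eps c ps (Mm (m n) (Mm (m n) ps)) = 0" unfolding ps_def
   using gq_lin[OF pI[OF u'(1)] pI[OF u(1)] e, of c "-1"] u'(2)[OF V2] u(3)[OF V2] unfolding ps_def by simp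
  then have "gq eps c (Mm (m n) ps) (Mm (m n) ps) = N2 (%p. cgrad (m n) (fst p) *R vv ps p)" using gq_Mm(1)[OF W m(1) e, of c] by simp
  then show ?thesis using order_trans[OF mult_left_mono[OF vv_le_Z[OF Mm_Q[OF W m(1)[of n]]] less_imp_le[OF C]] cb[OF Mm_Q[OF W m(1)]]] by simp
 qed
 have "(%n. C * N2 (%p. vv (Mm (m n) ps) p)) ~~> C * N2 (vv ps)" by (intro tendsto_intros l2lim_N2[OF l2lim_fst[OF l2lim_Mm(1)[OF W m]]])
 moreover have "(%n. N2 (%p. cgrad (m n) (fst p) *R vv ps p)) ~~> 0" using l2lim_N2[OF l2lim_Mm(2)[OF W m]] by simp
 ultimately have "C * N2 (vv ps) <= 0" using b by (intro LIMSEQ_le) auto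
 then have "N2 (vv ps) = 0" using C N2_nonneg[of "vv ps"] by (simp add: mult_le_0_iff)
 then have "AL p. vv ps p = 0" by (rule AE_eq_0_N2[OF W_parts(1)[OF W]])
 then have "AL p. p \<in> J \<times> S --> vv u' p = vv u p" by eventually_elim (simp add: ps_def)
 then show ?thesis by (rule W_unique[OF open_Times[OF J_open S_open] fspD(1)[OF V u'(1)] fspD(1)[OF V u(1)]])
qed

text \<open>Equality to a tensor pair is required only almost everywhere, which makes the set stable
  under changes on null sets, as L2 limits demand.\<close>

definition "TV = {Fi. W (J \<times> S) Fi & (\<exists>om. W J om & (AL p. Fi p = ptens om mu0 p))}"

lemma Pr_tens_u0: "Pr u0 (tens f u0) s = f s"
proof -
 have "Pr u0 (tens f u0) s = (LI y. f s * (u0 y)~2)" by (simp add: Pr_def tens_def power2_eq_square mult_ac)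
 then show ?thesis using N2_u0 by (simp add: N2_real)
qed

text \<open>For closedness, \<open>Pr u0\<close> recovers the one-dimensional factors from the
  products continuously, so convergence of the products implies convergence of the factors.\<close>

lemma fsp_TV: "fsp TV"
 unfolding fsp_def
proof (intro conjI ballI allI impI)
 show "W (J \<times> S) Fi" if "Fi \<in> TV" for Fi using that by (simp add: TV_def)
 show "(%p. 0) \<in> TV" using W_zero[of "J \<times> S"] W_zero[of J] by (auto simp: TV_def ptens_def tens_def zero_prod_def intro!: exI[of _ "%x. 0"])
next
 fix Fi Gi :: "real * real \<times> real => real * real \<times> real * real" and a assume "Fi \<in> TV" "Gi \<in> TV"
 then obtain om rh where h: "W (J \<times> S) Fi" "W (J \<times> S) Gi" "W J om" "W J rh" "AL p. Fi p = ptens om mu0 p" "AL p. Gi p = ptens rh mu0 p" unfolding TV_def by blast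
 have "AL p. Fi p + a *R Gi p = ptens (%s. om s + a *R rh s) mu0 p" using h(5,6)
  by eventually_elim (simp add: ptens_def tens_def algebra_simps)
 then show "(%p. Fi p + a *R Gi p) \<in> TV" using W_lin[OF h(1,2), of a] W_lin[OF h(3,4), of a] unfolding TV_def by blast
next
 fix X Fi assume X: "\<forall>n::nat. X n \<in> TV" and l: "l2lim X Fi"
 have "\<exists>om. \<forall>n. W J (om n) & (AL p. X n p = ptens (om n) mu0 p)" by (rule choice) (use X in \<open>simp add: TV_def\<close>)
 then obtain om where w: "!!n. W J (om n)" "!!n. AL p. X n p = ptens (om n) mu0 p" by blast
 have lp: "l2lim (%n. ptens (om n) mu0) Fi"
 proof -
  have s: "sqi (ptens (om n) mu0)" for n by (rule W_sqi(1)[OF W_ptens[OF w(1) W0]])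
  have "N2 (%p. ptens (om n) mu0 p - Fi p) = N2 (%p. X n p - Fi p)" for n unfolding N2_def
  proof (rule integral_cong_AE)
   have [measurable]: "X n \<in> bm" "Fi \<in> bm" "ptens (om n) mu0 \<in> bm" using l s by (auto simp: l2lim_def sqi_def)
   show "AL p. (norm (ptens (om n) mu0 p - Fi p))~2 = (norm (X n p - Fi p))~2" using w(2)[of n] by eventually_elim simp
   show "(%p. (norm (ptens (om n) mu0 p - Fi p))~2) \<in> borel_measurable lborel" "(%p. (norm (X n p - Fi p))~2) \<in> borel_measurable lborel" by measurable
  qed
  then show ?thesis using l s by (simp add: l2lim_def)
 qed
 define om' where "om' s = (Pr u0 (vv Fi) s, Pr u0 (gs Fi) s)" for s
 have f: "vv (ptens om mu0) = tens (%s. fst (om s)) u0" "gs (ptens om mu0) = tens (%s. snd (om s)) u0" for om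
  by (auto simp: ptens_def u0_def[abs_def])
 have "l2lim (%n s. (Pr u0 (vv (ptens (om n) mu0)) s, Pr u0 (gs (ptens (om n) mu0)) s)) om'"
  unfolding om'_def[abs_def] by (intro l2lim_Pair l2lim_Pr u0_sqi l2lim_fst[OF lp] l2lim_fst[OF l2lim_snd[OF lp]])
 then have lo: "l2lim om om'" by (simp add: f Pr_tens_u0)
 have "l2lim (%n. ptens (om n) mu0) (ptens om' mu0)"
  unfolding ptens_def[abs_def] by (intro l2lim_Pair l2lim_tens l2lim_fst l2lim_snd lo l2lim_const W_sqi(1)[OF W0])
 then have "AL p. Fi p = ptens om' mu0 p" by (rule l2lim_unique[OF lp])
 moreover have "W (J \<times> S) Fi" by (rule W_closed[OF _ l]) (use X in \<open>simp add: TV_def\<close>)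
 ultimately show "Fi \<in> TV" using W_closed[OF w(1) lo] unfolding TV_def by blast
next
 fix Fi and m :: "real => real" assume "Fi \<in> TV" and m: "test_fun UNIV m"
 then obtain om where h: "W (J \<times> S) Fi" "W J om" "AL p. Fi p = ptens om mu0 p" unfolding TV_def by blast
 obtain C R where C: "!!s. ||m s|| <= C" "!!s. ||cgrad m s|| <= C" using test_fun_bounds[OF m] by metis
 have "W J (%s. (m s * fst (om s), m s *R snd (om s) + fst (om s) *R cgrad m s))" by (rule W_mult[OF h(2) test_funD(1)[OF m], of C]) (use C in auto)
 moreover have "AL p. Mm m Fi p = ptens (%s. (m s * fst (om s), m s *R snd (om s) + fst (om s) *R cgrad m s)) mu0 p"
  using h(3) by eventually_elim (simp add: Mm_def ptens_def tens_def algebra_simps)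
 ultimately show "Mm m Fi \<in> TV" using W_Mm[OF h(1) m] unfolding TV_def by blast
qed

end

section \<open>The mixed term and the error estimate\<close>

lemma sqrt_le_scaled: "x <= k * t~2 ==> 0 <= t ==> sqrt x <= sqrt k * t" for x k t :: real
 using real_sqrt_le_mono[of x "k * t~2"] by (simp add: real_sqrt_mult)

text \<open>Dictionary: o1, o2 are w and w'; u is u0; v, g, d are eta, its s-derivative and p0 .
  grad_y eta; X, Z are the two \<open>Xp\<close> terms; e is eps, y and q are ev.y and ev.p0; i =
  1/eps^2, l = lam0, m = 1/M^2. The first three summands integrate to 0 over cross sections, the
  bracket collects the remainders.\<close>

lemma cross_term_algebra:
 fixes o1 o2 u X g Z e y H i d l m c v q :: real
 shows "(o2 * u + X) * (g + Z) + (1 - e * y) * H * i * (o1 * d) - l * (1 - e * y) * i * m * (o1 * u * v) + c * (o1 * u * v) =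
  o2 * (u * g) + H * i * o1 * ((1 - e * y) * (d - l * (u * v)) - v * (e * q)) + l * (H - m) * i * o1 * (u * v)
  + (o2 * u * Z + X * g + (X * Z + c * (o1 * u * v)) + (H * (e * i) * (v * (o1 * q)) - y * (l * (H - m)) * (e * i) * (o1 * u * v)))"
 by (simp add: algebra_simps)

context tube
begin

lemma gden_borel:
 assumes [measurable]: "Fi \<in> bm" "Gi \<in> bm"
 shows "gden eps c Fi Gi \<in> bm"
 unfolding gden_def[abs_def] Dp_def Xp_def by measurable

lemma gq_cong:
 assumes [measurable]: "Fi \<in> bm" "Fi' \<in> bm" "Gi \<in> bm" and ae: "AL p. Fi p = Fi' p"
 shows "gq eps c Fi Gi = gq eps c Fi' Gi"
 unfolding gq_def
proof (rule integral_cong_AE)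
 show "AL p. gden eps c Fi Gi p = gden eps c Fi' Gi p" using ae by eventually_elim (simp add: gden_def Dp_def Xp_def)
qed (simp_all add: gden_borel)

text \<open>From H |ev|^2 <= K, multiplied by H. Only one factor sqrt H is left, which the
  transversal part eta can carry.\<close>

lemma H_ev: "H s * norm (ev s) <= sqrt K * sqrt (H s)"
proof -
 have "(H s * norm (ev s))~2 = H s * (H s * (norm (ev s))~2)" by (simp add: power2_eq_square mult_ac)
 also have "... <= H s * K" using coeff_bound(4)[of s] H_pos[of s] by (intro mult_left_mono) auto
 finally have "H s * norm (ev s) <= sqrt (H s * K)" by (rule real_le_rsqrt)
 then show ?thesis by (simp add: real_sqrt_mult mult.commute)
qed

lemma u0_integrable: "intb u0"
proof -
 have "u0 y * indicator (cball 0 SR) y = u0 y" for y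
  using SR(2)[of y] out[of y] by (cases "y \<in> S") (auto simp: indicator_def u0_def)
 moreover have "intb (%y. u0 y * indicator (cball 0 SR) y)" by (rule sqi_times[OF u0_sqi sqi_indicator_compact[OF compact_cball]])
 ultimately show ?thesis by (simp only:)
qed

definition "KS = K * (1 + 2 * SR)"

lemma KS_nonneg: "0 <= KS" using K_nonneg SR(1) by (simp add: KS_def)

lemma Xp_bound_pair: assumes "snd p \<in> S" shows "||Xp Fi p|| <= 2 * KS * norm (vv Fi p, gy Fi p)"
proof -
 have "||vv Fi p|| + norm (gy Fi p) <= 2 * norm (vv Fi p, gy Fi p)"
  using norm_fst_le[of "vv Fi p" "gy Fi p"] norm_snd_le[of "gy Fi p" "vv Fi p"] by simp
 from order_trans[OF Xp_bound[OF assms, of Fi] mult_left_mono[OF this KS_nonneg[unfolded KS_def]]] show ?thesis by (simp add: KS_def)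
qed

text \<open>The order eps^(-2) disappears slicewise: eta and its s-derivative are orthogonal to u0,
  and the weighted eigenvalue equation trades the y-energy for a first-order correction. The
  remainders have order 1 except for one of order 1/eps, in which eta appears with the weight sqrt
  H.\<close>

lemma cross_term:
 assumes w: "W J om" and Qw: "Q (ptens om mu0)" and Qe: "Q et" and e: "0 < eps"
  and z: "AL s. Pr u0 (vv et) s = 0" "AL s. Pr u0 (gs et) s = 0"
 defines "a \<equiv> sqrt (N2 (tens (%s. fst (om s)) mu0))" and "G \<equiv> sqrt (N2 (%p. (vv et p, gy et p)))"
 shows "||gq eps c (ptens om mu0) et|| <= 2 * KS * (sqrt (N2 (%s. snd (om s))) * G) + 2 * KS * (a * sqrt (N2 (gs et)))
  + (4 * KS~2 + ||c||) * (a * G) + sqrt K * (1 + SR * lam0) / eps * (a * sqrt (N2 (%p. sH p *R vv et p)))"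
proof -
 note We = Q_W[OF Qe] and Ww = Q_W[OF Qw]
 let ?w = "ptens om mu0"
 have sw: "sqi (%s. fst (om s))" "sqi (%s. snd (om s))" using W_sqi(2,3)[OF w] by auto
 define A where "A = tens (%s. fst (om s)) mu0"
 have sA: "sqi A" unfolding A_def by (rule sqi_tens(1)[OF sw(1) W_sqi(1)[OF W0]])
 have sB: "sqi (gs ?w)" and nB: "N2 (gs ?w) = N2 (%s. snd (om s))"
  using sqi_tens[OF sw(2) u0_sqi] N2_u0 by (auto simp: ptens_def u0_def[abs_def])
 note [measurable] = W_parts(4)[OF We] W_parts(4)[OF Ww] sqi_measurable[OF sA]
 have A: "norm (vv ?w p) <= norm (A p)" "norm (gy ?w p) <= norm (A p)" "norm (vv ?w p, gy ?w p) = norm (A p)" for p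
 proof -
  have "A p = (vv ?w p, gy ?w p)" by (simp add: A_def ptens_def tens_def prod_eq_iff)
  then show "norm (vv ?w p) <= norm (A p)" "norm (gy ?w p) <= norm (A p)" "norm (vv ?w p, gy ?w p) = norm (A p)"
   using norm_fst_le[of "vv ?w p" "gy ?w p"] norm_snd_le[of "gy ?w p" "vv ?w p"] by auto
 qed
 have out: "AL p. snd p \<notin> S --> et p = 0" using W_out[OF We] by (rule eventually_mono) simp
 have sG: "sqi (%p. (vv et p, gy et p))" by (rule sqi_Pair(1)[OF W_parts(1,3)[OF We]])
 define R1 R2 R3 R4 where "R1 p = gs ?w p * Xp et p" and "R2 p = Xp ?w p * gs et p" and "R3 p = Xp ?w p * Xp et p + c * (vv ?w p * vv et p)"
  and "R4 p = H (fst p) / eps * (vv et p * (ev (fst p) @. gy ?w p)) - (ev (fst p) @. snd p) * V (fst p) / eps * (vv ?w p * vv et p)" for p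
 have Xm[measurable]: "Xp Fi \<in> bm" if [measurable]: "Fi \<in> bm" for Fi unfolding Xp_def[abs_def] by measurable
 have b1: "AL p. ||R1 p|| <= 2 * KS * (norm (gs ?w p) * norm (vv et p, gy et p))" using out
 proof eventually_elim
  case (elim p)
  show ?case
  proof (cases "snd p \<in> S")
   case True
   show ?thesis using mult_left_mono[OF Xp_bound_pair[OF True, of et] abs_ge_zero[of "gs ?w p"]] by (simp add: R1_def abs_mult mult_ac)
  next
   case False then show ?thesis using elim by (simp add: R1_def Xp_def)
  qed
 qed
 have b2: "AL p. ||R2 p|| <= 2 * KS * (norm (A p) * norm (gs et p))" using out
 proof eventually_elim
  case (elim p)
  show ?case
  proof (cases "snd p \<in> S")
   case True
   show ?thesis using mult_right_mono[OF Xp_bound_pair[OF True, of ?w] abs_ge_zero[of "gs et p"]] by (simp add: R2_def abs_mult A(3) mult_ac)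
  next
   case False then show ?thesis using elim by (simp add: R2_def)
  qed
 qed
 have b3: "AL p. ||R3 p|| <= (4 * KS~2 + ||c||) * (norm (A p) * norm (vv et p, gy et p))" using out
 proof eventually_elim
  case (elim p)
  show ?case
  proof (cases "snd p \<in> S")
   case True
   have 1: "||Xp ?w p * Xp et p|| <= (2 * KS * norm (A p)) * (2 * KS * norm (vv et p, gy et p))"
    unfolding abs_mult using Xp_bound_pair[OF True, of et] Xp_bound_pair[OF True, of ?w, unfolded A(3)] KS_nonneg by (intro mult_mono) auto
   have "||vv ?w p * vv et p|| <= norm (A p) * norm (vv et p, gy et p)"
    unfolding abs_mult using A(1)[of p] norm_fst_le[of "vv et p" "gy et p"] by (intro mult_mono) auto
   then have 2: "||c * (vv ?w p * vv et p)|| <= ||c|| * (norm (A p) * norm (vv et p, gy et p))" unfolding abs_mult[of c] by (rule mult_left_mono) simp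
   show ?thesis using order_trans[OF abs_triangle_ineq add_mono[OF 1 2]] by (simp add: R3_def algebra_simps power2_eq_square)
  next
   case False then show ?thesis using elim by (simp add: R3_def Xp_def)
  qed
 qed
 have b4: "AL p. ||R4 p|| <= sqrt K * (1 + SR * lam0) / eps * (norm (A p) * norm (sH p *R vv et p))" using out
 proof eventually_elim
  case (elim p)
  show ?case
  proof (cases "snd p \<in> S")
   case True
   define h v n where "h = H (fst p)" and "v = ||vv et p||" and "n = norm (A p)"
   have h: "0 < h" and v0: "0 <= v" and n0: "0 <= n" using H_pos by (auto simp: h_def v_def n_def)
   have he: "h * norm (ev (fst p)) <= sqrt K * sH p" using H_ev[of "fst p"] by (simp add: h_def sH_def)
   have "||ev (fst p) @. gy ?w p|| <= norm (ev (fst p)) * n" using order_trans[OF Cauchy_Schwarz_ineq2 mult_left_mono[OF A(2)[of p] norm_ge_zero]] by (simp add: n_def)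
   then have "||h / eps * (vv et p * (ev (fst p) @. gy ?w p))|| <= h / eps * (v * (norm (ev (fst p)) * n))"
    using h e v0 by (simp add: abs_mult v_def divide_right_mono mult_left_mono)
   also have "... = (h * norm (ev (fst p))) * (v * n / eps)" by simp
   also have "... <= (sqrt K * sH p) * (v * n / eps)" using he e v0 n0 by (intro mult_right_mono) auto
   finally have 1: "||h / eps * (vv et p * (ev (fst p) @. gy ?w p))|| <= (sqrt K * sH p) * (v * n / eps)" .
   have y: "||ev (fst p) @. snd p|| <= norm (ev (fst p)) * SR" by (rule order_trans[OF Cauchy_Schwarz_ineq2 mult_left_mono[OF SR(2)[OF True] norm_ge_zero]])
   have V: "||V (fst p)|| <= lam0 * h" using V_nonneg[of "fst p"] lam0_pos M_pos by (simp add: V_def h_def right_diff_distrib)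
   have vw: "||vv ?w p * vv et p|| <= n * v" unfolding abs_mult using A(1)[of p] by (intro mult_mono) (auto simp: n_def v_def)
   have "||(ev (fst p) @. snd p) * V (fst p) / eps * (vv ?w p * vv et p)|| = ||ev (fst p) @. snd p|| * ( ||V (fst p)|| * ||vv ?w p * vv et p|| / eps)"
    using e by (simp add: abs_mult)
   also have "... <= (norm (ev (fst p)) * SR) * ((lam0 * h) * (n * v) / eps)"
    using y V vw e h lam0_pos SR(1) by (intro mult_mono divide_right_mono) auto
   also have "... = (h * norm (ev (fst p))) * (SR * lam0 * (n * v) / eps)" by simp
   also have "... <= (sqrt K * sH p) * (SR * lam0 * (n * v) / eps)" using he e v0 n0 SR(1) lam0_pos by (intro mult_right_mono) auto
   finally have 2: "||(ev (fst p) @. snd p) * V (fst p) / eps * (vv ?w p * vv et p)|| <= (sqrt K * sH p) * (SR * lam0 * (n * v) / eps)" .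
   have "||R4 p|| <= (sqrt K * sH p) * (v * n / eps) + (sqrt K * sH p) * (SR * lam0 * (n * v) / eps)"
    using order_trans[OF abs_triangle_ineq4 add_mono[OF 1 2]] by (simp add: R4_def h_def)
   also have "... = sqrt K * (1 + SR * lam0) / eps * (norm (A p) * norm (sH p *R vv et p))"
    using sH_pos[of p] e by (simp add: n_def v_def abs_mult field_simps)
   finally show ?thesis .
  next
   case False then show ?thesis using elim by (simp add: R4_def)
  qed
 qed
 have c0: "0 <= 2 * KS" "0 <= 4 * KS~2 + ||c||" "0 <= sqrt K * (1 + SR * lam0) / eps" using KS_nonneg K_nonneg SR(1) lam0_pos e by auto
 have m: "R1 \<in> bm" "R2 \<in> bm" "R3 \<in> bm" "R4 \<in> bm"
  unfolding R1_def[abs_def] R2_def[abs_def] R3_def[abs_def] R4_def[abs_def] by measurable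
 note e1 = CS_bound[OF sB sG m(1) b1 c0(1)] and e2 = CS_bound[OF sA W_parts(2)[OF We] m(2) b2 c0(1)]
  and e3 = CS_bound[OF sA sG m(3) b3 c0(2)] and e4 = CS_bound[OF sA Q_v(1)[OF Qe] m(4) b4 c0(3)]
 \<comment> \<open>The part of the density that vanishes after integration over each cross section;
   its middle line is the integrand of \<open>eigenfunction_weighted\<close> minus the correction
   that balances it.\<close>
 define Zr where "Zr p = snd (om (fst p)) * (u0 (snd p) * gs et p)
   + H (fst p) / eps~2 * fst (om (fst p)) * ((1 - (eps *R ev (fst p)) @. snd p) * (p0 (snd p) @. gy et p - lam0 * (u0 (snd p) * vv et p)) - vv et p * ((eps *R ev (fst p)) @. p0 (snd p)))
   + V (fst p) / eps~2 * fst (om (fst p)) * (u0 (snd p) * vv et p)" for p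
 have wp: "vv ?w p = fst (om (fst p)) * u0 (snd p)" "gs ?w p = snd (om (fst p)) * u0 (snd p)" "gy ?w p = fst (om (fst p)) *R p0 (snd p)" for p
  by (auto simp: ptens_def tens_def u0_def p0_def)
 have split: "gden eps c ?w et p = Zr p + (R1 p + R2 p + R3 p + R4 p)" for p
 proof -
  define i m where "i = 1 / eps~2" and "m = 1 / M~2"
  have d: "x / eps = x * (eps * i)" "x / eps~2 = x * i" "x / (eps~2 * M~2) = x * i * m" for x
   using e by (simp_all add: i_def m_def power2_eq_square)
  show ?thesis unfolding gden_def Dp_def[of ?w] Dp_def[of et] R1_def R2_def R3_def R4_def Zr_def bt_def V_def wp inner_scaleR_left inner_scaleR_right d m_def[symmetric]
   by (rule cross_term_algebra)
 qed
 have iR: "intb (%p. R1 p + R2 p + R3 p + R4 p)" by (intro bi_add e1(1) e2(1) e3(1) e4(1))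
 have ig: "intb (gden eps c ?w et)" by (rule gden_terms(5)[OF pairI_Q[OF Qw Qe] e])
 have iZ: "intb Zr"
 proof -
  have "intb (%p. gden eps c ?w et p - (R1 p + R2 p + R3 p + R4 p))" by (rule bi_diff[OF ig iR])
  then show ?thesis unfolding split by simp
 qed
 have "(LI p. Zr p) = 0"
 proof (rule slice_eq_0[OF iZ])
  show "AL s. (LI y. Zr (s, y)) = 0"
   using W_slice[OF We] z sqi_slice(1)[OF W_parts(2)[OF We]]
  proof eventually_elim
   case (elim s)
   note ew = eigenfunction_weighted[OF elim(1), of "eps *R ev s", unfolded fst_conv snd_conv]
   have sv: "sqi (%y. vv et (s, y))" using W_sqi(2)[OF elim(1)] by simp
   have i1: "intb (%y. u0 y * gs et (s, y))" by (rule sqi_times[OF u0_sqi elim(4)])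
   have i3: "intb (%y. u0 y * vv et (s, y))" by (rule sqi_times[OF u0_sqi sv])
   have i2: "intb (%y. vv et (s, y) * ((eps *R ev s) @. p0 y))"
    using sqi_times[OF sv sqi_inner_const[OF p0_sqi, of "eps *R ev s"]] by (simp add: inner_commute)
   define a1 a2 a3 where "a1 = snd (om s)" and "a2 = H s / eps~2 * fst (om s)" and "a3 = V s / eps~2 * fst (om s)"
   define f1 f2 f3 f4 where "f1 y = u0 y * gs et (s, y)" and "f2 y = (1 - (eps *R ev s) @. y) * (p0 y @. gy et (s, y) - lam0 * (u0 y * vv et (s, y)))"
    and "f3 y = vv et (s, y) * ((eps *R ev s) @. p0 y)" and "f4 y = u0 y * vv et (s, y)" for y
   have fi: "intb f1" "intb f2" "intb f3" "intb f4"
    using i1 ew(2) i2 i3 by (simp_all only: f1_def[abs_def] f2_def[abs_def] f3_def[abs_def] f4_def[abs_def])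
   have f0: "integral\<^sup>L lborel f1 = 0" "integral\<^sup>L lborel f4 = 0" "integral\<^sup>L lborel f2 = integral\<^sup>L lborel f3"
    using elim(2,3) ew(1) by (simp_all only: f1_def[abs_def] f2_def[abs_def] f3_def[abs_def] f4_def[abs_def] Pr_def)
   have "(LI y. Zr (s, y)) = (LI y. a1 * f1 y + a2 * (f2 y - f3 y) + a3 * f4 y)"
    by (simp only: Zr_def fst_conv snd_conv a1_def a2_def a3_def f1_def f2_def f3_def f4_def)
   also have "... = a1 * integral\<^sup>L lborel f1 + a2 * (integral\<^sup>L lborel f2 - integral\<^sup>L lborel f3) + a3 * integral\<^sup>L lborel f4"
    using fi by simp
   also have "... = 0" using f0 by simp
   finally show ?case .
  qed
 qed
 then have "gq eps c ?w et = (LI p. R1 p + R2 p + R3 p + R4 p)"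
  unfolding gq_def split using bl_add[OF iZ iR] by simp
 also have "... = integral\<^sup>L lborel R1 + integral\<^sup>L lborel R2 + integral\<^sup>L lborel R3 + integral\<^sup>L lborel R4"
  using e1(1) e2(1) e3(1) e4(1) by simp
 finally have gqe: "gq eps c ?w et = integral\<^sup>L lborel R1 + integral\<^sup>L lborel R2 + integral\<^sup>L lborel R3 + integral\<^sup>L lborel R4" .
 have t: "||r1|| <= b1 ==> ||r2|| <= b2 ==> ||r3|| <= b3 ==> ||r4|| <= b4 ==> ||r1 + r2 + r3 + r4|| <= b1 + b2 + b3 + b4" for r1 r2 r3 r4 b1 b2 b3 b4 :: real by linarith
 show ?thesis unfolding gqe a_def G_def A_def[symmetric] nB[symmetric] by (rule t[OF e1(2) e2(2) e3(2) e4(2)])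
qed

lemma coercive_bound:
 assumes c1: "0 < c1" and e: "0 < eps" "eps <= 1"
  and cb: "!!Fi. Q Fi ==> c1 * N2 (gs Fi) <= gq eps c Fi Fi & c1 * En Fi <= eps~2 * gq eps c Fi Fi & c1 * N2 (vv Fi) <= eps * gq eps c Fi Fi \<and>
  c1 * N2 (%p. sH p *R gy Fi p) <= gq eps c Fi Fi"
 shows "coer eps c (c1 / (3 + M~2))"
proof -
 have M: "0 < 3 + M~2" by (rule add_pos_nonneg) auto
 have "c1 / (3 + M~2) * N2 (Z Fi) <= gq eps c Fi Fi" if Q: "Q Fi" for Fi
 proof -
  note [measurable] = W_parts(4)[OF Q_W[OF Q]]
  define g where "g = gq eps c Fi Fi"
  note b = cb[OF Q, folded g_def]
  have "0 <= c1 * N2 (gs Fi)" using c1 by simp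
  then have g0: "0 <= g" using b by linarith
  have "N2 (gy Fi) <= M~2 * N2 (%p. sH p *R gy Fi p)" by (rule unweight(2)[OF _ Q_gy[OF Q]]) measurable
  from mult_left_mono[OF this less_imp_le[OF c1]] have "c1 * N2 (gy Fi) <= M~2 * (c1 * N2 (%p. sH p *R gy Fi p))" by (simp only: mult.left_commute)
  also have "... <= M~2 * g" using b by (intro mult_left_mono) auto
  finally have "c1 * N2 (gy Fi) <= M~2 * g" .
  moreover have "eps * g <= 1 * g" using e g0 by (intro mult_right_mono) auto
  ultimately have "c1 * N2 (Z Fi) <= (3 + M~2) * g" using b unfolding Z_sqi(2,3)[OF Q] by (simp add: algebra_simps)
  then show ?thesis using M by (simp add: g_def field_simps)
 qed
 then show ?thesis using c1 e M by (simp add: coer_def)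
qed

text \<open>With f the norm of F and E the energy norm of the error: w is O(eps f) by coercivity
  applied to w, w' is O(f), eta with its weighted value and y-gradient is O(eps E), and the
  s-derivative of eta is O(E). So R1, R2 and R3 are at most a constant times eps f E, and R4 has
  size (1/eps)(eps f)(eps E). Hence E = O(eps f), and the squared L2 norm of the error is at most
  eps E^2 / c1.\<close>

theorem reduction_estimate:
 "\<exists>c0. \<forall>c\<ge>c0. \<exists>C>0. \<exists>e0>0. \<forall>eps. 0 < eps --> eps < e0 --> (\<exists>C'. coer eps c C') &
  (\<forall>F u w. sqi F --> Q u --> (\<forall>v. Q v --> gq eps c u v = (LI p. F p * vv v p)) --> w \<in> TV --> Q w -->
   (\<forall>v\<in>TV. Q v --> gq eps c w v = (LI p. F p * vv v p)) --> N2 (%p. vv u p - vv w p) <= C * eps^3 * N2 F)"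
proof -
 obtain c0 c1 e1 where h: "0 < c1 & 0 < e1 & e1 <= 1 & (\<forall>eps c Fi. 0 < eps --> eps < e1 --> c0 <= c --> Q Fi -->
  c1 * N2 (gs Fi) <= gq eps c Fi Fi & c1 * En Fi <= eps~2 * gq eps c Fi Fi & c1 * N2 (vv Fi) <= eps * gq eps c Fi Fi \<and>
  c1 * N2 (%p. sH p *R gy Fi p) <= gq eps c Fi Fi)" using coercivity by (elim exE)
 then have c1: "0 < c1" and e1: "0 < e1" "e1 <= 1" by simp_all
 note co = h[THEN conjunct2, THEN conjunct2, THEN conjunct2, rule_format]
 define k1 where "k1 = sqrt ((M~2 / lam0 + M~2) / c1)"
 define l where "l = sqrt (1 + lam0) / c1"
 have k0: "0 <= k1" "0 <= l" using c1 lam0_pos by (auto simp: k1_def l_def)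
 have est: "N2 (%p. vv u p - vv w p) <= D~2 / c1 * eps^3 * N2 F"
  if e: "0 < eps" "eps < e1" and c: "c0 <= c" and F: "sqi F" and Qu: "Q u" and su: "!!v. Q v ==> gq eps c u v = (LI p. F p * vv v p)"
   and w: "w \<in> TV" "Q w" and sw: "!!v. v \<in> TV ==> Q v ==> gq eps c w v = (LI p. F p * vv v p)"
   and D: "D = k1 + 2 * KS * (k1 / c1) + 2 * KS * (l * (2 / sqrt c1)) + (4 * KS~2 + ||c||) * (l * k1) + sqrt K * (1 + SR * lam0) * (l * sqrt (1 / (lam0 * c1)))"
  for eps c F u w D
 proof -
  have em: "eps <= 1" using e e1 by simp
  note cb = co[OF e c]
  note e0 = \<open>0 < eps\<close>
  obtain om where o: "W J om" "AL p. w p = ptens om mu0 p" using w(1) unfolding TV_def by blast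
  let ?w = "ptens om mu0"
  have Ww: "W (J \<times> S) ?w" by (rule W_ptens[OF o(1) W0])
  note [measurable] = W_parts(4)[OF Ww] W_parts(4)[OF Q_W[OF w(2)]]
  have "sqi (%p. sH p *R gy ?w p)"
  proof (rule sqi_bound(1)[OF _ Q_gy[OF w(2)], where C = 1])
   show "AL p. norm (sH p *R gy ?w p) <= 1 * norm (sH p *R gy w p)" using o(2) by eventually_elim simp
  qed measurable
  then have Qw: "Q ?w" using Ww by (simp add: Q_def)
  have TVw: "?w \<in> TV" using Ww o(1) unfolding TV_def by blast
  have sw': "gq eps c ?w v = (LI p. F p * vv v p)" if "v \<in> TV" "Q v" for v
   using gq_cong[OF W_parts(4)[OF Q_W[OF w(2)]] W_parts(4)[OF Ww] W_parts(4)[OF Q_W[OF that(2)]] o(2), of eps c] sw[OF that] by simp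
  define f where "f = sqrt (N2 F)"
  have f0: "0 <= f" "f~2 = N2 F" by (auto simp: f_def)
  have Fb: "||\<integral>p. F p * vv v p \<partial>lborel|| <= f * sqrt (N2 (vv v))" if "Q v" for v
   using CS_inner[OF F W_parts(1)[OF Q_W[OF that]]] by (simp add: f_def)
  have so: "sqi (%s. fst (om s))" "sqi (%s. snd (om s))" using W_sqi(2,3)[OF o(1)] by auto
  have nv: "N2 (vv ?w) = N2 (%s. fst (om s))" "N2 (gs ?w) = N2 (%s. snd (om s))"
   using sqi_tens(2)[OF so(1) u0_sqi] sqi_tens(2)[OF so(2) u0_sqi] N2_u0 by (auto simp: ptens_def u0_def[abs_def])
  define x where "x = gq eps c ?w ?w"
  define n where "n = sqrt (N2 (vv ?w))"
  have n0: "0 <= n" "N2 (vv ?w) = n~2" by (auto simp: n_def)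
  have xb: "x <= f * n" using sw'[OF TVw Qw] Fb[OF Qw] by (simp add: x_def n_def)
  \<comment> \<open>The equation for w tested with w gives x <= f n; together with coercivity, c1
    n^2 <= eps f n, and one factor n cancels.\<close>
  have "c1 * n~2 <= eps * x" using cb[OF Qw] n0 by (simp add: x_def)
  also have "... <= eps * (f * n)" using xb e0 by (intro mult_left_mono) auto
  finally have "n * (c1 * n) <= n * (eps * f)" by (simp add: power2_eq_square mult_ac)
  then have nb: "n <= eps * f / c1" using n0(1) c1 e0 f0(1) by (cases "n = 0") (auto simp: field_simps)
  have "c1 * N2 (%s. snd (om s)) <= f * (eps * f / c1)"
   using cb[OF Qw] xb mult_left_mono[OF nb f0(1)] unfolding nv(2)[symmetric] x_def by linarith
  also have "... <= f * (1 * f / c1)" using em f0 c1 by (intro mult_left_mono divide_right_mono mult_right_mono) auto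
  finally have "N2 (%s. snd (om s)) <= (f / c1)~2" using c1 by (simp add: field_simps power2_eq_square)
  then have n2: "sqrt (N2 (%s. snd (om s))) <= f / c1" using f0 c1 by (simp add: real_le_lsqrt)
  define a where "a = sqrt (N2 (tens (%s. fst (om s)) mu0))"
  have "N2 mu0 = 1 + lam0" using sqi_Pair(2)[OF u0_sqi p0_sqi] N2_u0 N2_p0 by (simp add: u0_def[abs_def] p0_def[abs_def])
  then have "a = n * sqrt (1 + lam0)" using sqi_tens(2)[OF so(1) W_sqi(1)[OF W0]] by (simp add: a_def n_def nv real_sqrt_mult)
  then have ab: "a <= l * (eps * f)" using mult_right_mono[OF nb, of "sqrt (1 + lam0)"] lam0_pos by (simp add: l_def mult_ac)
  define ps where "ps p = u p + (-1) *R ?w p" for p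
  have Qp: "Q ps" unfolding ps_def by (rule Q_lin[OF Qu Qw])
  note Wp = Q_W[OF Qp]
  define ze where "ze s = (Pr u0 (vv ps) s, Pr u0 (gs ps) s)" for s
  have wz: "W J ze" unfolding ze_def by (rule W_Pr[OF u0_sqi u0_integrable Wp])
  let ?z = "ptens ze mu0"
  have gz: "gy ?z p = tens (Pw ps) p0 p" "gs ?z p = tens (Pr u0 (gs ps)) u0 p" "vv ?z p = tens (Pr u0 (vv ps)) u0 p" for p
   by (auto simp: ptens_def ze_def Pw_def p0_def u0_def tens_def)
  have Qz: "Q ?z" using W_ptens[OF wz W0] tens_Pw_weighted(1)[OF Qp p0_sqi] by (simp add: Q_def gz)
  have TVz: "?z \<in> TV" using Q_W[OF Qz] wz unfolding TV_def by blast
  define et where "et p = ps p + (-1) *R ?z p" for p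
  have Qe: "Q et" unfolding et_def by (rule Q_lin[OF Qp Qz])
  have gl: "gq eps c ps v = gq eps c u v + (-1) * gq eps c ?w v" if "Q v" for v
   unfolding ps_def by (rule gq_lin[OF pairI_Q[OF Qu that] pairI_Q[OF Qw that] e0])
  define g where "g = gq eps c ps ps"
  \<comment> \<open>?z is a tensor product, and u and ?w satisfy the same equation against it. Hence
    only the transversal part et of ps has to be tested.\<close>
  have gz0: "gq eps c ps ?z = 0" using gl[OF Qz] su[OF Qz] sw'[OF TVz Qz] by simp
  have "gq eps c et ps = g + (-1) * gq eps c ?z ps" unfolding et_def g_def by (rule gq_lin[OF pairI_Q[OF Qp Qp] pairI_Q[OF Qz Qp] e0])
  then have ge: "g = (LI p. F p * vv et p) - gq eps c ?w et" using gz0 gl[OF Qe] su[OF Qe] by (simp add: gq_sym[of eps c ?z] gq_sym[of eps c et])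
  have z0: "AL s. Pr u0 (vv et) s = 0" "AL s. Pr u0 (gs et) s = 0"
  proof -
   have t: "sqi (tens (Pr u0 h) u0)" if "sqi h" for h :: "real * real \<times> real => real" by (rule sqi_tens(1)[OF sqi_Pr(1)[OF u0_sqi that] u0_sqi])
   have r: "AL s. Pr u0 (%p. h p - tens (Pr u0 h) u0 p) s = 0" if "sqi h" for h :: "real * real \<times> real => real"
    using Pr_diff[OF u0_sqi that t[OF that]] by eventually_elim (simp add: Pr_tens_u0)
   show "AL s. Pr u0 (vv et) s = 0" "AL s. Pr u0 (gs et) s = 0"
    using r[OF W_parts(1)[OF Wp]] r[OF W_parts(2)[OF Wp]] by (auto simp: et_def gz)
  qed
  note g3 = cb[OF Qp, folded g_def]
  have "0 <= c1 * N2 (gs ps)" using c1 by simp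
  then have g0: "0 <= g" using g3 by linarith
  define E where "E = sqrt g"
  have E: "0 <= E" "g = E~2" using g0 by (auto simp: E_def)
  \<comment> \<open>The y-gradient of et is precisely what \<open>En\<close> measures for ps, so
    coercivity gives it the extra factor eps^2.\<close>
  have "gy et p = gyp ps p" for p by (simp add: et_def gyp_def gz)
  then have ye: "N2 (%p. sH p *R gy et p) = En ps" by (simp add: En_def)
  have En: "N2 (%p. sH p *R gy et p) <= 1 / c1 * (eps * E)~2"
   using g3 c1 unfolding ye E(2) by (simp add: field_simps power_mult_distrib)
  have "N2 (%p. sH p *R vv et p) <= 1 / lam0 * (1 / c1 * (eps * E)~2)"
   by (rule order_trans[OF Q_v(2)[OF Qe] mult_left_mono[OF En]]) (use lam0_pos in simp)
  then have nY: "N2 (%p. sH p *R vv et p) <= 1 / (lam0 * c1) * (eps * E)~2" by simp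
  note [measurable] = W_parts(4)[OF Q_W[OF Qe]]
  have "N2 (vv et) <= M~2 * (1 / (lam0 * c1) * (eps * E)~2)"
   by (rule order_trans[OF unweight(2)[OF _ Q_v(1)[OF Qe]] mult_left_mono[OF nY]]) measurable
  moreover have "N2 (gy et) <= M~2 * (1 / c1 * (eps * E)~2)"
   by (rule order_trans[OF unweight(2)[OF _ Q_gy[OF Qe]] mult_left_mono[OF En]]) measurable
  ultimately have nG: "N2 (%p. (vv et p, gy et p)) <= (M~2 / lam0 + M~2) / c1 * (eps * E)~2"
   unfolding sqi_Pair(2)[OF W_parts(1,3)[OF Q_W[OF Qe]]] by (simp add: field_simps add_divide_distrib)
  have nS: "N2 (gs et) <= 4 / c1 * E~2"
  proof -
   have p: "sqi (Pr u0 (gs ps))" "N2 (Pr u0 (gs ps)) <= N2 (gs ps)" using sqi_Pr[OF u0_sqi W_parts(2)[OF Wp]] N2_u0 by auto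
   have "N2 (%p. gs ps p - tens (Pr u0 (gs ps)) u0 p) <= 2 * N2 (gs ps) + 2 * N2 (tens (Pr u0 (gs ps)) u0)"
    by (rule sqi_diff(2)[OF W_parts(2)[OF Wp] sqi_tens(1)[OF p(1) u0_sqi]])
   then have "N2 (gs et) <= 4 * N2 (gs ps)" using p(2) sqi_tens(2)[OF p(1) u0_sqi] N2_u0 by (simp add: et_def gz)
   moreover have "N2 (gs ps) <= E~2 / c1" using g3 c1 E by (simp add: field_simps)
   ultimately show ?thesis by simp
  qed
  define G where "G = sqrt (N2 (%p. (vv et p, gy et p)))"
  have eE: "0 <= eps * E" using e0 E by simp
  have bG: "G <= k1 * (eps * E)" unfolding G_def k1_def by (rule sqrt_le_scaled[OF nG eE])
  have bS: "sqrt (N2 (gs et)) <= 2 / sqrt c1 * E" using sqrt_le_scaled[OF nS E(1)] by (simp add: real_sqrt_divide)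
  have bY: "sqrt (N2 (%p. sH p *R vv et p)) <= sqrt (1 / (lam0 * c1)) * (eps * E)" by (rule sqrt_le_scaled[OF nY eE])
  have nn: "0 <= G" "0 <= a" "0 <= l * (eps * f)" "0 <= f / c1" using f0 c1 e0 k0 by (auto simp: G_def a_def)
  have vG: "sqrt (N2 (vv et)) <= G" unfolding G_def by (rule real_sqrt_le_mono) (simp add: sqi_Pair(2)[OF W_parts(1,3)[OF Q_W[OF Qe]]])
  have t0: "f * sqrt (N2 (vv et)) <= k1 * (eps * f * E)" using mult_left_mono[OF order_trans[OF vG bG] f0(1)] by (simp add: mult_ac)
  have t1: "sqrt (N2 (%s. snd (om s))) * G <= k1 / c1 * (eps * f * E)" using mult_mono[OF n2 bG nn(4,1)] by (simp add: mult_ac)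
  have t2: "a * sqrt (N2 (gs et)) <= l * (2 / sqrt c1) * (eps * f * E)" using mult_mono[OF ab bS nn(3)] by (simp add: mult_ac)
  have t3: "a * G <= l * k1 * (eps * f * E)"
  proof -
   have "a * G <= l * (eps * f) * (k1 * (eps * E))" by (rule mult_mono[OF ab bG nn(3,1)])
   also have "... = eps * (l * k1 * (eps * f * E))" by (simp add: mult_ac)
   also have "... <= 1 * (l * k1 * (eps * f * E))" using em k0 f0 E e0 by (intro mult_right_mono) auto
   finally show ?thesis by simp
  qed
  have t4: "1 / eps * (a * sqrt (N2 (%p. sH p *R vv et p))) <= l * sqrt (1 / (lam0 * c1)) * (eps * f * E)"
  proof -
   have "a * sqrt (N2 (%p. sH p *R vv et p)) <= l * (eps * f) * (sqrt (1 / (lam0 * c1)) * (eps * E))" by (rule mult_mono[OF ab bY nn(3)]) simp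
   then have "1 / eps * (a * sqrt (N2 (%p. sH p *R vv et p))) <= 1 / eps * (l * (eps * f) * (sqrt (1 / (lam0 * c1)) * (eps * E)))" using e0 by (intro mult_left_mono) auto
   also have "... = l * sqrt (1 / (lam0 * c1)) * (eps * f * E)" using e0 by (simp add: mult_ac)
   finally show ?thesis .
  qed
  have KK: "0 <= 2 * KS" "0 <= 4 * KS~2 + ||c||" "0 <= sqrt K * (1 + SR * lam0)" using KS_nonneg K_nonneg SR(1) lam0_pos by auto
  have "||gq eps c ?w et|| <= 2 * KS * (k1 / c1 * (eps * f * E)) + 2 * KS * (l * (2 / sqrt c1) * (eps * f * E)) + (4 * KS~2 + ||c||) * (l * k1 * (eps * f * E))
   + sqrt K * (1 + SR * lam0) * (l * sqrt (1 / (lam0 * c1)) * (eps * f * E))"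
   using cross_term[OF o(1) Qw Qe e0 z0, of c, folded a_def G_def]
    mult_left_mono[OF t1 KK(1)] mult_left_mono[OF t2 KK(1)] mult_left_mono[OF t3 KK(2)] mult_left_mono[OF t4 KK(3)] by simp
  then have "E~2 <= D * (eps * f * E)" using ge Fb[OF Qe] t0 unfolding E(2) D distrib_right mult.assoc by linarith
  then have "E * E <= E * (D * (eps * f))" by (simp add: power2_eq_square mult_ac)
  moreover have D0: "0 <= D" unfolding D using k0 KK c1 lam0_pos K_nonneg SR(1) by (intro add_nonneg_nonneg mult_nonneg_nonneg) auto
  ultimately have "E <= D * (eps * f)" using E(1) e0 f0(1) by (cases "E = 0") auto
  then have "E~2 <= (D * (eps * f))~2" using E(1) by (rule power_mono)
  then have "c1 * N2 (vv ps) <= eps * (D * (eps * f))~2" using g3 mult_left_mono[of "E~2" "(D * (eps * f))~2" eps] e0 unfolding E(2) by linarith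
  also have "... = D~2 * eps^3 * N2 F" unfolding f0(2)[symmetric] by (simp add: power_mult_distrib power2_eq_square power3_eq_cube)
  finally have "N2 (vv ps) <= D~2 / c1 * eps^3 * N2 F" using c1 by (simp add: field_simps)
  moreover have "N2 (vv ps) = N2 (%p. vv u p - vv w p)" unfolding N2_real
  proof (rule integral_cong_AE)
   note [measurable] = W_parts(4)[OF Wp] W_parts(4)[OF Q_W[OF Qu]]
   show "AL p. (vv ps p)~2 = (vv u p - vv w p)~2" using o(2) by eventually_elim (simp add: ps_def)
   show "(%p. (vv ps p)~2) \<in> borel_measurable lborel" "(%p. (vv u p - vv w p)~2) \<in> borel_measurable lborel" by measurable
  qed
  ultimately show ?thesis by simp
 qed
 show ?thesis
 proof (rule exI[of _ c0], intro allI impI)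
  fix c assume c: "c0 <= c"
  \<comment> \<open>The constant contains |c| from R3, so it is fixed only after c.\<close>
  define D where "D = k1 + 2 * KS * (k1 / c1) + 2 * KS * (l * (2 / sqrt c1)) + (4 * KS~2 + ||c||) * (l * k1) + sqrt K * (1 + SR * lam0) * (l * sqrt (1 / (lam0 * c1)))"
  have b: "D~2 / c1 * eps^3 * N2 F <= (D~2 / c1 + 1) * eps^3 * N2 F" if "0 < eps" for eps and F :: "real * real \<times> real => real"
   using that by (intro mult_right_mono) auto
  show "\<exists>C>0. \<exists>e0>0. \<forall>eps. 0 < eps --> eps < e0 --> (\<exists>C'. coer eps c C') &
  (\<forall>F u w. sqi F --> Q u --> (\<forall>v. Q v --> gq eps c u v = (LI p. F p * vv v p)) --> w \<in> TV --> Q w -->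
   (\<forall>v\<in>TV. Q v --> gq eps c w v = (LI p. F p * vv v p)) --> N2 (%p. vv u p - vv w p) <= C * eps^3 * N2 F)"
  proof -
   have D0: "0 < D~2 / c1 + 1" using c1 by (intro add_nonneg_pos) auto
   have all: "(\<exists>C'. coer eps c C') & (\<forall>F u w. sqi F --> Q u --> (\<forall>v. Q v --> gq eps c u v = (LI p. F p * vv v p)) --> w \<in> TV --> Q w -->
    (\<forall>v\<in>TV. Q v --> gq eps c w v = (LI p. F p * vv v p)) --> N2 (%p. vv u p - vv w p) <= (D~2 / c1 + 1) * eps^3 * N2 F)" if e: "0 < eps" "eps < e1" for eps
   proof (rule conjI)
    show "\<exists>C'. coer eps c C'" by (rule exI, rule coercive_bound[OF c1 e(1) less_imp_le[OF less_le_trans[OF e(2) e1(2)]] co[OF e c]])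
   next
    show "\<forall>F u w. sqi F --> Q u --> (\<forall>v. Q v --> gq eps c u v = (LI p. F p * vv v p)) --> w \<in> TV --> Q w -->
    (\<forall>v\<in>TV. Q v --> gq eps c w v = (LI p. F p * vv v p)) --> N2 (%p. vv u p - vv w p) <= (D~2 / c1 + 1) * eps^3 * N2 F"
    proof (intro allI impI)
   fix F u w assume h: "sqi F" "Q u" "\<forall>v. Q v --> gq eps c u v = (LI p. F p * vv v p)" "w \<in> TV" "Q w" "\<forall>v\<in>TV. Q v --> gq eps c w v = (LI p. F p * vv v p)"
   show "N2 (%p. vv u p - vv w p) <= (D~2 / c1 + 1) * eps^3 * N2 F"
    by (rule order_trans[OF est[OF e c h(1,2) _ h(4,5) _ D_def] b[OF e(1)]]) (use h in blast)+
    qed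
   qed
   show ?thesis by (rule exI[of _ "D~2 / c1 + 1"], rule conjI, rule D0, rule exI[of _ e1], rule conjI, rule e1, intro allI impI, rule all, assumption+)
  qed
 qed
qed


end

section \<open>Transfer to the stated forms and resolvents\<close>

lemma AE_fst:
 assumes "AL s. R s" shows "AL p. R (fst (p :: real * real \<times> real))"
proof -
 obtain N where N: "{s. \<not> R s} \<subseteq> N" "N \<in> null_sets lborel" using assms by (auto simp: eventually_ae_filter)
 have "N \<times> (UNIV :: (real * real) set) \<in> null_sets (lborel \<Otimes>\<^sub>M lborel)" by (rule lborel.times_in_null_sets1[OF N(2)]) simp
 then show ?thesis unfolding lborel_prod by (rule AE_I') (use N(1) in auto)
qed

lemma AE_snd:
 assumes "AL y. R y" shows "AL p. R (snd (p :: real * real \<times> real))"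
proof -
 obtain N where N: "{y. \<not> R y} \<subseteq> N" "N \<in> null_sets lborel" using assms by (auto simp: eventually_ae_filter)
 have "(UNIV :: real set) \<times> N \<in> null_sets (lborel \<Otimes>\<^sub>M lborel)" by (rule lborel.times_in_null_sets2[OF _ N(2)]) simp
 then show ?thesis unfolding lborel_prod by (rule AE_I') (use N(1) in auto)
qed

lemma rep_fst: "W V Fi ==> rep V (%x. fst (Fi x)) (%x. fst (Fi x))"
 by (rule repI) (auto dest: W_outside elim: eventually_mono)

lemma l2inner_rep:
 assumes F: "sqi F'" "rep V F F'" and W: "W V Gi" "rep V v (%x. fst (Gi x))"
 shows "l2inner V F v = (LI x. F' x * fst (Gi x))"
 unfolding l2inner_def
proof (rule lebesgue_AE(2))
 show "(%x. F' x * fst (Gi x)) \<in> bm" using sqi_measurable[OF F(1)] sqi_measurable[OF W_sqi(2)[OF W(1)]] by measurable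
 show "AL x. indicator V x * F x * v x = F' x * fst (Gi x)"
  using repD[OF F(2)] repD[OF W(2)] by eventually_elim (auto simp: indicator_def)
qed

lemma l2norm_rep:
 assumes F: "sqi F'" "rep V F F'" shows "l2norm V F = sqrt (N2 F')"
proof -
 have "(\<integral>x. indicator V x * (F x)~2 \<partial>lebesgue) = (LI x. (F' x)~2)"
 proof (rule lebesgue_AE(2))
  show "(%x. (F' x)~2) \<in> bm" using sqi_measurable[OF F(1)] by measurable
  show "AL x. indicator V x * (F x)~2 = (F' x)~2" using repD[OF F(2)] by eventually_elim (auto simp: indicator_def)
 qed
 then show ?thesis by (simp add: l2norm_def N2_real)
qed

text \<open>Ties the abstract coefficients to the geometric data. At s = 0, where h need not be
  differentiable, \<open>rho\<close> is left unrelated to dh/h.\<close>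

locale deformed_tube = tube S lam0 mu0 J H rho sig ev M K ka L for S lam0 mu0 J H rho sig ev M K ka L +
 fixes h dh k \<tau> \<alpha> ad :: "real => real" and uu :: "real * real => real"
 assumes h_pos: "!!s. s \<in> J ==> 0 < h s" and m_H: "!!s. s \<in> J ==> H s = 1 / (h s)~2"
  and m_rho: "!!s. s \<in> J ==> s ~= 0 ==> rho s = dh s / h s" and m_sig: "!!s. s \<in> J ==> sig s = \<tau> s + ad s"
  and m_ev: "!!s. s \<in> J ==> ev s = (h s * k s) *R zalpha \<alpha> s" and m_u: "rep S uu (%y. fst (mu0 y))"
begin

abbreviation "U \<equiv> J \<times> S"
abbreviation "g eps c \<equiv> gform U h dh k \<tau> \<alpha> ad lam0 M c eps"

lemma open_U: "open U" by (rule open_Times[OF J_open S_open])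

text \<open>Almost everywhere the densities agree, since \<open>wgrad\<close> is represented by the
  gradient component; the slice s = 0, on which \<open>rho\<close> is not prescribed, is a null
  set.\<close>

lemma gform_gq:
 assumes W: "W U Fi" "W U Gi" and r: "rep U u (vv Fi)" "rep U (wgrad U u) (%p. snd (Fi p))" "rep U v (vv Gi)" "rep U (wgrad U v) (%p. snd (Gi p))"
 shows "g eps c u v = gq eps c Fi Gi"
 unfolding gform_def gq_def
proof (rule lebesgue_AE(2)[OF gden_borel[OF W_parts(4)[OF W(1)] W_parts(4)[OF W(2)]]])
 show "AL p. indicator U p * (Dop U h dh \<tau> ad u p * Dop U h dh \<tau> ad v p
    + beta_eps eps h k \<alpha> p / (eps~2 * (h (fst p))~2) * (snd (wgrad U u p) @. snd (wgrad U v p))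
    - lam0 * beta_eps eps h k \<alpha> p / (eps~2 * M~2) * (u p * v p) + c * (u p * v p)) = gden eps c Fi Gi p"
  using repD(2)[OF r(1)] repD(2)[OF r(2)] repD(2)[OF r(3)] repD(2)[OF r(4)] W_outside[OF W(1)] AE_fst[OF AE_lborel_singleton[of 0]]
 proof eventually_elim
  case (elim p)
  show ?case
  proof (cases "p \<in> U")
   case True
   then have J: "fst p \<in> J" by (simp add: mem_Times_iff)
   have b: "beta_eps eps h k \<alpha> p = bt eps p" by (simp add: beta_eps_def bt_def m_ev[OF J])
   have D: "Dop U h dh \<tau> ad u p = Dp Fi p" "Dop U h dh \<tau> ad v p = Dp Gi p"
    using elim True by (simp_all add: Dop_def Let_def Dp_def Xp_def m_rho[OF J] m_sig[OF J])
   have Hh: "x / (eps~2 * (h (fst p))~2) = x * H (fst p) / eps~2" for x by (simp add: m_H[OF J])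
   show ?thesis using elim True by (simp add: D b Hh gden_def)
  next
   case False then show ?thesis using elim by (simp add: gden_def Dp_def Xp_def)
  qed
 qed
qed

lemma resolvent_form:
 assumes F: "sqi F'" "rep U F F'"
 shows "form_resolvent U (g eps c) F u ==> \<exists>Fi. W U Fi & rep U u (vv Fi) & (\<forall>Gi. W U Gi --> gq eps c Fi Gi = (LI p. F' p * vv Gi p))"
  "W U Fi ==> (!!Gi. W U Gi ==> gq eps c Fi Gi = (LI p. F' p * vv Gi p)) ==> form_resolvent U (g eps c) F (vv Fi)"
proof -
 assume f: "form_resolvent U (g eps c) F u"
 then obtain Fi where P: "W U Fi" "rep U u (vv Fi)" "rep U (wgrad U u) (%p. snd (Fi p))" using H10D[of U u] by (auto simp: form_resolvent_def)
 have "gq eps c Fi Gi = (LI p. F' p * vv Gi p)" if W: "W U Gi" for Gi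
 proof -
  note r = rep_fst[OF W] and h = H10I[OF open_U W rep_fst[OF W]]
  show ?thesis using f[unfolded form_resolvent_def, THEN conjunct2, THEN spec, THEN mp, OF h(1)] gform_gq[OF P(1) W P(2,3) r h(2), of c eps] l2inner_rep[OF F W r] by simp
 qed
 then show "\<exists>Fi. W U Fi & rep U u (vv Fi) & (\<forall>Gi. W U Gi --> gq eps c Fi Gi = (LI p. F' p * vv Gi p))" using P(1,2) by blast
next
 assume W: "W U Fi" and s: "!!Gi. W U Gi ==> gq eps c Fi Gi = (LI p. F' p * vv Gi p)"
 note h = H10I[OF open_U W rep_fst[OF W]]
 have "g eps c (vv Fi) v = l2inner U F v" if hv: "H10 U v" for v
 proof -
  obtain Gi where P: "W U Gi" "rep U v (vv Gi)" "rep U (wgrad U v) (%p. snd (Gi p))" using H10D[OF hv] by auto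
  show ?thesis using gform_gq[OF W P(1) rep_fst[OF W] h(2) P(2,3)] l2inner_rep[OF F P(1,2)] s[OF P(1)] by simp
 qed
 then show "form_resolvent U (g eps c) F (vv Fi)" using h(1) by (simp add: form_resolvent_def)
qed

lemma rep_tensor:
 assumes W: "W J om" and r: "rep J w (%s. fst (om s))"
 shows "rep U (tensor w uu) (vv (ptens om mu0))" "rep U (wgrad U (tensor w uu)) (%p. snd (ptens om mu0 p))"
proof -
 have m: "vv (ptens om mu0) \<in> bm" by (rule sqi_measurable[OF W_parts(1)[OF W_ptens[OF W W0]]])
 have v: "vv (ptens om mu0) p = fst (om (fst p)) * u0 (snd p)" for p by (simp add: ptens_def tens_def u0_def)
 have fs: "AL p. fst (p :: real * real \<times> real) \<in> J --> w (fst p) = fst (om (fst p))"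
  using repD(2)[OF r] by (rule AE_fst)
 have sn: "AL p. snd (p :: real * real \<times> real) \<in> S --> uu (snd p) = u0 (snd p)"
  using repD(2)[OF m_u] unfolding u0_def[symmetric] by (rule AE_snd)
 show r1: "rep U (tensor w uu) (vv (ptens om mu0))"
 proof (rule repI)
  show "AL p. p \<notin> U --> vv (ptens om mu0) p = 0" using W_outside[OF W_ptens[OF W W0]] by (rule eventually_mono) simp
  show "AL p. p \<in> U --> tensor w uu p = vv (ptens om mu0) p" using fs sn by eventually_elim (auto simp: v tensor_def)
 qed
 show "rep U (wgrad U (tensor w uu)) (%p. snd (ptens om mu0 p))" by (rule H10I(2)[OF open_U W_ptens[OF W W0] r1])
qed

text \<open>By Fubini, pairing the projection of F with z is pairing F with z(s)u0(y). Thus the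
  one-dimensional right side is the restriction of the full functional to tensor products.\<close>

lemma l2inner_projL:
 assumes F: "sqi F'" "rep U F F'" and W: "W J ze" "rep J z (%s. fst (ze s))"
 shows "l2inner J (projL S uu F) z = (LI p. F' p * vv (ptens ze mu0) p)"
proof -
 note [measurable] = sqi_measurable[OF F(1)]
 have "AL s. s \<in> J --> projL S uu F s = Pr u0 F' s" using AE_slices[OF repD(2)[OF F(2)]] AE_slices[OF repD(1)[OF F(2)]]
 proof eventually_elim
  case (elim s)
  show ?case
  proof
   assume s: "s \<in> J"
   show "projL S uu F s = Pr u0 F' s" unfolding projL_def Pr_def
   proof (rule lebesgue_AE(2))
    show "AL y. indicator S y * F (s, y) * uu y = u0 y * F' (s, y)"
     using elim repD[OF m_u] by eventually_elim (use s in \<open>auto simp: indicator_def u0_def\<close>)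
   qed measurable
  qed
 qed
 moreover have "AL s. s \<notin> J --> Pr u0 F' s = 0" using AE_slices[OF repD(1)[OF F(2)]]
 proof eventually_elim
  case (elim s)
  have "Pr u0 F' s = (\<integral>y. 0 \<partial>(lborel :: (real * real) measure))" if "s \<notin> J" unfolding Pr_def
   by (rule integral_cong_AE) (use elim that in \<open>auto elim: eventually_mono\<close>)
  then show ?case by simp
 qed
 ultimately have "rep J (projL S uu F) (Pr u0 F')" by (intro repI)
 from l2inner_rep[OF sqi_Pr(1)[OF u0_sqi F(1)] this W] have "l2inner J (projL S uu F) z = (LI s. Pr u0 F' s * fst (ze s))" .
 also have "... = (LI s. (LI y. F' (s, y) * vv (ptens ze mu0) (s, y)))"
  unfolding Pr_def integral_mult_left_zero[symmetric] by (simp add: ptens_def tens_def u0_def mult_ac)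
 also have "... = (LI p. F' p * vv (ptens ze mu0) p)" by (rule fubini(3)[OF sqi_times[OF F(1) W_parts(1)[OF W_ptens[OF W(1) W0]]]])
 finally show ?thesis .
qed

text \<open>Under w -> w(s)u0(y) the one-dimensional problem is the Galerkin problem on
  \<open>TV\<close>; this carries solutions in both directions.\<close>

lemma resolvent_tensor:
 assumes F: "sqi F'" "rep U F F'"
 defines "t \<equiv> %eps c w z. g eps c (tensor w uu) (tensor z uu)"
 shows "form_resolvent J (t eps c) (projL S uu F) w ==> \<exists>om. W J om & rep J w (%s. fst (om s)) & (\<forall>Gi\<in>TV. gq eps c (ptens om mu0) Gi = (LI p. F' p * vv Gi p))"
  "Fi \<in> TV ==> (!!Gi. Gi \<in> TV ==> gq eps c Fi Gi = (LI p. F' p * vv Gi p)) ==> \<exists>w. form_resolvent J (t eps c) (projL S uu F) w"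
proof -
 note Wt = W_ptens[OF _ W0, of J]
 have tg: "t eps c w z = gq eps c (ptens om mu0) (ptens ze mu0)" if "W J om" "rep J w (%s. fst (om s))" "W J ze" "rep J z (%s. fst (ze s))" for w z om ze
  unfolding t_def by (rule gform_gq[OF Wt[OF that(1)] Wt[OF that(3)] rep_tensor[OF that(1,2)] rep_tensor[OF that(3,4)]])
 {
  assume f: "form_resolvent J (t eps c) (projL S uu F) w"
  then obtain om where P: "W J om" "rep J w (%s. fst (om s))" using H10D[of J w] by (auto simp: form_resolvent_def)
  have "gq eps c (ptens om mu0) Gi = (LI p. F' p * vv Gi p)" if "Gi \<in> TV" for Gi
  proof -
   obtain ze where z: "W U Gi" "W J ze" "AL p. Gi p = ptens ze mu0 p" using \<open>Gi \<in> TV\<close> unfolding TV_def by blast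
   note [measurable] = sqi_measurable[OF F(1)] W_parts(4)[OF z(1)] W_parts(4)[OF Wt[OF z(2)]]
   have 1: "gq eps c (ptens om mu0) Gi = gq eps c (ptens om mu0) (ptens ze mu0)"
    unfolding gq_sym[of eps c "ptens om mu0"] by (rule gq_cong[OF W_parts(4)[OF z(1)] W_parts(4)[OF Wt[OF z(2)]] W_parts(4)[OF Wt[OF P(1)]] z(3)])
   have 2: "(LI p. F' p * vv Gi p) = (LI p. F' p * vv (ptens ze mu0) p)"
   proof (rule integral_cong_AE)
    show "AL p. F' p * vv Gi p = F' p * vv (ptens ze mu0) p" using z(3) by eventually_elim simp
   qed measurable
   note r = rep_fst[OF z(2)]
   show ?thesis unfolding 1 2 using f H10I(1)[OF J_open z(2) r] tg[OF P z(2) r] l2inner_projL[OF F z(2) r] by (simp add: form_resolvent_def)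
  qed
  then show "\<exists>om. W J om & rep J w (%s. fst (om s)) & (\<forall>Gi\<in>TV. gq eps c (ptens om mu0) Gi = (LI p. F' p * vv Gi p))" using P by blast
 next
  assume T: "Fi \<in> TV" and s: "!!Gi. Gi \<in> TV ==> gq eps c Fi Gi = (LI p. F' p * vv Gi p)"
  obtain om where o: "W U Fi" "W J om" "AL p. Fi p = ptens om mu0 p" using T unfolding TV_def by blast
  have "t eps c (%s. fst (om s)) z = l2inner J (projL S uu F) z" if hz: "H10 J z" for z
  proof -
   obtain ze where z: "W J ze" "rep J z (%s. fst (ze s))" using H10D[OF hz] by blast
   have "ptens ze mu0 \<in> TV" using Wt[OF z(1)] z(1) unfolding TV_def by blast
   from s[OF this] show ?thesis
    using tg[OF o(2) rep_fst[OF o(2)] z] l2inner_projL[OF F z] gq_cong[OF W_parts(4)[OF o(1)] W_parts(4)[OF Wt[OF o(2)]] W_parts(4)[OF Wt[OF z(1)]] o(3), of eps c] by simp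
  qed
  then have "form_resolvent J (t eps c) (projL S uu F) (%s. fst (om s))"
   using H10I(1)[OF J_open o(2) rep_fst[OF o(2)]] by (simp add: form_resolvent_def)
  then show "\<exists>w. form_resolvent J (t eps c) (projL S uu F) w" by blast
 }
qed

theorem resolvent_estimate:
 "\<exists>c0. \<forall>c\<ge>c0. \<exists>C10>0. \<exists>eps0>0. \<forall>eps. 0 < eps & eps < eps0 -->
  (\<forall>F. L2 U F -->
    (\<exists>u. form_resolvent U (g eps c) F u) \<and>
    (\<exists>w. form_resolvent J (%w z. g eps c (tensor w uu) (tensor z uu)) (projL S uu F) w) \<and>
    (\<forall>u w. form_resolvent U (g eps c) F u --> form_resolvent J (%w z. g eps c (tensor w uu) (tensor z uu)) (projL S uu F) w -->
       l2norm U (%p. u p - tensor w uu p) <= C10 * eps powr (3/2) * l2norm U F))"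
proof -
 obtain c0 where c0: "\<forall>c\<ge>c0. \<exists>C>0. \<exists>e0>0. \<forall>eps. 0 < eps --> eps < e0 --> (\<exists>C'. coer eps c C') &
  (\<forall>F u w. sqi F --> Q u --> (\<forall>v. Q v --> gq eps c u v = (LI p. F p * vv v p)) --> w \<in> TV --> Q w -->
   (\<forall>v\<in>TV. Q v --> gq eps c w v = (LI p. F p * vv v p)) --> N2 (%p. vv u p - vv w p) <= C * eps^3 * N2 F)"
  using reduction_estimate by (elim exE)
 show ?thesis
 proof (rule exI[of _ c0], intro allI impI)
  fix c assume c: "c0 <= c"
  obtain C e0 where C: "0 < C" and e0: "0 < e0" and main: "\<forall>eps. 0 < eps --> eps < e0 --> (\<exists>C'. coer eps c C') &
   (\<forall>F u w. sqi F --> Q u --> (\<forall>v. Q v --> gq eps c u v = (LI p. F p * vv v p)) --> w \<in> TV --> Q w -->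
   (\<forall>v\<in>TV. Q v --> gq eps c w v = (LI p. F p * vv v p)) --> N2 (%p. vv u p - vv w p) <= C * eps^3 * N2 F)"
   using c0[THEN spec, THEN mp, OF c] by (elim exE conjE) (rule that)
  have all: "(\<exists>u. form_resolvent U (g eps c) F u) & (\<exists>w. form_resolvent J (%w z. g eps c (tensor w uu) (tensor z uu)) (projL S uu F) w) \<and>
    (\<forall>u w. form_resolvent U (g eps c) F u --> form_resolvent J (%w z. g eps c (tensor w uu) (tensor z uu)) (projL S uu F) w -->
       l2norm U (%p. u p - tensor w uu p) <= sqrt C * eps powr (3/2) * l2norm U F)"
   if e: "0 < eps" "eps < e0" and LF: "L2 U F" for eps F
  proof -
   obtain F' where F: "sqi F'" "rep U F F'" using L2D[OF LF] by blast
   note m = main[THEN spec, THEN mp, OF e(1), THEN mp, OF e(2)]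
   obtain C' where co: "coer eps c C'" using m[THEN conjunct1] by (elim exE)
   note est = m[THEN conjunct2, rule_format]
   obtain u1 where u1: "W U u1" "Q u1" "sqi (%p. H (fst p) *R gy u1 p)" and u1s: "!!v. W U v ==> gq eps c u1 v = (LI p. F' p * vv v p)"
    using solution_exists[OF fsp_W co F(1)] by auto
   obtain w1 where w1: "w1 \<in> TV" "Q w1" "sqi (%p. H (fst p) *R gy w1 p)" and w1s: "!!v. v \<in> TV ==> gq eps c w1 v = (LI p. F' p * vv v p)"
    using solution_exists[OF fsp_TV co F(1)] by blast
   have bound: "l2norm U (%p. u p - tensor w uu p) <= sqrt C * eps powr (3/2) * l2norm U F"
    if u: "form_resolvent U (g eps c) F u" and w: "form_resolvent J (%w z. g eps c (tensor w uu) (tensor z uu)) (projL S uu F) w" for u w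
   proof -
    obtain Fi where P: "W U Fi" "rep U u (vv Fi)" "\<forall>Gi. W U Gi --> gq eps c Fi Gi = (LI p. F' p * vv Gi p)" using resolvent_form(1)[OF F u] by (elim exE conjE)
    obtain om where o: "W J om" "rep J w (%s. fst (om s))" "\<forall>Gi\<in>TV. gq eps c (ptens om mu0) Gi = (LI p. F' p * vv Gi p)" using resolvent_tensor(1)[OF F w] by (elim exE conjE)
    have oT: "ptens om mu0 \<in> TV" using W_ptens[OF o(1) W0] o(1) unfolding TV_def by blast
    \<comment> \<open>The error estimate is proved for finite-energy solutions. Uniqueness
      identifies arbitrary given solutions with the constructed ones, which do have finite
      energy.\<close>
    have a1: "AL p. Fi p = u1 p" by (rule solution_unique[OF fsp_W co, where l = "%v. \<integral>p. F' p * vv v p \<partial>lborel"]) (use u1 u1s P in auto)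
    have a2: "AL p. ptens om mu0 p = w1 p" by (rule solution_unique[OF fsp_TV co w1(1,3) w1s oT o(3)[rule_format]])
    have d: "sqi (%p. vv u1 p - vv w1 p)" by (rule sqi_diff(1)[OF W_parts(1)[OF u1(1)] W_parts(1)[OF Q_W[OF w1(2)]]])
    have "rep U (%p. u p - tensor w uu p) (%p. vv u1 p - vv w1 p)"
    proof (rule repI)
     show "AL p. p \<notin> U --> vv u1 p - vv w1 p = 0" using W_outside[OF u1(1)] W_outside[OF Q_W[OF w1(2)]] by eventually_elim simp
     show "AL p. p \<in> U --> u p - tensor w uu p = vv u1 p - vv w1 p" using repD(2)[OF P(2)] repD(2)[OF rep_tensor(1)[OF o(1,2)]] a1 a2 by eventually_elim simp
    qed
    from l2norm_rep[OF d this] have "l2norm U (%p. u p - tensor w uu p) = sqrt (N2 (%p. vv u1 p - vv w1 p))" .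
    also have "... <= sqrt (C * eps^3 * N2 F')"
     by (intro real_sqrt_le_mono est F(1) u1(2) w1(1,2) u1s w1s Q_W)
    also have "... = sqrt C * eps powr (3/2) * l2norm U F"
    proof -
     have "sqrt (eps^3) = eps powr (3/2)" using e(1) by (simp add: powr_half_sqrt[symmetric] powr_powr powr_realpow[symmetric] del: powr_numeral)
     then show ?thesis by (simp add: real_sqrt_mult l2norm_rep[OF F])
    qed
    finally show ?thesis .
   qed
   show ?thesis using resolvent_form(2)[OF F u1(1) u1s] resolvent_tensor(2)[OF F w1(1) w1s] bound by blast
  qed
  show "\<exists>C10>0. \<exists>eps0>0. \<forall>eps. 0 < eps & eps < eps0 -->
  (\<forall>F. L2 U F -->
    (\<exists>u. form_resolvent U (g eps c) F u) \<and>
    (\<exists>w. form_resolvent J (%w z. g eps c (tensor w uu) (tensor z uu)) (projL S uu F) w) \<and>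
    (\<forall>u w. form_resolvent U (g eps c) F u --> form_resolvent J (%w z. g eps c (tensor w uu) (tensor z uu)) (projL S uu F) w -->
       l2norm U (%p. u p - tensor w uu p) <= C10 * eps powr (3/2) * l2norm U F))"
   by (rule exI[of _ "sqrt C"], rule conjI, rule real_sqrt_gt_zero[OF C], rule exI[of _ e0], rule conjI, rule e0, intro allI impI, elim conjE, rule all, assumption+)
 qed
qed

end

section \<open>From the geometric hypotheses to the coefficients\<close>

text \<open>The mean value theorem for ln h on either side of \<open>a\<close>, the point where a
  derivative is not assumed; an interval across \<open>a\<close> is split there.\<close>

lemma log_lipschitz:
 fixes h dh :: "real => real"
 assumes I: "convex I" and pos: "!!s. s \<in> I ==> 0 < h s" and c: "continuous_on I h"
  and d: "!!s. s \<in> I ==> s ~= a ==> (h has_real_derivative dh s) (at s within I)" and b: "!!s. s \<in> I ==> s ~= a ==> ||dh s / h s|| <= K"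
  and st: "s \<in> I" "t \<in> I"
 shows "||ln (h s) - ln (h t)|| <= K * ||s - t||"
proof -
 have piece: "||ln (h x) - ln (h y)|| <= K * (y - x)" if xy: "x < y" "x \<in> I" "y \<in> I" "a <= x | y <= a" for x y
 proof -
  have sub: "{x..y} \<subseteq> I" using closed_segment_subset[OF xy(2,3) I] xy(1) by (simp add: closed_segment_eq_real_ivl)
  have D: "((%s. ln (h s)) has_real_derivative (inverse (h z) * dh z)) (at z)" if z: "x < z" "z < y" for z
  proof -
   have zI: "z \<in> I" "z ~= a" using z sub xy(4) by auto
   have "at z within I = at z" by (rule at_within_open_subset[of z "{x<..<y}"]) (use z sub in auto)
   then have "(h has_real_derivative dh z) (at z)" using d[OF zI] by simp
   from DERIV_chain2[where f=ln and g=h, OF DERIV_ln[OF pos[OF zI(1)]] this] show ?thesis .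
  qed
  have cl: "continuous_on {x..y} (%s. ln (h s))"
   by (intro continuous_on_ln continuous_on_subset[OF c sub]) (use pos sub in fastforce)
  have df: "(%s. ln (h s)) differentiable (at z)" if "x < z" "z < y" for z using D[OF that] by (auto simp: real_differentiable_def)
  obtain l z where l: "x < z" "z < y" "((%s. ln (h s)) has_real_derivative l) (at z)" "ln (h y) - ln (h x) = (y - x) * l"
   using MVT[OF xy(1) cl df] by blast
  have le: "l = dh z / h z" using DERIV_unique[OF l(3) D[OF l(1,2)]] by (simp add: field_simps)
  have "z \<in> I" "z ~= a" using l(1,2) sub xy(4) by auto
  then have "||l|| <= K" using b le by simp
  then have "(y - x) * ||l|| <= (y - x) * K" using xy(1) by (intro mult_left_mono) auto
  then show ?thesis using l(4) xy(1) by (simp add: abs_minus_commute[of "ln (h x)"] abs_mult mult.commute)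
 qed
 have le: "||ln (h x) - ln (h y)|| <= K * (y - x)" if xy: "x \<in> I" "y \<in> I" "x <= y" for x y
 proof -
  consider "x = y" | "x < y" "a <= x | y <= a" | "x < a" "a < y" using xy(3) by linarith
  then show ?thesis
  proof cases
   case 3
   have "a \<in> {x..y}" using 3 by simp
   then have aI: "a \<in> I" using closed_segment_subset[OF xy(1,2) I] xy(3) by (auto simp: closed_segment_eq_real_ivl)
   show ?thesis using piece[OF 3(1) xy(1) aI] piece[OF 3(2) aI xy(2)] by (simp add: algebra_simps)
  qed (use piece xy in auto)
 qed
 show ?thesis using le[OF st] le[OF st(2,1)] by (cases "s <= t") (auto simp: abs_minus_commute)
qed

text \<open>th2 is at most s^2 and at most 1, so three regions suffice: near 0 the expansion gives
  the quadratic drop, on a compact middle part h has a maximum strictly below M, and far out h is at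
  most m.\<close>

lemma gap_below_max:
 fixes h :: "real => real"
 assumes I: "closed I" and c: "continuous_on I h" and M: "h 0 = M" "!!s. s \<in> I ==> s ~= 0 ==> h s < M"
  and e: "(%s. h s - (M - s~2)) \<in> O[at 0 within I](%s. ||s|| ^ 3)"
  and far: "m < M" "!!s. s \<in> I ==> R <= ||s|| ==> h s <= m"
 shows "\<exists>ga>0. \<forall>s\<in>I. h s <= M - ga * th2 s"
proof -
 obtain C where C: "0 < C" "eventually (%s. norm (h s - (M - s~2)) <= C * norm ( ||s|| ^ 3)) (at 0 within I)" using landau_o.bigE[OF e] by blast
 then obtain d where d: "0 < d" "!!s. s \<in> I ==> s ~= 0 ==> dist s 0 < d ==> norm (h s - (M - s~2)) <= C * norm ( ||s|| ^ 3)" unfolding eventually_at by blast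
 \<comment> \<open>Within 1/(2 C) the cubic error is at most half of s^2.\<close>
 define de where "de = min d (1 / (2 * C))"
 have d0: "0 < de" using d C by (simp add: de_def)
 have t2: "th2 s <= s~2" for s unfolding th2_def by (simp add: divide_le_eq mult_le_cancel_left1 add_pos_nonneg)
 have near: "h s <= M - 1/2 * th2 s" if s: "s \<in> I" "||s|| < de" for s
 proof (cases "s = 0")
  case True then show ?thesis using M by (simp add: th2_def)
 next
  case False
  have "C * ||s|| <= 1/2" using s(2) C(1) by (simp add: de_def field_simps)
  then have "C * ||s|| * s~2 <= 1/2 * s~2" by (rule mult_right_mono) simp
  moreover have "||s|| ^ 3 = ||s|| * s~2" by (simp add: power3_eq_cube power2_eq_square)
  moreover have "||h s - (M - s~2)|| <= C * ||s|| ^ 3" using d(2)[OF s(1) False] s(2) by (simp add: de_def)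
  ultimately have "h s <= M - 1/2 * s~2" by (simp add: abs_le_iff mult.assoc)
  then show ?thesis using t2[of s] by simp
 qed
 define A where "A = I \<inter> {s. de <= ||s||} \<inter> {- R..R}"
 have A: "compact A" unfolding A_def by (intro closed_Int_compact closed_Int I closed_Collect_le continuous_intros compact_Icc)
 have "\<exists>m1<M. \<forall>s\<in>A. h s <= m1"
 proof (cases "A = {}")
  case True then show ?thesis using far(1) by blast
 next
  case False
  obtain x where x: "x \<in> A" "\<forall>s\<in>A. h s <= h x" using continuous_attains_sup[OF A False continuous_on_subset[OF c]] unfolding A_def by blast
  have "h x < M" using M(2)[of x] x(1) d0 by (auto simp: A_def)
  then show ?thesis using x(2) by blast
 qed
 then obtain m1 where m1: "m1 < M" "!!s. s \<in> A ==> h s <= m1" by blast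
 define ga where "ga = min (1/2) (M - max m m1)"
 have g0: "0 < ga" using m1(1) far(1) by (simp add: ga_def)
 have "h s <= M - ga * th2 s" if s: "s \<in> I" for s
 proof (cases "||s|| < de")
  case True
  have "ga <= 1/2" unfolding ga_def by (rule min.cobounded1)
  then have "ga * th2 s <= 1/2 * th2 s" by (rule mult_right_mono[OF _ th_facts(1)])
  then show ?thesis using near[OF s True] by linarith
 next
  case False
  have "h s <= max m m1"
  proof (cases "R <= ||s||")
   case True then show ?thesis using far(2)[OF s] by simp
  next
   case False
   then have "s \<in> A" using s \<open>\<not> ||s|| < de\<close> by (auto simp: A_def abs_le_iff)
   then show ?thesis using m1(2) by fastforce
  qed
  moreover have "ga * th2 s <= ga * 1" using th_facts(2)[of s] g0 by (intro mult_left_mono) auto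
  moreover have "ga <= M - max m m1" by (simp add: ga_def)
  ultimately show ?thesis by linarith
 qed
 then show ?thesis using g0 by blast
qed

text \<open>Serves the torsion, which is known only through B' = -\<tau> N: a derivative is Borel as
  a limit of continuous difference quotients. The closest-point map keeps their arguments in I, and
  at interior points it eventually acts as the identity.\<close>

lemma derivative_inner_borel:
 fixes B N :: "real => 'a::euclidean_space"
 assumes I: "closed I" "convex I" "I ~= {}" and B: "!!s. s \<in> I ==> (B has_vector_derivative D s) (at s within I)" and N: "continuous_on I N"
 shows "(%s. if s \<in> interior I then D s @. N s else 0) \<in> bm"
proof -
 define cl where "cl = closest_point I"
 have cl: "continuous_on UNIV cl" "!!s. cl s \<in> I" "!!s. s \<in> I ==> cl s = s"
  unfolding cl_def using I by (auto simp: continuous_on_closest_point closest_point_in_set closest_point_self)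
 have Bc: "continuous_on I B" by (rule continuous_on_vector_derivative[OF B])
 define f where "f n s = indicator (interior I) s * ((real (Suc n) *R (B (cl (s + 1 / real (Suc n))) - B (cl s))) @. N (cl s))" for n s
 have cc: "continuous_on UNIV (%s. cl (s + r))" for r by (rule continuous_on_compose2[OF cl(1)]) (auto intro!: continuous_intros)
 show ?thesis
 proof (rule borel_measurable_LIMSEQ_real)
  fix n
  have "continuous_on UNIV (%s. (real (Suc n) *R (B (cl (s + 1 / real (Suc n))) - B (cl s))) @. N (cl s))"
   by (intro continuous_intros continuous_on_compose2[OF Bc cc] continuous_on_compose2[OF Bc cl(1)] continuous_on_compose2[OF N cl(1)]) (use cl(2) in auto)
  then have m1: "(%s. (real (Suc n) *R (B (cl (s + 1 / real (Suc n))) - B (cl s))) @. N (cl s)) \<in> bm" by (rule borel_measurable_continuous_onI)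
  show "f n \<in> bm" unfolding f_def[abs_def] by (rule borel_measurable_times[OF borel_measurable_indicator m1]) simp
 next
  fix s
  show "(%n. f n s) ~~> (if s \<in> interior I then D s @. N s else 0)"
  proof (cases "s \<in> interior I")
   case True
   then have sI: "s \<in> I" using interior_subset by auto
   have "(B has_vector_derivative D s) (at s)" using B[OF sI] at_within_interior[OF True] by simp
   then have "((%t. B t @. N s) has_vector_derivative D s @. N s) (at s)" by (rule bounded_linear.has_vector_derivative[OF bounded_linear_inner_left])
   then have "((%t. B t @. N s) has_real_derivative D s @. N s) (at s)" by (simp add: has_real_derivative_iff_has_vector_derivative)
   then have "((%x. (B (s + x) @. N s - B s @. N s) / x) \<longlongrightarrow> D s @. N s) (at 0)" by (simp add: DERIV_def)
   moreover have x0: "(%n. 1 / real (Suc n)) ~~> 0" by (rule lim_1_over_n[THEN LIMSEQ_Suc])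
   ultimately have l: "(%n. (B (s + 1 / real (Suc n)) @. N s - B s @. N s) / (1 / real (Suc n))) ~~> D s @. N s"
    unfolding tendsto_at_iff_sequentially comp_def by (auto dest!: spec[of _ "%n. 1 / real (Suc n)"])
   have "(%n. s + 1 / real (Suc n)) ~~> s + 0" by (intro tendsto_intros x0)
   then have "eventually (%n. s + 1 / real (Suc n) \<in> interior I) sequentially" by (rule topological_tendstoD) (use True in auto)
   then have "eventually (%n. (B (s + 1 / real (Suc n)) @. N s - B s @. N s) / (1 / real (Suc n)) = f n s) sequentially"
   proof eventually_elim
    case (elim n)
    then have "cl (s + 1 / real (Suc n)) = s + 1 / real (Suc n)" using interior_subset by (intro cl(3)) auto
    then show ?case using True sI by (simp add: f_def cl(3) inner_diff_left mult.commute)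
   qed
   from Lim_transform_eventually[OF l this] show ?thesis using True by simp
  qed (simp add: f_def)
 qed
qed

text \<open>A Borel representative of u0 is positive only almost everywhere on S. Where it is not,
  it is reset to value 1 and gradient 0, which changes a null set and gives positivity at every
  point of S.\<close>

lemma eigenfunction_model:
 assumes S: "open S" and eig: "dirichlet_eigenpair S lam0 u0" and pos: "\<forall>y\<in>S. 0 < u0 y" and nrm: "(\<integral>y. indicator S y * (u0 y)~2 \<partial>lebesgue) = 1"
 shows "\<exists>mu0. W S mu0 & rep S u0 (%y. fst (mu0 y)) & (\<forall>Gi. W S Gi --> (LI y. snd (mu0 y) @. snd (Gi y)) = lam0 * (LI y. fst (mu0 y) * fst (Gi y))) \<and>
  (\<forall>y\<in>S. 0 < fst (mu0 y)) & (\<forall>y. y \<notin> S --> mu0 y = 0) & N2 (%y. fst (mu0 y)) = 1"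
proof -
 have h: "H10 S u0" and we: "!!v. H10 S v ==> (\<integral>y. indicator S y * (wgrad S u0 y @. wgrad S v y) \<partial>lebesgue) = lam0 * l2inner S u0 v"
  using eig by (auto simp: dirichlet_eigenpair_def)
 obtain Fi where P: "W S Fi" "rep S u0 (%y. fst (Fi y))" "rep S (wgrad S u0) (%y. snd (Fi y))" using H10D[OF h] by blast
 define mu0 where "mu0 y = (if y \<in> S then if 0 < fst (Fi y) then Fi y else (1, 0) else 0)" for y
 have [measurable]: "S \<in> sets borel" "Fi \<in> bm" using S W_borel[OF P(1)] by auto
 have m: "mu0 \<in> bm" unfolding mu0_def[abs_def] by measurable
 have ae: "AL y. Fi y = mu0 y" using repD(2)[OF P(2)] W_outside[OF P(1)] by eventually_elim (use pos in \<open>auto simp: mu0_def\<close>)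
 have W: "W S mu0" by (rule W_AE_cong[OF P(1) ae m])
 have r: "rep S u0 (%y. fst (mu0 y))" "rep S (wgrad S u0) (%y. snd (mu0 y))"
  using P(2,3) ae unfolding rep_def by (eventually_elim, simp)+
 have sm: "sqi (%y. fst (mu0 y))" by (rule W_sqi(2)[OF W])
 note [measurable] = m
 have "(LI y. snd (mu0 y) @. snd (Gi y)) = lam0 * (LI y. fst (mu0 y) * fst (Gi y))" if Y: "W S Gi" for Gi
 proof -
  note [measurable] = W_borel[OF Y]
  note v = rep_fst[OF Y] and hv = H10I[OF S Y rep_fst[OF Y]]
  have "(\<integral>y. indicator S y * (wgrad S u0 y @. wgrad S (%y. fst (Gi y)) y) \<partial>lebesgue) = (LI y. snd (mu0 y) @. snd (Gi y))"
  proof (rule lebesgue_AE(2))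
   show "AL y. indicator S y * (wgrad S u0 y @. wgrad S (%y. fst (Gi y)) y) = snd (mu0 y) @. snd (Gi y)"
    using repD[OF r(2)] repD[OF hv(2)] by eventually_elim (auto simp: indicator_def)
  qed measurable
  then show ?thesis using we[OF hv(1)] l2inner_rep[OF sm r(1) Y v] by simp
 qed
 moreover have "N2 (%y. fst (mu0 y)) = 1" using l2norm_rep[OF sm r(1)] nrm by (simp add: l2norm_def)
 moreover have "\<forall>y\<in>S. 0 < fst (mu0 y)" "\<forall>y. y \<notin> S --> mu0 y = 0" by (auto simp: mu0_def)
 ultimately show ?thesis using W r(1) by blast
qed

text \<open>The operator norm is expressed through solutions: for every F both problems are solvable
  and every pair of solutions obeys the bound. Since \<open>projL\<close> is the coefficient of the
  projection of F, \<open>tensor w u0\<close> is the image of F under the comparison operator. The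
  Dirichlet problems live on the open set \<open>interior I\<close>; the constants may depend on
  c.\<close>

theorem theorem4p3:
  fixes I :: "real set" and S :: "(real \<times> real) set"
    and r T N B :: "real \<Rightarrow> real^3"
    and k \<tau> \<alpha> ad h dh :: "real \<Rightarrow> real"
    and M lam0 :: real and u0 :: "real \<times> real \<Rightarrow> real"
  assumes I_def: "(\<exists>a b. 0 < a \<and> 0 < b \<and> I = {-a..b}) \<or> I = UNIV"
    (* simple C^2 curve parametrised by arc length with Frenet frame *)
    and r_simple: "inj_on r I"
    and r_deriv: "\<forall>s\<in>I. (r has_vector_derivative T s) (at s within I)"
    and T_deriv: "\<forall>s\<in>I. (T has_vector_derivative (k s *\<^sub>R N s)) (at s within I)"
    and r_C2: "continuous_on I (\<lambda>s. k s *\<^sub>R N s)"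
    and N_deriv: "\<forall>s\<in>I. (N has_vector_derivative (- k s *\<^sub>R T s + \<tau> s *\<^sub>R B s)) (at s within I)"
    and B_deriv: "\<forall>s\<in>I. (B has_vector_derivative (- \<tau> s *\<^sub>R N s)) (at s within I)"
    and frame_on: "\<forall>s\<in>I. norm (T s) = 1 \<and> norm (N s) = 1 \<and> norm (B s) = 1 \<and>
                      T s \<bullet> N s = 0 \<and> T s \<bullet> B s = 0 \<and> N s \<bullet> B s = 0"
    and k_nonneg: "\<forall>s\<in>I. 0 \<le> k s"
    (* alpha *)
    and alpha_deriv: "\<forall>s\<in>I. (\<alpha> has_real_derivative ad s) (at s within I)"
    and alpha_C1: "continuous_on I ad"
    and alpha0: "\<alpha> 0 = 0"
    and bounded_coeffs: "\<exists>K. \<forall>s\<in>I. \<bar>k s\<bar> \<le> K \<and> \<bar>\<tau> s\<bar> \<le> K \<and> \<bar>ad s\<bar> \<le> K"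
    (* cross-section *)
    and S_open: "open S" and S_bounded: "bounded S"
    and S_sc: "simply_connected S" and S_ne: "S \<noteq> {}"
    (* the deformation profile h *)
    and h_pos: "\<forall>s\<in>I. 0 < h s"
    and h_cont: "continuous_on I h"
    and h_deriv: "\<forall>s\<in>I - {0}. (h has_real_derivative dh s) (at s within I)"
    and h_C1: "continuous_on (I - {0}) dh"
    and h_log_bdd: "\<exists>K. \<forall>s\<in>I - {0}. \<bar>dh s / h s\<bar> \<le> K"
    and M_pos: "0 < M"
    and h_expansion: "(\<lambda>s. h s - (M - s\<^sup>2)) \<in> O[at 0 within I](\<lambda>s. \<bar>s\<bar> ^ 3)"
    and h_max: "h 0 = M" "\<forall>s\<in>I. s \<noteq> 0 \<longrightarrow> h s < M"
    and h_infty: "I = UNIV \<longrightarrow> (\<exists>m<M. eventually (\<lambda>s. h s \<le> m) at_infinity)"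
    (* injectivity of the tube maps *)
    and f_inj: "\<forall>\<epsilon>. 0 < \<epsilon> \<and> \<epsilon> < 1 \<longrightarrow> inj_on (ftube r N B \<alpha> h \<epsilon>) (I \<times> S)"
    (* lowest Dirichlet eigenvalue and normalised positive eigenfunction of S *)
    and eig: "dirichlet_eigenpair S lam0 u0"
    and eig_lowest: "\<forall>\<mu> u. dirichlet_eigenpair S \<mu> u \<longrightarrow> lam0 \<le> \<mu>"
    and u0_pos: "\<forall>y\<in>S. 0 < u0 y"
    and u0_norm: "(\<integral>y. indicator S y * (u0 y)\<^sup>2 \<partial>lebesgue) = 1"
  shows "\<exists>c0. \<forall>c\<ge>c0. \<exists>C10>0. \<exists>eps0>0. \<forall>\<epsilon>. 0 < \<epsilon> \<and> \<epsilon> < eps0 \<longrightarrow>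
     (\<forall>F. L2 (interior I \<times> S) F \<longrightarrow>
        (\<exists>u. form_resolvent (interior I \<times> S) (gform (interior I \<times> S) h dh k \<tau> \<alpha> ad lam0 M c \<epsilon>) F u) \<and>
        (\<exists>w. form_resolvent (interior I) (\<lambda>w z. gform (interior I \<times> S) h dh k \<tau> \<alpha> ad lam0 M c \<epsilon> (tensor w u0) (tensor z u0))
               (projL S u0 F) w) \<and>
        (\<forall>u w. form_resolvent (interior I \<times> S) (gform (interior I \<times> S) h dh k \<tau> \<alpha> ad lam0 M c \<epsilon>) F u \<longrightarrow>
               form_resolvent (interior I) (\<lambda>w z. gform (interior I \<times> S) h dh k \<tau> \<alpha> ad lam0 M c \<epsilon> (tensor w u0) (tensor z u0))
                 (projL S u0 F) w \<longrightarrow>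
               l2norm (interior I \<times> S) (\<lambda>p. u p - tensor w u0 p) \<le> C10 * \<epsilon> powr (3/2) * l2norm (interior I \<times> S) F))"
proof -
 have I: "closed I" "convex I" "0 \<in> I" using I_def by auto
 then have ne: "I ~= {}" by blast
 \<comment> \<open>Clamping to I extends h to the whole line with the same bounds, as the locale
   \<open>tube\<close> requires for H.\<close>
 define cl where "cl = closest_point I"
 have cl: "continuous_on UNIV cl" "!!s. cl s \<in> I" "!!s. s \<in> I ==> cl s = s" "!!s t. ||cl s - cl t|| <= ||s - t||"
  unfolding cl_def using I ne closest_point_lipschitz[OF I(2,1) ne]
  by (auto simp: continuous_on_closest_point closest_point_in_set closest_point_self dist_real_def)
 have JI: "!!s. s \<in> interior I ==> s \<in> I" using interior_subset by blast
 have Jb: "interior I \<in> sets borel" "interior I - {0} \<in> sets borel" by auto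
 obtain K1 where K1: "!!s. s \<in> I ==> ||k s|| <= K1 & ||\<tau> s|| <= K1 & ||ad s|| <= K1" using bounded_coeffs by blast
 obtain K2 where K2: "!!s. s \<in> I ==> s ~= 0 ==> ||dh s / h s|| <= K2" using h_log_bdd by blast
 have K10: "0 <= K1" using K1[OF I(3)] by linarith
 have hp: "!!s. s \<in> I ==> 0 < h s" and hM: "!!s. s \<in> I ==> h s <= M" using h_pos h_max by (auto simp: le_less)
 obtain m R where far: "m < M" "!!s. s \<in> I ==> R <= ||s|| ==> h s <= m"
 proof (cases "I = UNIV")
  case True
  then obtain m where m: "m < M" "eventually (%s. h s <= m) at_infinity" using h_infty by blast
  then obtain R where "!!s. R <= ||s|| ==> h s <= m" unfolding eventually_at_infinity by auto
  then show ?thesis using that m(1) by blast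
 next
  case False
  then obtain a b where "0 < a" "0 < b" "I = {-a..b}" using I_def by auto
  \<comment> \<open>On a bounded interval |s| never reaches a + b + 1, so the condition at infinity
    is vacuous and any m below M will do.\<close>
  then show ?thesis by (intro that[of "M - 1" "a + b + 1"]) (auto simp: abs_if split: if_splits)
 qed
 obtain \<gamma> where \<gamma>: "0 < \<gamma>" "!!s. s \<in> I ==> h s <= M - \<gamma> * th2 s"
  using gap_below_max[OF I(1) h_cont h_max(1) _ h_expansion far] h_max(2) by blast
 obtain \<mu>0 where mu: "W S \<mu>0" "rep S u0 (%y. fst (\<mu>0 y))" "!!\<Psi>. W S \<Psi> ==> (LI y. snd (\<mu>0 y) @. snd (\<Psi> y)) = lam0 * (LI y. fst (\<mu>0 y) * fst (\<Psi> y))"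
  "!!y. y \<in> S ==> 0 < fst (\<mu>0 y)" "!!y. y \<notin> S ==> \<mu>0 y = 0" "N2 (%y. fst (\<mu>0 y)) = 1"
  using eigenfunction_model[OF S_open eig u0_pos u0_norm] by blast
 interpret cross_section S lam0 \<mu>0
  by (intro cross_section.intro S_open S_bounded simply_connected_imp_connected[OF S_sc] S_ne mu)
 define H rho sig ev where "H s = 1 / (h (cl s))~2" and "rho s = (if s \<in> interior I - {0} then dh s / h s else 0)"
  and "sig s = (if s \<in> interior I then \<tau> s + ad s else 0)" and "ev s = (if s \<in> interior I then (h s * k s) *R zalpha \<alpha> s else 0)" for s
 define K where "K = 2 * K1 + ||K2|| + M * K1 + K1~2"
 have Kg: "0 <= K" "2 * K1 <= K" "||K2|| <= K" "M * K1 <= K" "K1~2 <= K" using K10 M_pos by (auto simp: K_def)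
 \<comment> \<open>From 1/x^2 - 1/M^2 = (M - x)(M + x)/(x^2 M^2) >= (M - x)/M^3 for 0 < x <= M,
   combined with M - h >= \<gamma> th2.\<close>
 define \<kappa> where "\<kappa> = lam0 * (\<gamma> / M^3)"
 have k0: "0 < \<kappa>" using lam0_pos \<gamma>(1) M_pos by (simp add: \<kappa>_def)
 \<comment> \<open>k is the norm of k N, because N is a unit vector and k is nonnegative.\<close>
 have cont_k: "continuous_on I k"
 proof -
  have "continuous_on I (%s. norm (k s *R N s))" by (intro continuous_intros r_C2)
  then show ?thesis by (rule continuous_on_cong[THEN iffD1, rotated 2]) (use frame_on k_nonneg in auto)
 qed
 have cont_a: "continuous_on I \<alpha>" by (rule DERIV_continuous_on) (use alpha_deriv in blast)
 have cont_N: "continuous_on I N" by (rule continuous_on_vector_derivative) (use N_deriv in blast)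
 have cont_hc: "continuous_on UNIV (%s. h (cl s))" by (rule continuous_on_compose2[OF h_cont cl(1)]) (use cl(2) in auto)
 have bH: "H \<in> bm" unfolding H_def[abs_def]
  by (intro borel_measurable_continuous_onI continuous_intros cont_hc) (use hp[OF cl(2)] in \<open>simp add: less_imp_neq[symmetric]\<close>)
 have brho: "rho \<in> bm" unfolding rho_def[abs_def]
  by (intro borel_measurable_continuous_on_if Jb continuous_on_const continuous_on_divide continuous_on_subset[OF h_C1] continuous_on_subset[OF h_cont])
   (use hp JI in \<open>auto simp: less_imp_neq[symmetric]\<close>)
 \<comment> \<open>\<tau> is minus the inner product of B' with N, which is Borel as a limit of
   difference quotients.\<close>
 have bsig: "sig \<in> bm"
 proof -
  have d: "(%s. if s \<in> interior I then (- \<tau> s *R N s) @. N s else 0) \<in> bm"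
   by (rule derivative_inner_borel[OF I(1,2) ne _ cont_N]) (use B_deriv in blast)
  have a: "(%s. if s \<in> interior I then ad s else 0) \<in> bm"
   by (intro borel_measurable_continuous_on_if Jb continuous_on_const continuous_on_subset[OF alpha_C1]) (use JI in auto)
  have e: "sig = (%s. (if s \<in> interior I then ad s else 0) - (if s \<in> interior I then (- \<tau> s *R N s) @. N s else 0))"
   using frame_on JI by (auto simp: sig_def power2_norm_eq_inner[symmetric] fun_eq_iff)
  show ?thesis unfolding e by (rule borel_measurable_diff[OF a d])
 qed
 have bev: "ev \<in> bm" unfolding ev_def[abs_def] zalpha_def
  by (intro borel_measurable_continuous_on_if Jb continuous_intros continuous_on_subset[OF h_cont] continuous_on_subset[OF cont_k] continuous_on_subset[OF cont_a])
   (use JI in auto)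
 have clJ: "H s = 1 / (h s)~2" if "s \<in> interior I" for s using cl(3)[OF JI[OF that]] by (simp add: H_def)
 have Hlow: "1 / M~2 <= H s" for s
  unfolding H_def using hp[OF cl(2), of s] hM[OF cl(2), of s] by (intro divide_left_mono power_mono) auto
 have nz: "norm (zalpha \<alpha> s) = 1" for s by (simp add: zalpha_def norm_Pair)
 have nev: "norm (ev s) = h s * ||k s||" if "s \<in> interior I" for s using that hp[OF JI[OF that]] by (simp add: ev_def nz abs_mult)
 have b1: "||rho s|| <= K" for s using K2[OF JI, of s] Kg by (auto simp: rho_def)
 have b2: "||sig s|| <= K" for s using K1[OF JI, of s] Kg by (auto simp: sig_def)
 have b3: "norm (ev s) <= K" for s
 proof (cases "s \<in> interior I")
  case True
  have "h s * ||k s|| <= M * K1" using hM[OF JI[OF True]] hp[OF JI[OF True]] K1[OF JI[OF True]] M_pos by (intro mult_mono) auto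
  then show ?thesis using nev[OF True] Kg by linarith
 qed (use Kg in \<open>simp add: ev_def\<close>)
 \<comment> \<open>H cancels h^2 in |ev|^2, leaving the squared curvature.\<close>
 have b4: "H s * (norm (ev s))~2 <= K" for s
 proof (cases "s \<in> interior I")
  case True
  have "H s * (norm (ev s))~2 = ||k s||~2" using hp[OF JI[OF True]] by (simp add: clJ[OF True] nev[OF True] power_mult_distrib)
  also have "... <= K1~2" using K1[OF JI[OF True]] by (intro power_mono) auto
  finally show ?thesis using Kg by linarith
 qed (use Kg in \<open>simp add: ev_def\<close>)
 have well: "\<kappa> * th2 s <= lam0 * (H s - 1 / M~2)" if s: "s \<in> interior I" for s
 proof -
  note sI = JI[OF s]
  define x where "x = h s"
  have x: "0 < x" "x <= M" using hp[OF sI] hM[OF sI] by (auto simp: x_def)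
  have "(M - x) / M^3 = (M - x) * M / (M~2 * M~2)" using M_pos by (simp add: power2_eq_square power3_eq_cube)
  also have "... <= (M - x) * (M + x) / (x~2 * M~2)" using x M_pos by (intro frac_le mult_left_mono mult_right_mono power_mono mult_nonneg_nonneg) auto
  also have "... = 1 / x~2 - 1 / M~2" using x M_pos by (simp add: field_simps power2_eq_square)
  finally have "(M - x) / M^3 <= H s - 1 / M~2" by (simp add: clJ[OF s] x_def)
  moreover have "\<gamma> * th2 s / M^3 <= (M - x) / M^3" using \<gamma>(2)[OF sI] M_pos by (intro divide_right_mono) (auto simp: x_def)
  ultimately have "lam0 * (\<gamma> * th2 s / M^3) <= lam0 * (H s - 1 / M~2)" using lam0_pos by (intro mult_left_mono) auto
  then show ?thesis by (simp add: \<kappa>_def mult_ac)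
 qed
 \<comment> \<open>|K2| is a Lipschitz constant of ln h, and clamping does not increase distances;
   over a unit step h changes by at most the factor exp |K2|, and H by its square.\<close>
 have comp: "H s <= (exp ||K2||)~2 * H t" if st: "||s - t|| <= 1" for s t
 proof -
  have "||ln (h (cl t)) - ln (h (cl s))|| <= ||K2|| * ||cl t - cl s||"
   by (rule log_lipschitz[OF I(2) hp h_cont _ _ cl(2) cl(2), where a = 0]) (use h_deriv K2 in force)+
  also have "... <= ||K2|| * 1" using cl(4)[of t s] st by (intro mult_left_mono) auto
  finally have "ln (h (cl t)) <= ||K2|| + ln (h (cl s))" by linarith
  then have "exp (ln (h (cl t))) <= exp ( ||K2|| + ln (h (cl s)))" by simp
  then have "h (cl t) <= exp ||K2|| * h (cl s)" using hp[OF cl(2), of t] hp[OF cl(2), of s] by (simp add: exp_add)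
  then have "(h (cl t))~2 <= (exp ||K2|| * h (cl s))~2" using hp[OF cl(2), of t] by (intro power_mono) auto
  then show ?thesis using hp[OF cl(2), of t] hp[OF cl(2), of s] by (simp add: H_def field_simps)
 qed
 interpret deformed_tube S lam0 \<mu>0 "interior I" H rho sig ev M K \<kappa> "(exp ||K2||)~2" h dh k \<tau> \<alpha> ad u0
 proof unfold_locales
  show "!!s. s \<in> interior I ==> s ~= 0 ==> rho s = dh s / h s" by (simp add: rho_def)
  show "!!s. s \<in> interior I ==> sig s = \<tau> s + ad s" by (simp add: sig_def)
  show "!!s. s \<in> interior I ==> ev s = (h s * k s) *R zalpha \<alpha> s" by (simp add: ev_def)
 qed (fact open_interior bH brho bsig bev M_pos Hlow Kg(1) b1 b2 b3 b4 k0 well comp hp[OF JI] clJ mu(2))+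
 show ?thesis by (rule resolvent_estimate)
qed
end
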